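(* Let $\mathscr{T}_{\mathrm{phd}}$ be the "smooth phase decomposition" map defined in the context. It is a smooth local diffeomorphism near $0$: there are neighborhoods of zero $\mathscr{U}\subset X_{\mathrm{ch}}$ and $\mathscr{V}\subset\ell^1\times X_{\mathrm{ch}}^\perp$ such that $$\mathscr{T}_{\mathrm{phd}}:\mathscr{V}\to\mathscr{U},\qquad (\underline\theta,\underline{\mathbf{W}})\mapsto\{\mathbf{W}_j(x)+\mathbf{H}_j(x)+\mathbf{u}_\star(x-\theta_j)-\mathbf{u}_\star(x)\}_{j\in\mathbb{Z}},$$ is invertible with $\mathscr{T}_{\mathrm{phd}}$ and $\mathscr{T}_{\mathrm{phd}}^{-1}$ smooth. Its derivative at the origin is $$\mathscr{L}_{\mathrm{phd}}:=\mathscr{T}_{\mathrm{phd}}'(0):\ell^1\times X_{\mathrm{ch}}^\perp\to X_{\mathrm{ch}},\qquad(\underline\theta,\underline{\mathbf{W}})\mapsto\underline{\mathbf{W}}+\underline{\mathbf{E}}*\underline\theta,\qquad (\underline{\mathbf{E}}*\underline\theta)_j=\sum_{k\in\mathbb{Z}}\mathbf{E}_{j-k}\theta_k,$$ where $$\mathbf{E}_{-1}=\tfrac14\psi-(\tfrac14+\tfrac12\phi)\mathbf{u}_\star',\quad \mathbf{E}_0=-\tfrac12(\psi+\mathbf{u}_\star'),\quad \mathbf{E}_1=\tfrac14\psi-(\tfrac14-\tfrac12\phi)\mathbf{u}_\star',\quad \mathbf{E}_j=0\ \text{for } |j|\ge2 .$$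
   Context: Setting: $D\in\mathbb{R}^{n\times n}$ is diagonal with strictly positive diagonal entries, $\mathbf{f}:\mathbb{R}^n\to\mathbb{R}^n$ is smooth (smooth = sufficiently many derivatives), and $\mathbf{u}_\star$ is a smooth even $2\pi$-periodic solution of $D\partial_{xx}\mathbf{u}+\mathbf{f}(\mathbf{u})=0$. For $\sigma\in[-\frac12,\frac12]$, $B(\sigma)=D(\partial_x+\mathrm{i}\sigma)^2+\mathbf{f}'(\mathbf{u}_\star):(H^2(\mathbb{T}_{2\pi}))^n\to(L^2(\mathbb{T}_{2\pi}))^n$, $\mathbb{T}_{2\pi}=\mathbb{R}/2\pi\mathbb{Z}$. Spectral stability is assumed: (i) $\mathrm{spec}(B(\sigma))\cap\{\mathrm{Re}\,\lambda\ge0\}=\emptyset$ for $\sigma\ne0$; (ii) $\mathrm{spec}(B(0))\cap\{\mathrm{Re}\,\lambda\ge0\}=\{0\}$, with $0$ simple and eigenspace $\mathrm{span}\{\mathbf{u}_\star'\}$; (iii) near $\sigma=0$ the eigenvalue continuing $0$ is smooth with $\lambda(\sigma)=-d\sigma^2+O(|\sigma|^3)$, $d>0$. $\langle\mathbf{u},\mathbf{v}\rangle=\int_{-\pi}^{\pi}(\mathbf{u}(x),\mathbf{v}(x))\,dx$ with $(\cdot,\cdot)$ the Euclidean inner product. $\mathbf{u}_{\mathrm{ad}}$ is the (odd) element of the kernel of the adjoint of $B(0)$ with $\langle\mathbf{u}_\star',\mathbf{u}_{\mathrm{ad}}\rangle=1$. Spaces: $X_{\mathrm{ch}}=\ell^1(\mathbb{Z},(L^1(-\pi,\pi))^n)\cap\ell^\infty(\mathbb{Z},(L^\infty(-\pi,\pi))^n)$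 with norm $\sum_j\|\mathbf{w}_j\|_{L^1}+\sup_j\|\mathbf{w}_j\|_{L^\infty}$; $X_{\mathrm{ch}}^\perp=\{\underline{\mathbf{v}}\in X_{\mathrm{ch}}:\langle\mathbf{v}_j,\mathbf{u}_{\mathrm{ad}}\rangle=0\ \forall j\in\mathbb{Z}\}$; $\ell^1=\ell^1(\mathbb{Z},\mathbb{R})$. Auxiliary functions: $\phi$ is a fixed smooth, odd, (weakly) increasing function on $[-\pi,\pi]$ with $\phi(x)=\frac12$ for $x>\frac\pi2$ and $\phi(x)=-\frac12$ for $x<-\frac\pi2$; $\psi\in(C_c^\infty(-\pi,\pi))^n$ is a fixed odd function (extended by $0$) with $\langle\psi,\mathbf{u}_{\mathrm{ad}}\rangle=1$. Definition of $\mathbf{H}_j$: $\mathbf{H}_j=\mathbf{H}_j^1+\mathbf{H}_j^2$, where $$\mathbf{H}_j^1(x)=\tfrac12\phi(x)\big(\mathbf{u}_\star(x-\theta_{j+1})-\mathbf{u}_\star(x-\theta_{j-1})\big)+\tfrac14\big(\mathbf{u}_\star(x-\theta_{j+1})+\mathbf{u}_\star(x-\theta_{j-1})-2\mathbf{u}_\star(x-\theta_j)\big),$$ $$\mathbf{H}_j^2(x)=c_j\,\psi(x-\theta_j),\qquad c_j=-\langle\mathbf{H}_j^1,\mathbf{u}_{\mathrm{ad}}(\cdot-\theta_j)\rangle-\langle\mathbf{W}_j,\mathbf{u}_{\mathrm{ad}}(\cdot-\theta_j)-\mathbf{u}_{\mathrm{ad}}\rangle .$$ *)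

theory Defs
  imports "HOL-Probability.Essential_Supremum" "HOL-Library.Landau_Symbols" "HOL-Library.Extended_Nat"
begin

section \<open>Maps of class \<open>C\<^sup>r\<close> between (subspaces of) normed spaces\<close>

text \<open>Bounded \<open>k\<close>-linear forms on the linear subspace \<open>S\<close>; the \<open>k\<close> arguments are given as a list.\<close>

definition bounded_multilinear_on ::
  "'a::real_normed_vector set \<Rightarrow> nat \<Rightarrow> ('a list \<Rightarrow> 'b::real_normed_vector) \<Rightarrow> bool" where
  "bounded_multilinear_on S k M \<longleftrightarrow>
     (\<forall>us vs. \<forall>x\<in>S. \<forall>y\<in>S. \<forall>a b.
        length us + 1 + length vs = k \<longrightarrow> set us \<subseteq> S \<longrightarrow> set vs \<subseteq> S \<longrightarrow>
        M (us @ (a *\<^sub>R x + b *\<^sub>R y) # vs) = a *\<^sub>R M (us @ x # vs) + b *\<^sub>R M (us @ y # vs)) \<and>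
     (\<exists>C. \<forall>vs. length vs = k \<longrightarrow> set vs \<subseteq> S \<longrightarrow> norm (M vs) \<le> C * prod_list (map norm vs))"

text \<open>\<open>f\<close> is of class \<open>C\<^sup>r\<close> (\<open>r = \<infinity>\<close> allowed) on \<open>V \<subseteq> S\<close>, where \<open>S\<close> is regarded as a normed space
  in its own right: \<open>G k x\<close> is the \<open>k\<close>-th Frechet derivative at \<open>x\<close>, a bounded \<open>k\<close>-linear form on \<open>S\<close>;
  differentiability and continuity of \<open>G k\<close> are with respect to the norm of bounded \<open>k\<close>-linear forms.
  The identification of an operator into \<open>k\<close>-linear forms with a \<open>k+1\<close>-linear form is
  \<open>G (Suc k) x (h # vs)\<close>.\<close>

definition C_class_on ::
  "enat \<Rightarrow> 'a::real_normed_vector set \<Rightarrow> 'a set \<Rightarrow> ('a \<Rightarrow> 'b::real_normed_vector) \<Rightarrow> bool" where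
  "C_class_on r S V f \<longleftrightarrow>
    (\<exists>G :: nat \<Rightarrow> 'a \<Rightarrow> 'a list \<Rightarrow> 'b.
       (\<forall>x\<in>V. G 0 x [] = f x) \<and>
       (\<forall>k. enat k \<le> r \<longrightarrow> (\<forall>x\<in>V. bounded_multilinear_on S k (G k x))) \<and>
       (\<forall>k. enat k < r \<longrightarrow> (\<forall>x\<in>V. \<forall>e>0. \<exists>d>0. \<forall>y\<in>V. norm (y - x) < d \<longrightarrow>
          (\<forall>vs. length vs = k \<longrightarrow> set vs \<subseteq> S \<longrightarrow>
             norm (G k y vs - G k x vs - G (Suc k) x ((y - x) # vs))
               \<le> e * norm (y - x) * prod_list (map norm vs)))) \<and>
       (\<forall>k. enat k \<le> r \<longrightarrow> (\<forall>x\<in>V. \<forall>e>0. \<exists>d>0. \<forall>y\<in>V. norm (y - x) < d \<longrightarrow>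
          (\<forall>vs. length vs = k \<longrightarrow> set vs \<subseteq> S \<longrightarrow>
             norm (G k y vs - G k x vs) \<le> e * prod_list (map norm vs)))))"

section \<open>The sequence space \<open>\<ell>\<^sup>1(\<int>,\<real>)\<close>\<close>

typedef l1 = "{\<theta> :: int \<Rightarrow> real. Infinite_Sum.abs_summable_on \<theta> UNIV}"
  morphisms l1_seq Abs_l1
  by (intro exI[of _ "\<lambda>_. 0"]) simp

setup_lifting type_definition_l1

lemma abs_summable_on_add:
  fixes a b :: "int \<Rightarrow> real"
  assumes "Infinite_Sum.abs_summable_on a UNIV" "Infinite_Sum.abs_summable_on b UNIV"
  shows "Infinite_Sum.abs_summable_on (\<lambda>j. a j + b j) UNIV"
  using assms by (simp only: summable_on_iff_abs_summable_on_real[symmetric] summable_on_add)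


instantiation l1 :: real_normed_vector
begin

lift_definition zero_l1 :: l1 is "\<lambda>_. 0" by simp

lift_definition plus_l1 :: "l1 \<Rightarrow> l1 \<Rightarrow> l1" is "\<lambda>a b j. a j + b j"
  by (rule abs_summable_on_add)

lift_definition uminus_l1 :: "l1 \<Rightarrow> l1" is "\<lambda>a j. - a j"
  by simp

lift_definition minus_l1 :: "l1 \<Rightarrow> l1 \<Rightarrow> l1" is "\<lambda>a b j. a j - b j"
  subgoal for a b using abs_summable_on_add[of a "\<lambda>j. - b j"] by simp
  done

lift_definition scaleR_l1 :: "real \<Rightarrow> l1 \<Rightarrow> l1" is "\<lambda>c a j. c * a j"
  by (simp add: abs_mult summable_on_cmult_right)

lift_definition norm_l1 :: "l1 \<Rightarrow> real" is "\<lambda>a. \<Sum>\<^sub>\<infinity>j. \<bar>a j\<bar>" .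

definition sgn_l1 :: "l1 \<Rightarrow> l1" where "sgn_l1 x = inverse (norm x) *\<^sub>R x"
definition dist_l1 :: "l1 \<Rightarrow> l1 \<Rightarrow> real" where "dist_l1 x y = norm (x - y)"
definition uniformity_l1 :: "(l1 \<times> l1) filter" where
  "uniformity_l1 = (INF e\<in>{0 <..}. principal {(x, y). dist x y < e})"
definition open_l1 :: "l1 set \<Rightarrow> bool" where
  "open_l1 U \<longleftrightarrow> (\<forall>x\<in>U. eventually (\<lambda>(x', y). x' = x \<longrightarrow> y \<in> U) uniformity)"

instance
proof
  fix x y z :: l1 and a b :: real
  show "x + y + z = x + (y + z)" "x + y = y + x" "0 + x = x" "- x + x = 0" "x - y = x + - y"
    "a *\<^sub>R (x + y) = a *\<^sub>R x + a *\<^sub>R y" "(a + b) *\<^sub>R x = a *\<^sub>R x + b *\<^sub>R x"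
    "a *\<^sub>R b *\<^sub>R x = (a * b) *\<^sub>R x" "1 *\<^sub>R x = x"
    by (transfer; auto simp: algebra_simps)+
  show "sgn x = inverse (norm x) *\<^sub>R x" "dist x y = norm (x - y)"
    "(uniformity :: (l1 \<times> l1) filter) = (INF e\<in>{0 <..}. principal {(x, y). dist x y < e})"
    by (rule sgn_l1_def dist_l1_def uniformity_l1_def)+
  show "open U \<longleftrightarrow> (\<forall>x\<in>U. eventually (\<lambda>(x', y). x' = x \<longrightarrow> y \<in> U) uniformity)" for U :: "l1 set"
    by (rule open_l1_def)
  show "norm x = 0 \<longleftrightarrow> x = 0"
  proof (transfer, intro iffI)
    fix x :: "int \<Rightarrow> real" assume x: "Infinite_Sum.abs_summable_on x UNIV" and 0: "(\<Sum>\<^sub>\<infinity>j. \<bar>x j\<bar>) = 0"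
    have "x j = 0" for j
    proof -
      have "\<bar>x j\<bar> = 0"
        by (rule nonneg_infsum_le_0D[where A=UNIV and f="\<lambda>j. \<bar>x j\<bar>"]) (use x 0 in auto)
      thus ?thesis by simp
    qed
    thus "x = (\<lambda>_. 0)" by auto
  qed simp
  show "norm (x + y) \<le> norm x + norm y"
  proof transfer
    fix x y :: "int \<Rightarrow> real" assume x: "Infinite_Sum.abs_summable_on x UNIV" and y: "Infinite_Sum.abs_summable_on y UNIV"
    have "(\<Sum>\<^sub>\<infinity>j. \<bar>x j + y j\<bar>) \<le> (\<Sum>\<^sub>\<infinity>j. \<bar>x j\<bar> + \<bar>y j\<bar>)"
      using x y abs_summable_on_add[OF x y] by (intro infsum_mono summable_on_add) auto
    also have "\<dots> = (\<Sum>\<^sub>\<infinity>j. \<bar>x j\<bar>) + (\<Sum>\<^sub>\<infinity>j. \<bar>y j\<bar>)"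
      using x y by (intro infsum_add) auto
    finally show "(\<Sum>\<^sub>\<infinity>j. \<bar>x j + y j\<bar>) \<le> (\<Sum>\<^sub>\<infinity>j. \<bar>x j\<bar>) + (\<Sum>\<^sub>\<infinity>j. \<bar>y j\<bar>)" .
  qed
  show "norm (a *\<^sub>R x) = \<bar>a\<bar> * norm x"
    by transfer (simp add: abs_mult infsum_cmult_right')
qed

end

section \<open>The space \<open>X\<^sub>c\<^sub>h\<close>\<close>

text \<open>Lebesgue measure on \<open>(-\<pi>,\<pi>)\<close>. Functions on the torus are represented by their restriction
  to this interval.\<close>

abbreviation cell :: "real measure" where
  "cell \<equiv> lebesgue_on {-pi<..<pi}"

text \<open>The sum over \<open>j \<in> \<int>\<close> of the \<open>L\<^sup>1\<close> norms is written as an integral for the counting measure,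
  so that the value \<open>\<infinity>\<close> is allowed.\<close>

definition xch_enorm :: "(int \<Rightarrow> real \<Rightarrow> 'a::euclidean_space) \<Rightarrow> ennreal" where
  "xch_enorm w = (\<integral>\<^sup>+j. (\<integral>\<^sup>+x. ennreal (norm (w j x)) \<partial>cell) \<partial>count_space UNIV)
               + (SUP j. esssup cell (\<lambda>x. ennreal (norm (w j x))))"

definition xch_funs :: "(int \<Rightarrow> real \<Rightarrow> 'a::euclidean_space) set" where
  "xch_funs = {w. (\<forall>j. w j \<in> borel_measurable cell) \<and> xch_enorm w < \<infinity>}"

definition xch_rel :: "(int \<Rightarrow> real \<Rightarrow> 'a::euclidean_space) \<Rightarrow> (int \<Rightarrow> real \<Rightarrow> 'a) \<Rightarrow> bool" where
  "xch_rel v w \<longleftrightarrow> v \<in> xch_funs \<and> w \<in> xch_funs \<and> (\<forall>j. AE x in cell. v j x = w j x)"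

lemma xch_funs_zero: "(\<lambda>j x. 0) \<in> (xch_funs :: (int \<Rightarrow> real \<Rightarrow> 'a::euclidean_space) set)"
proof -
  have "esssup cell (\<lambda>x. 0::ennreal) \<le> 0" by (rule esssup_I) auto
  thus ?thesis by (simp add: xch_funs_def xch_enorm_def)
qed

lemma xch_enorm_cong:
  assumes "\<And>j. AE x in cell. v j x = w j x"
    and "\<And>j. v j \<in> borel_measurable cell" "\<And>j. w j \<in> borel_measurable cell"
  shows "xch_enorm v = xch_enorm w"
proof -
  have "(\<integral>\<^sup>+x. ennreal (norm (v j x)) \<partial>cell) = (\<integral>\<^sup>+x. ennreal (norm (w j x)) \<partial>cell)" for j
    by (rule nn_integral_cong_AE) (use assms(1)[of j] in auto)
  moreover have "esssup cell (\<lambda>x. ennreal (norm (v j x))) = esssup cell (\<lambda>x. ennreal (norm (w j x)))" for j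
    by (rule esssup_AE_cong) (use assms(2,3)[of j] assms(1)[of j] in auto)
  ultimately show ?thesis by (simp add: xch_enorm_def)
qed

lemma xch_enorm_add:
  assumes [measurable]: "\<And>j. v j \<in> borel_measurable cell" "\<And>j. w j \<in> borel_measurable cell"
  shows "xch_enorm (\<lambda>j x. v j x + w j x) \<le> xch_enorm v + xch_enorm w"
proof -
  have 1: "(\<integral>\<^sup>+x. ennreal (norm (v j x + w j x)) \<partial>cell)
      \<le> (\<integral>\<^sup>+x. ennreal (norm (v j x)) \<partial>cell) + (\<integral>\<^sup>+x. ennreal (norm (w j x)) \<partial>cell)" for j
  proof -
    have "(\<integral>\<^sup>+x. ennreal (norm (v j x + w j x)) \<partial>cell)
        \<le> (\<integral>\<^sup>+x. ennreal (norm (v j x)) + ennreal (norm (w j x)) \<partial>cell)"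
      by (intro nn_integral_mono)
        (auto simp: norm_triangle_ineq simp flip: ennreal_plus intro!: ennreal_leI)
    also have "\<dots> = (\<integral>\<^sup>+x. ennreal (norm (v j x)) \<partial>cell) + (\<integral>\<^sup>+x. ennreal (norm (w j x)) \<partial>cell)"
      by (intro nn_integral_add) auto
    finally show ?thesis .
  qed
  have 2: "(\<integral>\<^sup>+j. (\<integral>\<^sup>+x. ennreal (norm (v j x + w j x)) \<partial>cell) \<partial>count_space UNIV)
     \<le> (\<integral>\<^sup>+j. (\<integral>\<^sup>+x. ennreal (norm (v j x)) \<partial>cell) \<partial>count_space UNIV)
     + (\<integral>\<^sup>+j. (\<integral>\<^sup>+x. ennreal (norm (w j x)) \<partial>cell) \<partial>count_space UNIV)"
    by (subst nn_integral_add[symmetric]) (auto intro!: nn_integral_mono 1)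
  have "esssup cell (\<lambda>x. ennreal (norm (v j x + w j x)))
     \<le> esssup cell (\<lambda>x. ennreal (norm (v j x))) + esssup cell (\<lambda>x. ennreal (norm (w j x)))" for j
  proof (rule esssup_I)
    have "AE x in cell. ennreal (norm (v j x)) \<le> esssup cell (\<lambda>x. ennreal (norm (v j x)))"
      "AE x in cell. ennreal (norm (w j x)) \<le> esssup cell (\<lambda>x. ennreal (norm (w j x)))"
      by (rule esssup_AE)+
    thus "AE x in cell. ennreal (norm (v j x + w j x))
       \<le> esssup cell (\<lambda>x. ennreal (norm (v j x))) + esssup cell (\<lambda>x. ennreal (norm (w j x)))"
    proof eventually_elim
      case (elim x)
      have "ennreal (norm (v j x + w j x)) \<le> ennreal (norm (v j x)) + ennreal (norm (w j x))"
        by (auto simp: norm_triangle_ineq simp flip: ennreal_plus intro!: ennreal_leI)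
      also have "\<dots> \<le> esssup cell (\<lambda>x. ennreal (norm (v j x))) + esssup cell (\<lambda>x. ennreal (norm (w j x)))"
        by (intro add_mono elim)
      finally show ?case .
    qed
  qed auto
  hence "esssup cell (\<lambda>x. ennreal (norm (v j x + w j x)))
     \<le> (SUP j. esssup cell (\<lambda>x. ennreal (norm (v j x)))) + (SUP j. esssup cell (\<lambda>x. ennreal (norm (w j x))))" for j
    by (rule order_trans) (intro add_mono SUP_upper UNIV_I)
  hence 3: "(SUP j. esssup cell (\<lambda>x. ennreal (norm (v j x + w j x))))
     \<le> (SUP j. esssup cell (\<lambda>x. ennreal (norm (v j x)))) + (SUP j. esssup cell (\<lambda>x. ennreal (norm (w j x))))"
    by (intro SUP_least)
  show ?thesis unfolding xch_enorm_def using add_mono[OF 2 3] by (simp add: ac_simps)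
qed

lemma xch_enorm_scale_le:
  assumes [measurable]: "\<And>j. w j \<in> borel_measurable cell"
  shows "xch_enorm (\<lambda>j x. c *\<^sub>R w j x) \<le> ennreal \<bar>c\<bar> * xch_enorm w"
proof -
  have 1: "(\<integral>\<^sup>+j. (\<integral>\<^sup>+x. ennreal (norm (c *\<^sub>R w j x)) \<partial>cell) \<partial>count_space UNIV)
     = ennreal \<bar>c\<bar> * (\<integral>\<^sup>+j. (\<integral>\<^sup>+x. ennreal (norm (w j x)) \<partial>cell) \<partial>count_space UNIV)"
    by (simp add: ennreal_mult nn_integral_cmult)
  have "esssup cell (\<lambda>x. ennreal (norm (c *\<^sub>R w j x)))
     \<le> ennreal \<bar>c\<bar> * esssup cell (\<lambda>x. ennreal (norm (w j x)))" for j
  proof (rule esssup_I)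
    have "AE x in cell. ennreal (norm (w j x)) \<le> esssup cell (\<lambda>x. ennreal (norm (w j x)))"
      by (rule esssup_AE)
    thus "AE x in cell. ennreal (norm (c *\<^sub>R w j x)) \<le> ennreal \<bar>c\<bar> * esssup cell (\<lambda>x. ennreal (norm (w j x)))"
      by eventually_elim (auto simp: ennreal_mult intro!: mult_left_mono)
  qed auto
  hence "esssup cell (\<lambda>x. ennreal (norm (c *\<^sub>R w j x)))
     \<le> ennreal \<bar>c\<bar> * (SUP j. esssup cell (\<lambda>x. ennreal (norm (w j x))))" for j
    by (rule order_trans) (intro mult_left_mono SUP_upper UNIV_I zero_le)
  hence 2: "(SUP j. esssup cell (\<lambda>x. ennreal (norm (c *\<^sub>R w j x))))
     \<le> ennreal \<bar>c\<bar> * (SUP j. esssup cell (\<lambda>x. ennreal (norm (w j x))))"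
    by (intro SUP_least)
  show ?thesis unfolding xch_enorm_def distrib_left 1 by (intro add_mono 2 order_refl)
qed

lemma xch_enorm_scale:
  assumes "\<And>j. w j \<in> borel_measurable cell"
  shows "xch_enorm (\<lambda>j x. c *\<^sub>R w j x) = ennreal \<bar>c\<bar> * xch_enorm w"
proof (cases "c = 0")
  case True
  thus ?thesis using xch_enorm_scale_le[of w 0, OF assms] by simp
next
  case False
  have "ennreal \<bar>c\<bar> * xch_enorm w = ennreal \<bar>c\<bar> * xch_enorm (\<lambda>j x. inverse c *\<^sub>R (c *\<^sub>R w j x))"
    using False by simp
  also have "\<dots> \<le> ennreal \<bar>c\<bar> * (ennreal \<bar>inverse c\<bar> * xch_enorm (\<lambda>j x. c *\<^sub>R w j x))"
    by (intro mult_left_mono xch_enorm_scale_le) (use assms in auto)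
  also have "\<dots> = ennreal (\<bar>c\<bar> * \<bar>inverse c\<bar>) * xch_enorm (\<lambda>j x. c *\<^sub>R w j x)"
    by (simp add: ennreal_mult mult.assoc)
  also have "\<dots> = xch_enorm (\<lambda>j x. c *\<^sub>R w j x)" using False by (simp flip: abs_mult)
  finally show ?thesis using xch_enorm_scale_le[of w c, OF assms] by (intro antisym)
qed

lemma xch_enorm_eq_0:
  assumes [measurable]: "\<And>j. w j \<in> borel_measurable cell" and "xch_enorm w = 0"
  shows "AE x in cell. w j x = 0"
proof -
  have "(\<integral>\<^sup>+j. (\<integral>\<^sup>+x. ennreal (norm (w j x)) \<partial>cell) \<partial>count_space UNIV) = 0"
    using assms(2) by (simp add: xch_enorm_def)
  hence "(\<integral>\<^sup>+x. ennreal (norm (w j x)) \<partial>cell) = 0"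
    by (simp add: nn_integral_0_iff_AE AE_count_space)
  thus ?thesis by (subst (asm) nn_integral_0_iff_AE) auto
qed

lemma xch_funs_add:
  "v \<in> xch_funs \<Longrightarrow> w \<in> xch_funs \<Longrightarrow> (\<lambda>j x. v j x + w j x) \<in> xch_funs"
  unfolding xch_funs_def
  by (auto intro!: le_less_trans[OF xch_enorm_add] borel_measurable_add)

lemma xch_funs_scale: "w \<in> xch_funs \<Longrightarrow> (\<lambda>j x. c *\<^sub>R w j x) \<in> xch_funs"
  unfolding xch_funs_def
  by (auto simp: xch_enorm_scale ennreal_mult_less_top intro!: borel_measurable_scaleR)

lemma xch_funs_uminus: "w \<in> xch_funs \<Longrightarrow> (\<lambda>j x. - w j x) \<in> xch_funs"
  using xch_funs_scale[of w "-1"] by simp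

lemma xch_funs_diff:
  "v \<in> xch_funs \<Longrightarrow> w \<in> xch_funs \<Longrightarrow> (\<lambda>j x. v j x - w j x) \<in> xch_funs"
  using xch_funs_add[OF _ xch_funs_uminus, of v w] by simp

text \<open>Elements of \<open>X\<^sub>c\<^sub>h\<close>: sequences of measurable functions with finite norm, up to equality
  almost everywhere. \<open>rep_xch W\<close> is a representative of \<open>W\<close>.\<close>

quotient_type (overloaded) 'a xch = "int \<Rightarrow> real \<Rightarrow> 'a::euclidean_space" / partial: xch_rel
proof (rule part_equivpI)
  show "\<exists>x. xch_rel x (x :: int \<Rightarrow> real \<Rightarrow> 'a)"
    using xch_funs_zero by (auto simp: xch_rel_def)
  show "symp (xch_rel :: (int \<Rightarrow> real \<Rightarrow> 'a) \<Rightarrow> _)"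
    by (rule sympI) (auto simp: xch_rel_def eq_commute)
  show "transp (xch_rel :: (int \<Rightarrow> real \<Rightarrow> 'a) \<Rightarrow> _)"
  proof (rule transpI)
    fix u v w :: "int \<Rightarrow> real \<Rightarrow> 'a"
    assume uv: "xch_rel u v" and vw: "xch_rel v w"
    have "AE x in cell. u j x = w j x" for j
    proof -
      have "AE x in cell. u j x = v j x" "AE x in cell. v j x = w j x"
        using uv vw by (auto simp: xch_rel_def)
      thus ?thesis by eventually_elim simp
    qed
    thus "xch_rel u w" using uv vw by (auto simp: xch_rel_def)
  qed
qed

instantiation xch :: (euclidean_space) real_normed_vector
begin

lift_definition zero_xch :: "'a xch" is "\<lambda>j x. 0"
  by (simp add: xch_rel_def xch_funs_zero)

lift_definition plus_xch :: "'a xch \<Rightarrow> 'a xch \<Rightarrow> 'a xch" is "\<lambda>v w j x. v j x + w j x"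
  unfolding xch_rel_def
proof (intro conjI allI)
  fix v v' w w' :: "int \<Rightarrow> real \<Rightarrow> 'a" and j
  assume v: "v \<in> xch_funs \<and> v' \<in> xch_funs \<and> (\<forall>j. AE x in cell. v j x = v' j x)"
    and w: "w \<in> xch_funs \<and> w' \<in> xch_funs \<and> (\<forall>j. AE x in cell. w j x = w' j x)"
  show "(\<lambda>j x. v j x + w j x) \<in> xch_funs" "(\<lambda>j x. v' j x + w' j x) \<in> xch_funs"
    using v w by (auto intro: xch_funs_add)
  have "AE x in cell. v j x = v' j x" "AE x in cell. w j x = w' j x" using v w by auto
  thus "AE x in cell. v j x + w j x = v' j x + w' j x" by eventually_elim simp
qed

lift_definition minus_xch :: "'a xch \<Rightarrow> 'a xch \<Rightarrow> 'a xch" is "\<lambda>v w j x. v j x - w j x"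
  unfolding xch_rel_def
proof (intro conjI allI)
  fix v v' w w' :: "int \<Rightarrow> real \<Rightarrow> 'a" and j
  assume v: "v \<in> xch_funs \<and> v' \<in> xch_funs \<and> (\<forall>j. AE x in cell. v j x = v' j x)"
    and w: "w \<in> xch_funs \<and> w' \<in> xch_funs \<and> (\<forall>j. AE x in cell. w j x = w' j x)"
  show "(\<lambda>j x. v j x - w j x) \<in> xch_funs" "(\<lambda>j x. v' j x - w' j x) \<in> xch_funs"
    using v w by (auto intro: xch_funs_diff)
  have "AE x in cell. v j x = v' j x" "AE x in cell. w j x = w' j x" using v w by auto
  thus "AE x in cell. v j x - w j x = v' j x - w' j x" by eventually_elim simp
qed

lift_definition uminus_xch :: "'a xch \<Rightarrow> 'a xch" is "\<lambda>w j x. - w j x"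
  by (auto simp: xch_rel_def intro: xch_funs_uminus)

lift_definition scaleR_xch :: "real \<Rightarrow> 'a xch \<Rightarrow> 'a xch" is "\<lambda>c w j x. c *\<^sub>R w j x"
  unfolding xch_rel_def
proof (intro conjI allI)
  fix c and w w' :: "int \<Rightarrow> real \<Rightarrow> 'a" and j
  assume w: "w \<in> xch_funs \<and> w' \<in> xch_funs \<and> (\<forall>j. AE x in cell. w j x = w' j x)"
  show "(\<lambda>j x. c *\<^sub>R w j x) \<in> xch_funs" "(\<lambda>j x. c *\<^sub>R w' j x) \<in> xch_funs"
    using w by (auto intro: xch_funs_scale)
  have "AE x in cell. w j x = w' j x" using w by auto
  thus "AE x in cell. c *\<^sub>R w j x = c *\<^sub>R w' j x" by eventually_elim simp
qed

lift_definition norm_xch :: "'a xch \<Rightarrow> real" is "\<lambda>w. enn2real (xch_enorm w)"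
  by (rule arg_cong[where f=enn2real], rule xch_enorm_cong) (auto simp: xch_rel_def xch_funs_def)

definition sgn_xch :: "'a xch \<Rightarrow> 'a xch" where "sgn_xch x = inverse (norm x) *\<^sub>R x"
definition dist_xch :: "'a xch \<Rightarrow> 'a xch \<Rightarrow> real" where "dist_xch x y = norm (x - y)"
definition uniformity_xch :: "('a xch \<times> 'a xch) filter" where
  "uniformity_xch = (INF e\<in>{0 <..}. principal {(x, y). dist x y < e})"
definition open_xch :: "'a xch set \<Rightarrow> bool" where
  "open_xch U \<longleftrightarrow> (\<forall>x\<in>U. eventually (\<lambda>(x', y). x' = x \<longrightarrow> y \<in> U) uniformity)"

instance
proof
  fix x y z :: "'a xch" and a b :: real
  show "x + y + z = x + (y + z)"
    by transfer (auto simp: xch_rel_def algebra_simps intro!: xch_funs_add)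
  show "x + y = y + x"
    by transfer (auto simp: xch_rel_def algebra_simps intro!: xch_funs_add)
  show "0 + x = x" by transfer (auto simp: xch_rel_def)
  show "- x + x = 0" by transfer (auto simp: xch_rel_def xch_funs_zero)
  show "x - y = x + - y"
    by transfer (auto simp: xch_rel_def algebra_simps intro!: xch_funs_diff)
  show "a *\<^sub>R (x + y) = a *\<^sub>R x + a *\<^sub>R y"
    by transfer (auto simp: xch_rel_def algebra_simps intro!: xch_funs_add xch_funs_scale)
  show "(a + b) *\<^sub>R x = a *\<^sub>R x + b *\<^sub>R x"
    by transfer (auto simp: xch_rel_def algebra_simps intro!: xch_funs_add xch_funs_scale)
  show "a *\<^sub>R b *\<^sub>R x = (a * b) *\<^sub>R x"
    by transfer (auto simp: xch_rel_def algebra_simps intro!: xch_funs_scale)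
  show "1 *\<^sub>R x = x" by transfer (auto simp: xch_rel_def)
  show "sgn x = inverse (norm x) *\<^sub>R x" "dist x y = norm (x - y)"
    "(uniformity :: ('a xch \<times> 'a xch) filter) = (INF e\<in>{0 <..}. principal {(x, y). dist x y < e})"
    by (rule sgn_xch_def dist_xch_def uniformity_xch_def)+
  show "open U \<longleftrightarrow> (\<forall>x\<in>U. eventually (\<lambda>(x', y). x' = x \<longrightarrow> y \<in> U) uniformity)" for U :: "'a xch set"
    by (rule open_xch_def)
  show "norm x = 0 \<longleftrightarrow> x = 0"
  proof (transfer, intro iffI)
    fix x :: "int \<Rightarrow> real \<Rightarrow> 'a" assume x: "xch_rel x x" and 0: "enn2real (xch_enorm x) = 0"
    have "xch_enorm x = 0"
      using x 0 by (auto simp: xch_rel_def xch_funs_def enn2real_eq_0_iff)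
    thus "xch_rel x (\<lambda>j x. 0)"
      using x xch_enorm_eq_0[of x] by (auto simp: xch_rel_def xch_funs_def xch_funs_zero[unfolded xch_funs_def, simplified])
  next
    fix x :: "int \<Rightarrow> real \<Rightarrow> 'a" assume x: "xch_rel x (\<lambda>j x. 0)"
    hence "xch_enorm x = xch_enorm (\<lambda>j x. 0 :: 'a)"
      by (intro xch_enorm_cong) (auto simp: xch_rel_def xch_funs_def)
    also have "\<dots> = 0" using xch_enorm_scale[of "\<lambda>j x. 0 :: 'a" 0] by simp
    finally show "enn2real (xch_enorm x) = 0" by simp
  qed
  show "norm (x + y) \<le> norm x + norm y"
  proof transfer
    fix x y :: "int \<Rightarrow> real \<Rightarrow> 'a" assume "xch_rel x x" "xch_rel y y"
    hence *: "\<And>j. x j \<in> borel_measurable cell" "\<And>j. y j \<in> borel_measurable cell"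
      "xch_enorm x < \<infinity>" "xch_enorm y < \<infinity>"
      by (auto simp: xch_rel_def xch_funs_def)
    have "enn2real (xch_enorm (\<lambda>j xa. x j xa + y j xa)) \<le> enn2real (xch_enorm x + xch_enorm y)"
      using * by (intro enn2real_mono xch_enorm_add) auto
    also have "\<dots> = enn2real (xch_enorm x) + enn2real (xch_enorm y)"
      using * by (intro enn2real_plus) auto
    finally show "enn2real (xch_enorm (\<lambda>j xa. x j xa + y j xa))
      \<le> enn2real (xch_enorm x) + enn2real (xch_enorm y)" .
  qed
  show "norm (a *\<^sub>R x) = \<bar>a\<bar> * norm x"
  proof transfer
    fix a and x :: "int \<Rightarrow> real \<Rightarrow> 'a" assume "xch_rel x x"
    hence "\<And>j. x j \<in> borel_measurable cell" by (auto simp: xch_rel_def xch_funs_def)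
    thus "enn2real (xch_enorm (\<lambda>j xa. a *\<^sub>R x j xa)) = \<bar>a\<bar> * enn2real (xch_enorm x)"
      by (simp add: xch_enorm_scale enn2real_mult)
  qed
qed

end

definition cell_ip :: "(real \<Rightarrow> 'a::euclidean_space) \<Rightarrow> (real \<Rightarrow> 'a) \<Rightarrow> real" where
  "cell_ip u v = (\<integral>x. u x \<bullet> v x \<partial>cell)"

definition Xch_perp :: "(real \<Rightarrow> 'a::euclidean_space) \<Rightarrow> 'a xch set" where
  "Xch_perp uad = {W. \<forall>j. cell_ip (rep_xch W j) uad = 0}"

section \<open>Sobolev spaces on the torus and the Bloch operators\<close>

definition L2_cell :: "(real \<Rightarrow> complex^'n) set" where
  "L2_cell = {u. u \<in> borel_measurable cell \<and> integrable cell (\<lambda>x. (norm (u x))\<^sup>2)}"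

definition L2_norm_cell :: "(real \<Rightarrow> complex^'n) \<Rightarrow> real" where
  "L2_norm_cell u = sqrt (\<integral>x. (norm (u x))\<^sup>2 \<partial>cell)"

definition L2_ip_cell :: "(real \<Rightarrow> complex^'n) \<Rightarrow> (real \<Rightarrow> complex^'n) \<Rightarrow> complex" where
  "L2_ip_cell u v = (\<integral>x. (\<Sum>i\<in>UNIV. u x $ i * cnj (v x $ i)) \<partial>cell)"

text \<open>Weak derivatives on the torus: the test functions are the smooth \<open>2\<pi>\<close>-periodic functions,
  not the ones supported inside the cell. This is what encodes periodicity of \<open>u\<close>.\<close>

definition weak_deriv :: "(real \<Rightarrow> complex^'n) \<Rightarrow> (real \<Rightarrow> complex^'n) \<Rightarrow> bool" where
  "weak_deriv u v \<longleftrightarrow>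
     (\<forall>\<eta> :: real \<Rightarrow> real. C_class_on \<infinity> UNIV UNIV \<eta> \<longrightarrow> (\<forall>x. \<eta> (x + 2 * pi) = \<eta> x) \<longrightarrow>
        (\<integral>x. deriv \<eta> x *\<^sub>R u x \<partial>cell) = - (\<integral>x. \<eta> x *\<^sub>R v x \<partial>cell))"

definition H1_cell :: "(real \<Rightarrow> complex^'n) set" where
  "H1_cell = {u \<in> L2_cell. \<exists>v \<in> L2_cell. weak_deriv u v}"

definition wderiv :: "(real \<Rightarrow> complex^'n) \<Rightarrow> real \<Rightarrow> complex^'n" where
  "wderiv u = (SOME v. v \<in> L2_cell \<and> weak_deriv u v)"

definition H2_cell :: "(real \<Rightarrow> complex^'n) set" where
  "H2_cell = {u \<in> H1_cell. wderiv u \<in> H1_cell}"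

definition cvec :: "real^'n \<Rightarrow> complex^'n" where
  "cvec v = (\<chi> i. complex_of_real (v $ i))"

definition cmat :: "real^'n^'m \<Rightarrow> complex^'n^'m" where
  "cmat A = (\<chi> i j. complex_of_real (A $ i $ j))"

definition twisted_deriv :: "real \<Rightarrow> (real \<Rightarrow> complex^'n) \<Rightarrow> real \<Rightarrow> complex^'n" where
  "twisted_deriv \<sigma> u = (\<lambda>x. wderiv u x + (\<i> * complex_of_real \<sigma>) *s u x)"

text \<open>\<open>B(\<sigma>) = D(\<partial>\<^sub>x + i\<sigma>)\<^sup>2 + f'(u\<^sub>\<star>)\<close>, to be applied to elements of \<open>H2_cell\<close>.\<close>

definition Bloch :: "real^'n^'n \<Rightarrow> (real^'n \<Rightarrow> real^'n) \<Rightarrow> (real \<Rightarrow> real^'n) \<Rightarrow> real \<Rightarrow>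
    (real \<Rightarrow> complex^'n) \<Rightarrow> real \<Rightarrow> complex^'n" where
  "Bloch D f ustar \<sigma> u = (\<lambda>x. cmat D *v twisted_deriv \<sigma> (twisted_deriv \<sigma> u) x
                             + cmat (jacobian f (at (ustar x))) *v u x)"

text \<open>The following notions are for an operator \<open>B\<close> on \<open>L\<^sup>2\<close> of the torus with domain \<open>H\<^sup>2\<close>.\<close>

definition resolvent_set :: "((real \<Rightarrow> complex^'n) \<Rightarrow> real \<Rightarrow> complex^'n) \<Rightarrow> complex set" where
  "resolvent_set B = {\<mu>.
     (\<forall>g\<in>L2_cell. \<exists>u\<in>H2_cell. AE x in cell. B u x - \<mu> *s u x = g x) \<and>
     (\<forall>u\<in>H2_cell. (AE x in cell. B u x - \<mu> *s u x = 0) \<longrightarrow> (AE x in cell. u x = 0)) \<and>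
     (\<exists>C. \<forall>u\<in>H2_cell. L2_norm_cell u \<le> C * L2_norm_cell (\<lambda>x. B u x - \<mu> *s u x))}"

definition spec :: "((real \<Rightarrow> complex^'n) \<Rightarrow> real \<Rightarrow> complex^'n) \<Rightarrow> complex set" where
  "spec B = - resolvent_set B"

definition eigenspace :: "((real \<Rightarrow> complex^'n) \<Rightarrow> real \<Rightarrow> complex^'n) \<Rightarrow> complex \<Rightarrow>
    (real \<Rightarrow> complex^'n) set" where
  "eigenspace B \<mu> = {u\<in>H2_cell. AE x in cell. B u x = \<mu> *s u x}"

text \<open>The union over \<open>k\<close> of the kernels of \<open>(B - \<mu>)\<^sup>k\<close>.\<close>

inductive_set root_space :: "((real \<Rightarrow> complex^'n) \<Rightarrow> real \<Rightarrow> complex^'n) \<Rightarrow> complex \<Rightarrow>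
    (real \<Rightarrow> complex^'n) set" for B \<mu> where
  zero: "u \<in> H2_cell \<Longrightarrow> AE x in cell. u x = 0 \<Longrightarrow> u \<in> root_space B \<mu>"
| step: "u \<in> H2_cell \<Longrightarrow> v \<in> root_space B \<mu> \<Longrightarrow> AE x in cell. B u x - \<mu> *s u x = v x \<Longrightarrow>
           u \<in> root_space B \<mu>"

text \<open>Complex span of a single function, up to equality almost everywhere.\<close>

definition in_cspan :: "(real \<Rightarrow> complex^'n) \<Rightarrow> (real \<Rightarrow> complex^'n) \<Rightarrow> bool" where
  "in_cspan u v \<longleftrightarrow> (\<exists>c. AE x in cell. u x = c *s v x)"

definition simple_eigenvalue :: "((real \<Rightarrow> complex^'n) \<Rightarrow> real \<Rightarrow> complex^'n) \<Rightarrow> complex \<Rightarrow> bool" where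
  "simple_eigenvalue B \<mu> \<longleftrightarrow>
     (\<exists>v\<in>root_space B \<mu>. \<not> (AE x in cell. v x = 0) \<and> (\<forall>u\<in>root_space B \<mu>. in_cspan u v))"

definition spectrally_stable :: "enat \<Rightarrow> real^'n^'n \<Rightarrow> (real^'n \<Rightarrow> real^'n) \<Rightarrow> (real \<Rightarrow> real^'n) \<Rightarrow> bool" where
  "spectrally_stable r D f ustar \<longleftrightarrow>
     (let B = Bloch D f ustar; u' = (\<lambda>x. cvec (vector_derivative ustar (at x))) in
       (\<forall>\<sigma>\<in>{-1/2..1/2}. \<sigma> \<noteq> 0 \<longrightarrow> spec (B \<sigma>) \<inter> {\<mu>. Re \<mu> \<ge> 0} = {}) \<and>
       (spec (B 0) \<inter> {\<mu>. Re \<mu> \<ge> 0} = {0} \<and> simple_eigenvalue (B 0) 0 \<and>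
        u' \<in> eigenspace (B 0) 0 \<and> \<not> (AE x in cell. u' x = 0) \<and>
        (\<forall>u\<in>eigenspace (B 0) 0. in_cspan u u')) \<and>
       (\<exists>\<delta>>0. \<exists>d>0. \<exists>lam :: real \<Rightarrow> complex.
          C_class_on r UNIV {-\<delta><..<\<delta>} lam \<and> lam 0 = 0 \<and>
          (\<forall>\<sigma>\<in>{-\<delta><..<\<delta>}. \<exists>u\<in>eigenspace (B \<sigma>) (lam \<sigma>). \<not> (AE x in cell. u x = 0)) \<and>
          (\<lambda>\<sigma>. lam \<sigma> + complex_of_real (d * \<sigma>\<^sup>2)) \<in> O[at 0](\<lambda>\<sigma>. complex_of_real (\<bar>\<sigma>\<bar> ^ 3))))"

text \<open>\<open>v\<close> belongs to the domain of the \<open>L\<^sup>2\<close>-adjoint of \<open>B\<close>, and the adjoint maps \<open>v\<close> to \<open>g\<close>.\<close>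

definition adjoint_maps :: "((real \<Rightarrow> complex^'n) \<Rightarrow> real \<Rightarrow> complex^'n) \<Rightarrow>
    (real \<Rightarrow> complex^'n) \<Rightarrow> (real \<Rightarrow> complex^'n) \<Rightarrow> bool" where
  "adjoint_maps B v g \<longleftrightarrow> v \<in> L2_cell \<and> g \<in> L2_cell \<and>
     (\<forall>u\<in>H2_cell. L2_ip_cell (B u) v = L2_ip_cell u g)"

section \<open>Smooth phase decomposition\<close>

definition H1_phd :: "(real \<Rightarrow> real^'n) \<Rightarrow> (real \<Rightarrow> real) \<Rightarrow> (int \<Rightarrow> real) \<Rightarrow> int \<Rightarrow> real \<Rightarrow> real^'n" where
  "H1_phd ustar \<phi> \<theta> j x =
     (1/2 * \<phi> x) *\<^sub>R (ustar (x - \<theta> (j+1)) - ustar (x - \<theta> (j-1)))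
     + (1/4) *\<^sub>R (ustar (x - \<theta> (j+1)) + ustar (x - \<theta> (j-1)) - 2 *\<^sub>R ustar (x - \<theta> j))"

definition c_phd :: "(real \<Rightarrow> real^'n) \<Rightarrow> (real \<Rightarrow> real^'n) \<Rightarrow> (real \<Rightarrow> real) \<Rightarrow>
    (int \<Rightarrow> real) \<Rightarrow> (int \<Rightarrow> real \<Rightarrow> real^'n) \<Rightarrow> int \<Rightarrow> real" where
  "c_phd ustar uad \<phi> \<theta> W j =
     - cell_ip (H1_phd ustar \<phi> \<theta> j) (\<lambda>x. uad (x - \<theta> j))
     - cell_ip (W j) (\<lambda>x. uad (x - \<theta> j) - uad x)"

definition H2_phd :: "(real \<Rightarrow> real^'n) \<Rightarrow> (real \<Rightarrow> real^'n) \<Rightarrow> (real \<Rightarrow> real) \<Rightarrow> (real \<Rightarrow> real^'n) \<Rightarrow>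
    (int \<Rightarrow> real) \<Rightarrow> (int \<Rightarrow> real \<Rightarrow> real^'n) \<Rightarrow> int \<Rightarrow> real \<Rightarrow> real^'n" where
  "H2_phd ustar uad \<phi> \<psi> \<theta> W j x = c_phd ustar uad \<phi> \<theta> W j *\<^sub>R \<psi> (x - \<theta> j)"

definition H_phd :: "(real \<Rightarrow> real^'n) \<Rightarrow> (real \<Rightarrow> real^'n) \<Rightarrow> (real \<Rightarrow> real) \<Rightarrow> (real \<Rightarrow> real^'n) \<Rightarrow>
    (int \<Rightarrow> real) \<Rightarrow> (int \<Rightarrow> real \<Rightarrow> real^'n) \<Rightarrow> int \<Rightarrow> real \<Rightarrow> real^'n" where
  "H_phd ustar uad \<phi> \<psi> \<theta> W j x = H1_phd ustar \<phi> \<theta> j x + H2_phd ustar uad \<phi> \<psi> \<theta> W j x"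

definition phd_fun :: "(real \<Rightarrow> real^'n) \<Rightarrow> (real \<Rightarrow> real^'n) \<Rightarrow> (real \<Rightarrow> real) \<Rightarrow> (real \<Rightarrow> real^'n) \<Rightarrow>
    (int \<Rightarrow> real) \<Rightarrow> (int \<Rightarrow> real \<Rightarrow> real^'n) \<Rightarrow> int \<Rightarrow> real \<Rightarrow> real^'n" where
  "phd_fun ustar uad \<phi> \<psi> \<theta> W j x =
     W j x + H_phd ustar uad \<phi> \<psi> \<theta> W j x + ustar (x - \<theta> j) - ustar x"

text \<open>\<open>abs_xch\<close> is meaningful on \<open>xch_funs\<close> only; membership has to be established separately,
  here and for the convolution below.\<close>

definition T_phd :: "(real \<Rightarrow> real^'n) \<Rightarrow> (real \<Rightarrow> real^'n) \<Rightarrow> (real \<Rightarrow> real) \<Rightarrow> (real \<Rightarrow> real^'n) \<Rightarrow>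
    l1 \<times> (real^'n) xch \<Rightarrow> (real^'n) xch" where
  "T_phd ustar uad \<phi> \<psi> = (\<lambda>(\<theta>, W). abs_xch (phd_fun ustar uad \<phi> \<psi> (l1_seq \<theta>) (rep_xch W)))"

definition E_phd :: "(real \<Rightarrow> real^'n) \<Rightarrow> (real \<Rightarrow> real) \<Rightarrow> (real \<Rightarrow> real^'n) \<Rightarrow> int \<Rightarrow> real \<Rightarrow> real^'n" where
  "E_phd ustar \<phi> \<psi> k x =
     (let u' = vector_derivative ustar (at x) in
      if k = -1 then (1/4) *\<^sub>R \<psi> x - (1/4 + 1/2 * \<phi> x) *\<^sub>R u'
      else if k = 0 then - ((1/2) *\<^sub>R (\<psi> x + u'))
      else if k = 1 then (1/4) *\<^sub>R \<psi> x - (1/4 - 1/2 * \<phi> x) *\<^sub>R u'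
      else 0)"

definition conv_Z :: "(int \<Rightarrow> real \<Rightarrow> real^'n) \<Rightarrow> (int \<Rightarrow> real) \<Rightarrow> int \<Rightarrow> real \<Rightarrow> real^'n" where
  "conv_Z E \<theta> j x = (\<Sum>\<^sub>\<infinity>k. \<theta> k *\<^sub>R E (j - k) x)"

definition L_phd :: "(real \<Rightarrow> real^'n) \<Rightarrow> (real \<Rightarrow> real) \<Rightarrow> (real \<Rightarrow> real^'n) \<Rightarrow>
    l1 \<times> (real^'n) xch \<Rightarrow> (real^'n) xch" where
  "L_phd ustar \<phi> \<psi> = (\<lambda>(\<theta>, W). W + abs_xch (conv_Z (E_phd ustar \<phi> \<psi>) (l1_seq \<theta>)))"

end

theory Submission
  imports Defs
begin

text \<open>The map is composed of bounded linear and bilinear operations on the sequence spaces and of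
  the superposition operators \<open>\<theta> \<mapsto> (g(\<cdot> - \<theta>\<^sub>j) - g)\<^sub>j\<close> for \<open>g = u\<^sub>\<star>, u\<^sub>a\<^sub>d, \<psi>\<close>. Such an operator is
  of class \<open>C\<^sup>r\<close> on \<open>\<ell>\<^sup>1\<close> if \<open>g\<close> has one derivative more; elliptic regularity provides it, since
  the differential equations make \<open>u\<^sub>\<star>\<close> of class \<open>C\<^bsup>r+2\<^esup>\<close> and \<open>u\<^sub>a\<^sub>d\<close> almost everywhere equal to a
  function of class \<open>C\<^bsup>r+1\<^esup>\<close>.

  The inverse is found without an inverse function theorem. For small \<open>s\<close> one has
  \<open>\<langle>u\<^sub>\<star>(\<cdot> - s), u\<^sub>a\<^sub>d(\<cdot> - s)\<rangle> = 0\<close> by parity and periodicity and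
  \<open>\<langle>\<psi>(\<cdot> - s), u\<^sub>a\<^sub>d(\<cdot> - s)\<rangle> = 1\<close>, so the choice of \<open>c\<^sub>j\<close> turns \<open>T(\<theta>, W) = w\<close> into the
  decoupled scalar equations \<open>\<langle>u\<^sub>\<star> + w\<^sub>j, u\<^sub>a\<^sub>d(\<cdot> - \<theta>\<^sub>j)\<rangle> = 0\<close>. These are strictly monotone in
  \<open>\<theta>\<^sub>j\<close> because \<open>\<langle>u\<^sub>\<star>', u\<^sub>a\<^sub>d\<rangle> = 1\<close>, and once \<open>\<theta>\<close> is known, \<open>c\<^sub>j\<close> and \<open>W\<close> are explicit.\<close>

text \<open>Why the equation decouples: pair \<open>T(\<theta>, W) = w\<close> in cell
  \<open>j\<close> with the translate by \<open>\<theta>_j\<close> of \<open>a\<close>, the regular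
  representative of \<open>uad\<close>. As \<open>W_j\<close> is orthogonal to \<open>a\<close>, it
  contributes its pairing with \<open>a(x - \<theta>_j) - a(x)\<close>; \<open>c_j\<close> cancels
  this together with the contribution of \<open>H1_j\<close>, the only place where neighbouring
  phases occur. Strict monotonicity then bounds \<open>\<theta>_j\<close> by a multiple of the L1
  norm of \<open>w_j\<close>, which puts the roots into \<open>l1\<close>. Pairing with the
  untranslated \<open>a\<close> removes \<open>W_j\<close> and leaves a scalar equation for
  \<open>c_j\<close>. The derivative of the phase, found by implicit differentiation, is an
  expression in the phase itself, so its smoothness is bootstrapped one order at a time. Two
  obstacles shape the form. A constant sequence of profiles is not in \<open>X_ch\<close>, so
  translates are split into the profile and a summable deviation. And \<open>C_class_on\<close>
  works relative to a subspace that is only a set, with one sequence of derivatives for all orders;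
  hence families indexed by lists instead of spaces of operators.\<close>

definition cons_lists :: "'a set \<Rightarrow> 'a list set \<Rightarrow> 'a list set" where
  "cons_lists S I = {h # i | h i. h \<in> S \<and> i \<in> I}"

definition cons_weight :: "('a::real_normed_vector list \<Rightarrow> real) \<Rightarrow> 'a list \<Rightarrow> real" where
  "cons_weight w l = norm (hd l) * w (tl l)"

lemma cons_weight_Cons [simp]: "cons_weight w (h # i) = norm h * w i"
  by (simp add: cons_weight_def)

lemma Cons_in_cons_lists [simp]: "h # i \<in> cons_lists S I \<longleftrightarrow> h \<in> S \<and> i \<in> I"
  by (auto simp: cons_lists_def)

lemma cons_listsE:
  assumes "l \<in> cons_lists S I"
  obtains h i where "l = h # i" "h \<in> S" "i \<in> I"
  using assms by (auto simp: cons_lists_def)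

section \<open>Calculus of smooth families: sums, products, reindexing\<close>

lemma eventually_at_in_self: "\<forall>\<^sub>F y in at x within V. y \<in> V"
  unfolding eventually_at_topological by (intro exI[of _ UNIV]) auto

text \<open>The weight plays the role of the product of the norms of the arguments: started from the
  constant 1 and extended by \<open>cons_weight\<close>, a bound uniform in the index relative to
  \<open>w\<close> is a bound in the norm of multilinear forms.\<close>

definition cont_family :: "'a::real_normed_vector set \<Rightarrow> 'i set \<Rightarrow> ('i \<Rightarrow> real) \<Rightarrow>
    ('i \<Rightarrow> 'a \<Rightarrow> 'b::real_normed_vector) \<Rightarrow> bool" where
  "cont_family V I w F \<longleftrightarrow> (\<forall>i\<in>I. 0 \<le> w i) \<and>
     (\<forall>x\<in>V. (\<exists>C\<ge>0. \<forall>i\<in>I. norm (F i x) \<le> C * w i) \<and>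
        (\<forall>e>0. \<forall>\<^sub>F y in at x within V. \<forall>i\<in>I. norm (F i y - F i x) \<le> e * w i))"

text \<open>Linearity is demanded in the new slot only; linearity in the slots below it is obtained
  later from limits of difference quotients. Boundedness of \<open>F'\<close> is supplied by
  \<open>cont_family\<close> at the next level of \<open>smooth_family\<close>.\<close>

definition family_deriv :: "'a::real_normed_vector set \<Rightarrow> 'a set \<Rightarrow> 'a list set \<Rightarrow> ('a list \<Rightarrow> real) \<Rightarrow>
    ('a list \<Rightarrow> 'a \<Rightarrow> 'b::real_normed_vector) \<Rightarrow> ('a list \<Rightarrow> 'a \<Rightarrow> 'b) \<Rightarrow> bool" where
  "family_deriv S V I w F F' \<longleftrightarrow>
     (\<forall>x\<in>V. \<forall>i\<in>I. \<forall>h\<in>S. \<forall>k\<in>S. \<forall>a b.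
        F' ((a *\<^sub>R h + b *\<^sub>R k) # i) x = a *\<^sub>R F' (h # i) x + b *\<^sub>R F' (k # i) x) \<and>
     (\<forall>x\<in>V. \<forall>e>0. \<forall>\<^sub>F y in at x within V. \<forall>i\<in>I.
        norm (F i y - F i x - F' ((y - x) # i) x) \<le> e * norm (y - x) * w i)"

text \<open>Families indexed by lists keep the type fixed under differentiation: the derivative in the
  direction \<open>h\<close> of the member with index \<open>i\<close> is the member with index \<open>h # i\<close>.\<close>

primrec smooth_family :: "nat \<Rightarrow> 'a::real_normed_vector set \<Rightarrow> 'a set \<Rightarrow> 'a list set \<Rightarrow>
    ('a list \<Rightarrow> real) \<Rightarrow> ('a list \<Rightarrow> 'a \<Rightarrow> 'b::real_normed_vector) \<Rightarrow> bool" where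
  "smooth_family 0 S V I w F \<longleftrightarrow> cont_family V I w F"
| "smooth_family (Suc k) S V I w F \<longleftrightarrow> cont_family V I w F \<and>
     (\<exists>F'. family_deriv S V I w F F' \<and> smooth_family k S V (cons_lists S I) (cons_weight w) F')"

abbreviation smooth_map where
  "smooth_map k S V f \<equiv> smooth_family k S V {[]} (\<lambda>_. 1) (\<lambda>_. f)"

lemma smooth_family_cont: "smooth_family k S V I w F \<Longrightarrow> cont_family V I w F"
  by (cases k) auto

lemma cont_familyI:
  assumes "\<And>i. i \<in> I \<Longrightarrow> 0 \<le> w i"
    and "\<And>x. x \<in> V \<Longrightarrow> \<exists>C. \<forall>i\<in>I. norm (F i x) \<le> C * w i"
    and "\<And>x e. x \<in> V \<Longrightarrow> e > 0 \<Longrightarrow> \<forall>\<^sub>F y in at x within V. \<forall>i\<in>I. norm (F i y - F i x) \<le> e * w i"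
  shows "cont_family V I w F"
  unfolding cont_family_def
proof (intro conjI ballI allI impI)
  fix x assume "x \<in> V"
  then obtain C where C: "\<forall>i\<in>I. norm (F i x) \<le> C * w i" using assms(2) by blast
  have "norm (F i x) \<le> max C 0 * w i" if "i \<in> I" for i
    using C that mult_right_mono[OF max.cobounded1[of C 0] assms(1)[OF that]] by force
  thus "\<exists>C\<ge>0. \<forall>i\<in>I. norm (F i x) \<le> C * w i" by (intro exI[of _ "max C 0"]) auto
qed (use assms in auto)

lemma cont_familyD:
  assumes "cont_family V I w F"
  shows "i \<in> I \<Longrightarrow> 0 \<le> w i"
    and "x \<in> V \<Longrightarrow> \<exists>C\<ge>0. \<forall>i\<in>I. norm (F i x) \<le> C * w i"
    and "x \<in> V \<Longrightarrow> e > 0 \<Longrightarrow> \<forall>\<^sub>F y in at x within V. \<forall>i\<in>I. norm (F i y - F i x) \<le> e * w i"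
  using assms by (auto simp: cont_family_def)

lemma cont_family_cong:
  assumes "\<And>i. i \<in> I \<Longrightarrow> w i = w' i" and "\<And>i x. i \<in> I \<Longrightarrow> x \<in> V \<Longrightarrow> F i x = G i x"
  shows "cont_family V I w F \<longleftrightarrow> cont_family V I w' G"
proof -
  have *: "cont_family V I w' G" if "cont_family V I w F"
      and "\<And>i. i \<in> I \<Longrightarrow> w i = w' i" and "\<And>i x. i \<in> I \<Longrightarrow> x \<in> V \<Longrightarrow> F i x = G i x" for w w' F G
  proof (rule cont_familyI)
    fix x and e :: real assume x: "x \<in> V" and e: "e > 0"
    have "\<forall>\<^sub>F y in at x within V. y \<in> V" by (rule eventually_at_in_self)
    thus "\<forall>\<^sub>F y in at x within V. \<forall>i\<in>I. norm (G i y - G i x) \<le> e * w' i"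
      using cont_familyD(3)[OF that(1) x e] by eventually_elim (use that x in auto)
  qed (use cont_familyD(1,2)[OF that(1)] that(2,3) in \<open>auto, metis\<close>)
  show ?thesis using *[of w F w' G] *[of w' G w F] assms by auto
qed

lemma family_deriv_cong:
  assumes "family_deriv S V I w F F'"
    and "\<And>i. i \<in> I \<Longrightarrow> w i = w' i" and "\<And>i x. i \<in> I \<Longrightarrow> x \<in> V \<Longrightarrow> F i x = G i x"
    and "\<And>h i x. h \<in> S \<Longrightarrow> i \<in> I \<Longrightarrow> x \<in> V \<Longrightarrow> F' (h # i) x = G' (h # i) x"
    and "subspace S" and "V \<subseteq> S"
  shows "family_deriv S V I w' G G'"
  unfolding family_deriv_def
proof (intro conjI ballI allI impI)
  fix x i h k and a b :: real assume "x \<in> V" "i \<in> I" "h \<in> S" "k \<in> S"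
  moreover have "a *\<^sub>R h + b *\<^sub>R k \<in> S" using \<open>subspace S\<close> calculation by (simp add: subspace_add subspace_scale)
  ultimately show "G' ((a *\<^sub>R h + b *\<^sub>R k) # i) x = a *\<^sub>R G' (h # i) x + b *\<^sub>R G' (k # i) x"
    using assms(1) assms(4)[symmetric] by (simp add: family_deriv_def)
next
  fix x and e :: real assume x: "x \<in> V" and e: "e > 0"
  have "\<forall>\<^sub>F y in at x within V. y \<in> V" by (rule eventually_at_in_self)
  moreover have "\<forall>\<^sub>F y in at x within V. \<forall>i\<in>I.
        norm (F i y - F i x - F' ((y - x) # i) x) \<le> e * norm (y - x) * w i"
    using assms(1) x e by (auto simp: family_deriv_def)
  ultimately show "\<forall>\<^sub>F y in at x within V. \<forall>i\<in>I.
        norm (G i y - G i x - G' ((y - x) # i) x) \<le> e * norm (y - x) * w' i"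
  proof eventually_elim
    case (elim y)
    have "y - x \<in> S" using elim(1) x assms(5,6) by (auto intro: subspace_diff)
    show ?case using elim assms(2,3,4) x \<open>y - x \<in> S\<close> by auto
  qed
qed

lemma smooth_family_cong:
  assumes "smooth_family k S V I w F" "subspace S" "V \<subseteq> S"
    and "\<And>i. i \<in> I \<Longrightarrow> w i = w' i" and "\<And>i x. i \<in> I \<Longrightarrow> x \<in> V \<Longrightarrow> F i x = G i x"
  shows "smooth_family k S V I w' G"
proof (cases k)
  case 0
  thus ?thesis using assms cont_family_cong[of I w w' V F G] by simp
next
  case (Suc n)
  then obtain F' where F': "family_deriv S V I w F F'"
      "smooth_family n S V (cons_lists S I) (cons_weight w) F'" using assms(1) by auto
  have "smooth_family n S V (cons_lists S I) (cons_weight w') F'"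
  proof -
    \<comment> \<open>The same \<open>F'\<close> serves for \<open>G\<close>, since derivatives only
      see values on \<open>V\<close>; what has to be carried through the recursion is the change of
      weights.\<close>
    have w_cong: "smooth_family n S V J u G \<Longrightarrow> (\<And>i. i \<in> J \<Longrightarrow> u i = u' i) \<Longrightarrow> smooth_family n S V J u' G"
      for J u u' and G :: "'a list \<Rightarrow> 'a \<Rightarrow> 'b"
    proof (induction n arbitrary: J u u' G)
      case 0
      thus ?case using cont_family_cong[of J u u' V G G] by simp
    next
      case (Suc n)
      obtain G' where G': "family_deriv S V J u G G'"
        "smooth_family n S V (cons_lists S J) (cons_weight u) G'" using Suc.prems by auto
      have "family_deriv S V J u' G G'"
        by (rule family_deriv_cong[OF G'(1)]) (use assms(2,3) Suc.prems in auto)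
      moreover have "smooth_family n S V (cons_lists S J) (cons_weight u') G'"
        by (rule Suc.IH[OF G'(2)]) (use Suc.prems(2) in \<open>auto elim!: cons_listsE\<close>)
      moreover have "cont_family V J u' G"
        using Suc.prems cont_family_cong[of J u u' V G G] by simp
      ultimately show ?case by auto
    qed
    show ?thesis
      by (rule w_cong[OF F'(2)]) (use assms(4) in \<open>auto elim!: cons_listsE\<close>)
  qed
  moreover have "family_deriv S V I w' G F'"
    by (rule family_deriv_cong[OF F'(1)]) (use assms in auto)
  moreover have "cont_family V I w' G"
    using smooth_family_cont[OF assms(1)] assms cont_family_cong[of I w w' V F G] by simp
  ultimately show ?thesis using Suc by auto
qed

lemma smooth_family_Suc_imp: "smooth_family (Suc k) S V I w F \<Longrightarrow> smooth_family k S V I w F"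
proof (induction k arbitrary: I w F)
  case (Suc k)
  then obtain F' where F': "family_deriv S V I w F F'" "cont_family V I w F"
      "smooth_family (Suc k) S V (cons_lists S I) (cons_weight w) F'" by (subst (asm) smooth_family.simps) auto
  show ?case using Suc.IH[OF F'(3)] F'(1,2) by auto
qed auto

lemma smooth_family_mono:
  assumes "smooth_family k S V I w F" "n \<le> k"
  shows "smooth_family n S V I w F"
  using assms(2,1)
proof (induction rule: dec_induct)
  case (step m)
  thus ?case using smooth_family_Suc_imp by blast
qed

text \<open>Needed to let a factor ignore the newest direction (\<open>\<rho> = tl\<close>, in the
  product rule) and to read a single map as a family that is constant in its index.\<close>

lemma smooth_family_reindex:
  assumes "smooth_family k S V I w F" "subspace S" "V \<subseteq> S"
    and "\<And>j. j \<in> J \<Longrightarrow> \<rho> j \<in> I" and "\<And>j. j \<in> J \<Longrightarrow> w (\<rho> j) = u j"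
  shows "smooth_family k S V J u (\<lambda>j. F (\<rho> j))"
  using assms
proof (induction k arbitrary: I w F J \<rho> u)
  case 0
  show ?case unfolding smooth_family.simps
  proof (rule cont_familyI)
    fix x and e :: real assume x: "x \<in> V" and e: "e > 0"
    have "\<forall>\<^sub>F y in at x within V. \<forall>i\<in>I. norm (F i y - F i x) \<le> e * w i"
      using cont_familyD(3)[of V I w F x e] 0 x e by simp
    thus "\<forall>\<^sub>F y in at x within V. \<forall>j\<in>J. norm (F (\<rho> j) y - F (\<rho> j) x) \<le> e * u j"
      by eventually_elim (use 0(4,5) in force)
  next
    fix x assume "x \<in> V"
    then obtain C where "\<forall>i\<in>I. norm (F i x) \<le> C * w i" using 0 cont_familyD(2)[of V I w F x] by auto
    thus "\<exists>C. \<forall>i\<in>J. norm (F (\<rho> i) x) \<le> C * u i" using 0(4,5) by (intro exI[of _ C]) force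
  next
    show "0 \<le> u i" if "i \<in> J" for i
      using 0 that cont_familyD(1)[of V I w F "\<rho> i"] by force
  qed
next
  case (Suc k)
  obtain F' where F': "family_deriv S V I w F F'" "cont_family V I w F"
      "smooth_family k S V (cons_lists S I) (cons_weight w) F'" using Suc.prems(1) by auto
  \<comment> \<open>Differentiation puts its direction at the head, so the reindexing acts on the
    tail.\<close>
  define \<rho>' where "\<rho>' = (\<lambda>l. hd l # \<rho> (tl l))"
  have "smooth_family k S V (cons_lists S J) (cons_weight u) (\<lambda>j. F' (\<rho>' j))"
    by (rule Suc.IH[OF F'(3)]) (use Suc.prems in \<open>auto simp: \<rho>'_def elim!: cons_listsE\<close>)
  moreover have "family_deriv S V J u (\<lambda>j. F (\<rho> j)) (\<lambda>j. F' (\<rho>' j))"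
    unfolding family_deriv_def
  proof (intro conjI ballI allI impI)
    fix x and e :: real assume x: "x \<in> V" and e: "e > 0"
    have "\<forall>\<^sub>F y in at x within V. \<forall>i\<in>I.
        norm (F i y - F i x - F' ((y - x) # i) x) \<le> e * norm (y - x) * w i"
      using F'(1) x e by (auto simp: family_deriv_def)
    thus "\<forall>\<^sub>F y in at x within V. \<forall>i\<in>J.
        norm (F (\<rho> i) y - F (\<rho> i) x - F' (\<rho>' ((y - x) # i)) x) \<le> e * norm (y - x) * u i"
      by eventually_elim (use Suc.prems(4,5) in \<open>force simp: \<rho>'_def\<close>)
  qed (use F'(1) Suc.prems(4) in \<open>auto simp: family_deriv_def \<rho>'_def\<close>)
  moreover have "cont_family V J u (\<lambda>j. F (\<rho> j))"
  proof -
    have "smooth_family 0 S V I w F" using F'(2) by simp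
    show ?thesis
    proof (rule cont_familyI)
      fix x and e :: real assume x: "x \<in> V" and e: "e > 0"
      show "\<forall>\<^sub>F y in at x within V. \<forall>j\<in>J. norm (F (\<rho> j) y - F (\<rho> j) x) \<le> e * u j"
        using cont_familyD(3)[OF F'(2) x e] by eventually_elim (use Suc.prems(4,5) in force)
    next
      fix x assume "x \<in> V"
      then obtain C where "\<forall>i\<in>I. norm (F i x) \<le> C * w i" using cont_familyD(2)[OF F'(2)] by auto
      thus "\<exists>C. \<forall>i\<in>J. norm (F (\<rho> i) x) \<le> C * u i"
        using Suc.prems(4,5) by (intro exI[of _ C]) force
    next
      show "0 \<le> u i" if "i \<in> J" for i
        using Suc.prems(4,5) that cont_familyD(1)[OF F'(2)] by force
    qed
  qed
  ultimately show ?case by auto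
qed

lemma cont_family_add:
  assumes "cont_family V I w F" "cont_family V I w G"
  shows "cont_family V I w (\<lambda>i x. F i x + G i x)"
proof (rule cont_familyI)
  fix x assume x: "x \<in> V"
  obtain C D where *: "\<forall>i\<in>I. norm (F i x) \<le> C * w i" "\<forall>i\<in>I. norm (G i x) \<le> D * w i"
    using cont_familyD(2)[OF assms(1) x] cont_familyD(2)[OF assms(2) x] by auto
  show "\<exists>C. \<forall>i\<in>I. norm (F i x + G i x) \<le> C * w i"
    by (rule exI[of _ "C + D"]) (use * in \<open>auto simp: distrib_right intro!: norm_triangle_le add_mono\<close>)
next
  fix x and e :: real assume x: "x \<in> V" and e: "e > 0"
  have "e / 2 > 0" using e by simp
  show "\<forall>\<^sub>F y in at x within V. \<forall>i\<in>I. norm (F i y + G i y - (F i x + G i x)) \<le> e * w i"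
    using cont_familyD(3)[OF assms(1) x \<open>e/2>0\<close>] cont_familyD(3)[OF assms(2) x \<open>e/2>0\<close>]
  proof eventually_elim
    case (elim y)
    show ?case
    proof
      fix i assume i: "i \<in> I"
      have "norm (F i y + G i y - (F i x + G i x)) \<le> norm (F i y - F i x) + norm (G i y - G i x)"
        using norm_triangle_ineq[of "F i y - F i x" "G i y - G i x"] by (simp add: algebra_simps)
      also have "\<dots> \<le> e / 2 * w i + e / 2 * w i" using elim i by (intro add_mono) auto
      finally show "norm (F i y + G i y - (F i x + G i x)) \<le> e * w i" by simp
    qed
  qed
qed (use cont_familyD(1)[OF assms(1)] in auto)

lemma smooth_family_add:
  assumes "smooth_family k S V I w F" "smooth_family k S V I w G"
  shows "smooth_family k S V I w (\<lambda>i x. F i x + G i x)"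
  using assms
proof (induction k arbitrary: I w F G)
  case 0 thus ?case by (simp add: cont_family_add)
next
  case (Suc k)
  obtain F' where F': "family_deriv S V I w F F'" "cont_family V I w F"
      "smooth_family k S V (cons_lists S I) (cons_weight w) F'" using Suc.prems(1) by auto
  obtain G' where G': "family_deriv S V I w G G'" "cont_family V I w G"
      "smooth_family k S V (cons_lists S I) (cons_weight w) G'" using Suc.prems(2) by auto
  have "family_deriv S V I w (\<lambda>i x. F i x + G i x) (\<lambda>i x. F' i x + G' i x)"
    unfolding family_deriv_def
  proof (intro conjI ballI allI impI)
    fix x and e :: real assume x: "x \<in> V" and e: "e > 0"
    have "\<forall>\<^sub>F y in at x within V. \<forall>i\<in>I.
        norm (F i y - F i x - F' ((y - x) # i) x) \<le> e / 2 * norm (y - x) * w i"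
      using F'(1) x e half_gt_zero unfolding family_deriv_def by blast
    moreover have "\<forall>\<^sub>F y in at x within V. \<forall>i\<in>I.
        norm (G i y - G i x - G' ((y - x) # i) x) \<le> e / 2 * norm (y - x) * w i"
      using G'(1) x e half_gt_zero unfolding family_deriv_def by blast
    ultimately show "\<forall>\<^sub>F y in at x within V. \<forall>i\<in>I.
        norm (F i y + G i y - (F i x + G i x) - (F' ((y - x) # i) x + G' ((y - x) # i) x)) \<le> e * norm (y - x) * w i"
    proof eventually_elim
      case (elim y)
      show ?case
      proof
        fix i assume i: "i \<in> I"
        have "norm (F i y + G i y - (F i x + G i x) - (F' ((y - x) # i) x + G' ((y - x) # i) x))
          \<le> norm (F i y - F i x - F' ((y - x) # i) x) + norm (G i y - G i x - G' ((y - x) # i) x)"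
          using norm_triangle_ineq[of "F i y - F i x - F' ((y - x) # i) x" "G i y - G i x - G' ((y - x) # i) x"]
          by (simp add: algebra_simps)
        also have "\<dots> \<le> e / 2 * norm (y - x) * w i + e / 2 * norm (y - x) * w i"
          using elim i by (intro add_mono) auto
        finally show "norm (F i y + G i y - (F i x + G i x) - (F' ((y - x) # i) x + G' ((y - x) # i) x))
          \<le> e * norm (y - x) * w i" by argo
      qed
    qed
  qed (use F'(1) G'(1) in \<open>auto simp: family_deriv_def algebra_simps\<close>)
  thus ?case using Suc.IH[OF F'(3) G'(3)] cont_family_add[OF F'(2) G'(2)] by auto
qed

lemma smooth_family_linear:
  assumes "smooth_family k S V I w F" "bounded_linear T"
  shows "smooth_family k S V I w (\<lambda>i x. T (F i x))"
  using assms(1)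
proof (induction k arbitrary: I w F)
  note cf = cont_familyD
  interpret T: bounded_linear T by fact
  obtain K where K: "K > 0" "\<And>x. norm (T x) \<le> norm x * K" using T.pos_bounded by auto
  have cont: "cont_family V I w (\<lambda>i x. T (F i x))" if "cont_family V I w F" for I w F
  proof (rule cont_familyI)
    fix x assume x: "x \<in> V"
    obtain C where C: "\<forall>i\<in>I. norm (F i x) \<le> C * w i" using cf(2)[OF \<open>cont_family V I w F\<close> x] by blast
    have "norm (T (F i x)) \<le> K * C * w i" if i: "i \<in> I" for i
    proof -
      have "norm (T (F i x)) \<le> norm (F i x) * K" by (rule K)
      also have "\<dots> \<le> (C * w i) * K" using C i K by (intro mult_right_mono) auto
      finally show ?thesis by (simp add: ac_simps)
    qed
    thus "\<exists>C. \<forall>i\<in>I. norm (T (F i x)) \<le> C * w i" by blast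
  next
    fix x and e :: real assume x: "x \<in> V" and e: "e > 0"
    have "e / K > 0" using e K by simp
    show "\<forall>\<^sub>F y in at x within V. \<forall>i\<in>I. norm (T (F i y) - T (F i x)) \<le> e * w i"
      using cf(3)[OF that x \<open>e / K > 0\<close>]
    proof eventually_elim
      case (elim y)
      show ?case
      proof
        fix i assume "i \<in> I"
        have "norm (T (F i y) - T (F i x)) \<le> norm (F i y - F i x) * K"
          using K(2)[of "F i y - F i x"] by (simp add: T.diff)
        also have "\<dots> \<le> (e / K * w i) * K" using elim \<open>i \<in> I\<close> K by (intro mult_right_mono) auto
        finally show "norm (T (F i y) - T (F i x)) \<le> e * w i" using K by simp
      qed
    qed
  qed (use cf(1)[OF that] in auto)
  {
    case 0 thus ?case using cont by simp
  next
    case (Suc k)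
    obtain F' where F': "family_deriv S V I w F F'" "cont_family V I w F"
      "smooth_family k S V (cons_lists S I) (cons_weight w) F'" using Suc.prems(1) by auto
    have "family_deriv S V I w (\<lambda>i x. T (F i x)) (\<lambda>i x. T (F' i x))"
      unfolding family_deriv_def
    proof (intro conjI ballI allI impI)
      fix x and e :: real assume x: "x \<in> V" and e: "e > 0"
      have "e / K > 0" using e K by simp
      have "\<forall>\<^sub>F y in at x within V. \<forall>i\<in>I.
        norm (F i y - F i x - F' ((y - x) # i) x) \<le> e / K * norm (y - x) * w i"
        using F'(1) x \<open>e / K > 0\<close> unfolding family_deriv_def by blast
      thus "\<forall>\<^sub>F y in at x within V. \<forall>i\<in>I.
        norm (T (F i y) - T (F i x) - T (F' ((y - x) # i) x)) \<le> e * norm (y - x) * w i"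
      proof eventually_elim
        case (elim y)
        show ?case
        proof
          fix i assume "i \<in> I"
          have "norm (T (F i y) - T (F i x) - T (F' ((y - x) # i) x)) \<le> norm (F i y - F i x - F' ((y - x) # i) x) * K"
            using K(2)[of "F i y - F i x - F' ((y - x) # i) x"] by (simp add: T.diff)
          also have "\<dots> \<le> (e / K * norm (y - x) * w i) * K" using elim \<open>i \<in> I\<close> K by (intro mult_right_mono) auto
          finally show "norm (T (F i y) - T (F i x) - T (F' ((y - x) # i) x)) \<le> e * norm (y - x) * w i"
            using K by simp
        qed
      qed
    qed (use F'(1) in \<open>auto simp: family_deriv_def T.add T.scaleR\<close>)
    thus ?case using Suc.IH[OF F'(3)] cont[OF F'(2)] by auto
  }
qed

text \<open>Of the three terms of the expansion about \<open>(a, b)\<close> the cross term is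
  quadratic in \<open>t\<close>; \<open>t \<le> 1\<close> reduces it to a linear one, so a single
  constant serves.\<close>

lemma (in bounded_bilinear) norm_sq_diff:
  assumes "norm (b' - b) \<le> t * v" "norm (a' - a) \<le> t * u" "norm a \<le> A * u" "norm b \<le> C * v"
    and "0 \<le> t" "t \<le> 1" "0 \<le> u" "0 \<le> v" "0 \<le> A" "0 \<le> C"
    and K: "\<And>a b. norm (prod a b) \<le> norm a * norm b * K" "0 \<le> K"
  shows "norm (prod a' b' - prod a b) \<le> t * (K * (A + C + 1)) * (u * v)"
proof -
  have "prod a' b' - prod a b = prod (a' - a) (b' - b) + prod a (b' - b) + prod (a' - a) b"
    by (simp add: diff_left diff_right)
  hence "norm (prod a' b' - prod a b) \<le> norm (prod (a' - a) (b' - b)) + norm (prod a (b' - b)) + norm (prod (a' - a) b)"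
    by (metis add_mono norm_triangle_ineq norm_triangle_le order_refl)
  also have "\<dots> \<le> (t * u) * (t * v) * K + (A * u) * (t * v) * K + (t * u) * (C * v) * K"
    using assms by (intro add_mono order_trans[OF K(1)] mult_mono) auto
  also have "\<dots> \<le> (t * u) * (1 * v) * K + (A * u) * (t * v) * K + (t * u) * (C * v) * K"
    using assms by (intro add_mono mult_mono) auto
  finally show ?thesis by (simp add: algebra_simps)
qed

lemma (in bounded_bilinear) norm_product_rule:
  assumes "norm (a' - a - da) \<le> t * n * u" "norm (b' - b - db) \<le> t * n * v" "norm (a' - a) \<le> t * u"
    and "norm a \<le> A * u" "norm b \<le> C * v" "norm db \<le> D * (n * v)"
    and "0 \<le> t" "t \<le> 1" "0 \<le> u" "0 \<le> v" "0 \<le> n" "0 \<le> A" "0 \<le> C" "0 \<le> D"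
    and K: "\<And>a b. norm (prod a b) \<le> norm a * norm b * K" "0 \<le> K"
  shows "norm (prod a' b' - prod a b - (prod da b + prod a db)) \<le> t * (K * (A + C + D + 1)) * n * (u * v)"
proof -
  have eq: "prod a' b' - prod a b - (prod da b + prod a db)
      = prod (a' - a - da) b + prod a (b' - b - db) + prod (a' - a) (b' - b)"
    by (simp add: diff_left diff_right add_left add_right algebra_simps)
  \<comment> \<open>The cross term of \<open>a' - a\<close> and \<open>b' - b\<close> must carry the
    factor \<open>n\<close>; it comes from \<open>b' - b\<close>, estimated through its
    linearization \<open>db\<close>.\<close>
  have b: "norm (b' - b) \<le> (D + 1) * n * v"
  proof -
    have "norm (b' - b) \<le> norm (b' - b - db) + norm db"
      using norm_triangle_ineq[of "b' - b - db" db] by simp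
    also have "\<dots> \<le> t * n * v + D * (n * v)" using assms by (intro add_mono) auto
    also have "\<dots> \<le> 1 * n * v + D * (n * v)" using assms by (intro add_mono mult_right_mono) auto
    finally show ?thesis by (simp add: algebra_simps)
  qed
  have "norm (prod a' b' - prod a b - (prod da b + prod a db))
     \<le> norm (prod (a' - a - da) b) + norm (prod a (b' - b - db)) + norm (prod (a' - a) (b' - b))"
    unfolding eq by (metis add_mono norm_triangle_ineq norm_triangle_le order_refl)
  also have "\<dots> \<le> (t * n * u) * (C * v) * K + (A * u) * (t * n * v) * K + (t * u) * ((D + 1) * n * v) * K"
    using assms b by (intro add_mono order_trans[OF K(1)] mult_mono) auto
  finally show ?thesis by (simp add: algebra_simps)
qed

text \<open>Choice of a tolerance: \<open>M\<close> collects the constants of an estimate and may be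
  0, whence \<open>M + 1\<close> in the denominator.\<close>

lemma scaled_threshold:
  fixes M e :: real assumes "0 \<le> M" "0 < e"
  obtains t where "0 < t" "t \<le> 1" "t * M \<le> e"
proof
  show "0 < min 1 (e / (M + 1))" "min 1 (e / (M + 1)) \<le> 1" using assms by auto
  have "min 1 (e / (M + 1)) * M \<le> e / (M + 1) * (M + 1)" using assms by (intro mult_mono) auto
  thus "min 1 (e / (M + 1)) * M \<le> e" using assms by simp
qed

lemma cont_family_bilinear:
  assumes "bounded_bilinear B" and F: "cont_family V I w F" and G: "cont_family V I u G"
  shows "cont_family V I (\<lambda>i. w i * u i) (\<lambda>i x. B (F i x) (G i x))"
proof (rule cont_familyI)
  interpret bounded_bilinear B by fact
  obtain K where K: "0 \<le> K" "\<And>a b. norm (B a b) \<le> norm a * norm b * K" using nonneg_bounded by auto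
  {
    fix x assume x: "x \<in> V"
    obtain A C where *: "\<forall>i\<in>I. norm (F i x) \<le> A * w i" "\<forall>i\<in>I. norm (G i x) \<le> C * u i" "0 \<le> A" "0 \<le> C"
      using cont_familyD(2)[OF F x] cont_familyD(2)[OF G x] by auto
    have "norm (B (F i x) (G i x)) \<le> A * C * K * (w i * u i)" if "i \<in> I" for i
    proof -
      have "norm (B (F i x) (G i x)) \<le> norm (F i x) * norm (G i x) * K" by (rule K)
      also have "\<dots> \<le> (A * w i) * (C * u i) * K"
        using * that K cont_familyD(1)[OF F] cont_familyD(1)[OF G] by (intro mult_mono mult_nonneg_nonneg) auto
      finally show ?thesis by (simp add: ac_simps)
    qed
    thus "\<exists>C. \<forall>i\<in>I. norm (B (F i x) (G i x)) \<le> C * (w i * u i)" by blast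
    fix e :: real assume e: "e > 0"
    obtain t where t: "0 < t" "t \<le> 1" "t * (K * (A + C + 1)) \<le> e"
      by (rule scaled_threshold[of "K * (A + C + 1)" e]) (use K * e in auto)
    show "\<forall>\<^sub>F y in at x within V. \<forall>i\<in>I. norm (B (F i y) (G i y) - B (F i x) (G i x)) \<le> e * (w i * u i)"
      using cont_familyD(3)[OF F x t(1)] cont_familyD(3)[OF G x t(1)]
    proof eventually_elim
      case (elim y)
      show ?case
      proof
        fix i assume i: "i \<in> I"
        have wu: "0 \<le> w i" "0 \<le> u i" using i cont_familyD(1)[OF F] cont_familyD(1)[OF G] by auto
        have "norm (B (F i y) (G i y) - B (F i x) (G i x)) \<le> t * (K * (A + C + 1)) * (w i * u i)"
          using norm_sq_diff[of "G i y" "G i x" t "u i" "F i y" "F i x" "w i" A C K] elim i wu K t * by auto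
        also have "\<dots> \<le> e * (w i * u i)" using t(3) wu by (intro mult_right_mono) auto
        finally show "norm (B (F i y) (G i y) - B (F i x) (G i x)) \<le> e * (w i * u i)" .
      qed
    qed
  }
qed (use cont_familyD(1)[OF F] cont_familyD(1)[OF G] in auto)

lemma family_deriv_bilinear:
  assumes "bounded_bilinear B" and S: "subspace S" "V \<subseteq> S"
    and F: "cont_family V I w F" "family_deriv S V I w F F'"
    and G: "cont_family V I u G" "family_deriv S V I u G G'" "cont_family V (cons_lists S I) (cons_weight u) G'"
  shows "family_deriv S V I (\<lambda>i. w i * u i) (\<lambda>i x. B (F i x) (G i x))
          (\<lambda>l x. B (F' l x) (G (tl l) x) + B (F (tl l) x) (G' l x))"
  unfolding family_deriv_def
proof (intro conjI ballI allI impI)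
  interpret bounded_bilinear B by fact
  obtain K where K: "0 \<le> K" "\<And>a b. norm (B a b) \<le> norm a * norm b * K" using nonneg_bounded by auto
  fix x assume x: "x \<in> V"
  {
    fix i h k and a b :: real
    assume "i \<in> I" "h \<in> S" "k \<in> S"
    hence "F' ((a *\<^sub>R h + b *\<^sub>R k) # i) x = a *\<^sub>R F' (h # i) x + b *\<^sub>R F' (k # i) x"
      "G' ((a *\<^sub>R h + b *\<^sub>R k) # i) x = a *\<^sub>R G' (h # i) x + b *\<^sub>R G' (k # i) x"
      using F(2) G(2) x by (auto simp: family_deriv_def)
    thus "B (F' ((a *\<^sub>R h + b *\<^sub>R k) # i) x) (G (tl ((a *\<^sub>R h + b *\<^sub>R k) # i)) x) +
       B (F (tl ((a *\<^sub>R h + b *\<^sub>R k) # i)) x) (G' ((a *\<^sub>R h + b *\<^sub>R k) # i) x) =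
       a *\<^sub>R (B (F' (h # i) x) (G (tl (h # i)) x) + B (F (tl (h # i)) x) (G' (h # i) x)) +
       b *\<^sub>R (B (F' (k # i) x) (G (tl (k # i)) x) + B (F (tl (k # i)) x) (G' (k # i) x))"
      by (simp add: add_left add_right scaleR_left scaleR_right algebra_simps)
  }
  obtain A C where *: "\<forall>i\<in>I. norm (F i x) \<le> A * w i" "\<forall>i\<in>I. norm (G i x) \<le> C * u i" "0 \<le> A" "0 \<le> C"
    using cont_familyD(2)[OF F(1) x] cont_familyD(2)[OF G(1) x] by auto
  obtain D where D: "\<forall>l\<in>cons_lists S I. norm (G' l x) \<le> D * cons_weight u l" "0 \<le> D"
    using cont_familyD(2)[OF G(3) x] by auto
  fix e :: real assume e: "e > 0"
  obtain t where t: "0 < t" "t \<le> 1" "t * (K * (A + C + D + 1)) \<le> e"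
    by (rule scaled_threshold[of "K * (A + C + D + 1)" e]) (use K * D e in auto)
  have "\<forall>\<^sub>F y in at x within V. y \<in> V" by (rule eventually_at_in_self)
  moreover have "\<forall>\<^sub>F y in at x within V. \<forall>i\<in>I. norm (F i y - F i x - F' ((y - x) # i) x) \<le> t * norm (y - x) * w i"
    using F(2) x t unfolding family_deriv_def by blast
  moreover have "\<forall>\<^sub>F y in at x within V. \<forall>i\<in>I. norm (G i y - G i x - G' ((y - x) # i) x) \<le> t * norm (y - x) * u i"
    using G(2) x t unfolding family_deriv_def by blast
  ultimately
  show "\<forall>\<^sub>F y in at x within V. \<forall>i\<in>I. norm (B (F i y) (G i y) - B (F i x) (G i x) -
      (B (F' ((y - x) # i) x) (G (tl ((y - x) # i)) x) + B (F (tl ((y - x) # i)) x) (G' ((y - x) # i) x)))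
      \<le> e * norm (y - x) * (w i * u i)"
    using cont_familyD(3)[OF F(1) x t(1)]
  proof eventually_elim
    case (elim y)
    show ?case
    proof
      fix i assume i: "i \<in> I"
      have wu: "0 \<le> w i" "0 \<le> u i" using i cont_familyD(1)[OF F(1)] cont_familyD(1)[OF G(1)] by auto
      have "y - x \<in> S" using elim(1) x S by (auto intro: subspace_diff)
      hence "norm (G' ((y - x) # i) x) \<le> D * (norm (y - x) * u i)"
        using bspec[OF D(1), of "(y - x) # i"] i by simp
      hence "norm (B (F i y) (G i y) - B (F i x) (G i x) - (B (F' ((y - x) # i) x) (G i x) + B (F i x) (G' ((y - x) # i) x)))
        \<le> t * (K * (A + C + D + 1)) * norm (y - x) * (w i * u i)"
        using elim i wu K t * D(2) by (intro norm_product_rule) auto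
      also have "\<dots> \<le> e * norm (y - x) * (w i * u i)" using t(3) wu by (intro mult_right_mono) auto
      finally show "norm (B (F i y) (G i y) - B (F i x) (G i x) -
      (B (F' ((y - x) # i) x) (G (tl ((y - x) # i)) x) + B (F (tl ((y - x) # i)) x) (G' ((y - x) # i) x)))
      \<le> e * norm (y - x) * (w i * u i)" by simp
    qed
  qed
qed

lemma smooth_family_bilinear:
  assumes "bounded_bilinear B" and S: "subspace S" "V \<subseteq> S"
    and "smooth_family k S V I w F" "smooth_family k S V I u G"
  shows "smooth_family k S V I (\<lambda>i. w i * u i) (\<lambda>i x. B (F i x) (G i x))"
  using assms(4,5)
proof (induction k arbitrary: I w F u G)
  case 0 thus ?case using cont_family_bilinear[OF assms(1)] by simp
next
  case (Suc k)
  obtain F' where F': "family_deriv S V I w F F'" "cont_family V I w F"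
      "smooth_family k S V (cons_lists S I) (cons_weight w) F'" using Suc.prems(1) by auto
  obtain G' where G': "family_deriv S V I u G G'" "cont_family V I u G"
      "smooth_family k S V (cons_lists S I) (cons_weight u) G'" using Suc.prems(2) by auto
  \<comment> \<open>The undifferentiated factor ignores the head of the index, and its weight omits
    the norm of that head, which the differentiated factor contributes; together they give
    \<open>cons_weight\<close> of the product.\<close>
  have tl: "smooth_family k S V (cons_lists S I) (\<lambda>l. w (tl l)) (\<lambda>l. F (tl l))"
    "smooth_family k S V (cons_lists S I) (\<lambda>l. u (tl l)) (\<lambda>l. G (tl l))"
    by (rule smooth_family_reindex[OF smooth_family_Suc_imp[OF Suc.prems(1)] S];
        force simp: cons_lists_def)
       (rule smooth_family_reindex[OF smooth_family_Suc_imp[OF Suc.prems(2)] S];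
        force simp: cons_lists_def)
  have "smooth_family k S V (cons_lists S I) (cons_weight (\<lambda>i. w i * u i)) (\<lambda>l x. B (F' l x) (G (tl l) x))"
    by (rule smooth_family_cong[OF Suc.IH[OF F'(3) tl(2)] S]) (auto elim!: cons_listsE)
  moreover have "smooth_family k S V (cons_lists S I) (cons_weight (\<lambda>i. w i * u i)) (\<lambda>l x. B (F (tl l) x) (G' l x))"
    by (rule smooth_family_cong[OF Suc.IH[OF tl(1) G'(3)] S]) (auto elim!: cons_listsE)
  ultimately have "smooth_family k S V (cons_lists S I) (cons_weight (\<lambda>i. w i * u i))
      (\<lambda>l x. B (F' l x) (G (tl l) x) + B (F (tl l) x) (G' l x))"
    by (rule smooth_family_add)
  thus ?case
    using family_deriv_bilinear[OF assms(1) S F'(2,1) G'(2,1) smooth_family_cont[OF G'(3)]]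
      cont_family_bilinear[OF assms(1) F'(2) G'(2)] by auto
qed

lemma smooth_family_const:
  assumes "\<And>i. i \<in> I \<Longrightarrow> norm (c i) \<le> C * w i" "\<And>i. i \<in> I \<Longrightarrow> 0 \<le> w i"
  shows "smooth_family k S V I w (\<lambda>i _. c i)"
  using assms
proof (induction k arbitrary: I w c C)
  case 0 thus ?case by (auto intro!: cont_familyI)
next
  case (Suc k)
  have "family_deriv S V I w (\<lambda>i _. c i) (\<lambda>_ _. 0)"
    using Suc.prems by (auto simp: family_deriv_def)
  moreover have "smooth_family k S V (cons_lists S I) (cons_weight w) (\<lambda>_ _. 0 :: 'b)"
    by (rule Suc.IH[where C = 0]) (use Suc.prems in \<open>auto elim!: cons_listsE\<close>)
  moreover have "cont_family V I w (\<lambda>i _. c i)" using Suc.prems by (auto intro!: cont_familyI)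
  ultimately show ?case by auto
qed

lemma smooth_map_bounded_linear:
  assumes "bounded_linear L"
  shows "smooth_map k S V L"
proof -
  interpret bounded_linear L by fact
  obtain K where K: "K > 0" "\<And>x. norm (L x) \<le> norm x * K" using pos_bounded by auto
  have cont: "cont_family V {[]} (\<lambda>_. 1) (\<lambda>_. L)"
  proof (rule cont_familyI)
    fix x and e :: real assume "x \<in> V" "e > 0"
    have "(L \<longlongrightarrow> L x) (at x within V)" by (rule tendsto) (rule tendsto_ident_at)
    hence "\<forall>\<^sub>F y in at x within V. dist (L y) (L x) < e" using \<open>e > 0\<close> by (rule tendstoD)
    thus "\<forall>\<^sub>F y in at x within V. \<forall>i\<in>{[]}. norm (L y - L x) \<le> e * 1"
      by eventually_elim (auto simp: dist_norm)
  qed auto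
  show ?thesis
  proof (cases k)
    case 0 thus ?thesis using cont by simp
  next
    case (Suc n)
    have "family_deriv S V {[]} (\<lambda>_. 1) (\<lambda>_. L) (\<lambda>l _. L (hd l))"
      by (auto simp: family_deriv_def add scaleR diff)
    moreover have "smooth_family n S V (cons_lists S {[]}) (cons_weight (\<lambda>_. 1)) (\<lambda>l _. L (hd l))"
      by (rule smooth_family_const[where C = K]) (use K in \<open>auto elim!: cons_listsE simp: mult.commute\<close>)
    ultimately show ?thesis using cont Suc by auto
  qed
qed

section \<open>Canonical derivatives and the passage to \<open>C_class_on\<close>\<close>

text \<open>\<open>smooth_map k\<close> provides its derivatives existentially and separately for
  each \<open>k\<close>, whereas \<open>C_class_on\<close> asks for one sequence for all orders,
  possibly infinitely many. A derivative is determined by its directional limits, so this limit is a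
  choice independent of \<open>k\<close>.\<close>

definition dir_deriv :: "('a::real_normed_vector list \<Rightarrow> 'a \<Rightarrow> 'b::real_normed_vector) \<Rightarrow> 'a list \<Rightarrow> 'a \<Rightarrow> 'b" where
  "dir_deriv F l x = Lim (at 0) (\<lambda>t::real. (F (tl l) (x + t *\<^sub>R hd l) - F (tl l) x) /\<^sub>R t)"

lemma family_deriv_zero:
  assumes "family_deriv S V I w F F'" "x \<in> V" "i \<in> I" "0 \<in> S"
  shows "F' (0 # i) x = 0"
proof -
  have "F' ((0 *\<^sub>R 0 + 0 *\<^sub>R 0) # i) x = 0 *\<^sub>R F' (0 # i) x + 0 *\<^sub>R F' (0 # i) x"
    using assms unfolding family_deriv_def by blast
  thus ?thesis by simp
qed

lemma openin_line:
  fixes x h :: "'a::real_normed_vector"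
  assumes S: "subspace S" and V: "openin (top_of_set S) V" and "x \<in> V" "h \<in> S"
  shows "\<forall>\<^sub>F t::real in at 0. x + t *\<^sub>R h \<in> V"
proof -
  obtain T where T: "open T" "V = S \<inter> T" using V by (auto simp: openin_open)
  have "((\<lambda>t::real. x + t *\<^sub>R h) \<longlongrightarrow> x + 0 *\<^sub>R h) (at 0)" by (intro tendsto_intros)
  hence "\<forall>\<^sub>F t::real in at 0. x + t *\<^sub>R h \<in> T" using T assms by (intro topological_tendstoD) auto
  thus ?thesis
  proof eventually_elim
    case (elim t)
    have "x + t *\<^sub>R h \<in> S" using S T assms by (auto intro!: subspace_add subspace_scale)
    thus ?case using elim T by simp
  qed
qed

text \<open>Relative openness keeps \<open>x + t h\<close> in \<open>V\<close> for small
  \<open>t\<close>, so the uniform estimate applies along the line. This makes the derivative unique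
  in the directions of \<open>S\<close>.\<close>

lemma family_deriv_line:
  assumes D: "family_deriv S V I w F F'" and S: "subspace S" and V: "openin (top_of_set S) V"
    and x: "x \<in> V" and h: "h \<in> S" and i: "i \<in> I" and w: "0 \<le> w i"
  shows "((\<lambda>t::real. (F i (x + t *\<^sub>R h) - F i x) /\<^sub>R t) \<longlongrightarrow> F' (h # i) x) (at 0)"
proof (cases "h = 0")
  \<comment> \<open>The filter \<open>at x within V\<close> excludes \<open>x\<close> itself, so the
    line must leave \<open>x\<close>; direction 0 is treated apart.\<close>
  case True
  have "F' (h # i) x = 0" using family_deriv_zero[OF D x i] S True by (simp add: subspace_0)
  thus ?thesis using True by simp
next
  case False
  have VS: "V \<subseteq> S" using openin_imp_subset[OF V] .
  have lim: "filterlim (\<lambda>t::real. x + t *\<^sub>R h) (at x within V) (at 0)"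
    unfolding filterlim_at
  proof
    have "((\<lambda>t::real. x + t *\<^sub>R h) \<longlongrightarrow> x + 0 *\<^sub>R h) (at 0)" by (intro tendsto_intros)
    thus "((\<lambda>t::real. x + t *\<^sub>R h) \<longlongrightarrow> x) (at 0)" by simp
    show "\<forall>\<^sub>F t::real in at 0. x + t *\<^sub>R h \<in> V \<and> x + t *\<^sub>R h \<noteq> x"
      using openin_line[OF S V x h] eventually_neq_at_within[of 0 0 UNIV]
      by eventually_elim (use False in auto)
  qed
  show ?thesis
  proof (rule tendstoI)
    fix e :: real assume e: "e > 0"
    obtain t where t: "0 < t" "t \<le> 1" "t * (norm h * w i) \<le> e / 2"
      by (rule scaled_threshold[of "norm h * w i" "e / 2"]) (use w e in auto)
    have "\<forall>\<^sub>F y in at x within V. \<forall>i\<in>I. norm (F i y - F i x - F' ((y - x) # i) x) \<le> t * norm (y - x) * w i"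
      using D x t unfolding family_deriv_def by blast
    hence "\<forall>\<^sub>F s::real in at 0. \<forall>i\<in>I. norm (F i (x + s *\<^sub>R h) - F i x - F' ((s *\<^sub>R h) # i) x) \<le> t * norm (s *\<^sub>R h) * w i"
      using lim by (auto simp: filterlim_iff)
    thus "\<forall>\<^sub>F s::real in at 0. dist ((F i (x + s *\<^sub>R h) - F i x) /\<^sub>R s) (F' (h # i) x) < e"
      using eventually_neq_at_within[of 0 0 UNIV]
    proof eventually_elim
      case (elim s)
      have "F' ((s *\<^sub>R h + 0 *\<^sub>R h) # i) x = s *\<^sub>R F' (h # i) x + 0 *\<^sub>R F' (h # i) x"
        using D x i h unfolding family_deriv_def by blast
      hence "(F i (x + s *\<^sub>R h) - F i x) /\<^sub>R s - F' (h # i) x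
        = (F i (x + s *\<^sub>R h) - F i x - F' ((s *\<^sub>R h) # i) x) /\<^sub>R s" using elim(2)
        by (simp add: scaleR_diff_right)
      hence "dist ((F i (x + s *\<^sub>R h) - F i x) /\<^sub>R s) (F' (h # i) x)
        = norm (F i (x + s *\<^sub>R h) - F i x - F' ((s *\<^sub>R h) # i) x) / \<bar>s\<bar>"
        by (simp add: dist_norm divide_inverse mult.commute)
      also have "\<dots> \<le> (t * norm (s *\<^sub>R h) * w i) / \<bar>s\<bar>"
        using elim(1) i by (intro divide_right_mono) auto
      also have "\<dots> = t * (norm h * w i)" using elim(2) by simp
      also have "\<dots> < e" using t e by linarith
      finally show ?case .
    qed
  qed
qed

lemma smooth_family_dir_deriv:
  assumes "smooth_family (Suc k) S V I w F" and S: "subspace S" and V: "openin (top_of_set S) V"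
  shows "family_deriv S V I w F (dir_deriv F)"
    and "smooth_family k S V (cons_lists S I) (cons_weight w) (dir_deriv F)"
proof -
  have VS: "V \<subseteq> S" using openin_imp_subset[OF V] .
  obtain F' where F': "family_deriv S V I w F F'" "cont_family V I w F"
      "smooth_family k S V (cons_lists S I) (cons_weight w) F'" using assms(1) by auto
  have eq: "F' (h # i) x = dir_deriv F (h # i) x" if "h \<in> S" "i \<in> I" "x \<in> V" for h i x
    using family_deriv_line[OF F'(1) S V that(3,1,2)] cont_familyD(1)[OF F'(2) that(2)]
    by (simp add: dir_deriv_def tendsto_Lim)
  show "family_deriv S V I w F (dir_deriv F)"
    by (rule family_deriv_cong[OF F'(1)]) (use eq S VS in auto)
  show "smooth_family k S V (cons_lists S I) (cons_weight w) (dir_deriv F)"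
    by (rule smooth_family_cong[OF F'(3) S VS]) (use eq in \<open>auto elim!: cons_listsE\<close>)
qed

lemma cons_lists_iterate: "(cons_lists S ^^ k) {[]} = {l. length l = k \<and> set l \<subseteq> S}"
proof (induction k)
  case (Suc k)
  have "l \<in> cons_lists S {l. length l = k \<and> set l \<subseteq> S} \<longleftrightarrow> length l = Suc k \<and> set l \<subseteq> S" for l
    by (cases l) (auto simp: cons_lists_def)
  thus ?case using Suc by auto
qed auto

lemma cons_weight_iterate: "(cons_weight ^^ length l) (\<lambda>_. 1) l = prod_list (map norm l)"
  by (induction l) auto

lemma smooth_map_iterate_dir_deriv:
  assumes "smooth_map (k + n) S V f" and S: "subspace S" and V: "openin (top_of_set S) V"
  shows "smooth_family n S V {l. length l = k \<and> set l \<subseteq> S} ((cons_weight ^^ k) (\<lambda>_. 1))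
    ((dir_deriv ^^ k) (\<lambda>_. f))"
  using assms(1) unfolding cons_lists_iterate[symmetric]
proof (induction k arbitrary: n)
  case (Suc k)
  have "smooth_family (Suc n) S V ((cons_lists S ^^ k) {[]}) ((cons_weight ^^ k) (\<lambda>_. 1)) ((dir_deriv ^^ k) (\<lambda>_. f))"
    by (rule Suc.IH) (use Suc.prems in simp)
  from smooth_family_dir_deriv(2)[OF this S V] show ?case by simp
qed simp

text \<open>\<open>family_deriv\<close> gives linearity in the head slot only, the case
  \<open>us = []\<close>. Each further direction in front is a limit of difference quotients of the
  previous identity, and limits preserve linear relations.\<close>

lemma iterate_dir_deriv_multilinear:
  assumes "smooth_map (length us + 1 + length vs) S V f"
    and S: "subspace S" and V: "openin (top_of_set S) V"
    and "set us \<subseteq> S" "set vs \<subseteq> S" "h \<in> S" "k \<in> S" "x \<in> V"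
  defines "D \<equiv> \<lambda>us. (dir_deriv ^^ (length us + 1 + length vs)) (\<lambda>_. f)"
  shows "D us (us @ (a *\<^sub>R h + b *\<^sub>R k) # vs) x = a *\<^sub>R D us (us @ h # vs) x + b *\<^sub>R D us (us @ k # vs) x"
  using assms(1,4,8)
proof (induction us arbitrary: x)
  case Nil
  have "smooth_family (Suc 0) S V {l. length l = length vs \<and> set l \<subseteq> S} ((cons_weight ^^ length vs) (\<lambda>_. 1))
    ((dir_deriv ^^ length vs) (\<lambda>_. f))"
    by (rule smooth_map_iterate_dir_deriv[OF _ S V]) (use Nil.prems(1) in \<open>simp del: smooth_family.simps\<close>)
  from smooth_family_dir_deriv(1)[OF this S V] show ?case
    using Nil.prems assms(5-7) by (auto simp: family_deriv_def D_def)
next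
  case (Cons u us)
  define m where "m = length us + 1 + length vs"
  have "smooth_map (m + Suc 0) S V f" using Cons.prems(1) by (simp add: m_def del: smooth_family.simps)
  note sm = smooth_map_iterate_dir_deriv[OF this S V]
  note sm' = smooth_map_iterate_dir_deriv[OF \<open>smooth_map (m + Suc 0) S V f\<close> S V, THEN smooth_family_dir_deriv(1), OF S V]
  have lim: "((\<lambda>t::real. (D us (us @ z # vs) (x + t *\<^sub>R u) - D us (us @ z # vs) x) /\<^sub>R t) \<longlongrightarrow>
      D (u # us) ((u # us) @ z # vs) x) (at 0)" if "z \<in> S" for z
  proof -
    have "us @ z # vs \<in> {l. length l = m \<and> set l \<subseteq> S}" using Cons.prems(2) assms(5) that by (auto simp: m_def)
    from family_deriv_line[OF sm' S V Cons.prems(3) _ this cont_familyD(1)[OF smooth_family_cont[OF sm] this], of u]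
    show ?thesis using Cons.prems(2) by (simp add: D_def m_def)
  qed
  have z: "a *\<^sub>R h + b *\<^sub>R k \<in> S" using S assms(6,7) by (simp add: subspace_add subspace_scale)
  have smus: "smooth_map (length us + 1 + length vs) S V f"
    by (rule smooth_family_mono[OF Cons.prems(1)]) simp
  \<comment> \<open>The identity is needed on all of \<open>V\<close>, since the quotient in
    direction \<open>u\<close> also evaluates it at \<open>x + t u\<close>.\<close>
  have IH: "D us (us @ (a *\<^sub>R h + b *\<^sub>R k) # vs) y = a *\<^sub>R D us (us @ h # vs) y + b *\<^sub>R D us (us @ k # vs) y" if "y \<in> V" for y
    by (rule Cons.IH) (use smus Cons.prems that in auto)
  let ?q = "\<lambda>z t. (D us (us @ z # vs) (x + t *\<^sub>R u) - D us (us @ z # vs) x) /\<^sub>R t"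
  have "((\<lambda>t::real. a *\<^sub>R ?q h t + b *\<^sub>R ?q k t) \<longlongrightarrow>
      a *\<^sub>R D (u # us) ((u # us) @ h # vs) x + b *\<^sub>R D (u # us) ((u # us) @ k # vs) x) (at 0)"
    by (intro tendsto_intros lim assms(6,7))
  moreover have "\<forall>\<^sub>F t::real in at 0. a *\<^sub>R ?q h t + b *\<^sub>R ?q k t = ?q (a *\<^sub>R h + b *\<^sub>R k) t"
  proof -
    have "u \<in> S" using Cons.prems(2) by simp
    from openin_line[OF S V Cons.prems(3) this] show ?thesis
      by eventually_elim (use Cons.prems in \<open>simp add: IH algebra_simps\<close>)
  qed
  ultimately have "((\<lambda>t::real. ?q (a *\<^sub>R h + b *\<^sub>R k) t) \<longlongrightarrow>
      a *\<^sub>R D (u # us) ((u # us) @ h # vs) x + b *\<^sub>R D (u # us) ((u # us) @ k # vs) x) (at 0)"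
    by (rule Lim_transform_eventually)
  thus ?case using lim[OF z] tendsto_unique[of "at (0::real)"] trivial_limit_at by blast
qed

lemma C_class_onI:
  assumes sm: "\<And>k. enat k \<le> r \<Longrightarrow> smooth_map k S V f"
    and S: "subspace S" and V: "openin (top_of_set S) V"
  shows "C_class_on r S V f"
  unfolding C_class_on_def
proof (rule exI[of _ "\<lambda>k x vs. (dir_deriv ^^ k) (\<lambda>_. f) vs x"], intro conjI allI impI ballI)
  let ?D = "\<lambda>k. (dir_deriv ^^ k) (\<lambda>_. f)"
  show "?D 0 [] x = f x" for x by simp
  have cont: "cont_family V {l. length l = k \<and> set l \<subseteq> S} ((cons_weight ^^ k) (\<lambda>_. 1)) (?D k)" if "enat k \<le> r" for k
    using smooth_map_iterate_dir_deriv[OF _ S V, of k 0 f] sm[OF that] by simp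
  {
    fix k x assume k: "enat k \<le> r" and x: "x \<in> V"
    show "bounded_multilinear_on S k (\<lambda>vs. ?D k vs x)"
      unfolding bounded_multilinear_on_def
    proof (intro conjI allI impI ballI)
      obtain C where "\<forall>l\<in>{l. length l = k \<and> set l \<subseteq> S}. norm (?D k l x) \<le> C * (cons_weight ^^ k) (\<lambda>_. 1) l"
        using cont_familyD(2)[OF cont[OF k] x] by auto
      hence "norm (?D k l x) \<le> C * prod_list (map norm l)" if "length l = k" "set l \<subseteq> S" for l
        using that cons_weight_iterate[of l] by auto
      thus "\<exists>C. \<forall>vs. length vs = k \<longrightarrow> set vs \<subseteq> S \<longrightarrow> norm (?D k vs x) \<le> C * prod_list (map norm vs)" by blast
    next
      fix us vs h z and a b :: real
      assume "length us + 1 + length vs = k" "set us \<subseteq> S" "set vs \<subseteq> S" "h \<in> S" "z \<in> S"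
      thus "?D k (us @ (a *\<^sub>R h + b *\<^sub>R z) # vs) x = a *\<^sub>R ?D k (us @ h # vs) x + b *\<^sub>R ?D k (us @ z # vs) x"
        using iterate_dir_deriv_multilinear[OF _ S V, of us vs f h z x a b] sm[OF k] x by auto
    qed
    fix e :: real assume e: "e > 0"
    obtain d where d: "d > 0" "\<forall>y\<in>V. y \<noteq> x \<and> dist y x < d \<longrightarrow> (\<forall>l\<in>{l. length l = k \<and> set l \<subseteq> S}.
        norm (?D k l y - ?D k l x) \<le> e * (cons_weight ^^ k) (\<lambda>_. 1) l)"
      using cont_familyD(3)[OF cont[OF k] x e] unfolding eventually_at by auto
    show "\<exists>d>0. \<forall>y\<in>V. norm (y - x) < d \<longrightarrow> (\<forall>vs. length vs = k \<longrightarrow> set vs \<subseteq> S \<longrightarrow>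
        norm (?D k vs y - ?D k vs x) \<le> e * prod_list (map norm vs))"
    proof (intro exI[of _ d] conjI ballI impI allI)
      fix y vs assume *: "y \<in> V" "norm (y - x) < d" "length vs = k" "set vs \<subseteq> S"
      \<comment> \<open>\<open>cont_family\<close> uses a punctured filter, so \<open>y = x\<close>
        has to be added.\<close>
      show "norm (?D k vs y - ?D k vs x) \<le> e * prod_list (map norm vs)"
      proof (cases "y = x")
        case False
        hence "norm (?D k vs y - ?D k vs x) \<le> e * (cons_weight ^^ k) (\<lambda>_. 1) vs"
          using d(2) * by (simp add: dist_norm)
        thus ?thesis using * cons_weight_iterate[of vs] by simp
      qed (use e in \<open>auto intro!: mult_nonneg_nonneg prod_list_nonneg\<close>)
    qed (fact d)
  }
  fix k x and e :: real assume k: "enat k < r" and x: "x \<in> V" and e: "e > 0"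
  have k': "enat (k + Suc 0) \<le> r" using k by (simp add: Suc_ile_eq)
  note sm' = smooth_map_iterate_dir_deriv[OF sm[OF k'] S V, THEN smooth_family_dir_deriv(1), OF S V]
  obtain d where d: "d > 0" "\<forall>y\<in>V. y \<noteq> x \<and> dist y x < d \<longrightarrow> (\<forall>l\<in>{l. length l = k \<and> set l \<subseteq> S}.
      norm (?D k l y - ?D k l x - dir_deriv (?D k) ((y - x) # l) x) \<le> e * norm (y - x) * (cons_weight ^^ k) (\<lambda>_. 1) l)"
    using sm' x e unfolding family_deriv_def eventually_at by blast
  show "\<exists>d>0. \<forall>y\<in>V. norm (y - x) < d \<longrightarrow> (\<forall>vs. length vs = k \<longrightarrow> set vs \<subseteq> S \<longrightarrow>
      norm (?D k vs y - ?D k vs x - ?D (Suc k) ((y - x) # vs) x) \<le> e * norm (y - x) * prod_list (map norm vs))"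
  proof (intro exI[of _ d] conjI ballI impI allI)
    fix y vs assume *: "y \<in> V" "norm (y - x) < d" "length vs = k" "set vs \<subseteq> S"
    show "norm (?D k vs y - ?D k vs x - ?D (Suc k) ((y - x) # vs) x) \<le> e * norm (y - x) * prod_list (map norm vs)"
    proof (cases "y = x")
      case False
      hence "norm (?D k vs y - ?D k vs x - dir_deriv (?D k) ((y - x) # vs) x) \<le> e * norm (y - x) * (cons_weight ^^ k) (\<lambda>_. 1) vs"
        using d(2) * by (simp add: dist_norm)
      thus ?thesis using * cons_weight_iterate[of vs] by simp
    next
      case True
      thus ?thesis using family_deriv_zero[OF sm' x, of vs] * S by (simp add: subspace_0)
    qed
  qed (fact d)
qed

section \<open>Curves\<close>

text \<open>Functions of one real variable need no multilinear forms; profiles and test functions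
  are handled in this class and converted from or to \<open>C_class_on\<close> only at the
  interfaces.\<close>

primrec C_curve :: "nat \<Rightarrow> (real \<Rightarrow> 'b::real_normed_vector) \<Rightarrow> bool" where
  "C_curve 0 g \<longleftrightarrow> continuous_on UNIV g"
| "C_curve (Suc k) g \<longleftrightarrow> (\<exists>g'. (\<forall>x. (g has_vector_derivative g' x) (at x)) \<and> C_curve k g')"

lemma C_curve_SucI:
  "(\<And>x. (g has_vector_derivative g' x) (at x)) \<Longrightarrow> C_curve k g' \<Longrightarrow> C_curve (Suc k) g"
  by auto

lemma C_curve_SucD:
  assumes "C_curve (Suc k) g"
  shows "(g has_vector_derivative vector_derivative g (at x)) (at x)"
    and "C_curve k (\<lambda>x. vector_derivative g (at x))"
proof -
  obtain g' where g': "\<And>x. (g has_vector_derivative g' x) (at x)" "C_curve k g'" using assms by auto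
  have "(\<lambda>x. vector_derivative g (at x)) = g'" using g'(1) by (auto intro: vector_derivative_at)
  thus "(g has_vector_derivative vector_derivative g (at x)) (at x)"
    "C_curve k (\<lambda>x. vector_derivative g (at x))" using g' by (auto simp: fun_eq_iff)
qed

lemma C_curve_continuous: "C_curve k g \<Longrightarrow> continuous_on UNIV g"
  by (cases k) (auto intro: continuous_on_vector_derivative)

lemma C_curve_Suc_imp: "C_curve (Suc k) g \<Longrightarrow> C_curve k g"
proof (induction k arbitrary: g)
  case 0
  thus ?case using C_curve_continuous[of "Suc 0" g] by simp
next
  case (Suc k)
  then obtain g' where "\<forall>x. (g has_vector_derivative g' x) (at x)" "C_curve (Suc k) g'"
    by (subst (asm) C_curve.simps) auto
  thus ?case using Suc.IH by (intro C_curve_SucI) auto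
qed

lemma C_curve_mono:
  assumes "C_curve k g" "n \<le> k"
  shows "C_curve n g"
  using assms(2,1)
proof (induction rule: dec_induct)
  case (step m)
  thus ?case using C_curve_Suc_imp by blast
qed

lemma C_curve_const [simp]: "C_curve k (\<lambda>_. c)"
  by (induction k arbitrary: c) (auto intro!: exI[of _ "\<lambda>_. 0"])

lemma C_curve_linear:
  assumes "bounded_linear T" "C_curve k g"
  shows "C_curve k (\<lambda>x. T (g x))"
  using assms(2)
proof (induction k arbitrary: g)
  case 0
  thus ?case using assms(1) by (auto intro: bounded_linear.continuous_on)
next
  case (Suc k)
  show ?case
    by (rule C_curve_SucI[OF bounded_linear.has_vector_derivative[OF assms(1) C_curve_SucD(1)[OF Suc.prems]]])
       (rule Suc.IH[OF C_curve_SucD(2)[OF Suc.prems]])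
qed

lemma C_curve_add: "C_curve k f \<Longrightarrow> C_curve k g \<Longrightarrow> C_curve k (\<lambda>x. f x + g x)"
proof (induction k arbitrary: f g)
  case 0
  thus ?case by (auto intro: continuous_on_add)
next
  case (Suc k)
  show ?case
    by (rule C_curve_SucI[OF has_vector_derivative_add[OF C_curve_SucD(1)[OF Suc.prems(1)] C_curve_SucD(1)[OF Suc.prems(2)]]])
       (rule Suc.IH[OF C_curve_SucD(2)[OF Suc.prems(1)] C_curve_SucD(2)[OF Suc.prems(2)]])
qed

lemma C_curve_sum: "(\<And>i. i \<in> A \<Longrightarrow> C_curve k (f i)) \<Longrightarrow> C_curve k (\<lambda>x. \<Sum>i\<in>A. f i x)"
  by (induction A rule: infinite_finite_induct) (auto intro: C_curve_add)

lemma C_curve_bilinear: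
  assumes "bounded_bilinear B" "C_curve k f" "C_curve k g"
  shows "C_curve k (\<lambda>x. B (f x) (g x))"
  using assms(2,3)
proof (induction k arbitrary: f g)
  case 0
  thus ?case using assms(1) by (auto intro: bounded_bilinear.continuous_on)
next
  case (Suc k)
  note fg = C_curve_SucD[OF Suc.prems(1)] C_curve_SucD[OF Suc.prems(2)]
  show ?case
    by (rule C_curve_SucI[OF bounded_bilinear.has_vector_derivative[OF assms(1) fg(1,3)]])
       (intro C_curve_add Suc.IH fg(2,4) C_curve_Suc_imp[OF Suc.prems(1)] C_curve_Suc_imp[OF Suc.prems(2)])
qed

lemmas C_curve_scaleR = C_curve_bilinear[OF bounded_bilinear_scaleR]
lemmas C_curve_mult = C_curve_bilinear[OF bounded_bilinear_mult]

lemma C_curve_minus: "C_curve k f \<Longrightarrow> C_curve k (\<lambda>x. - f x)"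
  using C_curve_linear[OF bounded_linear_minus[OF bounded_linear_ident]] .

lemma C_curve_cos_sin: "C_curve k (\<lambda>x. cos x :: real) \<and> C_curve k (\<lambda>x. sin x :: real)"
proof (induction k)
  case 0
  show ?case by (auto intro: continuous_intros)
next
  case (Suc k)
  have "(cos has_vector_derivative - sin x) (at x)" "(sin has_vector_derivative cos x) (at x)" for x :: real
    by (auto intro!: derivative_eq_intros simp: has_real_derivative_iff_has_vector_derivative[symmetric])
  thus ?case using Suc C_curve_minus[of k sin] C_curve_SucI[of cos "\<lambda>x. - sin x" k] C_curve_SucI[of sin cos k] by blast
qed

text \<open>The derivative of order \<open>m\<close> in directions \<open>h_1, ..., h_m\<close> is
  their product times the \<open>m\<close>-th derivative of the curve; the factor \<open>c i\<close>
  stores this product, so that the induction hypothesis applies to the derivative family.\<close>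

lemma smooth_family_C_curve:
  assumes "C_curve k g" "\<And>i. i \<in> I \<Longrightarrow> \<bar>c i\<bar> \<le> w i"
  shows "smooth_family k UNIV UNIV I w (\<lambda>i x. c i *\<^sub>R g x)"
  using assms
proof (induction k arbitrary: g I w c)
  have cont: "cont_family UNIV I w (\<lambda>i x. c i *\<^sub>R g x)" if "continuous_on UNIV g" "\<And>i. i \<in> I \<Longrightarrow> \<bar>c i\<bar> \<le> w i"
    for g :: "real \<Rightarrow> 'a" and I w and c :: "real list \<Rightarrow> real"
  proof (rule cont_familyI)
    show "\<exists>C. \<forall>i\<in>I. norm (c i *\<^sub>R g x) \<le> C * w i" for x
      by (rule exI[of _ "norm (g x)"]) (use that(2) in \<open>auto simp: mult.commute intro!: mult_right_mono\<close>)
    fix x and e :: real assume "e > 0"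
    have "(g \<longlongrightarrow> g x) (at x)" using that(1) by (simp add: continuous_on_def)
    hence "\<forall>\<^sub>F y in at x. dist (g y) (g x) < e" using \<open>e > 0\<close> by (rule tendstoD)
    thus "\<forall>\<^sub>F y in at x. \<forall>i\<in>I. norm (c i *\<^sub>R g y - c i *\<^sub>R g x) \<le> e * w i"
    proof eventually_elim
      case (elim y)
      show ?case
      proof
        fix i assume "i \<in> I"
        have "norm (c i *\<^sub>R g y - c i *\<^sub>R g x) = norm (g y - g x) * \<bar>c i\<bar>"
          by (simp flip: scaleR_diff_right)
        also have "\<dots> \<le> e * w i" using elim that(2) \<open>i \<in> I\<close> \<open>e > 0\<close>
          by (intro mult_mono) (auto simp: dist_norm)
        finally show "norm (c i *\<^sub>R g y - c i *\<^sub>R g x) \<le> e * w i" .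
      qed
    qed
  qed (use that in force)
  {
    case 0
    thus ?case using cont by simp
  next
    case (Suc k)
    let ?g' = "\<lambda>x. vector_derivative g (at x)"
    note g = C_curve_SucD[OF Suc.prems(1)]
    have "family_deriv UNIV UNIV I w (\<lambda>i x. c i *\<^sub>R g x) (\<lambda>l x. (hd l * c (tl l)) *\<^sub>R ?g' x)"
      unfolding family_deriv_def
    proof (intro conjI ballI allI impI)
      fix x and e :: real assume "e > 0"
      have "(g has_derivative (\<lambda>h. h *\<^sub>R ?g' x)) (at x)" using g(1) by (simp add: has_vector_derivative_def)
      then obtain d where d: "d > 0" "\<And>y. norm (y - x) < d \<Longrightarrow> norm (g y - g x - (y - x) *\<^sub>R ?g' x) \<le> e * norm (y - x)"
        using \<open>e > 0\<close> unfolding has_derivative_at_alt by blast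
      have "\<forall>i\<in>I. norm (c i *\<^sub>R g y - c i *\<^sub>R g x - (hd ((y - x) # i) * c (tl ((y - x) # i))) *\<^sub>R ?g' x)
          \<le> e * norm (y - x) * w i" if "dist y x < d" for y
      proof
        fix i assume "i \<in> I"
        have "norm (c i *\<^sub>R g y - c i *\<^sub>R g x - (hd ((y - x) # i) * c (tl ((y - x) # i))) *\<^sub>R ?g' x)
          = norm (g y - g x - (y - x) *\<^sub>R ?g' x) * \<bar>c i\<bar>"
        proof -
          have "c i *\<^sub>R g y - c i *\<^sub>R g x - (hd ((y - x) # i) * c (tl ((y - x) # i))) *\<^sub>R ?g' x
             = c i *\<^sub>R (g y - g x - (y - x) *\<^sub>R ?g' x)" by (simp add: algebra_simps)
          thus ?thesis by simp
        qed
        also have "\<dots> \<le> e * norm (y - x) * w i"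
          using d(2)[of y] that Suc.prems(2)[OF \<open>i \<in> I\<close>] \<open>e > 0\<close>
          by (intro mult_mono) (auto simp: dist_norm)
        finally show "norm (c i *\<^sub>R g y - c i *\<^sub>R g x - (hd ((y - x) # i) * c (tl ((y - x) # i))) *\<^sub>R ?g' x)
          \<le> e * norm (y - x) * w i" .
      qed
      thus "\<forall>\<^sub>F y in at x. \<forall>i\<in>I. norm (c i *\<^sub>R g y - c i *\<^sub>R g x - (hd ((y - x) # i) * c (tl ((y - x) # i))) *\<^sub>R ?g' x)
          \<le> e * norm (y - x) * w i"
        unfolding eventually_at using d(1) by blast
    qed (auto simp: algebra_simps)
    moreover have "smooth_family k UNIV UNIV (cons_lists UNIV I) (cons_weight w) (\<lambda>l x. (hd l * c (tl l)) *\<^sub>R ?g' x)"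
      by (rule Suc.IH[OF g(2)])
         (use Suc.prems(2) in \<open>auto elim!: cons_listsE simp: abs_mult intro!: mult_left_mono\<close>)
    moreover have "cont_family UNIV I w (\<lambda>i x. c i *\<^sub>R g x)"
      by (rule cont[OF C_curve_continuous[OF Suc.prems(1)] Suc.prems(2)])
    ultimately show ?case by auto
  }
qed

lemma C_class_on_C_curve: "(\<And>k. enat k \<le> r \<Longrightarrow> C_curve k g) \<Longrightarrow> C_class_on r UNIV UNIV g"
  using smooth_family_C_curve[where c = "\<lambda>_. 1" and w = "\<lambda>_. 1" and I = "{[]}" and g = g]
  by (intro C_class_onI) (auto simp: subspace_UNIV)

text \<open>Evaluating the forms at fixed arguments \<open>bs\<close> turns differentiability in the
  norm of forms into ordinary differentiability; the product of the norms of \<open>bs\<close>,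
  possibly 0, is absorbed by the choice of the tolerance.\<close>

lemma C_class_on_has_derivative:
  fixes G :: "nat \<Rightarrow> 'a::real_normed_vector \<Rightarrow> 'a list \<Rightarrow> 'b::real_normed_vector"
  assumes ml: "\<And>x. bounded_multilinear_on UNIV (Suc k) (G (Suc k) x)"
    and d: "\<And>x e. e > 0 \<Longrightarrow> \<exists>d>0. \<forall>y. norm (y - x) < d \<longrightarrow> (\<forall>vs. length vs = k \<longrightarrow>
        norm (G k y vs - G k x vs - G (Suc k) x ((y - x) # vs)) \<le> e * norm (y - x) * prod_list (map norm vs))"
    and len: "length bs = k"
  shows "((\<lambda>y. G k y bs) has_derivative (\<lambda>h. G (Suc k) x (h # bs))) (at x)"
proof -
  have lin: "G (Suc k) x ((a *\<^sub>R h + b *\<^sub>R z) # bs) = a *\<^sub>R G (Suc k) x (h # bs) + b *\<^sub>R G (Suc k) x (z # bs)" for a b h z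
    using ml[of x, unfolded bounded_multilinear_on_def, THEN conjunct1, THEN spec[of _ "[]"], THEN spec[of _ bs]] len by simp
  obtain C where C: "\<forall>vs. length vs = Suc k \<longrightarrow> norm (G (Suc k) x vs) \<le> C * prod_list (map norm vs)"
    using ml[of x] unfolding bounded_multilinear_on_def by auto
  have "bounded_linear (\<lambda>h. G (Suc k) x (h # bs))"
  proof (rule bounded_linear_intro)
    show "G (Suc k) x ((h + z) # bs) = G (Suc k) x (h # bs) + G (Suc k) x (z # bs)" for h z using lin[of 1 h 1 z] by simp
    show "G (Suc k) x ((a *\<^sub>R h) # bs) = a *\<^sub>R G (Suc k) x (h # bs)" for a h using lin[of a h 0 0] by simp
    show "norm (G (Suc k) x (h # bs)) \<le> norm h * (C * prod_list (map norm bs))" for h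
      using C[rule_format, of "h # bs"] len by (simp add: ac_simps)
  qed
  moreover have "\<exists>d>0. \<forall>y. norm (y - x) < d \<longrightarrow> norm (G k y bs - G k x bs - G (Suc k) x ((y - x) # bs)) \<le> e * norm (y - x)"
    if "e > 0" for e
  proof -
    have pn: "0 \<le> prod_list (map norm bs)" by (rule prod_list_nonneg) auto
    obtain t where t: "0 < t" "t * prod_list (map norm bs) \<le> e"
      using scaled_threshold[OF pn \<open>e > 0\<close>] by metis
    obtain d where "d > 0" "\<And>y vs. norm (y - x) < d \<Longrightarrow> length vs = k \<Longrightarrow>
        norm (G k y vs - G k x vs - G (Suc k) x ((y - x) # vs)) \<le> t * norm (y - x) * prod_list (map norm vs)"
      using d[OF t(1), of x] by blast
    moreover have "t * norm z * prod_list (map norm bs) \<le> e * norm z" for z :: 'a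
      using mult_right_mono[OF t(2), of "norm z"] by (simp add: ac_simps)
    ultimately show ?thesis using len by (intro exI[of _ d]) (auto intro: order_trans)
  qed
  ultimately show ?thesis unfolding has_derivative_at_alt by blast
qed

text \<open>The arguments are expanded in the standard basis, so that only the head slot of a derivative
  ever has to be differentiated through.\<close>

lemma C_class_on_compose_curve:
  fixes f :: "'a::euclidean_space \<Rightarrow> 'b::real_normed_vector"
  assumes "C_class_on r UNIV UNIV f" "1 \<le> r"
  obtains f' where "\<And>y. (f has_derivative f' y) (at y)"
    and "\<And>k u. enat k \<le> r \<Longrightarrow> C_curve k u \<Longrightarrow> C_curve k (\<lambda>x. f (u x))"
    and "\<And>k u b. enat (Suc k) \<le> r \<Longrightarrow> C_curve k u \<Longrightarrow> C_curve k (\<lambda>x. f' (u x) b)"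
proof -
  obtain G :: "nat \<Rightarrow> 'a \<Rightarrow> 'a list \<Rightarrow> 'b" where G:
    "\<And>x. G 0 x [] = f x"
    "\<And>k x. enat k \<le> r \<Longrightarrow> bounded_multilinear_on UNIV k (G k x)"
    "\<And>k x e. enat k < r \<Longrightarrow> e > 0 \<Longrightarrow> \<exists>d>0. \<forall>y. norm (y - x) < d \<longrightarrow> (\<forall>vs. length vs = k \<longrightarrow>
        norm (G k y vs - G k x vs - G (Suc k) x ((y - x) # vs)) \<le> e * norm (y - x) * prod_list (map norm vs))"
    "\<And>k x e. enat k \<le> r \<Longrightarrow> e > 0 \<Longrightarrow> \<exists>d>0. \<forall>y. norm (y - x) < d \<longrightarrow> (\<forall>vs. length vs = k \<longrightarrow>
        norm (G k y vs - G k x vs) \<le> e * prod_list (map norm vs))"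
    using assms(1) unfolding C_class_on_def
    apply (elim exE conjE)
    subgoal premises p for G by (rule p(1)[of G]) (use p(2-) in simp_all)
    done
  have deriv: "((\<lambda>y. G k y bs) has_derivative (\<lambda>h. G (Suc k) x (h # bs))) (at x)"
    if "enat (Suc k) \<le> r" "length bs = k" for k x bs
    by (rule C_class_on_has_derivative) (use G(2)[OF that(1)] G(3)[of k] that in \<open>auto simp: Suc_ile_eq\<close>)
  have comp: "C_curve k (\<lambda>x. G m (u x) bs)" if "enat (m + k) \<le> r" "C_curve k u" "length bs = m" for k m u bs
    using that
  proof (induction k arbitrary: m bs)
    case 0
    have "isCont (\<lambda>y. G m y bs) z" for z
    proof -
      have "\<exists>d>0. \<forall>y. norm (y - z) < d \<longrightarrow> norm (G m y bs - G m z bs) < e" if e: "e > 0" for e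
      proof -
        have pn: "0 \<le> prod_list (map norm bs)" by (rule prod_list_nonneg) auto
        obtain t where t: "0 < t" "t * prod_list (map norm bs) \<le> e / 2"
          using scaled_threshold[OF pn, of "e / 2"] e by auto
        obtain d where "d > 0" "\<And>y vs. norm (y - z) < d \<Longrightarrow> length vs = m \<Longrightarrow>
            norm (G m y vs - G m z vs) \<le> t * prod_list (map norm vs)"
          using G(4)[OF _ t(1), of m z] 0 by auto
        thus ?thesis using 0(3) t e by (intro exI[of _ d]) force
      qed
      thus ?thesis by (auto simp: continuous_at_eps_delta dist_norm)
    qed
    hence "continuous_on UNIV (\<lambda>y. G m y bs)" by (simp add: continuous_at_imp_continuous_on)
    thus ?case using 0(2) continuous_on_compose2[of UNIV "\<lambda>y. G m y bs" UNIV u] by simp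
  next
    case (Suc k)
    have m: "enat (Suc m) \<le> r" "enat (Suc m + k) \<le> r" using Suc.prems(1) by (auto intro: order_trans[rotated])
    note u = C_curve_SucD[OF Suc.prems(2)]
    let ?u' = "\<lambda>x. vector_derivative u (at x)"
    have "((\<lambda>x. G m (u x) bs) has_vector_derivative (\<Sum>b\<in>Basis. (?u' x \<bullet> b) *\<^sub>R G (Suc m) (u x) (b # bs))) (at x)" for x
    proof -
      have d: "((\<lambda>y. G m y bs) has_derivative (\<lambda>h. G (Suc m) (u x) (h # bs))) (at (u x))"
        by (rule deriv[OF m(1) Suc.prems(3)])
      have "((\<lambda>x. G m (u x) bs) has_derivative (\<lambda>t. G (Suc m) (u x) ((t *\<^sub>R ?u' x) # bs))) (at x)"
        using has_derivative_compose[OF u(1)[unfolded has_vector_derivative_def] d] .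
      moreover have "linear (\<lambda>h. G (Suc m) (u x) (h # bs))" using has_derivative_linear[OF d] .
      moreover have "G (Suc m) (u x) ((t *\<^sub>R ?u' x) # bs)
          = t *\<^sub>R (\<Sum>b\<in>Basis. (?u' x \<bullet> b) *\<^sub>R G (Suc m) (u x) (b # bs))"
        if lin: "linear (\<lambda>h. G (Suc m) (u x) (h # bs))" for t
      proof -
        have "G (Suc m) (u x) ((t *\<^sub>R ?u' x) # bs) = t *\<^sub>R G (Suc m) (u x) (?u' x # bs)"
          using linear_cmul[OF lin] .
        also have "G (Suc m) (u x) (?u' x # bs) = G (Suc m) (u x) ((\<Sum>b\<in>Basis. (?u' x \<bullet> b) *\<^sub>R b) # bs)"
          by (simp add: euclidean_representation)
        also have "\<dots> = (\<Sum>b\<in>Basis. (?u' x \<bullet> b) *\<^sub>R G (Suc m) (u x) (b # bs))"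
          using linear_sum[OF lin, of "\<lambda>b. (?u' x \<bullet> b) *\<^sub>R b" Basis] linear_cmul[OF lin] by simp
        finally show ?thesis .
      qed
      ultimately show ?thesis by (simp add: has_vector_derivative_def)
    qed
    moreover have "C_curve k (\<lambda>x. \<Sum>b\<in>Basis. (?u' x \<bullet> b) *\<^sub>R G (Suc m) (u x) (b # bs))"
      by (intro C_curve_sum C_curve_scaleR Suc.IH C_curve_linear[OF bounded_linear_inner_left] u(2))
        (use m Suc.prems C_curve_Suc_imp in auto)
    ultimately show ?case by (rule C_curve_SucI)
  qed
  show thesis
  proof
    show "(f has_derivative (\<lambda>h. G (Suc 0) y (h # []))) (at y)" for y
      using deriv[of 0 "[]" y] assms(2) by (simp add: G(1) one_enat_def)
    show "C_curve k (\<lambda>x. f (u x))" if "enat k \<le> r" "C_curve k u" for k u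
      using comp[of 0 k u "[]"] that by (simp add: G(1))
    show "C_curve k (\<lambda>x. G (Suc 0) (u x) (b # []))" if "enat (Suc k) \<le> r" "C_curve k u" for k u b
      using comp[of "Suc 0" k u "[b]"] that by simp
  qed
qed

lemma C_curve_id: "C_curve k (\<lambda>x. x)"
  by (cases k) (auto intro!: exI[of _ "\<lambda>_. 1"] has_vector_derivative_id)

lemma C_curve_of_C_class:
  fixes g :: "real \<Rightarrow> 'b::real_normed_vector"
  assumes "C_class_on r UNIV UNIV g" "1 \<le> r" "enat k \<le> r"
  shows "C_curve k g"
  by (rule C_class_on_compose_curve[OF assms(1,2)]) (use C_curve_id[of k] assms(3) in blast)

section \<open>Integration over the cell and fundamental lemmas on the circle\<close>

lemma finite_measure_cell: "finite_measure cell"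
  by (rule finite_measure_lebesgue_on) simp

lemma cell_measurable_continuous:
  fixes g :: "real \<Rightarrow> 'b::euclidean_space"
  assumes "continuous_on UNIV g"
  shows "g \<in> borel_measurable cell"
  by (rule continuous_imp_measurable_on_sets_lebesgue) (use assms continuous_on_subset in auto)

lemma integrable_cell_bounded:
  fixes g :: "real \<Rightarrow> 'b::euclidean_space"
  assumes "g \<in> borel_measurable cell" "\<And>x. x \<in> {-pi<..<pi} \<Longrightarrow> norm (g x) \<le> C"
  shows "integrable cell g"
  by (rule finite_measure.integrable_const_bound[OF finite_measure_cell, where B = C])
     (use assms in \<open>auto simp: AE_restrict_space_iff\<close>)

lemma continuous_bounded_on_cell:
  fixes g :: "real \<Rightarrow> 'b::euclidean_space"
  assumes "continuous_on UNIV g"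
  obtains C where "C \<ge> 0" "\<And>x. x \<in> {-pi..pi} \<Longrightarrow> norm (g x) \<le> C"
proof -
  have "compact (g ` {-pi..pi})"
    using assms continuous_on_subset by (intro compact_continuous_image) auto
  hence "bounded (g ` {-pi..pi})" by (rule compact_imp_bounded)
  then obtain C where C: "\<And>x. x \<in> {-pi..pi} \<Longrightarrow> norm (g x) \<le> C"
    unfolding bounded_iff by blast
  have "norm (g 0) \<le> C" using C[of 0] by simp
  hence "0 \<le> C" using norm_ge_zero[of "g 0"] by linarith
  thus thesis using that[of C] C by blast
qed

lemma integrable_cell_continuous:
  fixes g :: "real \<Rightarrow> 'b::euclidean_space"
  assumes "continuous_on UNIV g"
  shows "integrable cell g"
proof -
  obtain C where "\<And>x. x \<in> {-pi..pi} \<Longrightarrow> norm (g x) \<le> C" using continuous_bounded_on_cell[OF assms] by blast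
  thus ?thesis by (intro integrable_cell_bounded[where C = C] cell_measurable_continuous assms) auto
qed

lemma integrable_cell_mult_continuous:
  fixes v :: "real \<Rightarrow> 'b::euclidean_space"
  assumes "integrable cell v" "continuous_on UNIV g"
  shows "integrable cell (\<lambda>x. (g x :: real) *\<^sub>R v x)"
proof -
  obtain C where C: "\<And>x. x \<in> {-pi..pi} \<Longrightarrow> norm (g x) \<le> C" using continuous_bounded_on_cell[OF assms(2)] by blast
  show ?thesis
  proof (rule Bochner_Integration.integrable_bound[OF integrable_scaleR_right[OF assms(1), of C]])
    show "(\<lambda>x. g x *\<^sub>R v x) \<in> borel_measurable cell"
      using assms cell_measurable_continuous[OF assms(2)] by auto
    show "AE x in cell. norm (g x *\<^sub>R v x) \<le> norm (C *\<^sub>R v x)"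
    proof (rule AE_I2)
      fix x assume "x \<in> space cell"
      hence "\<bar>g x\<bar> \<le> C" using C[of x] by auto
      thus "norm (g x *\<^sub>R v x) \<le> norm (C *\<^sub>R v x)" by (auto intro!: mult_right_mono)
    qed
  qed
qed

lemma cell_FTC:
  fixes g :: "real \<Rightarrow> 'b::euclidean_space"
  assumes "\<And>x. (g has_vector_derivative g' x) (at x)" "continuous_on UNIV g'"
  shows "(\<integral>x. g' x \<partial>cell) = g pi - g (-pi)"
proof -
  have "(g' has_integral (\<integral>x. g' x \<partial>cell)) {-pi<..<pi}"
    by (rule has_integral_integral_lebesgue_on[OF integrable_cell_continuous[OF assms(2)]]) simp
  hence "(g' has_integral (\<integral>x. g' x \<partial>cell)) {-pi..pi}"
    by (simp add: has_integral_Icc_iff_Ioo)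
  moreover have "(g' has_integral (g pi - g (-pi))) {-pi..pi}"
    by (rule fundamental_theorem_of_calculus) (auto intro: has_vector_derivative_at_within assms(1))
  ultimately show ?thesis by (rule has_integral_unique)
qed

lemma cell_integral_deriv_periodic:
  fixes g :: "real \<Rightarrow> 'b::euclidean_space"
  assumes "\<And>x. (g has_vector_derivative g' x) (at x)" "continuous_on UNIV g'"
    and "\<And>x. g (x + 2 * pi) = g x"
  shows "(\<integral>x. g' x \<partial>cell) = 0"
  using cell_FTC[OF assms(1,2)] assms(3)[of "-pi"] by simp

section \<open>Density of trigonometric polynomials and the fundamental lemma\<close>

lemma C_curve_cis: "C_curve k cis"
proof -
  have "cis = (\<lambda>x. cos x *\<^sub>R 1 + sin x *\<^sub>R \<i>)" by (auto simp: fun_eq_iff complex_eq_iff)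
  moreover have "C_curve k (\<lambda>x. cos x *\<^sub>R 1 + sin x *\<^sub>R \<i>)"
    using C_curve_cos_sin[of k] by (intro C_curve_add C_curve_scaleR) auto
  ultimately show ?thesis by (simp only:)
qed

lemma C_curve_polynomial_cis:
  assumes "real_polynomial_function g"
  shows "C_curve k (\<lambda>x. g (cis x) :: real)"
  using assms by (induction rule: real_polynomial_function.induct)
    (auto intro: C_curve_add C_curve_mult C_curve_linear C_curve_cis)

lemma cis_periodic: "cis (x + 2 * pi) = cis x"
  by (simp add: complex_eq_iff)

lemma continuous_on_circle_compose:
  assumes "continuous_on (sphere 0 1) f"
  shows "continuous_on UNIV (\<lambda>x. f (cis x))"
  by (rule continuous_on_compose2[OF assms C_curve_continuous[OF C_curve_cis]]) auto

text \<open>Stone-Weierstrass on the circle: a real polynomial in \<open>cis x\<close> is a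
  trigonometric polynomial, hence an admissible test function, and the error is at most
  \<open>e\<close> times the L1 norm of \<open>v\<close>.\<close>

lemma orthogonal_imp_orthogonal_continuous:
  fixes v :: "real \<Rightarrow> real"
  assumes v: "integrable cell v"
    and orth: "\<And>\<eta> :: real \<Rightarrow> real. (\<And>k. C_curve k \<eta>) \<Longrightarrow> (\<And>x. \<eta> (x + 2 * pi) = \<eta> x) \<Longrightarrow> (\<integral>x. \<eta> x * v x \<partial>cell) = 0"
    and f: "continuous_on (sphere 0 1) f"
  shows "(\<integral>x. f (cis x) * v x \<partial>cell) = 0"
proof -
  have "\<bar>\<integral>x. f (cis x) * v x \<partial>cell\<bar> \<le> e * (\<integral>x. \<bar>v x\<bar> \<partial>cell)" if e: "e > 0" for e
  proof -
    obtain g where g: "real_polynomial_function g" "\<And>z. z \<in> sphere 0 1 \<Longrightarrow> \<bar>f z - g z\<bar> < e"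
      using Stone_Weierstrass_real_polynomial_function[OF compact_sphere f e] by blast
    have "(\<integral>x. g (cis x) * v x \<partial>cell) = 0"
      by (rule orth) (auto intro: C_curve_polynomial_cis g(1) simp only: cis_periodic)
    moreover have i: "integrable cell (\<lambda>x. f (cis x) * v x)" "integrable cell (\<lambda>x. g (cis x) * v x)"
      using integrable_cell_mult_continuous[OF v continuous_on_circle_compose[OF f]]
        integrable_cell_mult_continuous[OF v C_curve_continuous[OF C_curve_polynomial_cis[OF g(1)]]] by auto
    ultimately have "(\<integral>x. f (cis x) * v x \<partial>cell) = (\<integral>x. f (cis x) * v x - g (cis x) * v x \<partial>cell)"
      by (simp add: Bochner_Integration.integral_diff)
    also have "\<bar>\<dots>\<bar> \<le> (\<integral>x. e * \<bar>v x\<bar> \<partial>cell)"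
    proof (rule integral_abs_bound_integral)
      show "integrable cell (\<lambda>x. f (cis x) * v x - g (cis x) * v x)" using i by auto
      show "integrable cell (\<lambda>x. e * \<bar>v x\<bar>)" using v by auto
      show "\<bar>f (cis x) * v x - g (cis x) * v x\<bar> \<le> e * \<bar>v x\<bar>" for x
        using g(2)[of "cis x"] by (auto simp: abs_mult mult_right_mono simp flip: left_diff_distrib)
    qed
    finally show ?thesis by simp
  qed
  hence *: "\<And>e. e > 0 \<Longrightarrow> \<bar>\<integral>x. f (cis x) * v x \<partial>cell\<bar> \<le> e * (\<integral>x. \<bar>v x\<bar> \<partial>cell)" by blast
  have "\<bar>\<integral>x. f (cis x) * v x \<partial>cell\<bar> \<le> 0"
  proof (rule field_le_epsilon)
    fix e :: real assume "e > 0"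
    have I: "0 \<le> (\<integral>x. \<bar>v x\<bar> \<partial>cell)" by simp
    obtain t where "t > 0" "t * (\<integral>x. \<bar>v x\<bar> \<partial>cell) \<le> e" using scaled_threshold[OF I \<open>e > 0\<close>] by metis
    thus "\<bar>\<integral>x. f (cis x) * v x \<partial>cell\<bar> \<le> 0 + e" using *[of t] by linarith
  qed
  thus ?thesis by simp
qed

lemma cis_eq_imp: 
  assumes "cis x = cis y"
  obtains n :: int where "x - y = of_int n * (2 * pi)"
proof -
  have "cos x = cos y" "sin x = sin y" using assms by (auto simp: complex_eq_iff)
  hence "cos (x - y) = 1" using sin_cos_squared_add2[of y] by (simp add: cos_diff flip: power2_eq_square)
  then obtain n :: int where "x - y = of_int n * 2 * pi" using cos_one_2pi_int by auto
  thus thesis using that[of n] by simp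
qed

lemma cis_eq_on_cell:
  assumes "x \<in> {-pi<..<pi}" "y \<in> {-pi<..<pi}" "cis x = cis y"
  shows "x = y"
proof -
  obtain n :: int where n: "x - y = of_int n * (2 * pi)" using cis_eq_imp[OF assms(3)] .
  have "\<bar>of_int n * (2 * pi)\<bar> < 1 * (2 * pi)" using assms(1,2) unfolding n[symmetric] by auto
  hence "\<bar>of_int n\<bar> * (2 * pi) < 1 * (2 * pi)" by (simp add: abs_mult)
  hence "\<bar>of_int n :: real\<bar> < 1" by (rule mult_right_less_imp_less) simp
  hence "n = 0" by linarith
  thus ?thesis using n by simp
qed

text \<open>The indicator of a compact set is a pointwise limit of continuous functions on the
  circle, and dominated convergence applies with the majorant
  \<open>\<bar>v x\<bar>\<close>.\<close>

lemma orthogonal_imp_zero_on_compact: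
  fixes v :: "real \<Rightarrow> real"
  assumes v: "integrable cell v"
    and orth: "\<And>\<eta> :: real \<Rightarrow> real. (\<And>k. C_curve k \<eta>) \<Longrightarrow> (\<And>x. \<eta> (x + 2 * pi) = \<eta> x) \<Longrightarrow> (\<integral>x. \<eta> x * v x \<partial>cell) = 0"
    and C: "compact C" "C \<subseteq> {-pi<..<pi}"
  shows "(\<integral>x. indicator C x * v x \<partial>cell) = 0"
proof (cases "C = {}")
  case False
  define K where "K = cis ` C"
  have K: "compact K" "K \<noteq> {}"
    using C False continuous_on_subset[OF C_curve_continuous[OF C_curve_cis]]
    by (auto simp: K_def intro!: compact_continuous_image)
  \<comment> \<open>Cut-off by the distance to \<open>K\<close>, identically 1 on \<open>K\<close>.
    Off \<open>C\<close> it vanishes eventually, because \<open>cis\<close> is injective on the open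
    cell and \<open>K\<close> is closed.\<close>
  define f where "f = (\<lambda>n z. max 0 (1 - real n * infdist z K))"
  have cont: "continuous_on S (f n)" for S n
    unfolding f_def by (intro continuous_intros)
  have lim: "(\<lambda>n. f n (cis x)) \<longlonglongrightarrow> indicator C x" if x: "x \<in> {-pi<..<pi}" for x
  proof (cases "x \<in> C")
    case True
    hence "f n (cis x) = 1" for n by (simp add: f_def K_def)
    thus ?thesis using True by simp
  next
    case False
    have "cis x \<notin> K" using False cis_eq_on_cell[OF x] C(2) by (auto simp: K_def)
    hence "infdist (cis x) K > 0"
      using K in_closed_iff_infdist_zero[of K "cis x"] infdist_nonneg[of "cis x" K]
      by (auto simp: compact_imp_closed order_less_le)
    then obtain N where N: "1 < real N * infdist (cis x) K" using reals_Archimedean3 by blast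
    have "f n (cis x) = 0" if "n \<ge> N" for n
    proof -
      have "real N * infdist (cis x) K \<le> real n * infdist (cis x) K"
        using that by (intro mult_right_mono) (auto simp: infdist_nonneg)
      thus ?thesis using N by (simp add: f_def)
    qed
    hence "\<forall>\<^sub>F n in sequentially. f n (cis x) = 0" using eventually_sequentially by blast
    thus ?thesis using False by (auto intro: tendsto_eventually)
  qed
  have "(\<lambda>n. \<integral>x. f n (cis x) * v x \<partial>cell) \<longlonglongrightarrow> (\<integral>x. indicator C x * v x \<partial>cell)"
  proof (rule integral_dominated_convergence[where w = "\<lambda>x. \<bar>v x\<bar>"])
    have "C \<inter> {-pi<..<pi} \<in> sets cell"
      using C by (auto simp: sets_restrict_space intro!: imageI lmeasurable_compact fmeasurableD)
    hence "indicat_real (C \<inter> {-pi<..<pi}) \<in> borel_measurable cell" by simp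
    hence [measurable]: "indicat_real C \<in> borel_measurable cell" using C by (simp add: Int_absorb2)
    show "(\<lambda>x. indicator C x * v x) \<in> borel_measurable cell" using v by measurable
    show "(\<lambda>x. f n (cis x) * v x) \<in> borel_measurable cell" for n
      using cell_measurable_continuous[OF continuous_on_circle_compose[OF cont]] v by auto
    show "integrable cell (\<lambda>x. \<bar>v x\<bar>)" using v by auto
    show "AE x in cell. (\<lambda>n. f n (cis x) * v x) \<longlonglongrightarrow> indicator C x * v x"
      by (rule AE_I2) (use lim in \<open>auto intro!: tendsto_mult\<close>)
    have "\<bar>f n z\<bar> \<le> 1" for n z by (auto simp: f_def infdist_nonneg)
    thus "AE x in cell. norm (f n (cis x) * v x) \<le> \<bar>v x\<bar>" for n
      by (auto simp: abs_mult intro!: AE_I2 mult_left_le_one_le)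
  qed
  moreover have "(\<integral>x. f n (cis x) * v x \<partial>cell) = 0" for n
    by (rule orthogonal_imp_orthogonal_continuous[OF v orth cont])
  ultimately show ?thesis by (simp add: LIMSEQ_const_iff)
qed simp

text \<open>The set where \<open>v > 0\<close> is approximated from inside by closed sets. On each
  of them \<open>v\<close> is positive and yet has integral zero, so each is a null set, and inner
  regularity passes this on to the whole.\<close>

lemma orthogonal_imp_nonpos:
  fixes v :: "real \<Rightarrow> real"
  assumes v: "integrable cell v"
    and orth: "\<And>\<eta> :: real \<Rightarrow> real. (\<And>k. C_curve k \<eta>) \<Longrightarrow> (\<And>x. \<eta> (x + 2 * pi) = \<eta> x) \<Longrightarrow> (\<integral>x. \<eta> x * v x \<partial>cell) = 0"
  shows "AE x in cell. v x \<le> 0"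
proof -
  define P where "P = {x \<in> space cell. v x > 0}"
  have "v \<in> borel_measurable cell" using v by auto
  hence Ps: "P \<in> sets cell" unfolding P_def by measurable
  have Pl: "P \<in> sets lebesgue" using Ps by (auto simp: sets_restrict_space)
  have Pc: "P \<subseteq> {-pi<..<pi}" by (auto simp: P_def)
  have null: "T \<in> null_sets lebesgue" if T: "closed T" "T \<subseteq> P" for T
  proof -
    have "compact T" using T Pc 

      using bounded_subset[OF compact_imp_bounded[OF compact_Icc[of "-pi" pi]], of T] T Pc
      by (force simp: compact_eq_bounded_closed)
    have z: "(\<integral>x. indicator T x * v x \<partial>cell) = 0"
      by (rule orthogonal_imp_zero_on_compact[OF v orth \<open>compact T\<close>]) (use T Pc in auto)
    have Ts: "T \<in> sets cell"
      using \<open>compact T\<close> T Pc by (auto simp: sets_restrict_space intro!: image_eqI[of _ _ T] fmeasurableD lmeasurable_compact)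
    have i: "integrable cell (\<lambda>x. indicator T x * v x)"
      using integrable_mult_indicator[OF Ts v] by simp
    have "AE x in cell. indicator T x * v x = 0"
      using z T(2) i by (subst integral_nonneg_eq_0_iff_AE[symmetric]) (auto simp: P_def indicator_def intro!: AE_I2)
    hence "AE x in cell. x \<notin> T"
    proof eventually_elim
      case (elim x)
      thus ?case using T(2) by (cases "x \<in> T") (auto simp: P_def)
    qed
    hence "T \<in> null_sets cell" using Ts AE_iff_null_sets by blast
    thus ?thesis using null_sets_restrict_space[of "{-pi<..<pi}" lebesgue T] by simp
  qed
  have "emeasure lebesgue P \<le> ennreal e" if "e > 0" for e
  proof -
    obtain T where T: "closed T" "T \<subseteq> P" "emeasure lebesgue (P - T) < ennreal e"
      using sets_lebesgue_inner_closed[OF Pl \<open>e > 0\<close>] by metis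
    have "emeasure lebesgue P = emeasure lebesgue (P - T)"
      using emeasure_Diff_null_set[OF null[OF T(1,2)] Pl] by simp
    thus ?thesis using T(3) by simp
  qed
  hence *: "\<And>e. e > 0 \<Longrightarrow> emeasure lebesgue P \<le> 0 + ennreal e" by simp
  have "emeasure lebesgue P \<le> 0" by (rule ennreal_le_epsilon) (rule *)
  hence "P \<in> null_sets lebesgue" using Pl by (auto simp: null_sets_def)
  hence "P \<in> null_sets cell" using null_sets_restrict_space[of "{-pi<..<pi}" lebesgue P] Pc by simp
  hence "AE x in cell. x \<notin> P" using AE_iff_null_sets[OF Ps] by blast
  moreover have "AE x in cell. x \<in> space cell" by (rule AE_I2)
  ultimately show ?thesis by eventually_elim (simp add: P_def)
qed

lemma orthogonal_imp_AE_zero: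
  fixes v :: "real \<Rightarrow> real"
  assumes v: "integrable cell v"
    and orth: "\<And>\<eta> :: real \<Rightarrow> real. (\<And>k. C_curve k \<eta>) \<Longrightarrow> (\<And>x. \<eta> (x + 2 * pi) = \<eta> x) \<Longrightarrow> (\<integral>x. \<eta> x * v x \<partial>cell) = 0"
  shows "AE x in cell. v x = 0"
proof -
  have "AE x in cell. v x \<le> 0" by (rule orthogonal_imp_nonpos[OF v orth])
  moreover have "AE x in cell. - v x \<le> 0" by (rule orthogonal_imp_nonpos) (use v orth in auto)
  ultimately show ?thesis by eventually_elim simp
qed

section \<open>Periodic extension and periodic primitives\<close>

text \<open>\<open>cis\<close> maps the compact interval continuously onto the circle, a Hausdorff
  space, and so is a quotient map; \<open>g\<close> takes equal values at the two identified ends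
  and therefore factors through the circle. The extension is that factor composed with
  \<open>cis\<close>.\<close>

lemma periodic_extension:
  fixes g :: "real \<Rightarrow> real"
  assumes "continuous_on {-pi..pi} g" "g (-pi) = g pi"
  shows "\<exists>G. continuous_on UNIV G \<and> (\<forall>x. G (x + 2 * pi) = G x) \<and> (\<forall>x\<in>{-pi..pi}. G x = g x)"
proof -
  let ?X = "top_of_set {-pi..pi}" and ?Y = "top_of_set (sphere 0 1 :: complex set)"
  have "cis ` {-pi..pi} = sphere 0 1"
  proof (intro equalityI subsetI)
    fix z :: complex assume "z \<in> sphere 0 1"
    hence "z = cis (Arg z)" by (metis cis_Arg mem_sphere_0 norm_eq_zero sgn_div_norm inverse_1 scaleR_one zero_neq_one)
    thus "z \<in> cis ` {-pi..pi}" using Arg_bounded[of z] by (metis atLeastAtMost_iff imageI less_imp_le)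
  qed auto
  moreover have "continuous_on {-pi..pi} cis" using C_curve_continuous[OF C_curve_cis] continuous_on_subset by blast
  ultimately have q: "quotient_map ?X ?Y cis"
    by (intro T1_Spaces.continuous_imp_quotient_map) (auto simp: compact_space_subtopology Hausdorff_space_subtopology)
  have inj: "g x = g y" if "x \<in> {-pi..pi}" "y \<in> {-pi..pi}" "cis x = cis y" for x y
  proof -
    obtain n :: int where n: "x - y = of_int n * (2 * pi)" using cis_eq_imp[OF \<open>cis x = cis y\<close>] .
    have "\<bar>of_int n * (2 * pi)\<bar> \<le> 1 * (2 * pi)" using \<open>x \<in> _\<close> \<open>y \<in> _\<close> unfolding n[symmetric] by auto
    hence "\<bar>of_int n\<bar> * (2 * pi) \<le> 1 * (2 * pi)" by (simp add: abs_mult)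
    hence "\<bar>of_int n :: real\<bar> \<le> 1" by (rule mult_right_le_imp_le) simp
    hence "\<bar>n\<bar> \<le> 1" by linarith
    hence "n = -1 \<or> n = 0 \<or> n = 1" by arith
    moreover have "x \<le> pi" "-pi \<le> x" "y \<le> pi" "-pi \<le> y" using \<open>x \<in> _\<close> \<open>y \<in> _\<close> by auto
    moreover have "n = 1 \<Longrightarrow> x - y = 2 * pi" "n = -1 \<Longrightarrow> x - y = - 2 * pi" "n = 0 \<Longrightarrow> x - y = 0"
      using n by simp_all
    ultimately have "x = y \<or> x = pi \<and> y = -pi \<or> x = -pi \<and> y = pi" by linarith
    thus ?thesis using assms(2) by auto
  qed
  have "continuous_map ?X euclidean g" using assms(1) by simp
  have "\<exists>h. continuous_map ?Y euclidean h \<and> (\<forall>x\<in>{-pi..pi}. h (cis x) = g x)"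
  proof (rule quotient_map_lift_exists[OF q \<open>continuous_map ?X euclidean g\<close>])
    fix x y assume "x \<in> topspace ?X" "y \<in> topspace ?X" "cis x = cis y"
    thus "g x = g y" by (intro inj) (simp_all del: atLeastAtMost_iff)
  qed (simp del: atLeastAtMost_iff, blast)
  then obtain h where h: "continuous_map ?Y euclidean h" "\<And>x. x \<in> {-pi..pi} \<Longrightarrow> h (cis x) = g x"
    by blast
  have "continuous_on (sphere 0 1) h" using h(1) by simp
  from continuous_on_circle_compose[OF this] show ?thesis
    by (intro exI[of _ "\<lambda>x. h (cis x)"] conjI allI ballI) (use h(2) in \<open>simp_all only: cis_periodic\<close>)
qed

lemma periodic_const_of_derivative_zero:
  fixes F :: "real \<Rightarrow> 'b::euclidean_space"
  assumes "\<And>x. (F has_vector_derivative 0) (at x)"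
  shows "F x = F y"
  by (rule has_vector_derivative_zero_constant[of UNIV F]) (use assms in auto)

lemma measure_cell: "measure cell (space cell) = 2 * pi"
  by (simp add: measure_restrict_space)

lemma integrable_cell_const [simp]: "integrable cell (\<lambda>_. c :: 'b::euclidean_space)"
  by (rule integrable_cell_continuous) auto

lemma cell_integral_const: "(\<integral>x. c \<partial>cell) = 2 * pi * (c :: real)"
  by (simp only: lebesgue_integral_const measure_cell real_scaleR_def)

lemma cell_integral_diff_mean:
  fixes F :: "real \<Rightarrow> real"
  assumes "integrable cell F"
  shows "(\<integral>x. F x - (\<integral>x. F x \<partial>cell) / (2 * pi) \<partial>cell) = 0"
  using Bochner_Integration.integral_diff[OF assms integrable_cell_const[of "(\<integral>x. F x \<partial>cell) / (2 * pi)"]]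
  by (simp only: cell_integral_const) simp

text \<open>Zero mean is what makes a primitive periodic. The free additive constant is spent on
  giving the primitive zero mean as well, so that the lemma can be iterated.\<close>

lemma periodic_antiderivative:
  fixes q :: "real \<Rightarrow> real"
  assumes q: "continuous_on UNIV q" "\<And>x. q (x + 2 * pi) = q x" "(\<integral>x. q x \<partial>cell) = 0"
  shows "\<exists>Q. (\<forall>x. (Q has_vector_derivative q x) (at x)) \<and> (\<forall>x. Q (x + 2 * pi) = Q x) \<and> (\<integral>x. Q x \<partial>cell) = 0"
proof -
  obtain F where F: "\<And>x. (F has_vector_derivative q x) (at x)"
    using einterval_antiderivative[of "-\<infinity>" \<infinity> q] q(1) by (auto simp: continuous_on_eq_continuous_at)
  have per: "F (x + 2 * pi) = F x" for x
  proof -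
    have "((\<lambda>x. F (x + 2 * pi)) has_vector_derivative q x) (at x)" for x
      using vector_diff_chain_at[OF has_vector_derivative_add[OF has_vector_derivative_id has_vector_derivative_const], of F "q (x + 2 * pi)" x "2 * pi"]
        F[of "x + 2 * pi"] q(2)[of x] by (simp add: o_def)
    hence "((\<lambda>x. F (x + 2 * pi) - F x) has_vector_derivative 0) (at x)" for x
      using has_vector_derivative_diff[OF _ F] by fastforce
    \<comment> \<open>\<open>F (x + 2 * pi) - F x\<close> is constant, and at \<open>-pi\<close> it
      is the integral of \<open>q\<close> over one period.\<close>
    from periodic_const_of_derivative_zero[OF this, of x "-pi"]
    have "F (x + 2 * pi) - F x = F pi - F (-pi)" by simp
    also have "\<dots> = 0" using cell_FTC[OF F q(1)] q(3) by simp
    finally show ?thesis by simp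
  qed
  have Fc: "continuous_on UNIV F" using F by (intro continuous_on_vector_derivative) auto
  show ?thesis
  proof (intro exI[of _ "\<lambda>x. F x - (\<integral>x. F x \<partial>cell) / (2 * pi)"] conjI allI)
    show "((\<lambda>x. F x - (\<integral>x. F x \<partial>cell) / (2 * pi)) has_vector_derivative q x) (at x)" for x
      using has_vector_derivative_diff[OF F has_vector_derivative_const] by simp
    show "(\<integral>x. F x - (\<integral>x. F x \<partial>cell) / (2 * pi) \<partial>cell) = 0"
      by (rule cell_integral_diff_mean[OF integrable_cell_continuous[OF Fc]])
  qed (use per in auto)
qed

lemma C_curve_antiderivative:
  assumes "\<And>k. C_curve k q" "\<And>x. (Q has_vector_derivative q x) (at x)"
  shows "C_curve k Q"
  by (rule C_curve_mono[of "Suc k"]) (use assms C_curve_SucI in auto)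

text \<open>A smooth periodic function of mean zero is the second derivative of another one, by two
  periodic primitives. Hence \<open>h\<close> minus its mean is orthogonal to every test function,
  constants included.\<close>

lemma orthogonal_second_derivatives_imp_const:
  fixes h :: "real \<Rightarrow> real"
  assumes h: "integrable cell h"
    and orth: "\<And>\<eta> \<eta>' \<eta>'' :: real \<Rightarrow> real. (\<And>k. C_curve k \<eta>) \<Longrightarrow> (\<And>x. \<eta> (x + 2 * pi) = \<eta> x) \<Longrightarrow>
      (\<And>x. (\<eta> has_vector_derivative \<eta>' x) (at x)) \<Longrightarrow> (\<And>x. (\<eta>' has_vector_derivative \<eta>'' x) (at x)) \<Longrightarrow>
      (\<integral>x. \<eta>'' x * h x \<partial>cell) = 0"
  obtains c where "AE x in cell. h x = c"
proof -
  define c where "c = (\<integral>x. h x \<partial>cell) / (2 * pi)"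
  have v: "integrable cell (\<lambda>x. h x - c)" using h by auto
  have v0: "(\<integral>x. h x - c \<partial>cell) = 0" unfolding c_def by (rule cell_integral_diff_mean[OF h])
  have "AE x in cell. h x - c = 0"
  proof (rule orthogonal_imp_AE_zero[OF v])
    fix \<zeta> :: "real \<Rightarrow> real" assume \<zeta>: "\<And>k. C_curve k \<zeta>" "\<And>x. \<zeta> (x + 2 * pi) = \<zeta> x"
    define m where "m = (\<integral>x. \<zeta> x \<partial>cell) / (2 * pi)"
    define \<zeta>0 where "\<zeta>0 = (\<lambda>x. \<zeta> x + (- m))"
    have \<zeta>0: "C_curve k \<zeta>0" for k unfolding \<zeta>0_def by (intro C_curve_add \<zeta>) simp
    have \<zeta>c: "continuous_on UNIV \<zeta>" "continuous_on UNIV \<zeta>0"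
      using C_curve_continuous \<zeta>(1) \<zeta>0 by blast+
    have z0: "(\<integral>x. \<zeta>0 x \<partial>cell) = 0"
      using cell_integral_diff_mean[OF integrable_cell_continuous[OF \<zeta>c(1)]] by (simp add: \<zeta>0_def m_def)
    have \<zeta>0p: "\<zeta>0 (x + 2 * pi) = \<zeta>0 x" for x by (simp add: \<zeta>0_def \<zeta>(2))
    obtain Z where Z: "\<And>x. (Z has_vector_derivative \<zeta>0 x) (at x)" "\<And>x. Z (x + 2 * pi) = Z x" "(\<integral>x. Z x \<partial>cell) = 0"
      using periodic_antiderivative[OF \<zeta>c(2) \<zeta>0p z0] by blast
    have ZC: "C_curve k Z" for k using C_curve_antiderivative[OF \<zeta>0 Z(1)] .
    obtain Y where Y: "\<And>x. (Y has_vector_derivative Z x) (at x)" "\<And>x. Y (x + 2 * pi) = Y x" "(\<integral>x. Y x \<partial>cell) = 0"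
      using periodic_antiderivative[OF C_curve_continuous[OF ZC[of 0]] Z(2,3)] by blast
    have YC: "C_curve k Y" for k using C_curve_antiderivative[OF ZC Y(1)] .
    have 1: "(\<integral>x. \<zeta>0 x * h x \<partial>cell) = 0" by (rule orth[OF YC Y(2,1) Z(1)])
    have i: "integrable cell (\<lambda>x. \<zeta>0 x * h x)" using integrable_cell_mult_continuous[OF h \<zeta>c(2)] by simp
    have "(\<integral>x. \<zeta> x * (h x - c) \<partial>cell) = (\<integral>x. \<zeta>0 x * h x - c * \<zeta>0 x + m * (h x - c) \<partial>cell)"
      by (rule Bochner_Integration.integral_cong) (auto simp: \<zeta>0_def algebra_simps)
    also have "\<dots> = (\<integral>x. \<zeta>0 x * h x \<partial>cell) - c * (\<integral>x. \<zeta>0 x \<partial>cell) + m * (\<integral>x. h x - c \<partial>cell)"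
    proof -
      have "integrable cell (\<lambda>x. \<zeta>0 x * h x - c * \<zeta>0 x)" "integrable cell (\<lambda>x. m * (h x - c))"
        "integrable cell (\<lambda>x. c * \<zeta>0 x)"
        using i v integrable_cell_continuous[OF \<zeta>c(2)] by auto
      thus ?thesis
        using i by (simp only: Bochner_Integration.integral_add Bochner_Integration.integral_diff integral_mult_right_zero)
    qed
    finally show "(\<integral>x. \<zeta> x * (h x - c) \<partial>cell) = 0" using 1 z0 v0 by simp
  qed
  thus thesis using that[of c] by simp
qed

lemma cell_integration_by_parts:
  fixes f g :: "real \<Rightarrow> real"
  assumes f: "\<And>x. (f has_vector_derivative f' x) (at x)" "continuous_on UNIV f'" "\<And>x. f (x + 2 * pi) = f x"
    and g: "\<And>x. (g has_vector_derivative g' x) (at x)" "continuous_on UNIV g'" "\<And>x. g (x + 2 * pi) = g x"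
  shows "(\<integral>x. f x * g' x \<partial>cell) = - (\<integral>x. f' x * g x \<partial>cell)"
proof -
  have c: "continuous_on UNIV f" "continuous_on UNIV g"
    using f(1) g(1) by (auto intro: continuous_on_vector_derivative)
  have "(\<integral>x. f x * g' x + f' x * g x \<partial>cell) = 0"
  proof (rule cell_integral_deriv_periodic)
    show "((\<lambda>x. f x * g x) has_vector_derivative f x * g' x + f' x * g x) (at x)" for x
      by (rule has_vector_derivative_mult[OF f(1) g(1)])
    show "continuous_on UNIV (\<lambda>x. f x * g' x + f' x * g x)" using c f(2) g(2) by (intro continuous_intros)
  qed (simp add: f(3) g(3))
  moreover have "integrable cell (\<lambda>x. f x * g' x)" "integrable cell (\<lambda>x. f' x * g x)"
    using c f(2) g(2) by (auto intro!: integrable_cell_continuous continuous_intros)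
  ultimately show ?thesis by simp
qed

lemma C_curve_hvd_continuous:
  assumes "\<And>k. C_curve k \<eta>" "\<And>x. (\<eta> has_vector_derivative \<eta>' x) (at x)"
  shows "C_curve k \<eta>'"
proof -
  have "(\<lambda>x. vector_derivative \<eta> (at x)) = \<eta>'" using assms(2) by (auto intro: vector_derivative_at)
  thus ?thesis using C_curve_SucD(2)[OF assms(1)[of "Suc k"]] by simp
qed

lemma periodic_derivative:
  fixes g :: "real \<Rightarrow> 'b::real_normed_vector"
  assumes "\<And>x. (g has_vector_derivative g' x) (at x)" "\<And>x. g (x + p) = g x"
  shows "g' (x + p) = g' x"
proof -
  have "((\<lambda>x. g (x + p)) has_vector_derivative g' (x + p)) (at x)"
    using vector_diff_chain_at[OF has_vector_derivative_add[OF has_vector_derivative_id has_vector_derivative_const], of g "g' (x + p)" x p]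
      assms(1)[of "x + p"] by (simp add: o_def)
  hence "(g has_vector_derivative g' (x + p)) (at x)" by (simp add: assms(2))
  thus ?thesis using assms(1)[of x] by (rule vector_derivative_unique_at)
qed

section \<open>Weak second derivatives on the circle\<close>

text \<open>\<open>parts\<close> says that \<open>Qh\<close> is a weak primitive of
  \<open>q\<close>. With \<open>R\<close> a primitive of \<open>Qh - m\<close>, integration by parts
  turns the weak equation into orthogonality of \<open>d * p + R\<close> to all second derivatives,
  so this sum is a constant \<open>c\<close> and \<open>p\<close> equals \<open>(c - R) / d\<close>
  almost everywhere.\<close>

lemma weak_second_derivative_regular:
  fixes p q Qh :: "real \<Rightarrow> real"
  assumes p: "integrable cell p" and q: "integrable cell q"
    and Qh: "continuous_on UNIV Qh" "\<And>x. Qh (x + 2 * pi) = Qh x" and d: "d \<noteq> 0"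
    and parts: "\<And>\<eta> \<eta>' :: real \<Rightarrow> real. (\<And>x. (\<eta> has_vector_derivative \<eta>' x) (at x)) \<Longrightarrow> continuous_on UNIV \<eta>' \<Longrightarrow>
      (\<And>x. \<eta> (x + 2 * pi) = \<eta> x) \<Longrightarrow> (\<integral>x. \<eta> x * q x \<partial>cell) = - (\<integral>x. \<eta>' x * Qh x \<partial>cell)"
    and weak: "\<And>\<eta> \<eta>' \<eta>'' :: real \<Rightarrow> real. (\<And>k. C_curve k \<eta>) \<Longrightarrow> (\<And>x. \<eta> (x + 2 * pi) = \<eta> x) \<Longrightarrow>
      (\<And>x. (\<eta> has_vector_derivative \<eta>' x) (at x)) \<Longrightarrow> (\<And>x. (\<eta>' has_vector_derivative \<eta>'' x) (at x)) \<Longrightarrow>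
      (\<integral>x. d * (\<eta>'' x * p x) + \<eta> x * q x \<partial>cell) = 0"
  shows "\<exists>g m. (\<forall>x. (g has_vector_derivative - (Qh x - m) / d) (at x)) \<and> (\<forall>x. g (x + 2 * pi) = g x) \<and>
    (AE x in cell. p x = g x)"
proof -
  \<comment> \<open>Subtracting the mean makes the primitive \<open>R\<close> periodic; the tested
    identities do not notice it, since \<open>\<eta>'\<close> has mean zero.\<close>
  define m where "m = (\<integral>x. Qh x \<partial>cell) / (2 * pi)"
  define Q1 where "Q1 = (\<lambda>x. Qh x - m)"
  have Q1: "continuous_on UNIV Q1" "\<And>x. Q1 (x + 2 * pi) = Q1 x" "(\<integral>x. Q1 x \<partial>cell) = 0"
  proof -
    show "continuous_on UNIV Q1" unfolding Q1_def by (intro continuous_intros Qh(1))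
    show "Q1 (x + 2 * pi) = Q1 x" for x unfolding Q1_def Qh(2) ..
    show "(\<integral>x. Q1 x \<partial>cell) = 0"
      unfolding Q1_def m_def by (rule cell_integral_diff_mean[OF integrable_cell_continuous[OF Qh(1)]])
  qed
  obtain R where R: "\<And>x. (R has_vector_derivative Q1 x) (at x)" "\<And>x. R (x + 2 * pi) = R x" "(\<integral>x. R x \<partial>cell) = 0"
    using periodic_antiderivative[OF Q1] by blast
  have Rc: "continuous_on UNIV R" using R(1) by (auto intro: continuous_on_vector_derivative)
  have h: "integrable cell (\<lambda>x. d * p x + R x)" using p integrable_cell_continuous[OF Rc] by auto
  obtain c where c: "AE x in cell. d * p x + R x = c"
  proof (rule orthogonal_second_derivatives_imp_const[OF h])
    fix \<eta> \<eta>' \<eta>'' :: "real \<Rightarrow> real"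
    assume \<eta>: "\<And>k. C_curve k \<eta>" "\<And>x. \<eta> (x + 2 * pi) = \<eta> x"
      "\<And>x. (\<eta> has_vector_derivative \<eta>' x) (at x)" "\<And>x. (\<eta>' has_vector_derivative \<eta>'' x) (at x)"
    have "C_curve k \<eta>'" for k by (rule C_curve_hvd_continuous[OF \<eta>(1,3)])
    moreover from this have "C_curve k \<eta>''" for k by (rule C_curve_hvd_continuous[OF _ \<eta>(4)])
    ultimately have cont: "continuous_on UNIV \<eta>'" "continuous_on UNIV \<eta>''" "continuous_on UNIV \<eta>"
      using C_curve_continuous \<eta>(1) by blast+
    have \<eta>'p: "\<eta>' (x + 2 * pi) = \<eta>' x" for x by (rule periodic_derivative[OF \<eta>(3,2)])
    have i: "integrable cell (\<lambda>x. \<eta>'' x * p x)" "integrable cell (\<lambda>x. \<eta> x * q x)" "integrable cell (\<lambda>x. \<eta>'' x * R x)"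
      "integrable cell (\<lambda>x. \<eta>' x * Qh x)"
      using integrable_cell_mult_continuous[OF p cont(2)] integrable_cell_mult_continuous[OF q cont(3)]
      by (auto intro!: integrable_cell_continuous continuous_intros cont Rc Qh(1))
    have e0: "(\<integral>x. \<eta>' x \<partial>cell) = 0" by (rule cell_integral_deriv_periodic[OF \<eta>(3) cont(1) \<eta>(2)])
    have "(\<integral>x. R x * \<eta>'' x \<partial>cell) = - (\<integral>x. Q1 x * \<eta>' x \<partial>cell)"
      by (rule cell_integration_by_parts[OF R(1) Q1(1) R(2) \<eta>(4) cont(2) \<eta>'p])
    also have "(\<integral>x. Q1 x * \<eta>' x \<partial>cell) = (\<integral>x. \<eta>' x * Qh x - m * \<eta>' x \<partial>cell)"
      by (rule Bochner_Integration.integral_cong) (auto simp: Q1_def algebra_simps)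
    also have "\<dots> = (\<integral>x. \<eta>' x * Qh x \<partial>cell) - m * (\<integral>x. \<eta>' x \<partial>cell)"
      using i integrable_cell_continuous[OF cont(1)] by (subst Bochner_Integration.integral_diff) auto
    finally have 1: "(\<integral>x. \<eta>'' x * R x \<partial>cell) = (\<integral>x. \<eta> x * q x \<partial>cell)"
      using e0 parts[OF \<eta>(3) cont(1) \<eta>(2)] by (simp add: mult.commute)
    have "(\<integral>x. \<eta>'' x * (d * p x + R x) \<partial>cell) = (\<integral>x. d * (\<eta>'' x * p x) + \<eta>'' x * R x \<partial>cell)"
      by (rule Bochner_Integration.integral_cong) (auto simp: algebra_simps)
    also have "\<dots> = d * (\<integral>x. \<eta>'' x * p x \<partial>cell) + (\<integral>x. \<eta>'' x * R x \<partial>cell)"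
      using i by (subst Bochner_Integration.integral_add) auto
    also have "\<dots> = (\<integral>x. d * (\<eta>'' x * p x) + \<eta> x * q x \<partial>cell)"
      unfolding 1 using i by (subst Bochner_Integration.integral_add) auto
    also have "\<dots> = 0" by (rule weak[OF \<eta>])
    finally show "(\<integral>x. \<eta>'' x * (d * p x + R x) \<partial>cell) = 0" .
  qed
  show ?thesis
  proof (intro exI[of _ "\<lambda>x. (c - R x) / d"] exI[of _ m] conjI allI)
    show "((\<lambda>x. (c - R x) / d) has_vector_derivative - (Qh x - m) / d) (at x)" for x
      using R(1)[of x] d by (auto simp: Q1_def has_real_derivative_iff_has_vector_derivative[symmetric] intro!: derivative_eq_intros)
    show "AE x in cell. p x = (c - R x) / d" using c by eventually_elim (use d in \<open>auto simp: field_simps\<close>)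
  qed (simp add: R(2))
qed

lemma pair_sigma_finite_cell: "pair_sigma_finite cell cell"
proof -
  interpret finite_measure cell by (rule finite_measure_cell)
  show ?thesis by (intro pair_sigma_finite.intro sigma_finite_measure_axioms)
qed

text \<open>Integration by parts against the primitive of a merely integrable function, by Fubini's theorem.\<close>

lemma periodic_primitive_integrable:
  fixes q :: "real \<Rightarrow> real"
  assumes q: "integrable cell q" "(\<integral>x. q x \<partial>cell) = 0"
  obtains Qh where "continuous_on UNIV Qh" "\<And>x. Qh (x + 2 * pi) = Qh x"
    and "\<And>\<eta> \<eta>' :: real \<Rightarrow> real. (\<And>x. (\<eta> has_vector_derivative \<eta>' x) (at x)) \<Longrightarrow> continuous_on UNIV \<eta>' \<Longrightarrow>
      (\<And>x. \<eta> (x + 2 * pi) = \<eta> x) \<Longrightarrow> (\<integral>x. \<eta> x * q x \<partial>cell) = - (\<integral>x. \<eta>' x * Qh x \<partial>cell)"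
proof -
  define Q where "Q = (\<lambda>x. \<integral>t. indicator {..<x} t * q t \<partial>cell)"
  have idm [measurable]: "(\<lambda>x. x) \<in> borel_measurable cell" by (rule cell_measurable_continuous) auto
  have qm [measurable]: "q \<in> borel_measurable cell" using q by auto
  have Qc: "continuous_on {-pi..pi} Q"
  proof (rule continuous_at_imp_continuous_on, intro ballI)
    fix x
    show "isCont Q x" unfolding continuous_at_sequentially
    proof (intro allI impI)
      fix X :: "nat \<Rightarrow> real" assume X: "X \<longlonglongrightarrow> x"
      have "(\<lambda>n. \<integral>t. indicator {..<X n} t * q t \<partial>cell) \<longlonglongrightarrow> (\<integral>t. indicator {..<x} t * q t \<partial>cell)"
      proof (rule integral_dominated_convergence[where w = "\<lambda>t. \<bar>q t\<bar>"])
        show "integrable cell (\<lambda>t. \<bar>q t\<bar>)" using q by auto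
        show "AE t in cell. norm (indicator {..<X n} t * q t) \<le> \<bar>q t\<bar>" for n
          by (auto simp: indicator_def)
        \<comment> \<open>The indicators converge except possibly at the moving end point,
          \<open>t = x\<close>.\<close>
        have "AE t in lebesgue. t \<noteq> x" by (rule AE_completion[OF AE_lborel_singleton])
        hence "AE t in cell. t \<noteq> x" by (auto simp: AE_restrict_space_iff)
        thus "AE t in cell. (\<lambda>n. indicator {..<X n} t * q t) \<longlonglongrightarrow> indicator {..<x} t * q t"
        proof eventually_elim
          case (elim t)
          have "\<forall>\<^sub>F n in sequentially. indicator {..<X n} t * q t = indicator {..<x} t * q t"
          proof (cases "t < x")
            case True
            from order_tendstoD(1)[OF X this] show ?thesis by eventually_elim (use True in auto)
          next
            case False
            hence "x < t" using elim by simp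
            from order_tendstoD(2)[OF X this] show ?thesis by eventually_elim (use False in auto)
          qed
          thus ?case by (rule tendsto_eventually)
        qed
      qed measurable
      thus "(Q \<circ> X) \<longlonglongrightarrow> Q x" by (simp add: Q_def o_def)
    qed
  qed
  have "Q (-pi) = (\<integral>t. 0 \<partial>cell)" unfolding Q_def by (rule Bochner_Integration.integral_cong) auto
  moreover have "Q pi = (\<integral>t. q t \<partial>cell)" unfolding Q_def by (rule Bochner_Integration.integral_cong) auto
  \<comment> \<open>Here the zero mean of \<open>q\<close> enters: \<open>Q\<close> closes up to a
    periodic function.\<close>
  ultimately have "Q (-pi) = Q pi" using q(2) by simp
  then obtain Qh where Qh: "continuous_on UNIV Qh" "\<And>x. Qh (x + 2 * pi) = Qh x" "\<And>x. x \<in> {-pi..pi} \<Longrightarrow> Qh x = Q x"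
    using periodic_extension[OF Qc] by blast
  interpret pair_sigma_finite cell cell by (rule pair_sigma_finite_cell)
  show thesis
  proof (rule that[OF Qh(1,2)])
    fix \<eta> \<eta>' :: "real \<Rightarrow> real"
    assume \<eta>: "\<And>x. (\<eta> has_vector_derivative \<eta>' x) (at x)" "continuous_on UNIV \<eta>'" "\<And>x. \<eta> (x + 2 * pi) = \<eta> x"
    have \<eta>c: "continuous_on UNIV \<eta>" using \<eta>(1) by (auto intro: continuous_on_vector_derivative)
    have [measurable]: "\<eta>' \<in> borel_measurable cell" by (rule cell_measurable_continuous[OF \<eta>(2)])
    have i1: "integrable cell (\<lambda>t. indicator {..<x} t * q t)" for x
      by (rule Bochner_Integration.integrable_bound[OF q(1)]) (auto simp: indicator_def)
    have int: "integrable (cell \<Otimes>\<^sub>M cell) (\<lambda>(x, t). \<eta>' x * (indicator {..<x} t * q t))"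
    proof (rule Fubini_integrable)
      have "(\<lambda>(x, t). \<eta>' x * ((if t < x then 1 else 0) * q t)) \<in> borel_measurable (cell \<Otimes>\<^sub>M cell)" by measurable
      thus "(\<lambda>(x, t). \<eta>' x * (indicator {..<x} t * q t)) \<in> borel_measurable (cell \<Otimes>\<^sub>M cell)"
        by (simp add: indicator_def of_bool_def cong: if_cong)
      have m: "(\<lambda>x. \<integral>t. norm (\<eta>' x * ((if t < x then 1 else 0) * q t)) \<partial>cell) \<in> borel_measurable cell"
        by measurable
      have "integrable cell (\<lambda>x. \<eta>' x * (\<integral>t. \<bar>q t\<bar> \<partial>cell))"
        using integrable_cell_continuous[OF \<eta>(2)] by auto
      thus "integrable cell (\<lambda>x. \<integral>t. norm (case (x, t) of (x, t) \<Rightarrow> \<eta>' x * (indicator {..<x} t * q t)) \<partial>cell)"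
      proof (rule Bochner_Integration.integrable_bound)
        show "(\<lambda>x. \<integral>t. norm (case (x, t) of (x, t) \<Rightarrow> \<eta>' x * (indicator {..<x} t * q t)) \<partial>cell) \<in> borel_measurable cell"
          using m by (simp add: indicator_def of_bool_def cong: if_cong)
        have "\<bar>\<integral>t. \<bar>\<eta>' x\<bar> * \<bar>indicator {..<x} t * q t\<bar> \<partial>cell\<bar> \<le> \<bar>\<eta>' x * (\<integral>t. \<bar>q t\<bar> \<partial>cell)\<bar>" for x
        proof -
          have "(\<integral>t. \<bar>indicator {..<x} t * q t\<bar> \<partial>cell) \<le> (\<integral>t. \<bar>q t\<bar> \<partial>cell)"
            using q i1[of x] by (intro integral_mono) (auto simp: indicator_def)
          thus ?thesis by (simp add: abs_mult mult_left_mono)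
        qed
        thus "AE x in cell. norm (\<integral>t. norm (case (x, t) of (x, t) \<Rightarrow> \<eta>' x * (indicator {..<x} t * q t)) \<partial>cell)
            \<le> norm (\<eta>' x * (\<integral>t. \<bar>q t\<bar> \<partial>cell))" by (auto simp: abs_mult)
      qed
      show "AE x in cell. integrable cell (\<lambda>t. case (x, t) of (x, t) \<Rightarrow> \<eta>' x * (indicator {..<x} t * q t))"
        using i1 by auto
    qed
    \<comment> \<open>For fixed \<open>t\<close> the kernel restricts \<open>x\<close> to the
      interval from \<open>t\<close> to \<open>pi\<close>, so the inner integral is an instance of
      the fundamental theorem. The boundary term \<open>\<eta> pi * q t\<close> integrates to zero
      afterwards.\<close>
    have inner: "(\<integral>x. \<eta>' x * (indicator {..<x} t * q t) \<partial>cell) = (\<eta> pi - \<eta> t) * q t" if t: "t \<in> {-pi<..<pi}" for t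
    proof -
      have "(\<eta>' has_integral (\<eta> pi - \<eta> t)) {t..pi}"
        by (rule fundamental_theorem_of_calculus) (use t \<eta>(1) in \<open>auto intro: has_vector_derivative_at_within\<close>)
      hence "(\<eta>' has_integral (\<eta> pi - \<eta> t)) {t<..<pi}" by (simp add: has_integral_Icc_iff_Ioo)
      hence "((\<lambda>x. indicator {t<..<pi} x * \<eta>' x) has_integral (\<eta> pi - \<eta> t)) {-pi<..<pi}"
        using t has_integral_restrict[of "{t<..<pi}" "{-pi<..<pi}" \<eta>' "\<eta> pi - \<eta> t"]
        by (simp add: indicator_def of_bool_def if_distrib[where f = "\<lambda>c. c * _"] subset_iff cong: if_cong)
      moreover have "integrable cell (\<lambda>x. indicator {t<..<pi} x * \<eta>' x)"
        by (rule Bochner_Integration.integrable_bound[OF integrable_cell_continuous[OF \<eta>(2)]]) (auto simp: indicator_def)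
      ultimately have "(\<integral>x. indicator {t<..<pi} x * \<eta>' x \<partial>cell) = \<eta> pi - \<eta> t"
        using has_integral_unique[OF has_integral_integral_lebesgue_on[of "{-pi<..<pi}" "\<lambda>x. indicator {t<..<pi} x * \<eta>' x"]]
        by simp
      moreover have "(\<integral>x. \<eta>' x * (indicator {..<x} t * q t) \<partial>cell) = (\<integral>x. (indicator {t<..<pi} x * \<eta>' x) * q t \<partial>cell)"
        by (rule Bochner_Integration.integral_cong) (auto simp: indicator_def)
      ultimately show ?thesis by simp
    qed
    have i2: "integrable cell (\<lambda>t. \<eta> t * q t)" using integrable_cell_mult_continuous[OF q(1) \<eta>c] by simp
    have "(\<integral>x. \<eta>' x * Qh x \<partial>cell) = (\<integral>x. (\<integral>t. \<eta>' x * (indicator {..<x} t * q t) \<partial>cell) \<partial>cell)"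
      by (rule Bochner_Integration.integral_cong) (auto simp: Qh(3) Q_def)
    also have "\<dots> = (\<integral>t. (\<integral>x. \<eta>' x * (indicator {..<x} t * q t) \<partial>cell) \<partial>cell)"
      using Fubini_integral[OF int] by simp
    also have "\<dots> = (\<integral>t. \<eta> pi * q t - \<eta> t * q t \<partial>cell)"
    proof (rule Bochner_Integration.integral_cong[OF refl])
      fix t assume "t \<in> space cell"
      hence "t \<in> {-pi<..<pi}" by simp
      thus "(\<integral>x. \<eta>' x * (indicator {..<x} t * q t) \<partial>cell) = \<eta> pi * q t - \<eta> t * q t"
        by (subst inner) (simp_all add: left_diff_distrib)
    qed
    also have "\<dots> = \<eta> pi * (\<integral>t. q t \<partial>cell) - (\<integral>t. \<eta> t * q t \<partial>cell)"
      using q i2 by (subst Bochner_Integration.integral_diff) auto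
    finally show "(\<integral>x. \<eta> x * q x \<partial>cell) = - (\<integral>x. \<eta>' x * Qh x \<partial>cell)" using q(2) by simp
  qed
qed

section \<open>Weak derivatives on the torus\<close>

lemma L2_cell_integrable:
  assumes "u \<in> L2_cell"
  shows "integrable cell u"
proof (rule Bochner_Integration.integrable_bound)
  show "integrable cell (\<lambda>x. 1 + (norm (u x))\<^sup>2)" using assms by (auto simp: L2_cell_def)
  show "u \<in> borel_measurable cell" using assms by (auto simp: L2_cell_def)
  have "t \<le> 1 + t\<^sup>2" for t :: real
  proof -
    have "0 \<le> (t - 1/2)\<^sup>2" by simp
    thus ?thesis by (simp add: power2_eq_square algebra_simps)
  qed
  thus "AE x in cell. norm (u x) \<le> norm (1 + (norm (u x))\<^sup>2)" by simp
qed

lemma L2_cell_continuous: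
  assumes "continuous_on UNIV u"
  shows "u \<in> L2_cell"
proof -
  have "continuous_on UNIV (\<lambda>x. (norm (u x))\<^sup>2)" using assms by (intro continuous_intros)
  thus ?thesis using cell_measurable_continuous[OF assms] integrable_cell_continuous by (auto simp: L2_cell_def)
qed

lemma orthogonal_imp_AE_zero_vec:
  fixes v :: "real \<Rightarrow> 'b::euclidean_space"
  assumes v: "integrable cell v"
    and orth: "\<And>\<eta> :: real \<Rightarrow> real. (\<And>k. C_curve k \<eta>) \<Longrightarrow> (\<And>x. \<eta> (x + 2 * pi) = \<eta> x) \<Longrightarrow> (\<integral>x. \<eta> x *\<^sub>R v x \<partial>cell) = 0"
  shows "AE x in cell. v x = 0"
proof -
  have "AE x in cell. v x \<bullet> b = 0" for b
  proof (rule orthogonal_imp_AE_zero)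
    show "integrable cell (\<lambda>x. v x \<bullet> b)" using v by simp
    fix \<eta> :: "real \<Rightarrow> real" assume \<eta>: "\<And>k. C_curve k \<eta>" "\<And>x. \<eta> (x + 2 * pi) = \<eta> x"
    have "(\<integral>x. (\<eta> x *\<^sub>R v x) \<bullet> b \<partial>cell) = (\<integral>x. \<eta> x *\<^sub>R v x \<partial>cell) \<bullet> b"
      by (rule integral_inner_left)
         (use integrable_cell_mult_continuous[OF v C_curve_continuous[OF \<eta>(1)]] in auto)
    thus "(\<integral>x. \<eta> x * (v x \<bullet> b) \<partial>cell) = 0" using orth[OF \<eta>] by simp
  qed
  hence "AE x in cell. \<forall>b\<in>Basis. v x \<bullet> b = 0" by (intro eventually_ball_finite) auto
  thus ?thesis by eventually_elim (simp add: euclidean_all_zero_iff)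
qed

lemma test_function_curve:
  fixes \<eta> :: "real \<Rightarrow> real"
  assumes "C_class_on \<infinity> UNIV UNIV \<eta>"
  shows "C_curve k \<eta>" "(\<eta> has_vector_derivative deriv \<eta> x) (at x)" "continuous_on UNIV (deriv \<eta>)"
proof -
  show c: "C_curve k \<eta>" for k by (rule C_curve_of_C_class[OF assms]) auto
  show d: "(\<eta> has_vector_derivative deriv \<eta> x) (at x)" for x
    using C_curve_SucD(1)[OF c[of "Suc 0"], of x]
    by (metis DERIV_imp_deriv has_real_derivative_iff_has_vector_derivative)
  show "continuous_on UNIV (deriv \<eta>)"
    by (rule C_curve_continuous[OF C_curve_hvd_continuous[OF c d]])
qed

lemma weak_deriv_unique:
  assumes "weak_deriv u v" "weak_deriv u w" and v: "v \<in> L2_cell" and w: "w \<in> L2_cell"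
  shows "AE x in cell. v x = w x"
proof -
  have i: "integrable cell v" "integrable cell w" using v w by (auto intro: L2_cell_integrable)
  have "AE x in cell. v x - w x = 0"
  proof (rule orthogonal_imp_AE_zero_vec)
    show "integrable cell (\<lambda>x. v x - w x)" using i by simp
    fix \<eta> :: "real \<Rightarrow> real" assume \<eta>: "\<And>k. C_curve k \<eta>" "\<And>x. \<eta> (x + 2 * pi) = \<eta> x"
    have "C_class_on \<infinity> UNIV UNIV \<eta>" by (rule C_class_on_C_curve) (rule \<eta>(1))
    from assms(1)[unfolded weak_deriv_def, rule_format, OF this \<eta>(2)]
      assms(2)[unfolded weak_deriv_def, rule_format, OF this \<eta>(2)]
    have "(\<integral>x. \<eta> x *\<^sub>R v x \<partial>cell) = (\<integral>x. \<eta> x *\<^sub>R w x \<partial>cell)" by simp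
    moreover note i[THEN integrable_cell_mult_continuous, OF C_curve_continuous[OF \<eta>(1)[of 0]]]
    ultimately show "(\<integral>x. \<eta> x *\<^sub>R (v x - w x) \<partial>cell) = 0"
      by (simp add: scaleR_diff_right)
  qed
  thus ?thesis by simp
qed

lemma weak_deriv_classical:
  assumes u: "\<And>x. (u has_vector_derivative u' x) (at x)" "continuous_on UNIV u'" "\<And>x. u (x + 2 * pi) = u x"
  shows "weak_deriv u u'"
  unfolding weak_deriv_def
proof (intro allI impI)
  fix \<eta> :: "real \<Rightarrow> real" assume \<eta>: "C_class_on \<infinity> UNIV UNIV \<eta>" "\<forall>x. \<eta> (x + 2 * pi) = \<eta> x"
  note c = C_curve_continuous[OF test_function_curve(1)[OF \<eta>(1)]] test_function_curve(3)[OF \<eta>(1)]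
    continuous_on_vector_derivative[of UNIV u u'] u(2)
  have uc: "continuous_on UNIV u" using u(1) by (auto intro: continuous_on_vector_derivative)
  have "(\<integral>x. \<eta> x *\<^sub>R u' x + deriv \<eta> x *\<^sub>R u x \<partial>cell) = 0"
  proof (rule cell_integral_deriv_periodic)
    show "((\<lambda>x. \<eta> x *\<^sub>R u x) has_vector_derivative (\<eta> x *\<^sub>R u' x + deriv \<eta> x *\<^sub>R u x)) (at x)" for x
      using has_vector_derivative_scaleR[OF _ u(1), of \<eta> "deriv \<eta> x" x] test_function_curve(2)[OF \<eta>(1), of x]
      by (simp add: has_real_derivative_iff_has_vector_derivative)
    show "continuous_on UNIV (\<lambda>x. \<eta> x *\<^sub>R u' x + deriv \<eta> x *\<^sub>R u x)"
      by (intro continuous_intros c uc u(2))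
  qed (simp add: u(3) \<eta>(2))
  moreover have "integrable cell (\<lambda>x. \<eta> x *\<^sub>R u' x)" "integrable cell (\<lambda>x. deriv \<eta> x *\<^sub>R u x)"
    by (intro integrable_cell_continuous continuous_intros c uc u(2))+
  ultimately show "(\<integral>x. deriv \<eta> x *\<^sub>R u x \<partial>cell) = - (\<integral>x. \<eta> x *\<^sub>R u' x \<partial>cell)"
    by (simp add: eq_neg_iff_add_eq_0 add.commute)
qed

lemma weak_deriv_cong_AE:
  assumes "weak_deriv u v" "AE x in cell. u x = w x" "u \<in> L2_cell" "w \<in> L2_cell"
  shows "weak_deriv w v"
  unfolding weak_deriv_def
proof (intro allI impI)
  fix \<eta> :: "real \<Rightarrow> real" assume \<eta>: "C_class_on \<infinity> UNIV UNIV \<eta>" "\<forall>x. \<eta> (x + 2 * pi) = \<eta> x"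
  have m: "deriv \<eta> \<in> borel_measurable cell" "u \<in> borel_measurable cell" "w \<in> borel_measurable cell"
    using cell_measurable_continuous[OF test_function_curve(3)[OF \<eta>(1)]] assms(3,4) by (auto simp: L2_cell_def)
  have "(\<integral>x. deriv \<eta> x *\<^sub>R u x \<partial>cell) = (\<integral>x. deriv \<eta> x *\<^sub>R w x \<partial>cell)"
  proof (rule integral_cong_AE)
    show "AE x in cell. deriv \<eta> x *\<^sub>R u x = deriv \<eta> x *\<^sub>R w x" using assms(2) by eventually_elim simp
  qed (use m in auto)
  thus "(\<integral>x. deriv \<eta> x *\<^sub>R w x \<partial>cell) = - (\<integral>x. \<eta> x *\<^sub>R v x \<partial>cell)"
    using assms(1)[unfolded weak_deriv_def, rule_format, OF \<eta>(1) \<eta>(2)[rule_format]] by simp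
qed

text \<open>\<open>wderiv\<close> picks an arbitrary weak derivative; uniqueness identifies it
  almost everywhere with any known one.\<close>

lemma wderiv_AE:
  assumes "v \<in> L2_cell" "weak_deriv u v"
  shows "wderiv u \<in> L2_cell" "weak_deriv u (wderiv u)" "AE x in cell. wderiv u x = v x"
proof -
  have *: "wderiv u \<in> L2_cell \<and> weak_deriv u (wderiv u)"
    unfolding wderiv_def by (rule someI[of _ v]) (use assms in auto)
  thus "wderiv u \<in> L2_cell" "weak_deriv u (wderiv u)" by auto
  show "AE x in cell. wderiv u x = v x" by (rule weak_deriv_unique[of u]) (use * assms in auto)
qed

lemma H2_cell_classical:
  fixes u :: "real \<Rightarrow> complex^'n"
  assumes u: "\<And>x. (u has_vector_derivative u' x) (at x)" "\<And>x. (u' has_vector_derivative u'' x) (at x)"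
    "continuous_on UNIV u''" "\<And>x. u (x + 2 * pi) = u x"
  shows "u \<in> H2_cell" "AE x in cell. wderiv (wderiv u) x = u'' x"
    "wderiv (wderiv u) \<in> borel_measurable cell"
proof -
  have c: "continuous_on UNIV u" "continuous_on UNIV u'"
    using u(1,2) by (auto intro: continuous_on_vector_derivative)
  note L2 = L2_cell_continuous[OF c(1)] L2_cell_continuous[OF c(2)] L2_cell_continuous[OF u(3)]
  note w = wderiv_AE[OF L2(2) weak_deriv_classical[OF u(1) c(2) u(4)]]
  have "weak_deriv u' u''" by (rule weak_deriv_classical[OF u(2,3) periodic_derivative[OF u(1,4)]])
  \<comment> \<open>\<open>wderiv u\<close> agrees with \<open>u'\<close> only almost everywhere, so
    the weak derivative of \<open>u'\<close> has to be carried over.\<close>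
  hence "weak_deriv (wderiv u) u''"
    by (rule weak_deriv_cong_AE) (use w L2 in \<open>auto simp: eq_commute\<close>)
  note ww = wderiv_AE[OF L2(3) this]
  show "AE x in cell. wderiv (wderiv u) x = u'' x" by (rule ww(3))
  show "wderiv (wderiv u) \<in> borel_measurable cell" using ww(1) by (auto simp: L2_cell_def)
  show "u \<in> H2_cell" using w ww L2 by (auto simp: H2_cell_def H1_cell_def)
qed

section \<open>Regularity of the adjoint kernel\<close>

lemma twisted_deriv_0: "twisted_deriv 0 u = wderiv u"
  by (auto simp: twisted_deriv_def fun_eq_iff)

lemma vec_nth_measurable:
  assumes "(u :: real \<Rightarrow> 'b::euclidean_space^'n) \<in> borel_measurable cell"
  shows "(\<lambda>x. u x $ k) \<in> borel_measurable cell"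
  using measurable_compose[OF assms borel_measurable_continuous_onI[OF linear_continuous_on[OF bounded_linear_vec_nth[of k]]]] .

text \<open>The adjoint relation is tested with \<open>\<eta>\<close> times the \<open>i\<close>-th
  unit vector. This isolates the \<open>i\<close>-th component of the adjoint equation, in which the
  transposed Jacobian appears, hence the order \<open>k $ i\<close> under the sum over
  \<open>k\<close>.\<close>

lemma adjoint_kernel_weak:
  fixes D :: "real^'n^'n" and uad :: "real \<Rightarrow> real^'n"
  assumes adj: "adjoint_maps (Bloch D f ustar 0) (\<lambda>x. cvec (uad x)) (\<lambda>x. 0)"
    and D_diag: "\<And>i j. i \<noteq> j \<Longrightarrow> D $ i $ j = 0"
    and A: "\<And>k j. continuous_on UNIV (\<lambda>x. jacobian f (at (ustar x)) $ k $ j)"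
    and \<eta>: "\<And>k. C_curve k \<eta>" "\<And>x. \<eta> (x + 2 * pi) = \<eta> x"
      "\<And>x. (\<eta> has_vector_derivative \<eta>' x) (at x)" "\<And>x. (\<eta>' has_vector_derivative \<eta>'' x) (at x)"
  shows "(\<integral>x. D $ i $ i * (\<eta>'' x * uad x $ i) + \<eta> x * (\<Sum>k\<in>UNIV. jacobian f (at (ustar x)) $ k $ i * uad x $ k) \<partial>cell) = 0"
proof -
  let ?A = "\<lambda>x. jacobian f (at (ustar x))"
  define u where "u = (\<lambda>x. \<eta> x *\<^sub>R axis i (1 :: complex) :: complex^'n)"
  have \<eta>'c: "C_curve k \<eta>'" for k by (rule C_curve_hvd_continuous[OF \<eta>(1,3)])
  have \<eta>''c: "C_curve k \<eta>''" for k by (rule C_curve_hvd_continuous[OF \<eta>'c \<eta>(4)])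
  note cont = C_curve_continuous[OF \<eta>(1)[of 0]] C_curve_continuous[OF \<eta>''c[of 0]]
  have uc: "continuous_on UNIV u" unfolding u_def by (intro continuous_intros cont)
  have H2: "u \<in> H2_cell" "AE x in cell. wderiv (wderiv u) x = \<eta>'' x *\<^sub>R axis i 1"
    "wderiv (wderiv u) \<in> borel_measurable cell"
    by (rule H2_cell_classical[of u "\<lambda>x. \<eta>' x *\<^sub>R axis i 1" "\<lambda>x. \<eta>'' x *\<^sub>R axis i 1"];
        auto simp: u_def \<eta>(2) has_real_derivative_iff_has_vector_derivative[symmetric]
          intro!: continuous_intros cont(2) bounded_linear.has_vector_derivative[OF bounded_linear_scaleR_left] \<eta>(3,4))+
  have uadm: "(\<lambda>x. uad x $ k) \<in> borel_measurable cell" for k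
  proof -
    have "(\<lambda>x. cvec (uad x)) \<in> borel_measurable cell" using adj by (auto simp: adjoint_maps_def L2_cell_def)
    from measurable_compose[OF vec_nth_measurable[OF this, of k] borel_measurable_Re] show ?thesis by (simp add: cvec_def)
  qed
  have Am: "(\<lambda>x. ?A x $ k $ j) \<in> borel_measurable cell" for k j by (rule cell_measurable_continuous[OF A])
  have \<eta>m: "\<eta> \<in> borel_measurable cell" "\<eta>'' \<in> borel_measurable cell" by (rule cell_measurable_continuous[OF cont(1)] cell_measurable_continuous[OF cont(2)])+
  have B: "Bloch D f ustar 0 u x $ k = (\<Sum>j\<in>UNIV. of_real (D $ k $ j) * wderiv (wderiv u) x $ j)
      + (\<Sum>j\<in>UNIV. of_real (?A x $ k $ j) * u x $ j)" for x k
    by (simp add: Bloch_def twisted_deriv_0 matrix_vector_mult_def cmat_def)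
  have "0 = L2_ip_cell (Bloch D f ustar 0 u) (\<lambda>x. cvec (uad x))"
    using adj H2(1) by (auto simp: adjoint_maps_def L2_ip_cell_def)
  also have "\<dots> = (\<integral>x. (\<Sum>k\<in>UNIV. Bloch D f ustar 0 u x $ k * of_real (uad x $ k)) \<partial>cell)"
    by (simp add: L2_ip_cell_def cvec_def)
  also have "\<dots> = (\<integral>x. complex_of_real (D $ i $ i * (\<eta>'' x * uad x $ i) + \<eta> x * (\<Sum>k\<in>UNIV. ?A x $ k $ i * uad x $ k)) \<partial>cell)"
  proof (rule integral_cong_AE)
    note m = vec_nth_measurable[OF H2(3)] vec_nth_measurable[OF cell_measurable_continuous[OF uc]]
    show "(\<lambda>x. \<Sum>k\<in>UNIV. Bloch D f ustar 0 u x $ k * of_real (uad x $ k)) \<in> borel_measurable cell"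
      unfolding B using m Am uadm by (intro borel_measurable_sum borel_measurable_times borel_measurable_add borel_measurable_of_real) auto
    show "(\<lambda>x. complex_of_real (D $ i $ i * (\<eta>'' x * uad x $ i) + \<eta> x * (\<Sum>k\<in>UNIV. ?A x $ k $ i * uad x $ k))) \<in> borel_measurable cell"
    proof -
      note [measurable] = Am uadm \<eta>m
      show ?thesis by measurable
    qed
    show "AE x in cell. (\<Sum>k\<in>UNIV. Bloch D f ustar 0 u x $ k * of_real (uad x $ k)) =
        complex_of_real (D $ i $ i * (\<eta>'' x * uad x $ i) + \<eta> x * (\<Sum>k\<in>UNIV. ?A x $ k $ i * uad x $ k))"
      using H2(2)
    proof eventually_elim
      case (elim x)
      have ax: "(\<Sum>j\<in>UNIV. of_real (M $ k $ j) * (c *\<^sub>R axis i (1::complex)) $ j) = of_real (M $ k $ i * c)" for M :: "real^'n^'n" and k and c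
      proof -
        have "(\<Sum>j\<in>UNIV. of_real (M $ k $ j) * (c *\<^sub>R axis i (1::complex)) $ j)
          = (\<Sum>j\<in>UNIV. if j = i then of_real (M $ k $ i * c) else 0)"
          by (rule sum.cong) (auto simp: axis_def of_real_def)
        thus ?thesis by simp
      qed
      have "Bloch D f ustar 0 u x $ k = of_real (D $ k $ i * \<eta>'' x + ?A x $ k $ i * \<eta> x)" for k
        unfolding B elim ax of_real_add by (simp only: u_def ax)
      hence "(\<Sum>k\<in>UNIV. Bloch D f ustar 0 u x $ k * of_real (uad x $ k)) =
         of_real (\<Sum>k\<in>UNIV. (D $ k $ i * \<eta>'' x + ?A x $ k $ i * \<eta> x) * uad x $ k)" by simp
      also have "(\<Sum>k\<in>UNIV. (D $ k $ i * \<eta>'' x + ?A x $ k $ i * \<eta> x) * uad x $ k)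
        = (\<Sum>k\<in>UNIV. D $ k $ i * \<eta>'' x * uad x $ k) + \<eta> x * (\<Sum>k\<in>UNIV. ?A x $ k $ i * uad x $ k)"
        by (simp add: sum.distrib sum_distrib_left algebra_simps)
      also have "(\<Sum>k\<in>UNIV. D $ k $ i * \<eta>'' x * uad x $ k) = (\<Sum>k\<in>UNIV. if k = i then D $ i $ i * \<eta>'' x * uad x $ i else 0)"
        by (rule sum.cong) (auto simp: D_diag)
      finally show ?case by (simp add: mult.assoc)
    qed
  qed
  also have "\<dots> = complex_of_real (\<integral>x. D $ i $ i * (\<eta>'' x * uad x $ i) + \<eta> x * (\<Sum>k\<in>UNIV. ?A x $ k $ i * uad x $ k) \<partial>cell)"
    by (rule integral_complex_of_real)
  finally show ?thesis by simp
qed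

lemma periodic_int_shift:
  assumes "\<And>x. f (x + p) = f (x :: real)"
  shows "f (x + of_int n * p) = f x"
proof -
  have nat: "f (x + of_nat m * p) = f x" for x m
    by (induction m arbitrary: x) (use assms in \<open>auto simp: algebra_simps\<close>, metis add.assoc add.commute)
  show ?thesis
  proof (cases "n \<ge> 0")
    case True
    thus ?thesis using nat[of x "nat n"] by simp
  next
    case False
    thus ?thesis using nat[of "x + of_int n * p" "nat (-n)"] by simp
  qed
qed

lemma cell_representative:
  obtains y and n :: int where "y \<in> {-pi..<pi}" "x = y + of_int n * (2 * pi)"
proof -
  define n where "n = \<lfloor>(x + pi) / (2 * pi)\<rfloor>"
  have "of_int n \<le> (x + pi) / (2 * pi)" "(x + pi) / (2 * pi) < of_int n + 1" by (auto simp: n_def)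
  hence "of_int n * (2 * pi) \<le> x + pi" "x + pi < (of_int n + 1) * (2 * pi)"
    by (simp_all add: pos_le_divide_eq pos_divide_less_eq)
  hence "x - of_int n * (2 * pi) \<in> {-pi..<pi}" by (auto simp: distrib_right)
  thus thesis using that[of "x - of_int n * (2 * pi)" n] by simp
qed

text \<open>The continuous function \<open>\<bar>f x - g x\<bar>\<close> has integral zero over the
  cell, so it vanishes on the closed interval, and every real number is a periodic translate of a
  point there.\<close>

lemma continuous_AE_eq_imp_eq:
  fixes f g :: "real \<Rightarrow> real"
  assumes f: "continuous_on UNIV f" "\<And>x. f (x + 2 * pi) = f x"
    and g: "continuous_on UNIV g" "\<And>x. g (x + 2 * pi) = g x" and AE: "AE x in cell. f x = g x"
  shows "f = g"
proof
  fix x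
  obtain y and n :: int where y: "y \<in> {-pi..<pi}" "x = y + of_int n * (2 * pi)" using cell_representative .
  let ?h = "\<lambda>x. \<bar>f x - g x\<bar>"
  have hc: "continuous_on UNIV ?h" using f(1) g(1) by (intro continuous_intros)
  have "(\<integral>x. ?h x \<partial>cell) = 0"
    by (rule integral_eq_zero_AE) (use AE in auto)
  hence "(?h has_integral 0) {-pi<..<pi}"
    using has_integral_integral_lebesgue_on[OF integrable_cell_continuous[OF hc]] by simp
  hence "(?h has_integral 0) (cbox (-pi) pi)" by (simp add: has_integral_Icc_iff_Ioo)
  hence "?h y = 0"
    by (rule has_integral_0_cbox_imp_0[rotated 2])
       (use y in \<open>auto simp: box_real intro: continuous_on_subset[OF hc]\<close>)
  thus "f x = g x" using periodic_int_shift[of f "2 * pi", OF f(2)] periodic_int_shift[of g "2 * pi", OF g(2)] y(2) by simp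
qed

lemma C_curve_vec:
  fixes g :: "real \<Rightarrow> real^'n"
  assumes "\<And>i. C_curve k (\<lambda>x. g x $ i)"
  shows "C_curve k g"
proof -
  have "g x = (\<Sum>i\<in>UNIV. (g x $ i) *\<^sub>R axis i 1)" for x
    by (subst basis_expansion[of "g x", symmetric]) (simp add: scalar_mult_eq_scaleR)
  hence "g = (\<lambda>x. \<Sum>i\<in>UNIV. (g x $ i) *\<^sub>R axis i 1)" by (rule ext)
  moreover have "C_curve k (\<lambda>x. \<Sum>i\<in>UNIV. (g x $ i) *\<^sub>R axis i (1::real))"
    by (intro C_curve_sum C_curve_scaleR assms C_curve_const)
  ultimately show ?thesis by (simp only:)
qed

lemma C_curve_vec_nth:
  fixes g :: "real \<Rightarrow> 'b::euclidean_space^'n"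
  assumes "C_curve k g"
  shows "C_curve k (\<lambda>x. g x $ i)"
  by (rule C_curve_linear[OF bounded_linear_vec_nth assms])

lemma jacobian_nth:
  assumes "(f has_derivative f') (at y)"
  shows "jacobian f (at y) $ k $ i = f' (axis i 1) $ k"
  using frechet_derivative_at[OF assms] by (simp add: jacobian_def matrix_def)

text \<open>A continuous \<open>p\<close> coincides everywhere with the differentiable function
  found by \<open>weak_second_derivative_regular\<close>, so the weak equation becomes a classical
  one.\<close>

lemma weak_second_derivative_continuous:
  fixes p q :: "real \<Rightarrow> real"
  assumes p: "continuous_on UNIV p" "\<And>x. p (x + 2 * pi) = p x"
    and q: "continuous_on UNIV q" "\<And>x. q (x + 2 * pi) = q x" and d: "d \<noteq> 0"
    and weak: "\<And>\<eta> \<eta>' \<eta>'' :: real \<Rightarrow> real. (\<And>k. C_curve k \<eta>) \<Longrightarrow> (\<And>x. \<eta> (x + 2 * pi) = \<eta> x) \<Longrightarrow>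
      (\<And>x. (\<eta> has_vector_derivative \<eta>' x) (at x)) \<Longrightarrow> (\<And>x. (\<eta>' has_vector_derivative \<eta>'' x) (at x)) \<Longrightarrow>
      (\<integral>x. d * (\<eta>'' x * p x) + \<eta> x * q x \<partial>cell) = 0"
  shows "\<exists>p'. (\<forall>x. (p has_vector_derivative p' x) (at x)) \<and> (\<forall>x. (p' has_vector_derivative - q x / d) (at x))"
proof -
  \<comment> \<open>The constant test function yields the solvability condition.\<close>
  have q0: "(\<integral>x. q x \<partial>cell) = 0"
    using weak[of "\<lambda>_. 1" "\<lambda>_. 0" "\<lambda>_. 0"] by simp
  obtain Q where Q: "\<And>x. (Q has_vector_derivative q x) (at x)" "\<And>x. Q (x + 2 * pi) = Q x"
    using periodic_antiderivative[OF q q0] by blast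
  have Qc: "continuous_on UNIV Q" using Q(1) by (auto intro: continuous_on_vector_derivative)
  have parts: "(\<integral>x. \<eta> x * q x \<partial>cell) = - (\<integral>x. \<eta>' x * Q x \<partial>cell)"
    if \<eta>: "\<And>x. (\<eta> has_vector_derivative \<eta>' x) (at x)" "continuous_on UNIV \<eta>'" "\<And>x. \<eta> (x + 2 * pi) = \<eta> x"
    for \<eta> \<eta>' :: "real \<Rightarrow> real"
    by (rule cell_integration_by_parts[OF \<eta> Q(1) q(1) Q(2)])
  have "\<exists>g m. (\<forall>x. (g has_vector_derivative - (Q x - m) / d) (at x)) \<and> (\<forall>x. g (x + 2 * pi) = g x) \<and> (AE x in cell. p x = g x)"
    by (rule weak_second_derivative_regular[OF integrable_cell_continuous[OF p(1)] integrable_cell_continuous[OF q(1)] Qc Q(2) d];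
        (rule parts weak; assumption))
  then obtain g m where g: "\<And>x. (g has_vector_derivative - (Q x - m) / d) (at x)" "\<And>x. g (x + 2 * pi) = g x"
    "AE x in cell. p x = g x" by blast
  have "continuous_on UNIV g"
    by (rule continuous_on_vector_derivative[OF has_vector_derivative_at_within[OF g(1)]])
  hence "p = g" using continuous_AE_eq_imp_eq[OF p _ g(2,3)] by blast
  moreover have "((\<lambda>x. - (Q x - m) / d) has_vector_derivative - q x / d) (at x)" for x
    using Q(1)[of x] d by (auto simp: has_real_derivative_iff_has_vector_derivative[symmetric] intro!: derivative_eq_intros)
  ultimately show ?thesis using g(1) by (intro exI[of _ "\<lambda>x. - (Q x - m) / d"] conjI allI) (simp_all only:)
qed

text \<open>The weak equation first yields a continuous representative; differentiating the strong equation
  then gains two derivatives over the coefficient \<open>f'(u\<^sub>\<star>)\<close>, which is only of class \<open>C\<^bsup>r-1\<^esup>\<close>.\<close>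

lemma adjoint_kernel_regular:
  fixes D :: "real^'n^'n" and f :: "real^'n \<Rightarrow> real^'n" and ustar uad :: "real \<Rightarrow> real^'n"
  assumes r: "2 \<le> r"
    and D_diag: "\<And>i j. i \<noteq> j \<Longrightarrow> D $ i $ j = 0" and D_pos: "\<And>i. D $ i $ i > 0"
    and f: "C_class_on r UNIV UNIV f" and ustar: "C_class_on r UNIV UNIV ustar"
    and ustar_periodic: "\<And>x. ustar (x + 2 * pi) = ustar x"
    and adj: "adjoint_maps (Bloch D f ustar 0) (\<lambda>x. cvec (uad x)) (\<lambda>x. 0)"
  shows "\<exists>a. (\<forall>k. enat k \<le> r \<longrightarrow> C_curve (Suc k) a) \<and> (\<forall>x. a (x + 2 * pi) = a x) \<and> (AE x in cell. uad x = a x)"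
proof -
  have r1: "1 \<le> r" using r by (metis one_le_numeral order_trans)
  have us: "C_curve k ustar" if "enat k \<le> r" for k by (rule C_curve_of_C_class[OF ustar r1 that])
  obtain f' where f': "\<And>y. (f has_derivative f' y) (at y)"
    "\<And>k u b. enat (Suc k) \<le> r \<Longrightarrow> C_curve k u \<Longrightarrow> C_curve k (\<lambda>x. f' (u x) b)"
    using C_class_on_compose_curve[OF f r1] by metis
  define A where "A = (\<lambda>k i x. jacobian f (at (ustar x)) $ k $ i)"
  have A: "C_curve j (A k i)" if "enat (Suc j) \<le> r" for j k i
  proof -
    have "enat j \<le> r" using that by (rule order_trans[rotated]) simp
    hence "C_curve j (\<lambda>x. f' (ustar x) (axis i 1) $ k)" using f'(2)[OF that us] by (intro C_curve_vec_nth) auto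
    moreover have "A k i = (\<lambda>x. f' (ustar x) (axis i 1) $ k)" by (auto simp: A_def jacobian_nth[OF f'(1)])
    ultimately show ?thesis by (simp only:)
  qed
  have "enat (Suc 0) \<le> r" using r1 by (simp add: one_enat_def)
  note Ac = C_curve_continuous[OF A[OF this]]
  have Ap: "A k i (x + 2 * pi) = A k i x" for k i x by (simp add: A_def ustar_periodic)
  define q where "q = (\<lambda>i x. \<Sum>k\<in>UNIV. A k i x * uad x $ k)"
  have weak: "(\<integral>x. D $ i $ i * (\<eta>'' x * uad x $ i) + \<eta> x * q i x \<partial>cell) = 0"
    if "\<And>k. C_curve k \<eta>" "\<And>x. \<eta> (x + 2 * pi) = \<eta> x"
      "\<And>x. (\<eta> has_vector_derivative \<eta>' x) (at x)" "\<And>x. (\<eta>' has_vector_derivative \<eta>'' x) (at x)" for \<eta> \<eta>' \<eta>'' :: "real \<Rightarrow> real" and i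
    unfolding q_def A_def by (rule adjoint_kernel_weak[OF adj D_diag Ac[unfolded A_def] that])
  have ui: "integrable cell (\<lambda>x. uad x $ k)" for k
  proof -
    have "integrable cell (\<lambda>x. cvec (uad x))" using adj by (intro L2_cell_integrable) (auto simp: adjoint_maps_def)
    from integrable_bounded_linear[OF bounded_linear_compose[OF bounded_linear_Re bounded_linear_vec_nth[of k]] this]
    show ?thesis by (simp add: cvec_def)
  qed
  have Aui: "integrable cell (\<lambda>x. A k i x * uad x $ k)" for k i
    using integrable_cell_mult_continuous[OF ui Ac] by simp
  have qi: "integrable cell (q i)" for i unfolding q_def by (intro Bochner_Integration.integrable_sum Aui)
  \<comment> \<open>First pass: \<open>q i\<close> contains \<open>uad\<close>, which is merely
    square integrable, so only the primitive of an integrable function is at hand; this suffices for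
    a continuous representative.\<close>
  have "\<exists>g. continuous_on UNIV g \<and> (\<forall>x. g (x + 2 * pi) = g x) \<and> (AE x in cell. uad x $ i = g x)" for i
  proof -
    have q0: "(\<integral>x. q i x \<partial>cell) = 0" using weak[of "\<lambda>_. 1" "\<lambda>_. 0" "\<lambda>_. 0" i] by simp
    have d: "D $ i $ i \<noteq> 0" using D_pos[of i] by simp
    show ?thesis
    proof (rule periodic_primitive_integrable[OF qi[of i] q0])
      fix Q :: "real \<Rightarrow> real"
      assume Q: "continuous_on UNIV Q" "\<And>x. Q (x + 2 * pi) = Q x"
        and parts: "\<And>\<eta> \<eta>' :: real \<Rightarrow> real. (\<And>x. (\<eta> has_vector_derivative \<eta>' x) (at x)) \<Longrightarrow> continuous_on UNIV \<eta>' \<Longrightarrow>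
          (\<And>x. \<eta> (x + 2 * pi) = \<eta> x) \<Longrightarrow> (\<integral>x. \<eta> x * q i x \<partial>cell) = - (\<integral>x. \<eta>' x * Q x \<partial>cell)"
      have "\<exists>g m. (\<forall>x. (g has_vector_derivative - (Q x - m) / D $ i $ i) (at x)) \<and> (\<forall>x. g (x + 2 * pi) = g x) \<and>
          (AE x in cell. uad x $ i = g x)"
        by (rule weak_second_derivative_regular[OF ui qi Q d]; (rule parts weak; assumption))
      then obtain g m where "\<And>x. (g has_vector_derivative - (Q x - m) / D $ i $ i) (at x)" "\<And>x. g (x + 2 * pi) = g x"
          "AE x in cell. uad x $ i = g x" by blast
      moreover from this(1) have "continuous_on UNIV g" by (rule continuous_on_vector_derivative[OF has_vector_derivative_at_within])
      ultimately show ?thesis by blast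
    qed
  qed
  then obtain G where G: "\<And>i. continuous_on UNIV (G i)" "\<And>i x. G i (x + 2 * pi) = G i x"
    "\<And>i. AE x in cell. uad x $ i = G i x" by metis
  define a where "a = (\<lambda>x. \<chi> i. G i x)"
  have AEa: "AE x in cell. uad x = a x"
  proof -
    have "AE x in cell. \<forall>i. uad x $ i = G i x" by (rule eventually_all_finite) (rule G(3))
    thus ?thesis by eventually_elim (simp add: a_def vec_eq_iff)
  qed
  define qa where "qa = (\<lambda>i x. \<Sum>k\<in>UNIV. A k i x * G k x)"
  \<comment> \<open>Second pass, now with the continuous representatives in the zeroth order term,
    which gives classical second derivatives.\<close>
  have "\<exists>p'. (\<forall>x. (G i has_vector_derivative p' x) (at x)) \<and> (\<forall>x. (p' has_vector_derivative - qa i x / D $ i $ i) (at x))" for i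
  proof (rule weak_second_derivative_continuous[OF G(1,2)])
    show "D $ i $ i \<noteq> 0" using D_pos[of i] by simp
    show qac: "continuous_on UNIV (qa i)" unfolding qa_def by (intro continuous_intros Ac G(1))
    show "qa i (x + 2 * pi) = qa i x" for x by (simp add: qa_def Ap G(2))
    fix \<eta> \<eta>' \<eta>'' :: "real \<Rightarrow> real"
    assume \<eta>: "\<And>k. C_curve k \<eta>" "\<And>x. \<eta> (x + 2 * pi) = \<eta> x"
      "\<And>x. (\<eta> has_vector_derivative \<eta>' x) (at x)" "\<And>x. (\<eta>' has_vector_derivative \<eta>'' x) (at x)"
    have \<eta>'c: "C_curve k \<eta>'" for k by (rule C_curve_hvd_continuous[OF \<eta>(1,3)])
    have \<eta>''c: "C_curve k \<eta>''" for k by (rule C_curve_hvd_continuous[OF \<eta>'c \<eta>(4)])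
    note cont = C_curve_continuous[OF \<eta>(1)[of 0]] C_curve_continuous[OF \<eta>''c[of 0]]
    have "(\<integral>x. D $ i $ i * (\<eta>'' x * G i x) + \<eta> x * qa i x \<partial>cell)
      = (\<integral>x. D $ i $ i * (\<eta>'' x * uad x $ i) + \<eta> x * q i x \<partial>cell)"
    proof (rule integral_cong_AE)
      show "(\<lambda>x. D $ i $ i * (\<eta>'' x * G i x) + \<eta> x * qa i x) \<in> borel_measurable cell"
        by (intro cell_measurable_continuous continuous_intros cont G(1) qac)
      show "(\<lambda>x. D $ i $ i * (\<eta>'' x * uad x $ i) + \<eta> x * q i x) \<in> borel_measurable cell"
        using borel_measurable_integrable[OF ui] borel_measurable_integrable[OF qi]
          cell_measurable_continuous[OF cont(1)] cell_measurable_continuous[OF cont(2)]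
        by (intro borel_measurable_add borel_measurable_times) auto
      show "AE x in cell. D $ i $ i * (\<eta>'' x * G i x) + \<eta> x * qa i x = D $ i $ i * (\<eta>'' x * uad x $ i) + \<eta> x * q i x"
        using AEa by eventually_elim (simp add: a_def qa_def q_def)
    qed
    thus "(\<integral>x. D $ i $ i * (\<eta>'' x * G i x) + \<eta> x * qa i x \<partial>cell) = 0" using weak[OF \<eta>] by simp
  qed
  then obtain G' where G': "\<And>i x. (G i has_vector_derivative G' i x) (at x)"
    "\<And>i x. (G' i has_vector_derivative - qa i x / D $ i $ i) (at x)" by metis
  have step: "C_curve (Suc (Suc j)) (G i)" if "\<And>i. C_curve j (G i)" "enat (Suc j) \<le> r" for i j
  proof (rule C_curve_SucI[OF G'(1)], rule C_curve_SucI[OF G'(2)])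
    have "C_curve j (\<lambda>x. (- 1 / D $ i $ i) *\<^sub>R qa i x)" unfolding qa_def
      by (intro C_curve_scaleR C_curve_const C_curve_sum C_curve_mult A that)
    thus "C_curve j (\<lambda>x. - qa i x / D $ i $ i)" by simp
  qed
  \<comment> \<open>Each round gains two derivatives, of which the next round uses one. It ends with
    the coefficients, which are of class \<open>C^j\<close> only for
    \<open>j + 1 \<le> r\<close>.\<close>
  have reg: "C_curve (Suc (Suc j)) (G i)" if "enat (Suc j) \<le> r" for i j
    using that
  proof (induction j arbitrary: i)
    case 0
    show ?case by (rule step) (use 0 G(1) in auto)
  next
    case (Suc j)
    have "enat (Suc j) \<le> r" using Suc.prems by (rule order_trans[rotated]) simp
    hence "C_curve (Suc j) (G i)" for i by (intro C_curve_mono[OF Suc.IH]) auto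
    thus ?case using step Suc.prems by blast
  qed
  have "C_curve (Suc k) a" if "enat k \<le> r" for k
  proof (rule C_curve_vec)
    fix i
    have "C_curve (Suc k) (G i)"
    proof (cases k)
      case 0
      show ?thesis using C_curve_mono[OF reg[OF \<open>enat (Suc 0) \<le> r\<close>], of "Suc k"] 0 by simp
    next
      case (Suc j)
      thus ?thesis using reg[of j i] that by simp
    qed
    thus "C_curve (Suc k) (\<lambda>x. a x $ i)" by (simp add: a_def)
  qed
  moreover have "a (x + 2 * pi) = a x" for x by (simp add: a_def G(2))
  ultimately show ?thesis using AEa by blast
qed

text \<open>The diagonal entries are positive, so the equation can be solved for the second
  derivative, which is then as smooth as \<open>f\<close> composed with \<open>ustar\<close>. One
  pass suffices, since \<open>ustar\<close> is of class \<open>C^r\<close> by hypothesis.\<close>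

lemma periodic_solution_regular:
  fixes D :: "real^'n^'n" and f :: "real^'n \<Rightarrow> real^'n" and ustar :: "real \<Rightarrow> real^'n"
  assumes r: "2 \<le> r"
    and D_diag: "\<And>i j. i \<noteq> j \<Longrightarrow> D $ i $ j = 0" and D_pos: "\<And>i. D $ i $ i > 0"
    and f: "C_class_on r UNIV UNIV f" and ustar: "C_class_on r UNIV UNIV ustar"
    and sol: "\<And>x. D *v vector_derivative (\<lambda>y. vector_derivative ustar (at y)) (at x) + f (ustar x) = 0"
    and k: "enat k \<le> r"
  shows "C_curve (Suc (Suc k)) ustar"
proof -
  have r1: "1 \<le> r" using r by (metis one_le_numeral order_trans)
  have us: "C_curve k ustar" if "enat k \<le> r" for k by (rule C_curve_of_C_class[OF ustar r1 that])
  obtain f' where f': "\<And>k u. enat k \<le> r \<Longrightarrow> C_curve k u \<Longrightarrow> C_curve k (\<lambda>x. f (u x))"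
    using C_class_on_compose_curve[OF f r1] by metis
  have "enat (Suc (Suc 0)) \<le> r" using r by (simp add: numeral_2_eq_2 numeral_eq_enat)
  note u2 = us[OF this]
  let ?u' = "\<lambda>x. vector_derivative ustar (at x)" and ?u'' = "\<lambda>x. vector_derivative (\<lambda>y. vector_derivative ustar (at y)) (at x)"
  note d = C_curve_SucD(1)[OF u2] C_curve_SucD(1)[OF C_curve_SucD(2)[OF u2]]
  have eq: "?u'' x $ i = (- 1 / D $ i $ i) *\<^sub>R (f (ustar x) $ i)" for x i
  proof -
    have "(D *v ?u'' x) $ i = (\<Sum>j\<in>UNIV. if j = i then D $ i $ i * ?u'' x $ i else 0)"
      unfolding matrix_vector_mult_def vec_lambda_beta by (rule sum.cong) (auto simp: D_diag)
    hence "D $ i $ i * ?u'' x $ i + f (ustar x) $ i = 0" using arg_cong[OF sol[of x], of "\<lambda>v. v $ i"] by simp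
    thus ?thesis using D_pos[of i] by (simp add: field_simps)
  qed
  have "C_curve k (\<lambda>x. ?u'' x $ i)" for i
    unfolding eq by (intro C_curve_scaleR C_curve_const C_curve_vec_nth f' k us)
  hence "C_curve k ?u''" by (rule C_curve_vec)
  thus ?thesis using C_curve_SucI[OF d(1) C_curve_SucI[OF d(2)]] by blast
qed

section \<open>The sequence spaces\<close>

lemma rep_xch_funs: "rep_xch w \<in> xch_funs"
  using Quotient3_rep_reflp[OF Quotient3_xch] by (auto simp: xch_rel_def)

lemma abs_rep_xch [simp]: "abs_xch (rep_xch w) = w"
  by (rule Quotient3_abs_rep[OF Quotient3_xch])

lemma xch_rel_refl: "w \<in> xch_funs \<Longrightarrow> xch_rel w w"
  by (simp add: xch_rel_def)

lemma rep_abs_xch: "w \<in> xch_funs \<Longrightarrow> AE x in cell. rep_xch (abs_xch w) j x = w j x"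
  using rep_abs_rsp_left[OF Quotient3_xch xch_rel_refl] by (auto simp: xch_rel_def)

lemma abs_xch_eqI:
  "v \<in> xch_funs \<Longrightarrow> w \<in> xch_funs \<Longrightarrow> (\<And>j. AE x in cell. v j x = w j x) \<Longrightarrow> abs_xch v = abs_xch w"
  using Quotient3_rel_abs[OF Quotient3_xch, of v w] by (auto simp: xch_rel_def)

lemma xch_eqI: "(\<And>j. AE x in cell. rep_xch v j x = rep_xch w j x) \<Longrightarrow> v = w"
  using abs_xch_eqI[OF rep_xch_funs rep_xch_funs, of v w] by simp

lemma rep_xch_measurable [measurable]: "rep_xch w j \<in> borel_measurable cell"
  using rep_xch_funs[of w] by (auto simp: xch_funs_def)

lemma abs_xch_ops:
  assumes "v \<in> xch_funs" "w \<in> xch_funs"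
  shows "abs_xch v + abs_xch w = abs_xch (\<lambda>j x. v j x + w j x)"
    and "abs_xch v - abs_xch w = abs_xch (\<lambda>j x. v j x - w j x)"
  using assms by (auto intro!: plus_xch.abs_eq minus_xch.abs_eq xch_rel_refl)

lemma abs_xch_scaleR: "v \<in> xch_funs \<Longrightarrow> c *\<^sub>R abs_xch v = abs_xch (\<lambda>j x. c *\<^sub>R v j x)"
  by (auto intro!: scaleR_xch.abs_eq xch_rel_refl)

lemma rep_xch_plus: "AE x in cell. rep_xch (v + w) j x = rep_xch v j x + rep_xch w j x"
  using rep_abs_xch[OF xch_funs_add[OF rep_xch_funs rep_xch_funs], of v w j]
    abs_xch_ops(1)[OF rep_xch_funs rep_xch_funs, of v w] by simp

lemma rep_xch_minus: "AE x in cell. rep_xch (v - w) j x = rep_xch v j x - rep_xch w j x"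
  using rep_abs_xch[OF xch_funs_diff[OF rep_xch_funs rep_xch_funs], of v w j]
    abs_xch_ops(2)[OF rep_xch_funs rep_xch_funs, of v w] by simp

lemma rep_xch_scaleR: "AE x in cell. rep_xch (c *\<^sub>R w) j x = c *\<^sub>R rep_xch w j x"
  using rep_abs_xch[OF xch_funs_scale[OF rep_xch_funs], of c w j]
    abs_xch_scaleR[OF rep_xch_funs, of c w] by simp

lemma xch_enorm_rep: "xch_enorm (rep_xch w) = ennreal (norm w)"
  using norm_xch.abs_eq[OF xch_rel_refl[OF rep_xch_funs[of w]]] rep_xch_funs[of w]
  by (simp add: xch_funs_def ennreal_enn2real_if less_top)

lemma rep_xch_bounded: "AE x in cell. norm (rep_xch w j x) \<le> norm w"
proof -
  have "esssup cell (\<lambda>x. ennreal (norm (rep_xch w j x))) \<le> ennreal (norm w)"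
  proof -
    have "esssup cell (\<lambda>x. ennreal (norm (rep_xch w j x))) \<le> (SUP j. esssup cell (\<lambda>x. ennreal (norm (rep_xch w j x))))"
      by (rule SUP_upper) simp
    also have "\<dots> \<le> xch_enorm (rep_xch w)" unfolding xch_enorm_def by (rule add_increasing) auto
    finally show ?thesis by (simp add: xch_enorm_rep)
  qed
  moreover have "AE x in cell. ennreal (norm (rep_xch w j x)) \<le> esssup cell (\<lambda>x. ennreal (norm (rep_xch w j x)))"
    by (rule esssup_AE)
  ultimately have "AE x in cell. ennreal (norm (rep_xch w j x)) \<le> ennreal (norm w)"
    by (auto elim!: eventually_mono simp del: ennreal_le_iff intro: order_trans)
  thus ?thesis by simp
qed

lemma rep_xch_integrable: "integrable cell (rep_xch w j)"
  by (rule finite_measure.integrable_const_bound[OF finite_measure_cell rep_xch_bounded rep_xch_measurable])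

text \<open>The summable majorant of the \<open>l1\<close> estimates: bounds in a single cell are
  stated against it and summed with \<open>infsum_cell_norm1\<close>.\<close>

definition cell_norm1 :: "'a::euclidean_space xch \<Rightarrow> int \<Rightarrow> real" where
  "cell_norm1 w j = (\<integral>x. norm (rep_xch w j x) \<partial>cell)"

lemma cell_norm1_nonneg: "0 \<le> cell_norm1 w j"
  by (simp add: cell_norm1_def)

lemma cell_norm1_finite_sum:
  assumes "finite F"
  shows "sum (cell_norm1 w) F \<le> norm w"
proof -
  have nn: "(\<integral>\<^sup>+x. ennreal (norm (rep_xch w j x)) \<partial>cell) = ennreal (cell_norm1 w j)" for j
    unfolding cell_norm1_def by (rule nn_integral_eq_integral) (auto intro: rep_xch_integrable)
  have "ennreal (sum (cell_norm1 w) F) = (\<Sum>j\<in>F. ennreal (cell_norm1 w j))"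
    by (rule sum_ennreal[symmetric]) (rule cell_norm1_nonneg)
  also have "\<dots> = (\<integral>\<^sup>+j. ennreal (cell_norm1 w j) * indicator F j \<partial>count_space UNIV)"
    by (subst nn_integral_count_space'[OF assms]) (auto simp: indicator_def)
  also have "\<dots> \<le> (\<integral>\<^sup>+j. ennreal (cell_norm1 w j) \<partial>count_space UNIV)"
    by (rule nn_integral_mono) (auto simp: indicator_def)
  also have "\<dots> \<le> xch_enorm (rep_xch w)" unfolding xch_enorm_def nn by (rule add_increasing2) auto
  finally show ?thesis by (simp add: xch_enorm_rep)
qed

lemma cell_norm1_summable: "cell_norm1 w summable_on UNIV"
  by (rule nonneg_bdd_above_summable_on) (auto intro!: cell_norm1_nonneg bdd_aboveI2 cell_norm1_finite_sum)

lemma infsum_cell_norm1: "infsum (cell_norm1 w) UNIV \<le> norm w"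
  by (rule infsum_le_finite_sums[OF cell_norm1_summable]) (rule cell_norm1_finite_sum)

lemma cell_norm1_le: "cell_norm1 w j \<le> norm w"
  using cell_norm1_finite_sum[of "{j}" w] by simp

text \<open>Bridge between the norm of \<open>xch\<close>, defined through counting measure, and
  unconditional sums; the integers are enumerated by \<open>int_decode\<close>.\<close>

lemma nn_integral_le_infsum:
  fixes a :: "int \<Rightarrow> real"
  assumes "\<And>j. 0 \<le> a j" "a summable_on UNIV"
  shows "(\<integral>\<^sup>+j. ennreal (a j) \<partial>count_space UNIV) \<le> ennreal (infsum a UNIV)"
proof -
  have "(\<integral>\<^sup>+j. ennreal (a j) \<partial>count_space UNIV) = (\<integral>\<^sup>+i. ennreal (a (int_decode i)) \<partial>count_space UNIV)"
    by (rule nn_integral_bij_count_space[symmetric]) (rule bij_int_decode)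
  also have "\<dots> = (\<Sum>i. ennreal (a (int_decode i)))" by (rule nn_integral_count_space_nat)
  also have "\<dots> \<le> ennreal (infsum a UNIV)"
  proof (rule suminf_le_const)
    fix n
    have "(\<Sum>i<n. ennreal (a (int_decode i))) = ennreal (\<Sum>i<n. a (int_decode i))"
      by (rule sum_ennreal) (rule assms(1))
    also have "(\<Sum>i<n. a (int_decode i)) = sum a (int_decode ` {..<n})"
      by (subst sum.reindex) (auto intro: inj_int_decode)
    also have "\<dots> \<le> infsum a UNIV"
      by (rule finite_sum_le_infsum[OF assms(2)]) (auto simp: assms(1))
    finally show "(\<Sum>i<n. ennreal (a (int_decode i))) \<le> ennreal (infsum a UNIV)" by (simp add: ennreal_leI)
  qed auto
  finally show ?thesis .
qed

lemma xch_funsI: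
  assumes m: "\<And>j. w j \<in> borel_measurable cell"
    and a: "\<And>j. (\<integral>x. norm (w j x) \<partial>cell) \<le> a j" "a summable_on UNIV"
    and B: "0 \<le> B" "\<And>j. AE x in cell. norm (w j x) \<le> B"
  shows "w \<in> xch_funs" "norm (abs_xch w) \<le> infsum a UNIV + B"
proof -
  have i: "integrable cell (w j)" for j
    by (rule finite_measure.integrable_const_bound[OF finite_measure_cell B(2) m])
  have a0: "0 \<le> a j" for j by (rule order_trans[OF _ a(1)]) simp
  have "(\<integral>\<^sup>+x. ennreal (norm (w j x)) \<partial>cell) \<le> ennreal (a j)" for j
    using nn_integral_eq_integral[OF integrable_norm[OF i], of j] a(1)[of j] by (simp add: ennreal_leI)
  hence "(\<integral>\<^sup>+j. (\<integral>\<^sup>+x. ennreal (norm (w j x)) \<partial>cell) \<partial>count_space UNIV) \<le> ennreal (infsum a UNIV)"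
    by (intro order_trans[OF nn_integral_mono nn_integral_le_infsum[OF a0 a(2)]]) auto
  moreover have "(SUP j. esssup cell (\<lambda>x. ennreal (norm (w j x)))) \<le> ennreal B"
  proof (rule SUP_least)
    fix j show "esssup cell (\<lambda>x. ennreal (norm (w j x))) \<le> ennreal B"
    proof (rule esssup_I)
      show "AE x in cell. ennreal (norm (w j x)) \<le> ennreal B"
        using B(2)[of j] by eventually_elim (rule ennreal_leI)
    qed (use m in auto)
  qed
  ultimately have le: "xch_enorm w \<le> ennreal (infsum a UNIV + B)"
    unfolding xch_enorm_def using B(1) infsum_nonneg[of UNIV a] a0 by (simp add: add_mono)
  thus *: "w \<in> xch_funs" using m by (auto simp: xch_funs_def intro: le_less_trans)
  have "norm (abs_xch w) = enn2real (xch_enorm w)" by (rule norm_xch.abs_eq[OF xch_rel_refl[OF *]])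
  also have "\<dots> \<le> infsum a UNIV + B"
    using le B(1) infsum_nonneg[of UNIV a] a0 by (intro enn2real_leI) auto
  finally show "norm (abs_xch w) \<le> infsum a UNIV + B" .
qed

text \<open>In the constant, \<open>2 * pi\<close> is the length of the cell and accounts for the L1
  part; the 1 accounts for the supremum, since each \<open>a j\<close> is at most the sum.\<close>

lemma xch_funsI_pointwise:
  fixes w :: "int \<Rightarrow> real \<Rightarrow> 'a::euclidean_space"
  assumes m: "\<And>j. w j \<in> borel_measurable cell"
    and a: "\<And>j x. x \<in> {-pi<..<pi} \<Longrightarrow> norm (w j x) \<le> a j" "a summable_on UNIV"
  shows "w \<in> xch_funs" "norm (abs_xch w) \<le> (2 * pi + 1) * infsum a UNIV"
proof -
  have a0: "0 \<le> a j" for j using order_trans[OF norm_ge_zero a(1)[of 0 j]] by simp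
  have ai: "a j \<le> infsum a UNIV" for j
    using finite_sum_le_infsum[OF a(2), of "{j}"] a0 by simp
  have i: "integrable cell (w j)" for j by (rule integrable_cell_bounded[OF m a(1)])
  have 1: "(\<integral>x. norm (w j x) \<partial>cell) \<le> 2 * pi * a j" for j
  proof -
    have "(\<integral>x. norm (w j x) \<partial>cell) \<le> (\<integral>x. a j \<partial>cell)"
      by (rule integral_mono) (use i a(1) in auto)
    thus ?thesis by (simp only: cell_integral_const)
  qed
  have 2: "AE x in cell. norm (w j x) \<le> infsum a UNIV" for j
    by (rule AE_I2) (use a(1) ai order_trans in fastforce)
  have s: "(\<lambda>j. 2 * pi * a j) summable_on UNIV" by (rule summable_on_cmult_right[OF a(2)])
  have 0: "0 \<le> infsum a UNIV" by (rule infsum_nonneg) (rule a0)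
  note F = xch_funsI[OF m 1 s 0 2]
  show "w \<in> xch_funs" by (rule F(1))
  show "norm (abs_xch w) \<le> (2 * pi + 1) * infsum a UNIV"
    using F(2) by (simp add: infsum_cmult_right a(2) distrib_right)
qed

lemma l1_summable: "(\<lambda>j. \<bar>l1_seq \<theta> j\<bar>) summable_on UNIV"
  using l1_seq[of \<theta>] by simp

lemma l1_eqI: "(\<And>j. l1_seq a j = l1_seq b j) \<Longrightarrow> a = b"
  by (metis ext l1_seq_inject)

lemma l1_le_norm: "\<bar>l1_seq \<theta> j\<bar> \<le> norm \<theta>"
  using finite_sum_le_infsum[OF l1_summable, of "{j}" \<theta>] by (simp add: norm_l1.rep_eq)

lemma Abs_l1I:
  assumes "\<And>j. \<bar>f j\<bar> \<le> a j" "a summable_on UNIV"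
  shows "l1_seq (Abs_l1 f) = f" "norm (Abs_l1 f) \<le> infsum a UNIV"
proof -
  have s: "(\<lambda>j. \<bar>f j\<bar>) summable_on UNIV"
    by (rule summable_on_comparison_test[OF assms(2)]) (use assms(1) in auto)
  thus *: "l1_seq (Abs_l1 f) = f" by (intro Abs_l1_inverse) simp
  show "norm (Abs_l1 f) \<le> infsum a UNIV"
    unfolding norm_l1.rep_eq * by (rule infsum_mono[OF s assms(2)]) (rule assms(1))
qed

section \<open>Cellwise linear and bilinear operations\<close>

lemma bounded_bilinear_xchI:
  fixes M :: "'p::real_normed_vector \<Rightarrow> 'q::real_normed_vector \<Rightarrow> int \<Rightarrow> real \<Rightarrow> 'a::euclidean_space"
  assumes F: "\<And>p q. M p q \<in> xch_funs"
    and 1: "\<And>p p' q j. AE x in cell. M (p + p') q j x = M p q j x + M p' q j x"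
    and 2: "\<And>p q q' j. AE x in cell. M p (q + q') j x = M p q j x + M p q' j x"
    and 3: "\<And>c p q j. AE x in cell. M (c *\<^sub>R p) q j x = c *\<^sub>R M p q j x"
    and 4: "\<And>c p q j. AE x in cell. M p (c *\<^sub>R q) j x = c *\<^sub>R M p q j x"
    and K: "\<And>p q. norm (abs_xch (M p q)) \<le> norm p * norm q * K"
  shows "bounded_bilinear (\<lambda>p q. abs_xch (M p q))"
  by unfold_locales
     (use assms in \<open>auto simp: abs_xch_ops abs_xch_scaleR intro!: abs_xch_eqI xch_funs_add xch_funs_scale\<close>)

lemma bounded_linear_xchI:
  fixes M :: "'p::real_normed_vector \<Rightarrow> int \<Rightarrow> real \<Rightarrow> 'a::euclidean_space"
  assumes F: "\<And>p. M p \<in> xch_funs"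
    and 1: "\<And>p p' j. AE x in cell. M (p + p') j x = M p j x + M p' j x"
    and 3: "\<And>c p j. AE x in cell. M (c *\<^sub>R p) j x = c *\<^sub>R M p j x"
    and K: "\<And>p. norm (abs_xch (M p)) \<le> norm p * K"
  shows "bounded_linear (\<lambda>p. abs_xch (M p))"
  by (rule bounded_linear_intro[where K = K])
     (use assms in \<open>auto simp: abs_xch_ops abs_xch_scaleR intro!: abs_xch_eqI xch_funs_add xch_funs_scale\<close>)

definition mul_xch :: "l1 \<Rightarrow> 'a::euclidean_space xch \<Rightarrow> 'a xch" where
  "mul_xch a w = abs_xch (\<lambda>j x. l1_seq a j *\<^sub>R rep_xch w j x)"

text \<open>An \<open>l1\<close> sequence is bounded by its norm. The factor 2 arises because the L1
  part and the supremum part are each bounded by \<open>norm a * norm w\<close>.\<close>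

lemma mul_xch_funs:
  "(\<lambda>j x. l1_seq a j *\<^sub>R rep_xch w j x) \<in> xch_funs" (is ?A)
  "norm (mul_xch a w) \<le> norm a * norm w * 2" (is ?B)
proof -
  have 1: "(\<integral>x. norm (l1_seq a j *\<^sub>R rep_xch w j x) \<partial>cell) \<le> norm a * cell_norm1 w j" for j
    using l1_le_norm[of a j] by (simp add: cell_norm1_def mult_right_mono)
  have 2: "AE x in cell. norm (l1_seq a j *\<^sub>R rep_xch w j x) \<le> norm a * norm w" for j
    using rep_xch_bounded[of w j] by eventually_elim (use l1_le_norm[of a j] in \<open>auto intro!: mult_mono\<close>)
  note F = xch_funsI[OF _ 1 summable_on_cmult_right[OF cell_norm1_summable] _ 2]
  show ?A by (rule F(1)) auto
  have "norm (mul_xch a w) \<le> infsum (\<lambda>j. norm a * cell_norm1 w j) UNIV + norm a * norm w"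
    unfolding mul_xch_def by (rule F(2)) auto
  also have "infsum (\<lambda>j. norm a * cell_norm1 w j) UNIV \<le> norm a * norm w"
    using infsum_cell_norm1[of w] by (simp add: infsum_cmult_right cell_norm1_summable mult_left_mono)
  finally show ?B by simp
qed

lemma rep_mul_xch: "AE x in cell. rep_xch (mul_xch a w) j x = l1_seq a j *\<^sub>R rep_xch w j x"
  unfolding mul_xch_def by (rule rep_abs_xch[OF mul_xch_funs(1)])

lemma bounded_bilinear_mul_xch: "bounded_bilinear mul_xch"
  unfolding mul_xch_def
proof (rule bounded_bilinear_xchI[where K = 2, OF mul_xch_funs(1)])
  show "AE x in cell. l1_seq p j *\<^sub>R rep_xch (q + q') j x = l1_seq p j *\<^sub>R rep_xch q j x + l1_seq p j *\<^sub>R rep_xch q' j x" for p j and q q' :: "'a xch"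
    using rep_xch_plus[of q q' j] by eventually_elim (simp add: scaleR_add_right)
  show "AE x in cell. l1_seq p j *\<^sub>R rep_xch (c *\<^sub>R q) j x = c *\<^sub>R l1_seq p j *\<^sub>R rep_xch q j x" for p j c and q :: "'a xch"
    using rep_xch_scaleR[of c q j] by eventually_elim simp
  show "norm (abs_xch (\<lambda>j x. l1_seq p j *\<^sub>R rep_xch q j x)) \<le> norm p * norm q * 2" for p and q :: "'a xch"
    using mul_xch_funs(2)[of p q] by (simp add: mul_xch_def)
qed (auto simp: plus_l1.rep_eq scaleR_l1.rep_eq scaleR_add_left)

definition mul_fun_xch :: "(real \<Rightarrow> real) \<Rightarrow> 'a::euclidean_space xch \<Rightarrow> 'a xch" where
  "mul_fun_xch f w = abs_xch (\<lambda>j x. f x *\<^sub>R rep_xch w j x)"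

lemma mul_fun_xch_funs:
  assumes f: "f \<in> borel_measurable cell" "\<And>x. x \<in> {-pi<..<pi} \<Longrightarrow> \<bar>f x\<bar> \<le> C"
  shows "(\<lambda>j x. f x *\<^sub>R rep_xch w j x) \<in> xch_funs" (is ?A)
    and "norm (mul_fun_xch f w) \<le> norm w * (2 * C)" (is ?B)
proof -
  note [measurable] = f(1)
  have C: "0 \<le> C" using order_trans[OF abs_ge_zero f(2)[of 0]] by simp
  have 0: "AE x in cell. \<bar>f x\<bar> \<le> C" by (rule AE_I2) (use f(2) in auto)
  have 2: "AE x in cell. norm (f x *\<^sub>R rep_xch w j x) \<le> C * norm w" for j
    using rep_xch_bounded[of w j] 0 by eventually_elim (use C in \<open>auto intro!: mult_mono\<close>)
  have i: "integrable cell (\<lambda>x. f x *\<^sub>R rep_xch w j x)" for j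
    by (rule finite_measure.integrable_const_bound[OF finite_measure_cell 2]) measurable
  have 1: "(\<integral>x. norm (f x *\<^sub>R rep_xch w j x) \<partial>cell) \<le> C * cell_norm1 w j" for j
  proof -
    have "(\<integral>x. norm (f x *\<^sub>R rep_xch w j x) \<partial>cell) \<le> (\<integral>x. C * norm (rep_xch w j x) \<partial>cell)"
      by (rule integral_mono[OF integrable_norm[OF i]])
         (use f(2) rep_xch_integrable[of w j] in \<open>auto intro!: mult_right_mono\<close>)
    thus ?thesis by (simp add: cell_norm1_def)
  qed
  note F = xch_funsI[OF _ 1 summable_on_cmult_right[OF cell_norm1_summable] _ 2]
  show ?A by (rule F(1)) (use C in auto)
  have "norm (mul_fun_xch f w) \<le> infsum (\<lambda>j. C * cell_norm1 w j) UNIV + C * norm w"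
    unfolding mul_fun_xch_def by (rule F(2)) (use C in auto)
  also have "infsum (\<lambda>j. C * cell_norm1 w j) UNIV \<le> C * norm w"
    using infsum_cell_norm1[of w] C by (simp add: infsum_cmult_right cell_norm1_summable mult_left_mono)
  finally show ?B by (simp add: mult.commute mult.left_commute)
qed

lemma rep_mul_fun_xch:
  assumes f: "f \<in> borel_measurable cell" "\<And>x. x \<in> {-pi<..<pi} \<Longrightarrow> \<bar>f x\<bar> \<le> C"
  shows "AE x in cell. rep_xch (mul_fun_xch f w) j x = f x *\<^sub>R rep_xch w j x"
  unfolding mul_fun_xch_def by (rule rep_abs_xch[OF mul_fun_xch_funs(1)[OF assms]])

lemma bounded_linear_mul_fun_xch:
  assumes f: "f \<in> borel_measurable cell" "\<And>x. x \<in> {-pi<..<pi} \<Longrightarrow> \<bar>f x\<bar> \<le> C"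
  shows "bounded_linear (mul_fun_xch f :: 'a::euclidean_space xch \<Rightarrow> 'a xch)"
  unfolding mul_fun_xch_def
proof (rule bounded_linear_xchI[where K = "2 * C", OF mul_fun_xch_funs(1)[OF assms]])
  show "AE x in cell. f x *\<^sub>R rep_xch (q + q') j x = f x *\<^sub>R rep_xch q j x + f x *\<^sub>R rep_xch q' j x" for j and q q' :: "'a xch"
    using rep_xch_plus[of q q' j] by eventually_elim (simp add: scaleR_add_right)
  show "AE x in cell. f x *\<^sub>R rep_xch (c *\<^sub>R q) j x = c *\<^sub>R f x *\<^sub>R rep_xch q j x" for j c and q :: "'a xch"
    using rep_xch_scaleR[of c q j] by eventually_elim simp
  show "norm (abs_xch (\<lambda>j x. f x *\<^sub>R rep_xch q j x)) \<le> norm q * (2 * C)" for q :: "'a xch"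
    using mul_fun_xch_funs(2)[OF assms, where w = q] by (simp add: mul_fun_xch_def)
qed auto

text \<open>A nonzero profile repeated in every cell is not summable and has no place in
  \<open>xch\<close>. Products and pairings with a fixed function are therefore linear operations of
  their own: this one, \<open>mul_fun_xch\<close> and \<open>pair_fun_xch\<close>.\<close>

definition tensor_xch :: "(real \<Rightarrow> 'a::euclidean_space) \<Rightarrow> l1 \<Rightarrow> 'a xch" where
  "tensor_xch g a = abs_xch (\<lambda>j x. l1_seq a j *\<^sub>R g x)"

lemma tensor_xch_funs:
  fixes g :: "real \<Rightarrow> 'a::euclidean_space"
  assumes g: "continuous_on UNIV g" "\<And>x. x \<in> {-pi..pi} \<Longrightarrow> norm (g x) \<le> C"
  shows "(\<lambda>j x. l1_seq a j *\<^sub>R g x) \<in> xch_funs" (is ?A)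
    and "norm (tensor_xch g a) \<le> norm a * ((2 * pi + 1) * C)" (is ?B)
proof -
  have 1: "norm (l1_seq a j *\<^sub>R g x) \<le> C * \<bar>l1_seq a j\<bar>" if "x \<in> {-pi<..<pi}" for j x
    using g(2)[of x] that by (auto simp: mult.commute intro!: mult_right_mono)
  have m: "(\<lambda>x. l1_seq a j *\<^sub>R g x) \<in> borel_measurable cell" for j
    using cell_measurable_continuous[OF g(1)] by auto
  note F = xch_funsI_pointwise[OF m 1 summable_on_cmult_right[OF l1_summable]]
  show ?A by (rule F(1))
  show ?B using F(2) by (simp add: tensor_xch_def infsum_cmult_right l1_summable norm_l1.rep_eq ac_simps)
qed

lemma rep_tensor_xch:
  fixes g :: "real \<Rightarrow> 'a::euclidean_space"
  assumes "continuous_on UNIV g"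
  shows "AE x in cell. rep_xch (tensor_xch g a) j x = l1_seq a j *\<^sub>R g x"
proof -
  obtain C where "\<And>x. x \<in> {-pi..pi} \<Longrightarrow> norm (g x) \<le> C" using continuous_bounded_on_cell[OF assms] by blast
  from tensor_xch_funs(1)[OF assms this] show ?thesis unfolding tensor_xch_def by (rule rep_abs_xch)
qed

lemma bounded_linear_tensor_xch:
  fixes g :: "real \<Rightarrow> 'a::euclidean_space"
  assumes "continuous_on UNIV g"
  shows "bounded_linear (tensor_xch g)"
proof -
  obtain C where C: "\<And>x. x \<in> {-pi..pi} \<Longrightarrow> norm (g x) \<le> C" using continuous_bounded_on_cell[OF assms] by blast
  show ?thesis unfolding tensor_xch_def
    by (rule bounded_linear_xchI[where K = "(2 * pi + 1) * C", OF tensor_xch_funs(1)[OF assms C]])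
       (use tensor_xch_funs(2)[OF assms C] in \<open>auto simp: plus_l1.rep_eq scaleR_l1.rep_eq scaleR_add_left tensor_xch_def\<close>)
qed

definition pair_xch :: "'a::euclidean_space xch \<Rightarrow> 'a xch \<Rightarrow> l1" where
  "pair_xch v w = Abs_l1 (\<lambda>j. cell_ip (rep_xch v j) (rep_xch w j))"

definition pair_fun_xch :: "(real \<Rightarrow> 'a::euclidean_space) \<Rightarrow> 'a xch \<Rightarrow> l1" where
  "pair_fun_xch g w = Abs_l1 (\<lambda>j. cell_ip (rep_xch w j) g)"

lemma cell_ip_bound:
  fixes g :: "real \<Rightarrow> 'a::euclidean_space"
  assumes g: "g \<in> borel_measurable cell" "AE x in cell. norm (g x) \<le> C" and v: "integrable cell v"
  shows "integrable cell (\<lambda>x. v x \<bullet> g x)" "\<bar>cell_ip v g\<bar> \<le> C * (\<integral>x. norm (v x) \<partial>cell)"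
proof -
  have b: "AE x in cell. norm (v x \<bullet> g x) \<le> norm (C * norm (v x))"
    using g(2)
  proof eventually_elim
    case (elim x)
    have "norm (v x \<bullet> g x) \<le> norm (v x) * norm (g x)" by (simp add: Cauchy_Schwarz_ineq2)
    also have "\<dots> \<le> norm (v x) * C" using elim by (intro mult_left_mono) auto
    also have "\<dots> \<le> norm (C * norm (v x))" by (simp add: mult.commute)
    finally show ?case .
  qed
  have i: "integrable cell (\<lambda>x. C * norm (v x))" using v by auto
  show vi: "integrable cell (\<lambda>x. v x \<bullet> g x)"
    by (rule Bochner_Integration.integrable_bound[OF i _ b]) (use g v in auto)
  have "\<bar>cell_ip v g\<bar> \<le> (\<integral>x. \<bar>v x \<bullet> g x\<bar> \<partial>cell)" unfolding cell_ip_def by (rule integral_abs_bound)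
  also have "\<dots> \<le> (\<integral>x. C * norm (v x) \<partial>cell)"
  proof (rule integral_mono_AE)
    show "AE x in cell. \<bar>v x \<bullet> g x\<bar> \<le> C * norm (v x)"
      using g(2)
    proof eventually_elim
      case (elim x)
      have "\<bar>v x \<bullet> g x\<bar> \<le> norm (v x) * norm (g x)" by (rule Cauchy_Schwarz_ineq2)
      also have "\<dots> \<le> norm (v x) * C" using elim by (intro mult_left_mono) auto
      finally show ?case by (simp add: mult.commute)
    qed
  qed (use vi i in auto)
  finally show "\<bar>cell_ip v g\<bar> \<le> C * (\<integral>x. norm (v x) \<partial>cell)" by simp
qed

lemma cell_ip_cong_AE:
  assumes "AE x in cell. u x = u' x" "AE x in cell. v x = v' x"
    and [measurable]: "u \<in> borel_measurable cell" "u' \<in> borel_measurable cell" "v \<in> borel_measurable cell" "v' \<in> borel_measurable cell"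
  shows "cell_ip u v = cell_ip u' v'"
  unfolding cell_ip_def
proof (rule integral_cong_AE)
  show "AE x in cell. u x \<bullet> v x = u' x \<bullet> v' x" using assms(1,2) by eventually_elim simp
qed measurable

lemma cell_ip_xch:
  "integrable cell (\<lambda>x. rep_xch v j x \<bullet> rep_xch w j x)"
  "\<bar>cell_ip (rep_xch v j) (rep_xch w j)\<bar> \<le> norm w * cell_norm1 v j"
  using cell_ip_bound[OF rep_xch_measurable rep_xch_bounded rep_xch_integrable] by (auto simp: cell_norm1_def)

lemma l1_seq_pair_xch: "l1_seq (pair_xch v w) j = cell_ip (rep_xch v j) (rep_xch w j)"
  and norm_pair_xch: "norm (pair_xch v w) \<le> norm v * norm w * 1"
proof -
  note F = Abs_l1I[OF cell_ip_xch(2) summable_on_cmult_right[OF cell_norm1_summable]]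
  show "l1_seq (pair_xch v w) j = cell_ip (rep_xch v j) (rep_xch w j)" by (simp add: pair_xch_def F(1))
  have "norm (pair_xch v w) \<le> norm w * infsum (cell_norm1 v) UNIV"
    using F(2)[of v w] by (simp add: pair_xch_def infsum_cmult_right cell_norm1_summable)
  also have "\<dots> \<le> norm w * norm v" by (intro mult_left_mono infsum_cell_norm1) auto
  finally show "norm (pair_xch v w) \<le> norm v * norm w * 1" by (simp add: mult.commute)
qed

lemma bounded_bilinear_pair_xch: "bounded_bilinear (pair_xch :: 'a::euclidean_space xch \<Rightarrow> _)"
proof
  fix u v w :: "'a xch" and c :: real
  have i: "integrable cell (\<lambda>x. rep_xch v j x \<bullet> rep_xch w j x)" for j and v w :: "'a xch" by (rule cell_ip_xch(1))
  show "pair_xch (u + v) w = pair_xch u w + pair_xch v w"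
  proof (rule l1_eqI)
    fix j
    have "cell_ip (rep_xch (u + v) j) (rep_xch w j) = cell_ip (\<lambda>x. rep_xch u j x + rep_xch v j x) (rep_xch w j)"
      by (rule cell_ip_cong_AE[OF rep_xch_plus]) auto
    also have "\<dots> = cell_ip (rep_xch u j) (rep_xch w j) + cell_ip (rep_xch v j) (rep_xch w j)"
      by (simp add: cell_ip_def inner_add_left i)
    finally show "l1_seq (pair_xch (u + v) w) j = l1_seq (pair_xch u w + pair_xch v w) j"
      by (simp add: l1_seq_pair_xch plus_l1.rep_eq)
  qed
  show "pair_xch w (u + v) = pair_xch w u + pair_xch w v"
  proof (rule l1_eqI)
    fix j
    have "cell_ip (rep_xch w j) (rep_xch (u + v) j) = cell_ip (rep_xch w j) (\<lambda>x. rep_xch u j x + rep_xch v j x)"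
      by (rule cell_ip_cong_AE[OF _ rep_xch_plus]) auto
    also have "\<dots> = cell_ip (rep_xch w j) (rep_xch u j) + cell_ip (rep_xch w j) (rep_xch v j)"
      by (simp add: cell_ip_def inner_add_right i)
    finally show "l1_seq (pair_xch w (u + v)) j = l1_seq (pair_xch w u + pair_xch w v) j"
      by (simp add: l1_seq_pair_xch plus_l1.rep_eq)
  qed
  show "pair_xch (c *\<^sub>R u) w = c *\<^sub>R pair_xch u w"
  proof (rule l1_eqI)
    fix j
    have "cell_ip (rep_xch (c *\<^sub>R u) j) (rep_xch w j) = cell_ip (\<lambda>x. c *\<^sub>R rep_xch u j x) (rep_xch w j)"
      by (rule cell_ip_cong_AE[OF rep_xch_scaleR]) auto
    thus "l1_seq (pair_xch (c *\<^sub>R u) w) j = l1_seq (c *\<^sub>R pair_xch u w) j"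
      by (simp add: l1_seq_pair_xch scaleR_l1.rep_eq cell_ip_def)
  qed
  show "pair_xch w (c *\<^sub>R u) = c *\<^sub>R pair_xch w u"
  proof (rule l1_eqI)
    fix j
    have "cell_ip (rep_xch w j) (rep_xch (c *\<^sub>R u) j) = cell_ip (rep_xch w j) (\<lambda>x. c *\<^sub>R rep_xch u j x)"
      by (rule cell_ip_cong_AE[OF _ rep_xch_scaleR]) auto
    thus "l1_seq (pair_xch w (c *\<^sub>R u)) j = l1_seq (c *\<^sub>R pair_xch w u) j"
      by (simp add: l1_seq_pair_xch scaleR_l1.rep_eq cell_ip_def)
  qed
  show "\<exists>K. \<forall>a b. norm (pair_xch a b :: l1) \<le> norm (a :: 'a xch) * norm b * K" using norm_pair_xch by blast
qed

lemma pair_fun_xch_bound: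
  fixes g :: "real \<Rightarrow> 'a::euclidean_space"
  assumes g: "continuous_on UNIV g" "\<And>x. x \<in> {-pi..pi} \<Longrightarrow> norm (g x) \<le> C"
  shows "integrable cell (\<lambda>x. rep_xch w j x \<bullet> g x)" "\<bar>cell_ip (rep_xch w j) g\<bar> \<le> C * cell_norm1 w j"
  using cell_ip_bound[OF cell_measurable_continuous[OF g(1)] _ rep_xch_integrable[of w j], of C] g(2)
  by (auto simp: cell_norm1_def AE_restrict_space_iff)

lemma l1_seq_pair_fun_xch:
  fixes g :: "real \<Rightarrow> 'a::euclidean_space"
  assumes "continuous_on UNIV g"
  shows "l1_seq (pair_fun_xch g w) j = cell_ip (rep_xch w j) g"
proof -
  obtain C where C: "\<And>x. x \<in> {-pi..pi} \<Longrightarrow> norm (g x) \<le> C" using continuous_bounded_on_cell[OF assms] by blast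
  show ?thesis
    using Abs_l1I(1)[OF pair_fun_xch_bound(2)[OF assms C] summable_on_cmult_right[OF cell_norm1_summable]]
    by (simp add: pair_fun_xch_def)
qed

lemma bounded_linear_pair_fun_xch:
  fixes g :: "real \<Rightarrow> 'a::euclidean_space"
  assumes g: "continuous_on UNIV g"
  shows "bounded_linear (pair_fun_xch g)"
proof -
  obtain C where C: "0 \<le> C" "\<And>x. x \<in> {-pi..pi} \<Longrightarrow> norm (g x) \<le> C" using continuous_bounded_on_cell[OF assms] by blast
  note B = pair_fun_xch_bound[OF g C(2)]
  have gm: "g \<in> borel_measurable cell" by (rule cell_measurable_continuous[OF g])
  show ?thesis
  proof (rule bounded_linear_intro[where K = C])
    fix u v :: "'a xch" and c :: real
    show "pair_fun_xch g (u + v) = pair_fun_xch g u + pair_fun_xch g v"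
    proof (rule l1_eqI)
      fix j
      have "cell_ip (rep_xch (u + v) j) g = cell_ip (\<lambda>x. rep_xch u j x + rep_xch v j x) g"
        by (rule cell_ip_cong_AE[OF rep_xch_plus]) (auto simp: gm)
      also have "\<dots> = cell_ip (rep_xch u j) g + cell_ip (rep_xch v j) g"
        using B(1)[of u j] B(1)[of v j] by (simp add: cell_ip_def inner_add_left)
      finally show "l1_seq (pair_fun_xch g (u + v)) j = l1_seq (pair_fun_xch g u + pair_fun_xch g v) j"
        by (simp add: l1_seq_pair_fun_xch[OF g] plus_l1.rep_eq)
    qed
    show "pair_fun_xch g (c *\<^sub>R u) = c *\<^sub>R pair_fun_xch g u"
    proof (rule l1_eqI)
      fix j
      have "cell_ip (rep_xch (c *\<^sub>R u) j) g = cell_ip (\<lambda>x. c *\<^sub>R rep_xch u j x) g"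
        by (rule cell_ip_cong_AE[OF rep_xch_scaleR]) (auto simp: gm)
      thus "l1_seq (pair_fun_xch g (c *\<^sub>R u)) j = l1_seq (c *\<^sub>R pair_fun_xch g u) j"
        by (simp add: l1_seq_pair_fun_xch[OF g] scaleR_l1.rep_eq cell_ip_def)
    qed
    have "norm (pair_fun_xch g u) \<le> C * infsum (cell_norm1 u) UNIV"
      using Abs_l1I(2)[OF B(2) summable_on_cmult_right[OF cell_norm1_summable], of u]
      by (simp add: pair_fun_xch_def infsum_cmult_right cell_norm1_summable)
    also have "\<dots> \<le> C * norm u" using C(1) by (intro mult_left_mono infsum_cell_norm1)
    finally show "norm (pair_fun_xch g u) \<le> norm u * C" by (simp add: mult.commute)
  qed
qed

definition mul_l1 :: "l1 \<Rightarrow> l1 \<Rightarrow> l1" where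
  "mul_l1 a b = Abs_l1 (\<lambda>j. l1_seq a j * l1_seq b j)"

lemma l1_seq_mul_l1: "l1_seq (mul_l1 a b) j = l1_seq a j * l1_seq b j"
  and norm_mul_l1: "norm (mul_l1 a b) \<le> norm a * norm b * 1"
proof -
  have "\<bar>l1_seq a j * l1_seq b j\<bar> \<le> norm a * \<bar>l1_seq b j\<bar>" for j
    using l1_le_norm[of a j] by (simp add: abs_mult mult_right_mono)
  note F = Abs_l1I[OF this summable_on_cmult_right[OF l1_summable]]
  show "l1_seq (mul_l1 a b) j = l1_seq a j * l1_seq b j" by (simp add: mul_l1_def F(1))
  show "norm (mul_l1 a b) \<le> norm a * norm b * 1"
    using F(2) by (simp add: mul_l1_def infsum_cmult_right l1_summable norm_l1.rep_eq)
qed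

lemma bounded_bilinear_mul_l1: "bounded_bilinear mul_l1"
  by unfold_locales
     (auto intro!: l1_eqI exI[of _ 1] norm_mul_l1[simplified]
       simp: l1_seq_mul_l1 plus_l1.rep_eq scaleR_l1.rep_eq algebra_simps)

definition shift_l1 :: "int \<Rightarrow> l1 \<Rightarrow> l1" where
  "shift_l1 k a = Abs_l1 (\<lambda>j. l1_seq a (j + k))"

lemma l1_seq_shift_l1: "l1_seq (shift_l1 k a) j = l1_seq a (j + k)"
  and norm_shift_l1: "norm (shift_l1 k a) \<le> norm a * 1"
proof -
  have b: "bij_betw (\<lambda>j. j + k) UNIV UNIV" by (rule bij_betwI[where g = "\<lambda>j. j - k"]) auto
  have "(\<lambda>j. \<bar>l1_seq a (j + k)\<bar>) summable_on UNIV"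
    using summable_on_reindex_bij_betw[OF b, of "\<lambda>j. \<bar>l1_seq a j\<bar>"] l1_summable by simp
  note F = Abs_l1I[OF order_refl this]
  show "l1_seq (shift_l1 k a) j = l1_seq a (j + k)" by (simp add: shift_l1_def F(1))
  show "norm (shift_l1 k a) \<le> norm a * 1"
    using F(2) infsum_reindex_bij_betw[OF b, of "\<lambda>j. \<bar>l1_seq a j\<bar>"] by (simp add: shift_l1_def norm_l1.rep_eq)
qed

lemma bounded_linear_shift_l1: "bounded_linear (shift_l1 k)"
  by (rule bounded_linear_intro[where K = 1])
     (auto intro!: l1_eqI norm_shift_l1 simp: l1_seq_shift_l1 plus_l1.rep_eq scaleR_l1.rep_eq simp del: mult_1_right)

section \<open>Superposition operators\<close>

lemma smooth_family_of_map:
  assumes "smooth_map k S V f" "subspace S" "V \<subseteq> S"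
  shows "smooth_family k S V I (\<lambda>_. 1) (\<lambda>_. f)"
  by (rule smooth_family_reindex[OF assms, where \<rho> = "\<lambda>_. []"]) auto

lemma smooth_family_bilinear_map:
  assumes "bounded_bilinear B" "subspace S" "V \<subseteq> S" "smooth_family k S V I w F" "smooth_map k S V f"
  shows "smooth_family k S V I w (\<lambda>i x. B (F i x) (f x))"
  by (rule smooth_family_cong[OF smooth_family_bilinear[OF assms(1-4) smooth_family_of_map[OF assms(5,2,3)]]])
     (use assms in auto)

lemma smooth_map_bilinear:
  assumes "bounded_bilinear B" "subspace S" "V \<subseteq> S" "smooth_map k S V f" "smooth_map k S V g"
  shows "smooth_map k S V (\<lambda>x. B (f x) (g x))"
  using smooth_family_bilinear_map[OF assms] .

lemma smooth_family_minus: "smooth_family k S V I w F \<Longrightarrow> smooth_family k S V I w (\<lambda>i x. - F i x)"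
  using smooth_family_linear[OF _ bounded_linear_minus[OF bounded_linear_ident]] .

lemma smooth_family_diff:
  "smooth_family k S V I w F \<Longrightarrow> smooth_family k S V I w G \<Longrightarrow> smooth_family k S V I w (\<lambda>i x. F i x - G i x)"
  using smooth_family_add[OF _ smooth_family_minus] by fastforce

lemma smooth_map_0_compose:
  assumes \<theta>: "smooth_map 0 S V \<theta>" and \<Phi>: "\<And>x. x \<in> V \<Longrightarrow> isCont \<Phi> (\<theta> x)"
  shows "smooth_map 0 S V (\<lambda>x. \<Phi> (\<theta> x))"
  unfolding smooth_family.simps
proof (rule cont_familyI)
  fix x and e :: real assume x: "x \<in> V" and e: "e > 0"
  from \<Phi>[OF x] e obtain d where d: "d > 0" "\<And>z. dist z (\<theta> x) < d \<Longrightarrow> dist (\<Phi> z) (\<Phi> (\<theta> x)) < e"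
    unfolding continuous_at_eps_delta by blast
  have "d / 2 > 0" using d by simp
  from cont_familyD(3)[OF \<theta>[unfolded smooth_family.simps] x this]
  show "\<forall>\<^sub>F y in at x within V. \<forall>i\<in>{[]}. norm (\<Phi> (\<theta> y) - \<Phi> (\<theta> x)) \<le> e * 1"
  proof eventually_elim
    case (elim y)
    hence "dist (\<theta> y) (\<theta> x) < d" using d(1) by (simp add: dist_norm)
    thus ?case using d(2) by (simp add: dist_norm less_imp_le)
  qed
qed auto

text \<open>In the applications \<open>\<Phi>' x\<close> is built from linear and bilinear
  operations and from maps already known to be smooth of order \<open>k\<close>; \<open>sm\<close>
  records exactly this, so that a formula for the derivative raises the order by one.\<close>

lemma smooth_map_chain:
  fixes \<Phi> :: "'b::real_normed_vector \<Rightarrow> 'c::real_normed_vector" and S :: "'a::real_normed_vector set"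
  assumes \<theta>: "smooth_map (Suc k) S V \<theta>" and S: "subspace S" "V \<subseteq> S"
    and \<Phi>: "\<And>x. x \<in> V \<Longrightarrow> (\<Phi> has_derivative \<Phi>' x) (at (\<theta> x))"
    and sm: "\<And>\<theta>'. smooth_family k S V (cons_lists S {[]}) (cons_weight (\<lambda>_. 1)) \<theta>' \<Longrightarrow>
        smooth_family k S V (cons_lists S {[]}) (cons_weight (\<lambda>_. 1)) (\<lambda>l x. \<Phi>' x (\<theta>' l x))"
  shows "smooth_map (Suc k) S V (\<lambda>x. \<Phi> (\<theta> x))"
proof -
  obtain \<theta>' where \<theta>': "family_deriv S V {[]} (\<lambda>_. 1) (\<lambda>_. \<theta>) \<theta>'" "cont_family V {[] :: 'a list} (\<lambda>_. 1) (\<lambda>_. \<theta>)"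
    "smooth_family k S V (cons_lists S {[]}) (cons_weight (\<lambda>_. 1)) \<theta>'"
    using \<theta> unfolding smooth_family.simps by blast
  have "family_deriv S V {[]} (\<lambda>_. 1) (\<lambda>_ x. \<Phi> (\<theta> x)) (\<lambda>l x. \<Phi>' x (\<theta>' l x))"
    unfolding family_deriv_def
  proof (intro conjI ballI allI impI)
    fix x assume x: "x \<in> V"
    interpret L: bounded_linear "\<Phi>' x" using \<Phi>[OF x] by (rule has_derivative_bounded_linear)
    {
      fix i h z and a b :: real assume "i \<in> {[] :: 'a list}" "h \<in> S" "z \<in> S"
      hence "\<theta>' ((a *\<^sub>R h + b *\<^sub>R z) # i) x = a *\<^sub>R \<theta>' (h # i) x + b *\<^sub>R \<theta>' (z # i) x"
        using \<theta>'(1) x unfolding family_deriv_def by blast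
      thus "\<Phi>' x (\<theta>' ((a *\<^sub>R h + b *\<^sub>R z) # i) x) = a *\<^sub>R \<Phi>' x (\<theta>' (h # i) x) + b *\<^sub>R \<Phi>' x (\<theta>' (z # i) x)"
        by (simp add: L.add L.scaleR)
    }
    fix e :: real assume e: "e > 0"
    obtain K where K: "K > 0" "\<And>v. norm (\<Phi>' x v) \<le> norm v * K" using L.pos_bounded by auto
    obtain C where C: "0 \<le> C" "\<forall>l\<in>cons_lists S {[]}. norm (\<theta>' l x) \<le> C * cons_weight (\<lambda>_. 1) l"
      using cont_familyD(2)[OF smooth_family_cont[OF \<theta>'(3)] x] by auto
    \<comment> \<open>\<open>t\<close> controls the remainder of \<open>\<Phi>\<close>, on
      increments of size at most \<open>(C + 1) * norm (y - x)\<close>; \<open>s\<close> controls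
      the remainder of \<open>\<theta>\<close>, which passes through \<open>\<Phi>' x\<close> with
      bound \<open>K\<close>. Each uses half of \<open>e\<close>.\<close>
    obtain t where t: "0 < t" "t * (C + 1) \<le> e / 2" by (rule scaled_threshold[of "C + 1" "e / 2"]) (use C e in auto)
    obtain s where s: "0 < s" "s \<le> 1" "s * K \<le> e / 2" by (rule scaled_threshold[of K "e / 2"]) (use K e in auto)
    obtain d where d: "d > 0" "\<And>z. norm (z - \<theta> x) < d \<Longrightarrow>
        norm (\<Phi> z - \<Phi> (\<theta> x) - \<Phi>' x (z - \<theta> x)) \<le> t * norm (z - \<theta> x)"
      using \<Phi>[OF x] t(1) unfolding has_derivative_at_alt by blast
    have "d / 2 > 0" using d by simp
    note near = cont_familyD(3)[OF \<theta>'(2) x this]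
    have lin: "\<forall>\<^sub>F y in at x within V. \<forall>i\<in>{[]}. norm (\<theta> y - \<theta> x - \<theta>' ((y - x) # i) x) \<le> s * norm (y - x) * 1"
      using \<theta>'(1) x s(1) unfolding family_deriv_def by blast
    show "\<forall>\<^sub>F y in at x within V. \<forall>i\<in>{[]}.
        norm (\<Phi> (\<theta> y) - \<Phi> (\<theta> x) - \<Phi>' x (\<theta>' ((y - x) # i) x)) \<le> e * norm (y - x) * 1"
      using near lin eventually_at_in_self[of V x]
    proof eventually_elim
      case (elim y)
      let ?h = "\<theta>' [y - x] x"
      have yx: "y - x \<in> S" using elim x S by (auto intro: subspace_diff)
      have h: "norm ?h \<le> C * norm (y - x)" using bspec[OF C(2), of "[y - x]"] yx by simp
      have l: "norm (\<theta> y - \<theta> x - ?h) \<le> s * norm (y - x)" using elim by simp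
      have "norm (\<theta> y - \<theta> x) \<le> norm (\<theta> y - \<theta> x - ?h) + norm ?h"
        using norm_triangle_ineq[of "\<theta> y - \<theta> x - ?h" ?h] by simp
      also have "\<dots> \<le> 1 * norm (y - x) + C * norm (y - x)"
        using l h s by (intro add_mono order_trans[OF l] mult_right_mono) auto
      finally have n: "norm (\<theta> y - \<theta> x) \<le> (C + 1) * norm (y - x)" by (simp add: algebra_simps)
      have "norm (\<theta> y - \<theta> x) < d" using elim(1) d by simp
      note 1 = d(2)[OF this]
      have "norm (\<Phi> (\<theta> y) - \<Phi> (\<theta> x) - \<Phi>' x ?h)
        \<le> norm (\<Phi> (\<theta> y) - \<Phi> (\<theta> x) - \<Phi>' x (\<theta> y - \<theta> x)) + norm (\<Phi>' x (\<theta> y - \<theta> x - ?h))"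
        using norm_triangle_ineq[of "\<Phi> (\<theta> y) - \<Phi> (\<theta> x) - \<Phi>' x (\<theta> y - \<theta> x)" "\<Phi>' x (\<theta> y - \<theta> x - ?h)"]
        by (simp add: L.diff)
      also have "\<dots> \<le> t * ((C + 1) * norm (y - x)) + s * norm (y - x) * K"
        using 1 n t K(1) by (intro add_mono order_trans[OF 1] order_trans[OF K(2)] mult_left_mono mult_right_mono l) auto
      also have "\<dots> = (t * (C + 1)) * norm (y - x) + (s * K) * norm (y - x)" by simp
      also have "\<dots> \<le> e / 2 * norm (y - x) + e / 2 * norm (y - x)"
        using t s by (intro add_mono mult_right_mono) auto
      finally show ?case by simp
    qed
  qed
  moreover have "smooth_map 0 S V (\<lambda>x. \<Phi> (\<theta> x))"
    using smooth_map_0_compose[of S V \<theta> \<Phi>] \<theta>'(2) has_derivative_continuous[OF \<Phi>] by simp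
  ultimately show ?thesis using sm[OF \<theta>'(3)] by auto
qed

text \<open>The remainders of the superposition operator, of the reciprocal and of the phase are all
  quadratic. The sign of \<open>C\<close> is left free, whence \<open>max C 0\<close>.\<close>

lemma has_derivative_of_quadratic_bound:
  assumes "bounded_linear f'" "d > 0" "\<And>y. norm (y - x) < d \<Longrightarrow> norm (f y - f x - f' (y - x)) \<le> C * norm (y - x) * norm (y - x)"
  shows "(f has_derivative f') (at x)"
  unfolding has_derivative_at_alt
proof (intro conjI allI impI assms(1))
  fix e :: real assume e: "e > 0"
  obtain t where t: "0 < t" "t * max C 0 \<le> e" using scaled_threshold[OF _ e, of "max C 0"] by auto
  have "norm (f y - f x - f' (y - x)) \<le> e * norm (y - x)" if "norm (y - x) < min d t" for y
  proof -
    have "norm (f y - f x - f' (y - x)) \<le> C * norm (y - x) * norm (y - x)" using assms(3) that by auto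
    also have "\<dots> \<le> (max C 0 * t) * norm (y - x)"
      using that t by (intro mult_right_mono mult_mono) auto
    also have "\<dots> \<le> e * norm (y - x)" using t by (intro mult_right_mono) (auto simp: mult.commute)
    finally show ?thesis .
  qed
  thus "\<exists>d>0. \<forall>y. norm (y - x) < d \<longrightarrow> norm (f y - f x - f' (y - x)) \<le> e * norm (y - x)"
    using assms(2) t(1) by (intro exI[of _ "min d t"]) auto
qed

section \<open>Profiles with Lipschitz derivatives and their translates\<close>

definition lipschitz_curve :: "real \<Rightarrow> (real \<Rightarrow> 'b::real_normed_vector) \<Rightarrow> bool" where
  "lipschitz_curve L g \<longleftrightarrow> 0 \<le> L \<and> (\<forall>x y. norm (g x - g y) \<le> L * \<bar>x - y\<bar>)"

text \<open>Order \<open>k\<close> on \<open>l1\<close> requires the increments of the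
  \<open>k\<close>-th derivative of the profile under the shifts \<open>\<theta>_j\<close> to be
  summable in \<open>j\<close>; a global Lipschitz bound provides it. This is where one derivative
  of the profile is spent.\<close>

primrec lip_curve :: "nat \<Rightarrow> (real \<Rightarrow> 'b::real_normed_vector) \<Rightarrow> bool" where
  "lip_curve 0 g \<longleftrightarrow> (\<exists>L. lipschitz_curve L g)"
| "lip_curve (Suc k) g \<longleftrightarrow> (\<exists>L. lipschitz_curve L g) \<and>
     (\<exists>g'. (\<forall>x. (g has_vector_derivative g' x) (at x)) \<and> lip_curve k g')"

lemma lip_curveD: "lip_curve k g \<Longrightarrow> \<exists>L. lipschitz_curve L g"
  by (cases k) auto

lemma lipschitz_curve_continuous:
  assumes "lipschitz_curve L g"
  shows "continuous_on UNIV g"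
proof -
  have "L-lipschitz_on UNIV g"
    using assms by (auto simp: lipschitz_curve_def lipschitz_on_def dist_norm)
  thus ?thesis by (rule lipschitz_on_continuous_on)
qed

lemma lipschitz_curve_of_bounded_derivative:
  fixes g :: "real \<Rightarrow> 'b::real_normed_vector"
  assumes "\<And>x. (g has_vector_derivative g' x) (at x)" "\<And>x. norm (g' x) \<le> B"
  shows "lipschitz_curve B g"
  unfolding lipschitz_curve_def
proof (intro conjI allI)
  show "0 \<le> B" using order_trans[OF norm_ge_zero assms(2)[of 0]] .
  fix x y
  have "onorm (\<lambda>h. h *\<^sub>R g' z) \<le> B" for z
    using assms(2)[of z] by (intro onorm_le) (simp add: mult.commute[of B] mult_left_mono)
  hence "norm (g x - g y) \<le> B * norm (x - y)"
    using assms(1) by (intro differentiable_bound[of UNIV g "\<lambda>z h. h *\<^sub>R g' z"]) (auto simp: has_vector_derivative_def)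
  thus "norm (g x - g y) \<le> B * \<bar>x - y\<bar>" by simp
qed

text \<open>Mean value inequality for \<open>g\<close> minus its linearization at \<open>x\<close>.
  It gives the constant \<open>L\<close> in place of \<open>L / 2\<close>, which is good
  enough.\<close>

lemma lipschitz_curve_taylor:
  fixes g :: "real \<Rightarrow> 'b::real_normed_vector"
  assumes g: "\<And>x. (g has_vector_derivative g' x) (at x)" and L: "lipschitz_curve L g'"
  shows "norm (g y - g x - (y - x) *\<^sub>R g' x) \<le> L * \<bar>y - x\<bar> * \<bar>y - x\<bar>"
proof -
  have "norm (g y - g x - (\<lambda>z h. h *\<^sub>R g' z) x (y - x)) \<le> norm (y - x) * (L * \<bar>y - x\<bar>)"
  proof (rule differentiable_bound_linearization[where S = "closed_segment x y"])
    show "x + t *\<^sub>R (y - x) \<in> closed_segment x y" if "t \<in> {0..1}" for t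
      using that unfolding closed_segment_def by (auto intro!: exI[of _ t] simp: algebra_simps)
    show "(g has_derivative (\<lambda>h. h *\<^sub>R g' z)) (at z within closed_segment x y)" for z
      using g[of z] by (auto simp: has_vector_derivative_def intro: has_derivative_at_withinI)
    show "onorm ((\<lambda>h. h *\<^sub>R g' z) - (\<lambda>h. h *\<^sub>R g' x)) \<le> L * \<bar>y - x\<bar>" if z: "z \<in> closed_segment x y" for z
    proof (rule onorm_le)
      fix h :: real
      have "\<bar>z - x\<bar> \<le> \<bar>y - x\<bar>" using z by (auto simp: closed_segment_eq_real_ivl split: if_splits)
      hence "norm (g' z - g' x) \<le> L * \<bar>y - x\<bar>"
        using L unfolding lipschitz_curve_def by (meson mult_left_mono order_trans)
      thus "norm (((\<lambda>h. h *\<^sub>R g' z) - (\<lambda>h. h *\<^sub>R g' x)) h) \<le> L * \<bar>y - x\<bar> * norm h"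
        by (simp add: mult.commute[of "L * _"] mult_left_mono flip: scaleR_diff_right)
    qed
  qed auto
  thus ?thesis by (simp add: ac_simps)
qed

definition sup_xch :: "(real \<Rightarrow> 'a::euclidean_space) \<Rightarrow> l1 \<Rightarrow> 'a xch" where
  "sup_xch g \<theta> = abs_xch (\<lambda>j x. g (x - l1_seq \<theta> j) - g x)"

lemma shift_continuous: "continuous_on UNIV g \<Longrightarrow> continuous_on UNIV (\<lambda>x. g (x - c :: real))"
  by (rule continuous_on_compose2[of UNIV g]) (auto intro: continuous_intros)

lemma sup_xch_funs:
  fixes g :: "real \<Rightarrow> 'a::euclidean_space"
  assumes L: "lipschitz_curve L g"
  shows "(\<lambda>j x. g (x - l1_seq \<theta> j) - g x) \<in> xch_funs"
proof -
  have m: "(\<lambda>x. g (x - l1_seq \<theta> j) - g x) \<in> borel_measurable cell" for j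
    using lipschitz_curve_continuous[OF L] by (intro cell_measurable_continuous continuous_intros shift_continuous)
  have b: "norm (g (x - l1_seq \<theta> j) - g x) \<le> L * \<bar>l1_seq \<theta> j\<bar>" for j x
  proof -
    have "norm (g (x - l1_seq \<theta> j) - g x) \<le> L * \<bar>(x - l1_seq \<theta> j) - x\<bar>"
      using L unfolding lipschitz_curve_def by blast
    thus ?thesis by simp
  qed
  show ?thesis by (rule xch_funsI_pointwise(1)[OF m b summable_on_cmult_right[OF l1_summable]])
qed

lemma rep_sup_xch:
  fixes g :: "real \<Rightarrow> 'a::euclidean_space"
  assumes "lipschitz_curve L g"
  shows "AE x in cell. rep_xch (sup_xch g \<theta>) j x = g (x - l1_seq \<theta> j) - g x"
  unfolding sup_xch_def by (rule rep_abs_xch[OF sup_xch_funs[OF assms]])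

lemma sup_xch_lipschitz:
  fixes g :: "real \<Rightarrow> 'a::euclidean_space"
  assumes L: "lipschitz_curve L g"
  shows "norm (sup_xch g \<theta> - sup_xch g \<zeta>) \<le> (2 * pi + 1) * L * norm (\<theta> - \<zeta>)"
proof -
  have m: "(\<lambda>x. g (x - l1_seq \<theta> j) - g x - (g (x - l1_seq \<zeta> j) - g x)) \<in> borel_measurable cell" for j
    using lipschitz_curve_continuous[OF L] by (intro cell_measurable_continuous continuous_intros shift_continuous)
  have b: "norm (g (x - l1_seq \<theta> j) - g x - (g (x - l1_seq \<zeta> j) - g x)) \<le> L * \<bar>l1_seq (\<theta> - \<zeta>) j\<bar>" for j x
  proof -
    have "norm (g (x - l1_seq \<theta> j) - g (x - l1_seq \<zeta> j)) \<le> L * \<bar>(x - l1_seq \<theta> j) - (x - l1_seq \<zeta> j)\<bar>"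
      using L unfolding lipschitz_curve_def by blast
    thus ?thesis by (simp add: minus_l1.rep_eq abs_minus_commute)
  qed
  have "norm (sup_xch g \<theta> - sup_xch g \<zeta>) \<le> (2 * pi + 1) * infsum (\<lambda>j. L * \<bar>l1_seq (\<theta> - \<zeta>) j\<bar>) UNIV"
    unfolding sup_xch_def abs_xch_ops(2)[OF sup_xch_funs[OF L] sup_xch_funs[OF L]]
    by (rule xch_funsI_pointwise(2)[OF m b summable_on_cmult_right[OF l1_summable]])
  thus ?thesis by (simp add: infsum_cmult_right l1_summable norm_l1.rep_eq)
qed

lemma isCont_sup_xch:
  fixes g :: "real \<Rightarrow> 'a::euclidean_space"
  assumes L: "lipschitz_curve L g"
  shows "isCont (sup_xch g) \<theta>"
proof -
  have "((2 * pi + 1) * L)-lipschitz_on UNIV (sup_xch g)"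
    using sup_xch_lipschitz[OF L] L by (auto simp: lipschitz_on_def dist_norm lipschitz_curve_def)
  from lipschitz_on_continuous_on[OF this] show ?thesis by (simp add: continuous_on_eq_continuous_at)
qed

text \<open>The candidate is \<open>- h_j g'(x - \<theta>_j)\<close>, split into a fixed profile and
  its deviation so that both pieces lie in \<open>xch\<close>. In each cell the Taylor remainder is
  at most \<open>L\<close> times the square of \<open>h_j\<close>, hence at most
  \<open>L * norm h\<close> times its absolute value, which is summable.\<close>

lemma has_derivative_sup_xch:
  fixes g :: "real \<Rightarrow> 'a::euclidean_space"
  assumes g: "\<And>x. (g has_vector_derivative g' x) (at x)" and K: "lipschitz_curve K g" and L: "lipschitz_curve L g'"
  shows "(sup_xch g has_derivative (\<lambda>h. - (tensor_xch g' h + mul_xch h (sup_xch g' \<theta>)))) (at \<theta>)"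
proof (rule has_derivative_of_quadratic_bound[where d = 1])
  note c = lipschitz_curve_continuous[OF K] lipschitz_curve_continuous[OF L]
  interpret B: bounded_bilinear mul_xch by (rule bounded_bilinear_mul_xch)
  show "bounded_linear (\<lambda>h. - (tensor_xch g' h + mul_xch h (sup_xch g' \<theta>)))"
    by (intro bounded_linear_minus bounded_linear_add bounded_linear_tensor_xch c(2) B.bounded_linear_left)
  fix \<zeta> :: l1
  define h where "h = \<zeta> - \<theta>"
  define R where "R = (\<lambda>j x. g (x - l1_seq \<zeta> j) - g (x - l1_seq \<theta> j) + l1_seq h j *\<^sub>R g' (x - l1_seq \<theta> j))"
  have m: "R j \<in> borel_measurable cell" for j
    unfolding R_def by (intro cell_measurable_continuous continuous_intros shift_continuous c)
  have b: "norm (R j x) \<le> L * norm h * \<bar>l1_seq h j\<bar>" for j x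
  proof -
    have "norm (R j x) \<le> L * \<bar>l1_seq h j\<bar> * \<bar>l1_seq h j\<bar>"
      using lipschitz_curve_taylor[OF g L, of "x - l1_seq \<zeta> j" "x - l1_seq \<theta> j"]
      by (simp add: R_def h_def minus_l1.rep_eq abs_minus_commute algebra_simps)
    also have "\<dots> \<le> L * norm h * \<bar>l1_seq h j\<bar>"
      using L l1_le_norm[of h j] by (intro mult_right_mono mult_left_mono) (auto simp: lipschitz_curve_def)
    finally show ?thesis .
  qed
  note F = xch_funsI_pointwise[OF m b summable_on_cmult_right[OF l1_summable]]
  have "sup_xch g \<zeta> - sup_xch g \<theta> - (- (tensor_xch g' h + mul_xch h (sup_xch g' \<theta>))) = abs_xch R"
  proof (rule xch_eqI)
    fix j
    have "sup_xch g \<zeta> - sup_xch g \<theta> - (- (tensor_xch g' h + mul_xch h (sup_xch g' \<theta>)))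
      = (sup_xch g \<zeta> - sup_xch g \<theta>) + (tensor_xch g' h + mul_xch h (sup_xch g' \<theta>))" by simp
    moreover have "AE x in cell. rep_xch ((sup_xch g \<zeta> - sup_xch g \<theta>) + (tensor_xch g' h + mul_xch h (sup_xch g' \<theta>))) j x
        = rep_xch (abs_xch R) j x"
      using rep_abs_xch[OF F(1), of j] rep_xch_plus[of "sup_xch g \<zeta> - sup_xch g \<theta>" "tensor_xch g' h + mul_xch h (sup_xch g' \<theta>)" j]
        rep_xch_minus[of "sup_xch g \<zeta>" "sup_xch g \<theta>" j] rep_xch_plus[of "tensor_xch g' h" "mul_xch h (sup_xch g' \<theta>)" j]
        rep_sup_xch[OF K, of \<zeta> j] rep_sup_xch[OF K, of \<theta> j] rep_sup_xch[OF L, of \<theta> j]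
        rep_tensor_xch[OF c(2), of h j] rep_mul_xch[of h "sup_xch g' \<theta>" j]
    proof eventually_elim
      case (elim x)
      have "R j x = g (x - l1_seq \<zeta> j) - g (x - l1_seq \<theta> j) + l1_seq h j *\<^sub>R g' (x - l1_seq \<theta> j)"
        by (simp add: R_def)
      thus ?case unfolding elim(2,3,4) elim(1,5,6,8,9) elim(7) by (simp add: scaleR_diff_right)
    qed
    ultimately show "AE x in cell. rep_xch (sup_xch g \<zeta> - sup_xch g \<theta> - (- (tensor_xch g' h + mul_xch h (sup_xch g' \<theta>)))) j x
        = rep_xch (abs_xch R) j x" by (simp only:)
  qed
  hence "norm (sup_xch g \<zeta> - sup_xch g \<theta> - (- (tensor_xch g' h + mul_xch h (sup_xch g' \<theta>)))) \<le> (2 * pi + 1) * (L * norm h * norm h)"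
    using F(2) by (simp add: infsum_cmult_right l1_summable norm_l1.rep_eq)
  thus "norm (sup_xch g \<zeta> - sup_xch g \<theta> - (- (tensor_xch g' (\<zeta> - \<theta>) + mul_xch (\<zeta> - \<theta>) (sup_xch g' \<theta>))))
      \<le> ((2 * pi + 1) * L) * norm (\<zeta> - \<theta>) * norm (\<zeta> - \<theta>)" by (simp add: h_def mult.assoc)
qed simp

lemma smooth_map_sup_xch:
  fixes g :: "real \<Rightarrow> 'a::euclidean_space" and S :: "'s::real_normed_vector set"
  assumes "lip_curve k g" "smooth_map k S V \<theta>" and S: "subspace S" "V \<subseteq> S"
  shows "smooth_map k S V (\<lambda>x. sup_xch g (\<theta> x))"
  using assms(1,2)
proof (induction k arbitrary: g)
  case 0
  then obtain L where "lipschitz_curve L g" by auto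
  thus ?case using smooth_map_0_compose[OF 0(2), of "sup_xch g"] isCont_sup_xch by blast
next
  case (Suc k)
  obtain K g' L where g: "lipschitz_curve K g" "\<And>x. (g has_vector_derivative g' x) (at x)" "lip_curve k g'" "lipschitz_curve L g'"
    using Suc.prems(1) lip_curveD[of k] unfolding lip_curve.simps by blast
  note IH = Suc.IH[OF g(3) smooth_family_Suc_imp[OF Suc.prems(2)]]
  show ?case
  proof (rule smooth_map_chain[OF Suc.prems(2) S has_derivative_sup_xch[OF g(2,1,4)]])
    fix \<theta>' :: "'s list \<Rightarrow> 's \<Rightarrow> l1" assume "smooth_family k S V (cons_lists S {[]}) (cons_weight (\<lambda>_. 1)) \<theta>'"
    thus "smooth_family k S V (cons_lists S {[]}) (cons_weight (\<lambda>_. 1))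
        (\<lambda>l x. - (tensor_xch g' (\<theta>' l x) + mul_xch (\<theta>' l x) (sup_xch g' (\<theta> x))))"
      by (intro smooth_family_minus smooth_family_add smooth_family_linear[OF _ bounded_linear_tensor_xch]
          smooth_family_bilinear_map[OF bounded_bilinear_mul_xch S _ IH] lipschitz_curve_continuous[OF g(4)])
  qed
qed

text \<open>\<open>1 + recip_l1 q\<close> is the pointwise reciprocal of \<open>1 + q\<close>, for small \<open>q\<close>.\<close>

definition recip_l1 :: "l1 \<Rightarrow> l1" where
  "recip_l1 q = Abs_l1 (\<lambda>j. - l1_seq q j / (1 + l1_seq q j))"

lemma l1_seq_recip_l1:
  assumes "norm q < 1/2"
  shows "l1_seq (recip_l1 q) j = - l1_seq q j / (1 + l1_seq q j)"
    and "1 + l1_seq (recip_l1 q) j = 1 / (1 + l1_seq q j)" and "1/2 \<le> 1 + l1_seq q j"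
proof -
  have *: "\<bar>l1_seq q j\<bar> < 1/2" for j using l1_le_norm[of q j] assms by linarith
  hence pos: "1/2 \<le> 1 + l1_seq q j" for j using *[of j] by linarith
  have "\<bar>- l1_seq q j / (1 + l1_seq q j)\<bar> \<le> 2 * \<bar>l1_seq q j\<bar>" for j
  proof -
    have "\<bar>l1_seq q j\<bar> / (1 + l1_seq q j) \<le> \<bar>l1_seq q j\<bar> / (1/2)"
      using pos[of j] by (intro divide_left_mono) auto
    thus ?thesis using pos[of j] by (simp add: abs_divide)
  qed
  from Abs_l1I(1)[OF this summable_on_cmult_right[OF l1_summable]]
  show 1: "l1_seq (recip_l1 q) j = - l1_seq q j / (1 + l1_seq q j)" by (simp add: recip_l1_def)
  show "1/2 \<le> 1 + l1_seq q j" by (rule pos)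
  thus "1 + l1_seq (recip_l1 q) j = 1 / (1 + l1_seq q j)" unfolding 1 by (simp add: field_simps)
qed

text \<open>With \<open>1 + \<rho> = 1 / (1 + q)\<close> the derivative is
  \<open>- (1 + \<rho>)^2 h\<close>, multiplied out because the unit sequence is not in
  \<open>l1\<close>. The remainder is \<open>h^2\<close> over three factors, each at least 1/2,
  which gives the constant 8.\<close>

lemma has_derivative_recip_l1:
  assumes q: "norm q < 1/2"
  defines "\<rho> \<equiv> recip_l1 q"
  shows "(recip_l1 has_derivative (\<lambda>h. - (h + 2 *\<^sub>R mul_l1 h \<rho> + mul_l1 (mul_l1 h \<rho>) \<rho>))) (at q)"
proof (rule has_derivative_of_quadratic_bound[where d = "1/2 - norm q" and C = 8])
  interpret B: bounded_bilinear mul_l1 by (rule bounded_bilinear_mul_l1)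
  show "bounded_linear (\<lambda>h. - (h + 2 *\<^sub>R mul_l1 h \<rho> + mul_l1 (mul_l1 h \<rho>) \<rho>))"
    by (intro bounded_linear_minus bounded_linear_add bounded_linear_ident
        bounded_linear_compose[OF bounded_linear_scaleR_right B.bounded_linear_left]
        bounded_linear_compose[OF B.bounded_linear_left B.bounded_linear_left])
  fix z assume z: "norm (z - q) < 1/2 - norm q"
  have zn: "norm z < 1/2" using z norm_triangle_ineq[of "z - q" q] by simp
  define h where "h = z - q"
  define R where "R = (\<lambda>j. l1_seq h j * l1_seq h j / ((1 + l1_seq q j) * (1 + l1_seq q j) * (1 + l1_seq z j)))"
  have b: "\<bar>R j\<bar> \<le> (8 * norm h) * \<bar>l1_seq h j\<bar>" for j
  proof -
    have "(1/2) * (1/2) * (1/2) \<le> (1 + l1_seq q j) * (1 + l1_seq q j) * (1 + l1_seq z j)"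
      using l1_seq_recip_l1(3)[OF q, of j] l1_seq_recip_l1(3)[OF zn, of j] by (intro mult_mono) auto
    hence p: "1/8 \<le> \<bar>(1 + l1_seq q j) * (1 + l1_seq q j) * (1 + l1_seq z j)\<bar>" by simp
    have "\<bar>R j\<bar> \<le> \<bar>l1_seq h j\<bar> * \<bar>l1_seq h j\<bar> / (1/8)"
      unfolding R_def abs_divide using p by (intro frac_le) (simp_all add: abs_mult)
    also have "\<dots> = 8 * \<bar>l1_seq h j\<bar> * \<bar>l1_seq h j\<bar>" by simp
    also have "\<dots> \<le> 8 * norm h * \<bar>l1_seq h j\<bar>" using l1_le_norm[of h j] by (intro mult_right_mono mult_left_mono) auto
    finally show ?thesis .
  qed
  note F = Abs_l1I[OF b summable_on_cmult_right[OF l1_summable]]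
  have "recip_l1 z - recip_l1 q - - (h + 2 *\<^sub>R mul_l1 h \<rho> + mul_l1 (mul_l1 h \<rho>) \<rho>) = Abs_l1 R"
  proof (rule l1_eqI)
    fix j
    define u v where "u = 1 + l1_seq q j" and "v = 1 + l1_seq z j"
    have uv: "u \<noteq> 0" "v \<noteq> 0" using l1_seq_recip_l1(3)[OF q, of j] l1_seq_recip_l1(3)[OF zn, of j] by (auto simp: u_def v_def)
    have hj: "l1_seq h j = v - u" by (simp add: h_def u_def v_def minus_l1.rep_eq)
    have r: "l1_seq (recip_l1 q) j = 1 / u - 1" "l1_seq (recip_l1 z) j = 1 / v - 1"
      using l1_seq_recip_l1(2)[OF q, of j] l1_seq_recip_l1(2)[OF zn, of j] by (auto simp: u_def v_def)
    have "l1_seq (recip_l1 z - recip_l1 q - - (h + 2 *\<^sub>R mul_l1 h \<rho> + mul_l1 (mul_l1 h \<rho>) \<rho>)) j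
      = (1 / v - 1 / u) + (v - u) * (1 + 2 * (1 / u - 1) + (1 / u - 1) * (1 / u - 1))"
      by (simp add: minus_l1.rep_eq uminus_l1.rep_eq plus_l1.rep_eq scaleR_l1.rep_eq l1_seq_mul_l1 hj r \<rho>_def algebra_simps)
    also have "\<dots> = (v - u) * (v - u) / (u * u * v)" using uv by (simp add: field_simps)
    also have "\<dots> = l1_seq (Abs_l1 R) j" unfolding F(1) by (simp add: R_def hj u_def[symmetric] v_def[symmetric])
    finally show "l1_seq (recip_l1 z - recip_l1 q - - (h + 2 *\<^sub>R mul_l1 h \<rho> + mul_l1 (mul_l1 h \<rho>) \<rho>)) j = l1_seq (Abs_l1 R) j" .
  qed
  hence "norm (recip_l1 z - recip_l1 q - - (h + 2 *\<^sub>R mul_l1 h \<rho> + mul_l1 (mul_l1 h \<rho>) \<rho>)) \<le> 8 * norm h * norm h"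
    using F(2) by (simp add: infsum_cmult_right l1_summable norm_l1.rep_eq)
  thus "norm (recip_l1 z - recip_l1 q - - (z - q + 2 *\<^sub>R mul_l1 (z - q) \<rho> + mul_l1 (mul_l1 (z - q) \<rho>) \<rho>))
      \<le> 8 * norm (z - q) * norm (z - q)" by (simp add: h_def)
qed (use q in simp)

lemma smooth_map_recip_l1:
  fixes S :: "'s::real_normed_vector set"
  assumes "smooth_map k S V q" and q: "\<And>x. x \<in> V \<Longrightarrow> norm (q x) < 1/2" and S: "subspace S" "V \<subseteq> S"
  shows "smooth_map k S V (\<lambda>x. recip_l1 (q x))"
  using assms(1)
proof (induction k)
  case 0
  thus ?case using smooth_map_0_compose[OF 0, of recip_l1] has_derivative_continuous[OF has_derivative_recip_l1[OF q]] by blast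
next
  case (Suc k)
  note IH = Suc.IH[OF smooth_family_Suc_imp[OF Suc.prems]]
  show ?case
  proof (rule smooth_map_chain[OF Suc.prems S has_derivative_recip_l1[OF q]])
    fix \<theta>' :: "'s list \<Rightarrow> 's \<Rightarrow> l1" assume "smooth_family k S V (cons_lists S {[]}) (cons_weight (\<lambda>_. 1)) \<theta>'"
    thus "smooth_family k S V (cons_lists S {[]}) (cons_weight (\<lambda>_. 1))
        (\<lambda>l x. - (\<theta>' l x + 2 *\<^sub>R mul_l1 (\<theta>' l x) (recip_l1 (q x)) + mul_l1 (mul_l1 (\<theta>' l x) (recip_l1 (q x))) (recip_l1 (q x))))"
      by (intro smooth_family_minus smooth_family_add smooth_family_linear[OF _ bounded_linear_scaleR_right]
          smooth_family_bilinear_map[OF bounded_bilinear_mul_l1 S _ IH])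
  qed
qed

text \<open>Covers both \<open>u\<^sub>\<star>\<close> and \<open>u\<^sub>a\<^sub>d\<close> (periodic) and \<open>\<psi>\<close> (supported in the cell).\<close>

definition tame :: "(real \<Rightarrow> 'b::real_normed_vector) \<Rightarrow> bool" where
  "tame g \<longleftrightarrow> (\<forall>x. g (x + 2 * pi) = g x) \<or> (\<forall>x. \<bar>x\<bar> > pi \<longrightarrow> g x = 0)"

lemma tame_bounded:
  fixes g :: "real \<Rightarrow> 'b::euclidean_space"
  assumes "tame g" "continuous_on UNIV g"
  shows "\<exists>C. \<forall>x. norm (g x) \<le> C"
proof -
  obtain C where C: "0 \<le> C" "\<And>x. x \<in> {-pi..pi} \<Longrightarrow> norm (g x) \<le> C" using continuous_bounded_on_cell[OF assms(2)] by blast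
  have "norm (g x) \<le> C" for x
    using assms(1) unfolding tame_def
  proof
    assume per: "\<forall>x. g (x + 2 * pi) = g x"
    obtain y and n :: int where "y \<in> {-pi..<pi}" "x = y + of_int n * (2 * pi)" using cell_representative .
    thus ?thesis using C(2)[of y] periodic_int_shift[of g "2 * pi" y n] per by simp
  next
    assume "\<forall>x. \<bar>x\<bar> > pi \<longrightarrow> g x = 0"
    thus ?thesis using C(1) C(2)[of x] by (cases "\<bar>x\<bar> > pi") (auto simp: not_less abs_le_iff)
  qed
  thus ?thesis by blast
qed

lemma tame_derivative:
  fixes g :: "real \<Rightarrow> 'b::real_normed_vector"
  assumes "tame g" "\<And>x. (g has_vector_derivative g' x) (at x)"
  shows "tame g'"
proof (cases "\<forall>x. g (x + 2 * pi) = g x")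
  case True
  thus ?thesis using periodic_derivative[OF assms(2), of "2 * pi"] by (simp add: tame_def)
next
  case False
  hence 0: "\<And>x. \<bar>x\<bar> > pi \<Longrightarrow> g x = 0" using assms(1) by (auto simp: tame_def)
  have "g' x = 0" if "\<bar>x\<bar> > pi" for x
  proof -
    have "open {y :: real. pi < \<bar>y\<bar>}" by (intro open_Collect_less continuous_intros)
    hence "((\<lambda>_. 0) has_vector_derivative g' x) (at x)"
      using has_vector_derivative_transform_within_open[OF assms(2), of "{y. pi < \<bar>y\<bar>}" x "\<lambda>_. 0"] that 0 by auto
    thus ?thesis by (rule vector_derivative_unique_at[OF _ has_vector_derivative_const])
  qed
  thus ?thesis by (simp add: tame_def)
qed

lemma lipschitz_of_tame_C_curve:
  fixes g :: "real \<Rightarrow> 'b::euclidean_space"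
  assumes "C_curve (Suc k) g" "tame g"
  shows "\<exists>L. lipschitz_curve L g"
proof -
  note d = C_curve_SucD[OF assms(1)]
  obtain C where "\<And>x. norm (vector_derivative g (at x)) \<le> C"
    using tame_bounded[OF tame_derivative[OF assms(2) d(1)] C_curve_continuous[OF d(2)]] by blast
  from lipschitz_curve_of_bounded_derivative[OF d(1) this] show ?thesis ..
qed

text \<open>Continuous tame functions are bounded on the line, derivatives of tame functions are
  tame, and a bounded derivative of order \<open>k + 1\<close> is a Lipschitz bound for order
  \<open>k\<close>.\<close>

lemma lip_curve_of_C_curve:
  fixes g :: "real \<Rightarrow> 'b::euclidean_space"
  assumes "C_curve (Suc k) g" "tame g"
  shows "lip_curve k g"
  using assms
proof (induction k arbitrary: g)
  case 0
  show ?case unfolding lip_curve.simps by (rule lipschitz_of_tame_C_curve[OF 0])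
next
  case (Suc k)
  note d = C_curve_SucD[OF Suc.prems(1)]
  show ?case unfolding lip_curve.simps
  proof (intro conjI exI[of _ "\<lambda>x. vector_derivative g (at x)"] allI)
    show "\<exists>L. lipschitz_curve L g" by (rule lipschitz_of_tame_C_curve[OF Suc.prems])
    show "lip_curve k (\<lambda>x. vector_derivative g (at x))"
      by (rule Suc.IH[OF d(2) tame_derivative[OF Suc.prems(2) d(1)]])
  qed (rule d(1))
qed

section \<open>Solving for the phase\<close>

lemma cell_ip_continuous:
  fixes v f :: "real \<Rightarrow> 'a::euclidean_space"
  assumes v: "integrable cell v" and f: "continuous_on UNIV f"
  shows "integrable cell (\<lambda>x. v x \<bullet> f x)"
    and "(\<And>x. norm (f x) \<le> C) \<Longrightarrow> \<bar>cell_ip v f\<bar> \<le> C * (\<integral>x. norm (v x) \<partial>cell)"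
proof -
  obtain K where K: "\<And>x. x \<in> {-pi..pi} \<Longrightarrow> norm (f x) \<le> K" using continuous_bounded_on_cell[OF f] by blast
  show "integrable cell (\<lambda>x. v x \<bullet> f x)"
    by (rule cell_ip_bound(1)[OF cell_measurable_continuous[OF f] _ v, of K])
       (use K in \<open>auto simp: AE_restrict_space_iff\<close>)
  show "\<bar>cell_ip v f\<bar> \<le> C * (\<integral>x. norm (v x) \<partial>cell)" if "\<And>x. norm (f x) \<le> C"
    by (rule cell_ip_bound(2)[OF cell_measurable_continuous[OF f] _ v]) (use that in auto)
qed

lemma cell_ip_lin:
  fixes v w f g :: "real \<Rightarrow> 'a::euclidean_space"
  assumes v: "integrable cell v" and w: "integrable cell w" and f: "continuous_on UNIV f" and g: "continuous_on UNIV g"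
  shows "cell_ip (\<lambda>x. v x + w x) f = cell_ip v f + cell_ip w f"
    and "cell_ip (\<lambda>x. v x - w x) f = cell_ip v f - cell_ip w f"
    and "cell_ip v (\<lambda>x. f x + g x) = cell_ip v f + cell_ip v g"
    and "cell_ip v (\<lambda>x. f x - g x) = cell_ip v f - cell_ip v g"
    and "cell_ip v (\<lambda>x. c *\<^sub>R f x) = c * cell_ip v f"
  using cell_ip_continuous(1)[OF v f] cell_ip_continuous(1)[OF v g] cell_ip_continuous(1)[OF w f]
  by (simp_all add: cell_ip_def inner_add_left inner_add_right inner_diff_left inner_diff_right)

text \<open>Expresses the pairing with a translate of \<open>g\<close> through operations whose
  smoothness in \<open>\<theta>\<close> and \<open>w\<close> is known.\<close>

lemma pair_shift:
  fixes g :: "real \<Rightarrow> 'a::euclidean_space"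
  assumes g: "lipschitz_curve L g"
  shows "l1_seq (pair_fun_xch g w + pair_xch w (sup_xch g \<theta>)) j = cell_ip (rep_xch w j) (\<lambda>x. g (x - l1_seq \<theta> j))"
proof -
  note c = lipschitz_curve_continuous[OF g]
  have m: "(\<lambda>x. g (x - l1_seq \<theta> j) - g x) \<in> borel_measurable cell"
    by (intro cell_measurable_continuous continuous_intros shift_continuous c)
  have "cell_ip (rep_xch w j) (rep_xch (sup_xch g \<theta>) j) = cell_ip (rep_xch w j) (\<lambda>x. g (x - l1_seq \<theta> j) - g x)"
    by (rule cell_ip_cong_AE[OF _ rep_sup_xch[OF g]]) (use m in auto)
  also have "\<dots> = cell_ip (rep_xch w j) (\<lambda>x. g (x - l1_seq \<theta> j)) - cell_ip (rep_xch w j) g"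
    by (rule cell_ip_lin(4)[OF rep_xch_integrable rep_xch_integrable shift_continuous[OF c] c])
  finally show ?thesis by (simp add: plus_l1.rep_eq l1_seq_pair_fun_xch[OF c] l1_seq_pair_xch)
qed

lemma norm_pair_fun_xch:
  fixes g :: "real \<Rightarrow> 'a::euclidean_space"
  assumes g: "continuous_on UNIV g" "\<And>x. x \<in> {-pi..pi} \<Longrightarrow> norm (g x) \<le> C"
  shows "norm (pair_fun_xch g w) \<le> C * norm w"
proof -
  have "0 \<le> C" using order_trans[OF norm_ge_zero g(2)[of 0]] by simp
  have "norm (pair_fun_xch g w) \<le> C * infsum (cell_norm1 w) UNIV"
    using Abs_l1I(2)[OF pair_fun_xch_bound(2)[OF g] summable_on_cmult_right[OF cell_norm1_summable], of w]
    by (simp add: pair_fun_xch_def infsum_cmult_right cell_norm1_summable)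
  also have "\<dots> \<le> C * norm w" using \<open>0 \<le> C\<close> by (intro mult_left_mono infsum_cell_norm1)
  finally show ?thesis .
qed

lemma sup_xch_0 [simp]: "sup_xch g 0 = 0"
  unfolding sup_xch_def zero_xch.abs_eq by (simp add: zero_l1.rep_eq)

lemma norm_sup_xch:
  fixes g :: "real \<Rightarrow> 'a::euclidean_space"
  assumes "lipschitz_curve L g"
  shows "norm (sup_xch g \<theta>) \<le> (2 * pi + 1) * L * norm \<theta>"
  using sup_xch_lipschitz[OF assms, of \<theta> 0] by simp

lemma lip_curve_Suc_imp: "lip_curve (Suc k) g \<Longrightarrow> lip_curve k g"
proof (induction k arbitrary: g)
  case (Suc k)
  then obtain g' where "\<forall>x. (g has_vector_derivative g' x) (at x)" "lip_curve (Suc k) g'" "\<exists>L. lipschitz_curve L g"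
    by (subst (asm) lip_curve.simps) blast
  thus ?case using Suc.IH[of g'] unfolding lip_curve.simps by blast
qed auto

lemma lip_curve_derivative:
  assumes "lip_curve (Suc k) g" "\<And>x. (g has_vector_derivative g' x) (at x)"
  shows "lip_curve k g'"
proof -
  obtain g'' where g'': "\<And>x. (g has_vector_derivative g'' x) (at x)" "lip_curve k g''" using assms(1) by auto
  have "g'' = g'" by (rule ext) (rule vector_derivative_unique_at[OF g''(1) assms(2)])
  thus ?thesis using g''(2) by simp
qed

text \<open>To be read with \<open>u\<close> the wave and \<open>a\<close> the regular
  representative of \<open>uad\<close>; \<open>ua'\<close> is
  \<open>\<langle>u', a\<rangle> = 1\<close> integrated by parts. The condition on
  \<open>\<delta>\<close> limits the change of slope under translation. The last three conditions on
  \<open>\<epsilon>\<close> limit, in this order, the change of slope due to \<open>w\<close>, the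
  value of the equation at phase 0, and the norm of \<open>slope_dev\<close>.\<close>

locale phase_equation =
  fixes u a a' :: "real \<Rightarrow> 'a::euclidean_space" and La L1 Ca C1 Cu \<delta> \<epsilon> :: real
  assumes u: "continuous_on UNIV u" and a: "\<And>x. (a has_vector_derivative a' x) (at x)"
    and La: "lipschitz_curve La a" and L1: "lipschitz_curve L1 a'"
    and Ca: "\<And>x. norm (a x) \<le> Ca" and C1: "\<And>x. norm (a' x) \<le> C1" and Cu: "\<And>x. x \<in> {-pi..pi} \<Longrightarrow> norm (u x) \<le> Cu"
    and ua: "cell_ip u a = 0" and ua': "cell_ip u a' = -1"
    and \<delta>: "0 < \<delta>" "L1 * \<delta> * (\<integral>x. norm (u x) \<partial>cell) \<le> 1/4"
    and \<epsilon>: "0 < \<epsilon>" "\<epsilon> \<le> 1" "C1 * \<epsilon> \<le> 1/4" "Ca * \<epsilon> \<le> \<delta> / 8"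
      "(Cu * ((2 * pi + 1) * L1 * (2 * Ca)) + C1 + (2 * pi + 1) * L1 * (2 * Ca)) * \<epsilon> < 1/2"
begin

definition B :: "(real \<Rightarrow> 'a) \<Rightarrow> real \<Rightarrow> real" where "B v s = cell_ip v (\<lambda>x. a (x - s))"
definition B' :: "(real \<Rightarrow> 'a) \<Rightarrow> real \<Rightarrow> real" where "B' v s = cell_ip v (\<lambda>x. a' (x - s))"
abbreviation N :: "(real \<Rightarrow> 'a) \<Rightarrow> real" where "N v \<equiv> (\<integral>x. norm (v x) \<partial>cell)"

lemma ac: "continuous_on UNIV a" "continuous_on UNIV a'"
  using lipschitz_curve_continuous La L1 by blast+

lemma nonneg: "0 \<le> Ca" "0 \<le> C1" "0 \<le> La" "0 \<le> L1"
  using order_trans[OF norm_ge_zero Ca[of 0]] order_trans[OF norm_ge_zero C1[of 0]] La L1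
  by (auto simp: lipschitz_curve_def)

lemma ui: "integrable cell u"
  by (rule integrable_cell_continuous[OF u])

lemma B_bound: "integrable cell v \<Longrightarrow> \<bar>B v s\<bar> \<le> Ca * N v"
  unfolding B_def by (rule cell_ip_continuous(2)[OF _ shift_continuous[OF ac(1)]]) (auto simp: Ca)

lemma B'_bound: "integrable cell v \<Longrightarrow> \<bar>B' v s\<bar> \<le> C1 * N v"
  unfolding B'_def by (rule cell_ip_continuous(2)[OF _ shift_continuous[OF ac(2)]]) (auto simp: C1)

lemma B_add: "integrable cell v \<Longrightarrow> integrable cell w \<Longrightarrow> B (\<lambda>x. v x + w x) s = B v s + B w s"
  and B'_add: "integrable cell v \<Longrightarrow> integrable cell w \<Longrightarrow> B' (\<lambda>x. v x + w x) s = B' v s + B' w s"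
  unfolding B_def B'_def using cell_ip_lin(1) shift_continuous ac by blast+

lemma B_lipschitz:
  assumes "integrable cell v"
  shows "\<bar>B v s' - B v s\<bar> \<le> La * \<bar>s' - s\<bar> * N v"
proof -
  have "B v s' - B v s = cell_ip v (\<lambda>x. a (x - s') - a (x - s))"
    unfolding B_def by (rule cell_ip_lin(4)[symmetric, OF assms assms]) (intro shift_continuous ac)+
  also have "\<bar>\<dots>\<bar> \<le> La * \<bar>s' - s\<bar> * N v"
  proof (rule cell_ip_continuous(2)[OF assms])
    show "norm (a (x - s') - a (x - s)) \<le> La * \<bar>s' - s\<bar>" for x
    proof -
      have "norm (a (x - s') - a (x - s)) \<le> La * \<bar>(x - s') - (x - s)\<bar>" using La unfolding lipschitz_curve_def by blast
      thus ?thesis by (simp add: abs_minus_commute)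
    qed
  qed (intro continuous_intros shift_continuous ac)
  finally show ?thesis .
qed

lemma B'_lipschitz:
  assumes "integrable cell v"
  shows "\<bar>B' v s' - B' v s\<bar> \<le> L1 * \<bar>s' - s\<bar> * N v"
proof -
  have "B' v s' - B' v s = cell_ip v (\<lambda>x. a' (x - s') - a' (x - s))"
    unfolding B'_def by (rule cell_ip_lin(4)[symmetric, OF assms assms]) (intro shift_continuous ac)+
  also have "\<bar>\<dots>\<bar> \<le> L1 * \<bar>s' - s\<bar> * N v"
  proof (rule cell_ip_continuous(2)[OF assms])
    show "norm (a' (x - s') - a' (x - s)) \<le> L1 * \<bar>s' - s\<bar>" for x
    proof -
      have "norm (a' (x - s') - a' (x - s)) \<le> L1 * \<bar>(x - s') - (x - s)\<bar>" using L1 unfolding lipschitz_curve_def by blast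
      thus ?thesis by (simp add: abs_minus_commute)
    qed
  qed (intro continuous_intros shift_continuous ac)
  finally show ?thesis .
qed

lemma B_taylor:
  assumes v: "integrable cell v"
  shows "\<bar>B v s' - B v s + (s' - s) * B' v s\<bar> \<le> L1 * \<bar>s' - s\<bar> * \<bar>s' - s\<bar> * N v"
proof -
  have c: "continuous_on UNIV (\<lambda>x. a (x - s'))" "continuous_on UNIV (\<lambda>x. a (x - s))" "continuous_on UNIV (\<lambda>x. a' (x - s))"
    by (intro shift_continuous ac)+
  have c': "continuous_on UNIV (\<lambda>x. a (x - s') - a (x - s))" "continuous_on UNIV (\<lambda>x. (s' - s) *\<^sub>R a' (x - s))"
    by (intro continuous_intros c)+
  have "B v s' - B v s + (s' - s) * B' v s = cell_ip v (\<lambda>x. (a (x - s') - a (x - s)) + (s' - s) *\<^sub>R a' (x - s))"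
    unfolding cell_ip_lin(3)[OF v v c'] cell_ip_lin(4)[OF v v c(1,2)] cell_ip_lin(5)[OF v v c(3) c(3)] B_def B'_def ..
  also have "\<bar>\<dots>\<bar> \<le> L1 * \<bar>s' - s\<bar> * \<bar>s' - s\<bar> * N v"
  proof (rule cell_ip_continuous(2)[OF v])
    show "norm (a (x - s') - a (x - s) + (s' - s) *\<^sub>R a' (x - s)) \<le> L1 * \<bar>s' - s\<bar> * \<bar>s' - s\<bar>" for x
      using lipschitz_curve_taylor[OF a L1, of "x - s'" "x - s"] by (simp add: abs_minus_commute algebra_simps)
  qed (intro continuous_intros c)
  finally show ?thesis .
qed

lemma B_derivative:
  assumes v: "integrable cell v"
  shows "(B v has_real_derivative - B' v s) (at s)"
proof -
  have "(B v has_derivative (\<lambda>h. - B' v s * h)) (at s)"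
  proof (rule has_derivative_of_quadratic_bound[where d = 1 and C = "L1 * N v"])
    show "bounded_linear ((*) (- B' v s))" by (rule bounded_linear_mult_right)
    show "norm (B v y - B v s - - B' v s * (y - s)) \<le> L1 * N v * norm (y - s) * norm (y - s)" for y
    proof -
      have "B v y - B v s - - B' v s * (y - s) = B v y - B v s + (y - s) * B' v s" by (simp add: mult.commute)
      thus ?thesis using B_taylor[OF v, of y s] by (simp only: real_norm_def ac_simps)
    qed
  qed simp
  thus ?thesis unfolding has_field_derivative_def .
qed

text \<open>By \<open>B_derivative\<close> this quantity is the slope of the scalar equation. It is
  1 for \<open>v = 0\<close> and \<open>s = 0\<close>; the translation and \<open>v\<close> each
  cost at most 1/4.\<close>

lemma slope:
  assumes v: "integrable cell v" "N v \<le> \<epsilon>" and s: "\<bar>s\<bar> \<le> \<delta>"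
  shows "1/2 \<le> - B' (\<lambda>x. u x + v x) s"
proof -
  have "B' u 0 = -1" using ua' by (simp add: B'_def)
  moreover have "\<bar>B' u s - B' u 0\<bar> \<le> 1/4"
  proof -
    have "\<bar>B' u s - B' u 0\<bar> \<le> L1 * \<bar>s - 0\<bar> * N u" by (rule B'_lipschitz[OF ui])
    also have "\<dots> \<le> L1 * \<delta> * N u" using s nonneg by (intro mult_right_mono mult_left_mono) auto
    finally show ?thesis using \<delta>(2) by linarith
  qed
  moreover have "\<bar>B' v s\<bar> \<le> 1/4"
  proof -
    have "\<bar>B' v s\<bar> \<le> C1 * N v" by (rule B'_bound[OF v(1)])
    also have "\<dots> \<le> C1 * \<epsilon>" using v(2) nonneg by (intro mult_left_mono) auto
    finally show ?thesis using \<epsilon>(3) by linarith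
  qed
  ultimately show ?thesis unfolding B'_add[OF ui v(1)] by linarith
qed

lemma growth_aux:
  assumes v: "integrable cell v" "N v \<le> \<epsilon>" and s: "\<bar>s\<bar> \<le> \<delta>" "\<bar>s'\<bar> \<le> \<delta>" "s < s'"
  shows "(s' - s) / 2 \<le> B (\<lambda>x. u x + v x) s' - B (\<lambda>x. u x + v x) s"
proof -
  let ?z = "\<lambda>x. u x + v x"
  have zi: "integrable cell ?z" using ui v by auto
  obtain \<xi> where \<xi>: "s < \<xi>" "\<xi> < s'" "B ?z s' - B ?z s = (s' - s) * (- B' ?z \<xi>)"
    using MVT2[OF s(3), of "B ?z" "\<lambda>s. - B' ?z s"] B_derivative[OF zi] by blast
  have "(s' - s) * (1/2) \<le> (s' - s) * (- B' ?z \<xi>)"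
    using slope[OF v, of \<xi>] \<xi> s by (intro mult_left_mono) auto
  thus ?thesis using \<xi>(3) by simp
qed

text \<open>Source of the uniqueness of the root, of its bound by the L1 norm of \<open>w_j\<close>
  and of its Lipschitz dependence on \<open>w\<close>.\<close>

lemma growth:
  assumes v: "integrable cell v" "N v \<le> \<epsilon>" and s: "\<bar>s\<bar> \<le> \<delta>" "\<bar>s'\<bar> \<le> \<delta>"
  shows "\<bar>s' - s\<bar> \<le> 2 * \<bar>B (\<lambda>x. u x + v x) s' - B (\<lambda>x. u x + v x) s\<bar>"
  using growth_aux[OF v s] growth_aux[OF v s(2,1)] by (cases s s' rule: linorder_cases) auto

text \<open>At 0 the function is at most \<open>\<delta> / 8\<close> in absolute value, while it
  changes by at least \<open>\<delta> / 2\<close> towards either end, so it changes sign.\<close>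

lemma root_exists:
  assumes v: "integrable cell v" "N v \<le> \<epsilon>"
  shows "\<exists>s. \<bar>s\<bar> \<le> \<delta> \<and> B (\<lambda>x. u x + v x) s = 0"
proof -
  let ?z = "\<lambda>x. u x + v x"
  have zi: "integrable cell ?z" using ui v by auto
  have "B ?z 0 = B v 0" using ua by (simp add: B_add[OF ui v(1)]) (simp add: B_def)
  moreover have "\<bar>B v 0\<bar> \<le> \<delta> / 8"
  proof -
    have "\<bar>B v 0\<bar> \<le> Ca * N v" by (rule B_bound[OF v(1)])
    also have "\<dots> \<le> Ca * \<epsilon>" using v(2) nonneg by (intro mult_left_mono) auto
    finally show ?thesis using \<epsilon>(4) by linarith
  qed
  moreover have "\<delta> / 2 \<le> B ?z \<delta> - B ?z 0" "\<delta> / 2 \<le> B ?z 0 - B ?z (-\<delta>)"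
    using growth_aux[OF v, of 0 \<delta>] growth_aux[OF v, of "-\<delta>" 0] \<delta> by auto
  ultimately have "B ?z (-\<delta>) \<le> 0" "0 \<le> B ?z \<delta>" using \<delta> by linarith+
  moreover have "continuous_on {-\<delta>..\<delta>} (B ?z)"
    using B_derivative[OF zi] DERIV_isCont continuous_at_imp_continuous_on by blast
  ultimately obtain s where "-\<delta> \<le> s" "s \<le> \<delta>" "B ?z s = 0" using IVT'[of "B ?z" "-\<delta>" 0 \<delta>] \<delta> by auto
  thus ?thesis by (intro exI[of _ s]) auto
qed

section \<open>The phase as a map into \<open>l1\<close> and its derivative\<close>

definition phase :: "'a xch \<Rightarrow> l1" where
  "phase w = Abs_l1 (\<lambda>j. SOME s. \<bar>s\<bar> \<le> \<delta> \<and> B (\<lambda>x. u x + rep_xch w j x) s = 0)"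

lemma small:
  assumes "norm w < \<epsilon>"
  shows "integrable cell (rep_xch w j)" "N (rep_xch w j) \<le> \<epsilon>"
  using rep_xch_integrable cell_norm1_le[of w j] assms by (auto simp: cell_norm1_def)

lemma phase:
  assumes w: "norm w < \<epsilon>"
  shows "\<bar>l1_seq (phase w) j\<bar> \<le> \<delta>" "B (\<lambda>x. u x + rep_xch w j x) (l1_seq (phase w) j) = 0"
    and "norm (phase w) \<le> 2 * Ca * norm w"
proof -
  let ?s = "\<lambda>j. SOME s. \<bar>s\<bar> \<le> \<delta> \<and> B (\<lambda>x. u x + rep_xch w j x) s = 0"
  have s: "\<bar>?s j\<bar> \<le> \<delta> \<and> B (\<lambda>x. u x + rep_xch w j x) (?s j) = 0" for j
    by (rule someI_ex[OF root_exists[OF small[OF w]]])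
  \<comment> \<open>The root is compared with 0, where \<open>u\<close> contributes nothing and only
    the pairing of \<open>w_j\<close> is left; this makes the sequence of roots summable.\<close>
  have b: "\<bar>?s j\<bar> \<le> 2 * Ca * cell_norm1 w j" for j
  proof -
    have "\<bar>?s j - 0\<bar> \<le> 2 * \<bar>B (\<lambda>x. u x + rep_xch w j x) (?s j) - B (\<lambda>x. u x + rep_xch w j x) 0\<bar>"
      by (rule growth[OF small[OF w]]) (use s \<delta> in auto)
    also have "\<dots> = 2 * \<bar>B (rep_xch w j) 0\<bar>"
      using s[of j] ua by (simp add: B_add[OF ui rep_xch_integrable, where s = 0]) (simp add: B_def)
    also have "\<dots> \<le> 2 * (Ca * cell_norm1 w j)"
      using B_bound[OF rep_xch_integrable[of w j], of 0] by (simp add: cell_norm1_def)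
    finally show ?thesis by simp
  qed
  note F = Abs_l1I[OF b summable_on_cmult_right[OF cell_norm1_summable]]
  have seq: "l1_seq (phase w) = ?s" unfolding phase_def by (rule F(1))
  show "\<bar>l1_seq (phase w) j\<bar> \<le> \<delta>" "B (\<lambda>x. u x + rep_xch w j x) (l1_seq (phase w) j) = 0"
    using s unfolding seq by auto
  have "norm (phase w) \<le> 2 * Ca * infsum (cell_norm1 w) UNIV"
    using F(2) by (simp add: phase_def infsum_cmult_right cell_norm1_summable)
  also have "\<dots> \<le> 2 * Ca * norm w" using nonneg by (intro mult_left_mono infsum_cell_norm1) auto
  finally show "norm (phase w) \<le> 2 * Ca * norm w" .
qed

lemma phase_unique:
  assumes w: "norm w < \<epsilon>" and \<theta>: "\<And>j. \<bar>l1_seq \<theta> j\<bar> \<le> \<delta>" "\<And>j. B (\<lambda>x. u x + rep_xch w j x) (l1_seq \<theta> j) = 0"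
  shows "\<theta> = phase w"
proof (rule l1_eqI)
  fix j
  have "\<bar>l1_seq \<theta> j - l1_seq (phase w) j\<bar> \<le> 0"
    using growth[OF small[OF w] phase(1)[OF w] \<theta>(1), of j j j] \<theta>(2)[of j] phase(2)[OF w, of j] by simp
  thus "l1_seq \<theta> j = l1_seq (phase w) j" by simp
qed

text \<open>The root for \<open>w'\<close> annihilates \<open>u + w'_j\<close>, so only the
  increment is left over in the equation for \<open>w\<close>; \<open>growth\<close> converts this
  into a distance of roots.\<close>

lemma phase_step:
  assumes w: "norm w < \<epsilon>" and w': "norm w' < \<epsilon>"
  shows "B (\<lambda>x. u x + rep_xch w j x) (l1_seq (phase w') j) = - B (rep_xch (w' - w) j) (l1_seq (phase w') j)"
    and "\<bar>l1_seq (phase w') j - l1_seq (phase w) j\<bar> \<le> 2 * Ca * cell_norm1 (w' - w) j"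
proof -
  let ?s' = "l1_seq (phase w') j"
  have i: "integrable cell (\<lambda>x. u x + rep_xch w j x)" using ui rep_xch_integrable by auto
  have "B (rep_xch (w' - w) j) ?s' = B (\<lambda>x. rep_xch w' j x - rep_xch w j x) ?s'" unfolding B_def
    by (rule cell_ip_cong_AE[OF rep_xch_minus]) (auto intro: cell_measurable_continuous shift_continuous ac)
  hence "B (\<lambda>x. (u x + rep_xch w j x) + rep_xch (w' - w) j x) ?s'
      = B (\<lambda>x. (u x + rep_xch w j x) + (rep_xch w' j x - rep_xch w j x)) ?s'"
    using B_add[OF i rep_xch_integrable[of "w' - w" j], of ?s']
      B_add[OF i Bochner_Integration.integrable_diff[OF rep_xch_integrable[of w' j] rep_xch_integrable[of w j]], of ?s'] by simp
  also have "\<dots> = 0" using phase(2)[OF w', of j] by simp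
  finally show 1: "B (\<lambda>x. u x + rep_xch w j x) ?s' = - B (rep_xch (w' - w) j) ?s'"
    unfolding B_add[OF i rep_xch_integrable] by simp
  have "\<bar>?s' - l1_seq (phase w) j\<bar> \<le> 2 * \<bar>B (rep_xch (w' - w) j) ?s'\<bar>"
    using growth[OF small[OF w] phase(1)[OF w] phase(1)[OF w'], of j j j] phase(2)[OF w, of j] 1 by simp
  also have "\<dots> \<le> 2 * (Ca * cell_norm1 (w' - w) j)"
    using B_bound[OF rep_xch_integrable[of "w' - w" j]] by (simp add: cell_norm1_def)
  finally show "\<bar>?s' - l1_seq (phase w) j\<bar> \<le> 2 * Ca * cell_norm1 (w' - w) j" by simp
qed

text \<open>\<open>1 + slope_dev w\<close> is the derivative of the phase equation with respect to the phase.\<close>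

definition slope_dev :: "'a xch \<Rightarrow> l1" where
  "slope_dev w = - (pair_fun_xch u (sup_xch a' (phase w)) + (pair_fun_xch a' w + pair_xch w (sup_xch a' (phase w))))"

lemma slope_dev: "1 + l1_seq (slope_dev w) j = - B' (\<lambda>x. u x + rep_xch w j x) (l1_seq (phase w) j)"
proof -
  let ?s = "l1_seq (phase w) j"
  have "cell_ip (rep_xch (sup_xch a' (phase w)) j) u = cell_ip (\<lambda>x. a' (x - ?s) - a' x) u"
    by (rule cell_ip_cong_AE[OF rep_sup_xch[OF L1]])
       (auto intro!: cell_measurable_continuous continuous_intros shift_continuous ac u)
  also have "\<dots> = cell_ip u (\<lambda>x. a' (x - ?s) - a' x)" by (simp add: cell_ip_def inner_commute)
  \<comment> \<open>The 1 is \<open>- \<langle>u, a'\<rangle>\<close>.\<close>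
  also have "\<dots> = B' u ?s + 1" using ua' unfolding B'_def
    by (subst cell_ip_lin(4)[OF ui ui shift_continuous[OF ac(2)] ac(2)]) simp
  finally have 1: "l1_seq (pair_fun_xch u (sup_xch a' (phase w))) j = B' u ?s + 1"
    by (simp add: l1_seq_pair_fun_xch[OF u])
  have "l1_seq (slope_dev w) j = - (B' u ?s + 1 + B' (rep_xch w j) ?s)"
    unfolding slope_dev_def uminus_l1.rep_eq plus_l1.rep_eq[of "pair_fun_xch u _"] 1 pair_shift[OF L1] B'_def ..
  thus ?thesis by (simp add: B'_add[OF ui rep_xch_integrable])
qed

lemma norm_slope_dev:
  assumes w: "norm w < \<epsilon>"
  shows "norm (slope_dev w) < 1/2"
proof -
  let ?\<kappa> = "(2 * pi + 1) * L1 * (2 * Ca)"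
  have Cu0: "0 \<le> Cu" using order_trans[OF norm_ge_zero Cu[of 0]] by simp
  have \<kappa>0: "0 \<le> ?\<kappa>" using nonneg by simp
  have "norm (sup_xch a' (phase w)) \<le> (2 * pi + 1) * L1 * norm (phase w)" by (rule norm_sup_xch[OF L1])
  also have "\<dots> \<le> (2 * pi + 1) * L1 * (2 * Ca * norm w)" using phase(3)[OF w] nonneg by (intro mult_left_mono) auto
  finally have s: "norm (sup_xch a' (phase w)) \<le> ?\<kappa> * norm w" by (simp only: mult.assoc)
  have "norm (pair_fun_xch u (sup_xch a' (phase w))) \<le> Cu * (?\<kappa> * norm w)"
    by (rule order_trans[OF norm_pair_fun_xch[OF u Cu] mult_left_mono[OF s Cu0]])
  moreover have "norm (pair_fun_xch a' w) \<le> C1 * norm w" by (rule norm_pair_fun_xch[OF ac(2) C1])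
  \<comment> \<open>This term is quadratic in \<open>w\<close>; \<open>norm w \<le> 1\<close>
    reduces it to a linear one.\<close>
  moreover have "norm (pair_xch w (sup_xch a' (phase w))) \<le> 1 * (?\<kappa> * norm w)"
    using norm_pair_xch[of w "sup_xch a' (phase w)"] s w \<epsilon>(2)
    by (intro order_trans[OF norm_pair_xch[of w, unfolded mult_1_right] mult_mono]) auto
  ultimately have "norm (slope_dev w) \<le> Cu * (?\<kappa> * norm w) + (C1 * norm w + 1 * (?\<kappa> * norm w))"
    unfolding slope_dev_def norm_minus_cancel by (intro norm_triangle_le add_mono) auto
  also have "\<dots> = (Cu * ?\<kappa> + C1 + ?\<kappa>) * norm w" by (simp add: algebra_simps)
  also have "\<dots> \<le> (Cu * ?\<kappa> + C1 + ?\<kappa>) * \<epsilon>" using Cu0 \<kappa>0 nonneg w by (intro mult_left_mono) auto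
  finally show ?thesis using \<epsilon>(5) by linarith
qed

text \<open>Implicit differentiation of the phase equation: minus the pairing of \<open>h\<close>
  with the translate of \<open>a\<close>, divided by the slope. The quotient is written with
  \<open>recip_l1\<close>, so that the formula is composed of smooth operations on \<open>w\<close>,
  \<open>h\<close> and the phase.\<close>

definition phase' :: "'a xch \<Rightarrow> 'a xch \<Rightarrow> l1" where
  "phase' w h = - ((pair_fun_xch a h + pair_xch h (sup_xch a (phase w)))
      + mul_l1 (pair_fun_xch a h + pair_xch h (sup_xch a (phase w))) (recip_l1 (slope_dev w)))"

lemma phase'_seq:
  assumes w: "norm w < \<epsilon>"
  shows "l1_seq (phase' w h) j = - B (rep_xch h j) (l1_seq (phase w) j) / (- B' (\<lambda>x. u x + rep_xch w j x) (l1_seq (phase w) j))"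
proof -
  let ?Y = "pair_fun_xch a h + pair_xch h (sup_xch a (phase w))"
  have "l1_seq (phase' w h) j = - (l1_seq ?Y j * (1 + l1_seq (recip_l1 (slope_dev w)) j))"
    unfolding phase'_def uminus_l1.rep_eq plus_l1.rep_eq[of ?Y] l1_seq_mul_l1 by (simp add: distrib_left)
  thus ?thesis unfolding pair_shift[OF La] l1_seq_recip_l1(2)[OF norm_slope_dev[OF w]] slope_dev B_def by simp
qed

text \<open>In each cell the Taylor expansion of \<open>B\<close> at the old root is compared with
  \<open>phase_step\<close>. Two errors arise, the quadratic Taylor term and the evaluation of the
  increment at the new instead of the old root; both are of the order of the square of the L1 norm
  of \<open>h_j\<close>.\<close>

lemma phase_has_derivative:
  assumes w: "norm w < \<epsilon>"
  shows "(phase has_derivative phase' w) (at w)"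
proof -
  interpret P: bounded_bilinear "pair_xch :: 'a xch \<Rightarrow> 'a xch \<Rightarrow> l1" by (rule bounded_bilinear_pair_xch)
  interpret M: bounded_bilinear mul_l1 by (rule bounded_bilinear_mul_l1)
  \<comment> \<open>The two summands are the constants of the two errors, with the displacement of
    the root bounded by \<open>2 * Ca\<close> times the L1 norm of \<open>h_j\<close>; the factor 2
    comes from dividing by a slope of at least 1/2.\<close>
  define K where "K = 2 * (L1 * (2 * Ca) * (2 * Ca) * (N u + \<epsilon>) + La * (2 * Ca))"
  have Nu: "0 \<le> N u" by simp
  have K0: "0 \<le> K" unfolding K_def using nonneg Nu \<epsilon>(1) by simp
  show ?thesis
  proof (rule has_derivative_of_quadratic_bound[where d = "\<epsilon> - norm w" and C = K])
    have Y: "bounded_linear (\<lambda>h. pair_fun_xch a h + pair_xch h (sup_xch a (phase w)))"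
      by (intro bounded_linear_add bounded_linear_pair_fun_xch ac P.bounded_linear_left)
    show "bounded_linear (phase' w)" unfolding phase'_def
      by (intro bounded_linear_minus bounded_linear_add[OF Y bounded_linear_compose[OF M.bounded_linear_left Y]])
    fix w' assume "norm (w' - w) < \<epsilon> - norm w"
    hence w': "norm w' < \<epsilon>" using norm_triangle_ineq[of "w' - w" w] by simp
    define h where "h = w' - w"
    have bnd: "\<bar>l1_seq (phase w' - phase w - phase' w h) j\<bar> \<le> K * norm h * cell_norm1 h j" for j
    proof -
      let ?z = "\<lambda>x. u x + rep_xch w j x"
      define s s' n q where "s = l1_seq (phase w) j" and "s' = l1_seq (phase w') j" and "n = cell_norm1 h j" and "q = - B' ?z s"
      have zi: "integrable cell ?z" using ui rep_xch_integrable by auto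
      have q: "1/2 \<le> q" unfolding q_def s_def by (rule slope[OF small[OF w] phase(1)[OF w]])
      have n0: "0 \<le> n" by (simp add: n_def cell_norm1_nonneg)
      have ds: "\<bar>s' - s\<bar> \<le> 2 * Ca * n" using phase_step(2)[OF w w', of j] by (simp add: s_def s'_def n_def h_def)
      have Nz: "N ?z \<le> N u + \<epsilon>"
      proof -
        have "N ?z \<le> (\<integral>x. norm (u x) + norm (rep_xch w j x) \<partial>cell)"
          using ui small[OF w, of j] zi by (intro integral_mono) (auto intro: norm_triangle_ineq)
        also have "\<dots> = N u + N (rep_xch w j)" using ui small[OF w, of j] by simp
        finally show ?thesis using small(2)[OF w, of j] by simp
      qed
      have "B ?z s' - B ?z s + (s' - s) * B' ?z s = - B (rep_xch h j) s' - (s' - s) * q"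
        using phase_step(1)[OF w w', of j] phase(2)[OF w, of j] by (simp add: q_def s_def s'_def h_def)
      hence E1: "\<bar>- B (rep_xch h j) s' - (s' - s) * q\<bar> \<le> L1 * \<bar>s' - s\<bar> * \<bar>s' - s\<bar> * N ?z"
        using B_taylor[OF zi, of s' s] by simp
      also have "\<dots> \<le> L1 * (2 * Ca * n) * (2 * Ca * n) * (N u + \<epsilon>)"
        using ds Nz nonneg n0 by (intro mult_mono) (auto intro!: mult_nonneg_nonneg)
      finally have E1: "\<bar>- B (rep_xch h j) s' - (s' - s) * q\<bar> \<le> L1 * (2 * Ca * n) * (2 * Ca * n) * (N u + \<epsilon>)" .
      have "\<bar>B (rep_xch h j) s' - B (rep_xch h j) s\<bar> \<le> La * \<bar>s' - s\<bar> * n"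
        using B_lipschitz[OF rep_xch_integrable[of h j], of s' s] by (simp add: n_def cell_norm1_def)
      also have "\<dots> \<le> La * (2 * Ca * n) * n"
        using ds nonneg n0 by (intro mult_mono) (auto intro!: mult_nonneg_nonneg)
      finally have E2: "\<bar>B (rep_xch h j) s' - B (rep_xch h j) s\<bar> \<le> La * (2 * Ca * n) * n" .
      have E: "\<bar>(s' - s) * q + B (rep_xch h j) s\<bar> \<le> (K / 2) * (n * n)"
      proof -
        have "\<bar>(s' - s) * q + B (rep_xch h j) s\<bar> \<le> L1 * (2 * Ca * n) * (2 * Ca * n) * (N u + \<epsilon>) + La * (2 * Ca * n) * n"
          using E1 E2 by linarith
        also have "\<dots> = (K / 2) * (n * n)" by (simp add: K_def algebra_simps)
        finally show ?thesis .
      qed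
      have "l1_seq (phase w' - phase w - phase' w h) j = ((s' - s) * q + B (rep_xch h j) s) / q"
        using q unfolding minus_l1.rep_eq phase'_seq[OF w] s_def[symmetric] s'_def[symmetric] q_def[symmetric]
        by (simp add: field_simps)
      hence "\<bar>l1_seq (phase w' - phase w - phase' w h) j\<bar> = \<bar>(s' - s) * q + B (rep_xch h j) s\<bar> / q"
        using q by simp
      also have "\<dots> \<le> ((K / 2) * (n * n)) / (1/2)" using E q K0 n0 by (intro frac_le) simp_all
      also have "\<dots> = K * n * n" by simp
      also have "\<dots> \<le> K * norm h * n" using n0 K0 cell_norm1_le[of h j] by (intro mult_right_mono mult_left_mono) (auto simp: n_def)
      finally show ?thesis by (simp add: n_def)
    qed
    have s: "(\<lambda>j. K * norm h * cell_norm1 h j) summable_on UNIV" by (rule summable_on_cmult_right[OF cell_norm1_summable])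
    have "norm (phase w' - phase w - phase' w h) \<le> infsum (\<lambda>j. K * norm h * cell_norm1 h j) UNIV"
      using Abs_l1I(2)[OF bnd s] by (simp add: l1_seq_inverse)
    also have "\<dots> = K * norm h * infsum (cell_norm1 h) UNIV" by (simp add: infsum_cmult_right cell_norm1_summable)
    also have "\<dots> \<le> K * norm h * norm h" using K0 by (intro mult_left_mono infsum_cell_norm1) auto
    finally show "norm (phase w' - phase w - phase' w (w' - w)) \<le> K * norm (w' - w) * norm (w' - w)" by (simp add: h_def)
  qed (use w in simp)
qed

text \<open>\<open>phase'\<close> contains the phase only through translates of \<open>a\<close> and
  \<open>a'\<close>, so order \<open>k\<close> of the phase gives order \<open>k\<close> of its
  derivative.\<close>

lemma smooth_phase_step:
  assumes "lip_curve k a" "lip_curve k a'" and ph: "smooth_map k UNIV (ball 0 \<epsilon>) phase"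
  shows "smooth_map (Suc k) UNIV (ball 0 \<epsilon>) phase"
proof (rule smooth_map_chain[where \<theta> = "\<lambda>x. x" and \<Phi>' = phase'])
  note S = subspace_UNIV subset_UNIV[of "ball (0 :: 'a xch) \<epsilon>"]
  show "smooth_map (Suc k) UNIV (ball 0 \<epsilon>) (\<lambda>x :: 'a xch. x)" by (rule smooth_map_bounded_linear[OF bounded_linear_ident])
  show "(phase has_derivative phase' x) (at x)" if "x \<in> ball 0 \<epsilon>" for x
    by (rule phase_has_derivative) (use that in simp)
  have id: "smooth_map k UNIV (ball 0 \<epsilon>) (\<lambda>x :: 'a xch. x)" by (rule smooth_map_bounded_linear[OF bounded_linear_ident])
  have sa: "smooth_map k UNIV (ball 0 \<epsilon>) (\<lambda>x. sup_xch a (phase x))" by (rule smooth_map_sup_xch[OF assms(1) ph S])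
  have sa': "smooth_map k UNIV (ball 0 \<epsilon>) (\<lambda>x. sup_xch a' (phase x))" by (rule smooth_map_sup_xch[OF assms(2) ph S])
  have sd: "smooth_map k UNIV (ball 0 \<epsilon>) slope_dev" unfolding slope_dev_def
    by (intro smooth_family_minus smooth_family_add smooth_family_linear[OF _ bounded_linear_pair_fun_xch]
        smooth_map_bilinear[OF bounded_bilinear_pair_xch S] u ac sa' id)
  have sr: "smooth_map k UNIV (ball 0 \<epsilon>) (\<lambda>x. recip_l1 (slope_dev x))"
    by (rule smooth_map_recip_l1[OF sd _ S]) (use norm_slope_dev in auto)
  fix \<theta>' :: "'a xch list \<Rightarrow> 'a xch \<Rightarrow> 'a xch"
  assume \<theta>': "smooth_family k UNIV (ball 0 \<epsilon>) (cons_lists UNIV {[]}) (cons_weight (\<lambda>_. 1)) \<theta>'"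
  have Y: "smooth_family k UNIV (ball 0 \<epsilon>) (cons_lists UNIV {[]}) (cons_weight (\<lambda>_. 1))
      (\<lambda>l x. pair_fun_xch a (\<theta>' l x) + pair_xch (\<theta>' l x) (sup_xch a (phase x)))"
    by (intro smooth_family_add smooth_family_linear[OF \<theta>' bounded_linear_pair_fun_xch] ac
        smooth_family_bilinear_map[OF bounded_bilinear_pair_xch S \<theta>' sa])
  show "smooth_family k UNIV (ball 0 \<epsilon>) (cons_lists UNIV {[]}) (cons_weight (\<lambda>_. 1)) (\<lambda>l x. phase' x (\<theta>' l x))"
    unfolding phase'_def
    by (intro smooth_family_minus smooth_family_add[OF Y smooth_family_bilinear_map[OF bounded_bilinear_mul_l1 S Y sr]])
qed (auto simp: subspace_UNIV)

lemma smooth_phase: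
  assumes "lip_curve k a" "lip_curve k a'"
  shows "smooth_map (Suc k) UNIV (ball 0 \<epsilon>) phase"
  using assms
proof (induction k)
  case 0
  have "smooth_map 0 UNIV (ball 0 \<epsilon>) phase"
    by (rule smooth_map_0_compose[OF smooth_map_bounded_linear[OF bounded_linear_ident]])
       (use has_derivative_continuous[OF phase_has_derivative] in auto)
  thus ?case by (rule smooth_phase_step[OF 0])
next
  case (Suc k)
  show ?case
    by (rule smooth_phase_step[OF Suc.prems Suc.IH[OF Suc.prems[THEN lip_curve_Suc_imp]]])
qed

end

section \<open>The phase decomposition and its inverse\<close>

lemma xch_funs_cong_AE:
  assumes "w \<in> xch_funs" "\<And>j. v j \<in> borel_measurable cell" "\<And>j. AE x in cell. v j x = w j x"
  shows "v \<in> xch_funs"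
  using assms xch_enorm_cong[of v w] by (auto simp: xch_funs_def)

text \<open>Exhibiting an element of \<open>xch\<close> that agrees with \<open>v\<close> almost
  everywhere settles at once the membership in \<open>xch_funs\<close>, without which
  \<open>abs_xch v\<close> says nothing, and the value.\<close>

lemma abs_xch_eq_rep:
  assumes "\<And>j. v j \<in> borel_measurable cell" "\<And>j. AE x in cell. rep_xch w j x = v j x"
  shows "v \<in> xch_funs" "abs_xch v = w"
proof -
  have AE: "AE x in cell. v j x = rep_xch w j x" for j
    using assms(2)[of j] by eventually_elim simp
  show v: "v \<in> xch_funs" by (rule xch_funs_cong_AE[OF rep_xch_funs[of w] assms(1) AE])
  have "abs_xch v = abs_xch (rep_xch w)" by (rule abs_xch_eqI[OF v rep_xch_funs AE])
  thus "abs_xch v = w" by simp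
qed

lemma Xch_perp_eq: "continuous_on UNIV g \<Longrightarrow> Xch_perp g = {W. pair_fun_xch g W = 0}"
  using l1_seq_pair_fun_xch[of g]
  by (auto simp: Xch_perp_def zero_l1.rep_eq intro!: l1_eqI) (metis zero_l1.rep_eq)

lemma pair_fun_mul_xch:
  fixes g :: "real \<Rightarrow> 'a::euclidean_space"
  assumes g: "continuous_on UNIV g"
  shows "pair_fun_xch g (mul_xch c w) = mul_l1 c (pair_fun_xch g w)"
proof (rule l1_eqI)
  fix j
  have "cell_ip (rep_xch (mul_xch c w) j) g = cell_ip (\<lambda>x. l1_seq c j *\<^sub>R rep_xch w j x) g"
    by (rule cell_ip_cong_AE[OF rep_mul_xch]) (use cell_measurable_continuous[OF g] in auto)
  thus "l1_seq (pair_fun_xch g (mul_xch c w)) j = l1_seq (mul_l1 c (pair_fun_xch g w)) j"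
    by (simp add: l1_seq_pair_fun_xch[OF g] l1_seq_mul_l1 cell_ip_def)
qed

lemma pair_fun_tensor_xch:
  fixes g f :: "real \<Rightarrow> 'a::euclidean_space"
  assumes g: "continuous_on UNIV g" and f: "continuous_on UNIV f"
  shows "pair_fun_xch g (tensor_xch f c) = cell_ip f g *\<^sub>R c"
proof (rule l1_eqI)
  fix j
  have "cell_ip (rep_xch (tensor_xch f c) j) g = cell_ip (\<lambda>x. l1_seq c j *\<^sub>R f x) g"
    by (rule cell_ip_cong_AE[OF rep_tensor_xch[OF f]])
       (use cell_measurable_continuous[OF g] cell_measurable_continuous[OF f] in auto)
  thus "l1_seq (pair_fun_xch g (tensor_xch f c)) j = l1_seq (cell_ip f g *\<^sub>R c) j"
    by (simp add: l1_seq_pair_fun_xch[OF g] scaleR_l1.rep_eq cell_ip_def)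
qed

text \<open>Data of the decomposition itself. \<open>uas\<close> and \<open>\<phi>u'a\<close> come
  from parity, the former also from periodicity; \<open>\<psi>as\<close> is restricted to shifts
  that keep the support of \<open>\<psi>\<close> inside the cell. The condition
  \<open>\<epsilon>'\<close> makes \<open>1 + gx\<close> invertible.\<close>

locale phase_decomposition = phase_equation u a a' La L1 Ca C1 Cu \<delta> \<epsilon>
  for u a a' :: "real \<Rightarrow> real^'n" and La L1 Ca C1 Cu \<delta> \<epsilon> :: real +
  fixes \<phi> :: "real \<Rightarrow> real" and \<psi> u' \<psi>' :: "real \<Rightarrow> real^'n" and Lu Lu1 L\<psi> L\<psi>1 C\<phi> :: real
  assumes u': "\<And>x. (u has_vector_derivative u' x) (at x)" and Lu: "lipschitz_curve Lu u" and Lu1: "lipschitz_curve Lu1 u'"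
    and \<psi>': "\<And>x. (\<psi> has_vector_derivative \<psi>' x) (at x)" and L\<psi>: "lipschitz_curve L\<psi> \<psi>" and L\<psi>1: "lipschitz_curve L\<psi>1 \<psi>'"
    and \<phi>: "\<phi> \<in> borel_measurable cell" "\<And>x. x \<in> {-pi<..<pi} \<Longrightarrow> \<bar>\<phi> x\<bar> \<le> C\<phi>"
    and uas: "\<And>s. cell_ip (\<lambda>x. u (x - s)) (\<lambda>x. a (x - s)) = 0"
    and \<psi>as: "\<And>s. \<bar>s\<bar> \<le> \<delta> \<Longrightarrow> cell_ip (\<lambda>x. \<psi> (x - s)) (\<lambda>x. a (x - s)) = 1"
    and u'a: "cell_ip u' a = 1" and \<phi>u'a: "cell_ip (\<lambda>x. \<phi> x *\<^sub>R u' x) a = 0"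
    and \<epsilon>': "Ca * ((2 * pi + 1) * L\<psi>) * (2 * Ca * \<epsilon>) < 1/2"
begin

lemma \<psi>c: "continuous_on UNIV \<psi>" and uc': "continuous_on UNIV u'"
  using lipschitz_curve_continuous L\<psi> Lu1 by blast+

lemma \<psi>a: "cell_ip \<psi> a = 1"
  using \<psi>as[of 0] \<delta>(1) by simp

text \<open>In \<open>H1_phd\<close> the coefficients of the translates of \<open>u\<close> add up
  to zero, so each translate may be replaced by its deviation from \<open>u\<close>, which is an
  element of \<open>xch\<close>.\<close>

definition H1x :: "l1 \<Rightarrow> (real^'n) xch" where
  "H1x \<theta> = mul_fun_xch \<phi> ((1/2) *\<^sub>R (sup_xch u (shift_l1 1 \<theta>) - sup_xch u (shift_l1 (-1) \<theta>)))
     + (1/4) *\<^sub>R (sup_xch u (shift_l1 1 \<theta>) + sup_xch u (shift_l1 (-1) \<theta>) - 2 *\<^sub>R sup_xch u \<theta>)"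

definition pairS :: "l1 \<Rightarrow> (real^'n) xch \<Rightarrow> l1" where
  "pairS \<theta> v = pair_fun_xch a v + pair_xch v (sup_xch a \<theta>)"

definition cx :: "l1 \<Rightarrow> (real^'n) xch \<Rightarrow> l1" where
  "cx \<theta> W = - pairS \<theta> (H1x \<theta>) - pair_xch W (sup_xch a \<theta>)"

text \<open>The coefficient is an argument because the inverse finds it before \<open>W\<close>,
  when \<open>cx \<theta> W\<close> is not yet available.\<close>

definition H2x :: "l1 \<Rightarrow> l1 \<Rightarrow> (real^'n) xch" where
  "H2x \<theta> c = tensor_xch \<psi> c + mul_xch c (sup_xch \<psi> \<theta>)"

definition Tx :: "l1 \<Rightarrow> (real^'n) xch \<Rightarrow> (real^'n) xch" where
  "Tx \<theta> W = W + H1x \<theta> + H2x \<theta> (cx \<theta> W) + sup_xch u \<theta>"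

lemma pairS_seq: "l1_seq (pairS \<theta> v) j = B (rep_xch v j) (l1_seq \<theta> j)"
  unfolding pairS_def B_def by (rule pair_shift[OF La])

lemma bounded_linear_pairS: "bounded_linear (pairS \<theta>)"
  unfolding pairS_def
  by (intro bounded_linear_add bounded_linear_pair_fun_xch ac bounded_bilinear.bounded_linear_left[OF bounded_bilinear_pair_xch])

lemma rep_mul_phi: "AE x in cell. rep_xch (mul_fun_xch \<phi> w) j x = \<phi> x *\<^sub>R rep_xch w j x"
  by (rule rep_mul_fun_xch[OF \<phi>])

lemma rep_H1x: "AE x in cell. rep_xch (H1x \<theta>) j x = H1_phd u \<phi> (l1_seq \<theta>) j x"
proof -
  let ?p = "sup_xch u (shift_l1 1 \<theta>)" and ?m = "sup_xch u (shift_l1 (-1) \<theta>)" and ?z = "sup_xch u \<theta>"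
  have s: "l1_seq (shift_l1 1 \<theta>) j = l1_seq \<theta> (j + 1)" "l1_seq (shift_l1 (-1) \<theta>) j = l1_seq \<theta> (j - 1)"
    by (simp_all add: l1_seq_shift_l1)
  show ?thesis unfolding H1x_def
    using rep_xch_plus[of "mul_fun_xch \<phi> ((1/2) *\<^sub>R (?p - ?m))" "(1/4) *\<^sub>R (?p + ?m - 2 *\<^sub>R ?z)" j]
      rep_mul_phi[of "(1/2) *\<^sub>R (?p - ?m)" j] rep_xch_scaleR[of "1/2" "?p - ?m" j] rep_xch_minus[of ?p ?m j]
      rep_xch_scaleR[of "1/4" "?p + ?m - 2 *\<^sub>R ?z" j] rep_xch_minus[of "?p + ?m" "2 *\<^sub>R ?z" j] rep_xch_plus[of ?p ?m j]
      rep_xch_scaleR[of 2 ?z j] rep_sup_xch[OF Lu, of "shift_l1 1 \<theta>" j] rep_sup_xch[OF Lu, of "shift_l1 (-1) \<theta>" j]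
      rep_sup_xch[OF Lu, of \<theta> j]
  proof eventually_elim
    case (elim x)
    have "(\<phi> x *\<^sub>R (1/2) *\<^sub>R (p - n - (q - n))) + (1/4) *\<^sub>R (p - n + (q - n) - 2 *\<^sub>R (z - n))
      = (1/2 * \<phi> x) *\<^sub>R (p - q) + (1/4) *\<^sub>R (p + q - 2 *\<^sub>R z)" for p q n z :: "real^'n"
      by (simp add: algebra_simps scaleR_2)
    thus ?case unfolding elim s H1_phd_def by blast
  qed
qed

lemma H1_phd_measurable: "H1_phd u \<phi> \<theta> j \<in> borel_measurable cell"
proof -
  have c: "(\<lambda>x. u (x - s)) \<in> borel_measurable cell" for s by (rule cell_measurable_continuous[OF shift_continuous[OF u]])
  note [measurable] = \<phi>(1) c
  show ?thesis unfolding H1_phd_def by measurable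
qed

lemma shift_measurable [measurable]:
  "(\<lambda>x. u (x - s)) \<in> borel_measurable cell" "(\<lambda>x. a (x - s)) \<in> borel_measurable cell" "(\<lambda>x. \<psi> (x - s)) \<in> borel_measurable cell"
  "u \<in> borel_measurable cell" "a \<in> borel_measurable cell" "\<psi> \<in> borel_measurable cell" "u' \<in> borel_measurable cell"
  by (intro cell_measurable_continuous shift_continuous u ac \<psi>c uc')+

lemma cx_eq: "c_phd u a \<phi> (l1_seq \<theta>) (rep_xch W) j = l1_seq (cx \<theta> W) j"
proof -
  let ?s = "l1_seq \<theta> j"
  have "cell_ip (H1_phd u \<phi> (l1_seq \<theta>) j) (\<lambda>x. a (x - ?s)) = cell_ip (rep_xch (H1x \<theta>) j) (\<lambda>x. a (x - ?s))"
    by (rule cell_ip_cong_AE[symmetric, OF rep_H1x]) (auto intro: H1_phd_measurable)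
  moreover have "cell_ip (rep_xch W j) (rep_xch (sup_xch a \<theta>) j) = cell_ip (rep_xch W j) (\<lambda>x. a (x - ?s) - a x)"
    by (rule cell_ip_cong_AE[OF _ rep_sup_xch[OF La]]) auto
  ultimately show ?thesis
    by (simp add: c_phd_def cx_def minus_l1.rep_eq uminus_l1.rep_eq pairS_seq B_def l1_seq_pair_xch)
qed

lemma rep_H2x: "AE x in cell. rep_xch (H2x \<theta> c) j x = l1_seq c j *\<^sub>R \<psi> (x - l1_seq \<theta> j)"
  unfolding H2x_def
  using rep_xch_plus[of "tensor_xch \<psi> c" "mul_xch c (sup_xch \<psi> \<theta>)" j] rep_tensor_xch[OF \<psi>c, of c j]
    rep_mul_xch[of c "sup_xch \<psi> \<theta>" j] rep_sup_xch[OF L\<psi>, of \<theta> j]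
  by eventually_elim (simp add: scaleR_diff_right)

lemma Tx_eq:
  shows "phd_fun u a \<phi> \<psi> (l1_seq \<theta>) (rep_xch W) \<in> xch_funs" (is "?v \<in> _")
    and "abs_xch (phd_fun u a \<phi> \<psi> (l1_seq \<theta>) (rep_xch W)) = Tx \<theta> W"
proof -
  have m: "?v j \<in> borel_measurable cell" for j
  proof -
    note [measurable] = H1_phd_measurable
    have "?v j = (\<lambda>x. rep_xch W j x + (H1_phd u \<phi> (l1_seq \<theta>) j x + c_phd u a \<phi> (l1_seq \<theta>) (rep_xch W) j *\<^sub>R \<psi> (x - l1_seq \<theta> j))
        + u (x - l1_seq \<theta> j) - u x)" by (simp add: fun_eq_iff phd_fun_def H_phd_def H2_phd_def)
    thus ?thesis by simp
  qed
  have AE: "AE x in cell. rep_xch (Tx \<theta> W) j x = ?v j x" for j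
    unfolding Tx_def
    using rep_xch_plus[of "W + H1x \<theta> + H2x \<theta> (cx \<theta> W)" "sup_xch u \<theta>" j] rep_xch_plus[of "W + H1x \<theta>" "H2x \<theta> (cx \<theta> W)" j]
      rep_xch_plus[of W "H1x \<theta>" j] rep_H1x[of \<theta> j] rep_H2x[of \<theta> "cx \<theta> W" j] rep_sup_xch[OF Lu, of \<theta> j]
    by eventually_elim (simp add: phd_fun_def H_phd_def H2_phd_def cx_eq)
  show "?v \<in> xch_funs" "abs_xch ?v = Tx \<theta> W" by (rule abs_xch_eq_rep[OF m AE])+
qed

lemma T_phd_eq: "T_phd u a \<phi> \<psi> p = Tx (fst p) (snd p)"
  by (simp add: T_phd_def case_prod_beta Tx_eq(2))

subsection \<open>The inverse\<close>

lemma pairS_H2x: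
  assumes "\<And>j. \<bar>l1_seq \<theta> j\<bar> \<le> \<delta>"
  shows "pairS \<theta> (H2x \<theta> c) = c"
proof (rule l1_eqI)
  fix j
  let ?s = "l1_seq \<theta> j"
  have "B (rep_xch (H2x \<theta> c) j) ?s = cell_ip (\<lambda>x. l1_seq c j *\<^sub>R \<psi> (x - ?s)) (\<lambda>x. a (x - ?s))"
    unfolding B_def by (rule cell_ip_cong_AE[OF rep_H2x]) auto
  also have "\<dots> = l1_seq c j * cell_ip (\<lambda>x. \<psi> (x - ?s)) (\<lambda>x. a (x - ?s))" by (simp add: cell_ip_def)
  finally show "l1_seq (pairS \<theta> (H2x \<theta> c)) j = l1_seq c j" using \<psi>as[OF assms] by (simp add: pairS_seq)
qed

text \<open>The translate of \<open>u\<close> pairs to zero with the equally translated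
  \<open>a\<close> by \<open>uas\<close>; the untranslated \<open>u\<close> that remains is the
  \<open>u\<close> of the phase equation.\<close>

lemma pairS_sup_u: "l1_seq (pairS \<theta> (sup_xch u \<theta>)) j = - B u (l1_seq \<theta> j)"
proof -
  let ?s = "l1_seq \<theta> j"
  have us: "integrable cell (\<lambda>x. u (x - ?s))" by (rule integrable_cell_continuous[OF shift_continuous[OF u]])
  have as: "continuous_on UNIV (\<lambda>x. a (x - ?s))" by (rule shift_continuous[OF ac(1)])
  have "B (rep_xch (sup_xch u \<theta>) j) ?s = cell_ip (\<lambda>x. u (x - ?s) - u x) (\<lambda>x. a (x - ?s))"
    unfolding B_def by (rule cell_ip_cong_AE[OF rep_sup_xch[OF Lu]]) auto
  also have "\<dots> = - B u ?s" unfolding B_def using uas by (simp add: cell_ip_lin(2)[OF us ui as as])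
  finally show ?thesis by (simp add: pairS_seq)
qed

lemma pair_fun_H2x: "pair_fun_xch a (H2x \<theta> c) = c + mul_l1 c (pair_fun_xch a (sup_xch \<psi> \<theta>))"
proof -
  interpret P: bounded_linear "pair_fun_xch a" by (rule bounded_linear_pair_fun_xch[OF ac(1)])
  show ?thesis by (simp add: H2x_def P.add pair_fun_mul_xch[OF ac(1)] pair_fun_tensor_xch[OF ac(1) \<psi>c] \<psi>a)
qed

text \<open>If \<open>T(\<theta>, W) = w\<close>, then \<open>w\<close> minus the parts known from
  the phase is \<open>W + H2\<close>. Pairing with the untranslated \<open>a\<close> removes
  \<open>W\<close> and leaves \<open>c\<close> times \<open>1 + gx w\<close>; \<open>Zc\<close>
  solves this for the coefficient, and \<open>ZW\<close> is the rest.\<close>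

definition Yx :: "(real^'n) xch \<Rightarrow> l1" where
  "Yx w = pair_fun_xch a (w - H1x (phase w) - sup_xch u (phase w))"

definition gx :: "(real^'n) xch \<Rightarrow> l1" where
  "gx w = pair_fun_xch a (sup_xch \<psi> (phase w))"

definition Zc :: "(real^'n) xch \<Rightarrow> l1" where
  "Zc w = Yx w + mul_l1 (Yx w) (recip_l1 (gx w))"

definition ZW :: "(real^'n) xch \<Rightarrow> (real^'n) xch" where
  "ZW w = w - H1x (phase w) - H2x (phase w) (Zc w) - sup_xch u (phase w)"

lemma norm_gx:
  assumes "norm w < \<epsilon>"
  shows "norm (gx w) < 1/2"
proof -
  have L0: "0 \<le> L\<psi>" using L\<psi> by (simp add: lipschitz_curve_def)
  have "norm (gx w) \<le> Ca * norm (sup_xch \<psi> (phase w))" unfolding gx_def by (rule norm_pair_fun_xch[OF ac(1) Ca])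
  also have "\<dots> \<le> Ca * ((2 * pi + 1) * L\<psi> * norm (phase w))" by (intro mult_left_mono norm_sup_xch[OF L\<psi>] nonneg)
  also have "\<dots> \<le> Ca * ((2 * pi + 1) * L\<psi> * (2 * Ca * \<epsilon>))"
    using nonneg L0 assms by (intro mult_left_mono order_trans[OF phase(3)[OF assms]]) auto
  finally show ?thesis using \<epsilon>' by (simp add: mult.assoc)
qed

lemma recip_cancel:
  assumes "norm g < 1/2"
  shows "(c + mul_l1 c g) + mul_l1 (c + mul_l1 c g) (recip_l1 g) = c"
    and "(y + mul_l1 y (recip_l1 g)) + mul_l1 (y + mul_l1 y (recip_l1 g)) g = y"
proof -
  have eq: "(1 + l1_seq g j) * (1 + l1_seq (recip_l1 g) j) = 1" for j
    using l1_seq_recip_l1(2,3)[OF assms, of j] by simp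
  have "l1_seq c j + l1_seq c j * l1_seq g j + (l1_seq c j + l1_seq c j * l1_seq g j) * l1_seq (recip_l1 g) j
      = l1_seq c j * ((1 + l1_seq g j) * (1 + l1_seq (recip_l1 g) j))" for j c by (simp add: algebra_simps)
  thus "(c + mul_l1 c g) + mul_l1 (c + mul_l1 c g) (recip_l1 g) = c"
    by (intro l1_eqI) (simp add: plus_l1.rep_eq l1_seq_mul_l1 eq)
  have "l1_seq y j + l1_seq y j * l1_seq (recip_l1 g) j + (l1_seq y j + l1_seq y j * l1_seq (recip_l1 g) j) * l1_seq g j
      = l1_seq y j * ((1 + l1_seq g j) * (1 + l1_seq (recip_l1 g) j))" for j y by (simp add: algebra_simps)
  thus "(y + mul_l1 y (recip_l1 g)) + mul_l1 (y + mul_l1 y (recip_l1 g)) g = y"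
    by (intro l1_eqI) (simp add: plus_l1.rep_eq l1_seq_mul_l1 eq)
qed

lemma ZW_perp:
  assumes "norm w < \<epsilon>"
  shows "pair_fun_xch a (ZW w) = 0"
proof -
  interpret P: bounded_linear "pair_fun_xch a" by (rule bounded_linear_pair_fun_xch[OF ac(1)])
  have "ZW w = (w - H1x (phase w) - sup_xch u (phase w)) - H2x (phase w) (Zc w)" by (simp add: ZW_def)
  hence "pair_fun_xch a (ZW w) = Yx w - (Zc w + mul_l1 (Zc w) (gx w))"
    by (simp add: P.diff Yx_def pair_fun_H2x gx_def)
  also have "Zc w + mul_l1 (Zc w) (gx w) = Yx w" unfolding Zc_def by (rule recip_cancel(2)[OF norm_gx[OF assms]])
  finally show ?thesis by simp
qed

text \<open>The point is that \<open>Zc\<close>, found by pairing with \<open>a\<close>, satisfies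
  the prescribed formula \<open>cx\<close>, which pairs with translates of \<open>a\<close>; the
  phase equation for \<open>w\<close> is precisely the missing identity.\<close>

lemma Tx_inverse:
  assumes w: "norm w < \<epsilon>"
  shows "Tx (phase w) (ZW w) = w"
proof -
  let ?\<theta> = "phase w"
  interpret S: bounded_linear "pairS ?\<theta>" by (rule bounded_linear_pairS)
  have "pair_xch (ZW w) (sup_xch a ?\<theta>) = pairS ?\<theta> (ZW w)" by (simp add: pairS_def ZW_perp[OF w])
  hence "cx ?\<theta> (ZW w) = - pairS ?\<theta> (H1x ?\<theta> + ZW w)" by (simp add: cx_def S.add)
  also have "H1x ?\<theta> + ZW w = w - H2x ?\<theta> (Zc w) - sup_xch u ?\<theta>" by (simp add: ZW_def)
  also have "pairS ?\<theta> \<dots> = pairS ?\<theta> w - Zc w - pairS ?\<theta> (sup_xch u ?\<theta>)"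
    by (simp add: S.diff pairS_H2x phase(1)[OF w])
  also have "pairS ?\<theta> w = pairS ?\<theta> (sup_xch u ?\<theta>)"
  proof (rule l1_eqI)
    fix j
    show "l1_seq (pairS ?\<theta> w) j = l1_seq (pairS ?\<theta> (sup_xch u ?\<theta>)) j"
      using phase(2)[OF w, of j] unfolding pairS_sup_u by (simp add: pairS_seq B_add[OF ui rep_xch_integrable])
  qed
  finally have "cx ?\<theta> (ZW w) = Zc w" by simp
  thus ?thesis by (simp add: Tx_def ZW_def)
qed

text \<open>Pairing with the translates of \<open>a\<close> cancels \<open>cx\<close> against
  \<open>H1\<close> and \<open>W\<close> and leaves the phase equation, whose small root is unique.
  Pairing with \<open>a\<close> itself then recovers the coefficient and \<open>W\<close>.\<close>

lemma Tx_left_inverse: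
  assumes W: "pair_fun_xch a W = 0" and \<theta>: "norm \<theta> < \<delta>" and w: "norm (Tx \<theta> W) < \<epsilon>"
  shows "phase (Tx \<theta> W) = \<theta>" "ZW (Tx \<theta> W) = W"
proof -
  let ?w = "Tx \<theta> W" and ?c = "cx \<theta> W"
  interpret S: bounded_linear "pairS \<theta>" by (rule bounded_linear_pairS)
  interpret P: bounded_linear "pair_fun_xch a" by (rule bounded_linear_pair_fun_xch[OF ac(1)])
  have \<theta>j: "\<bar>l1_seq \<theta> j\<bar> \<le> \<delta>" for j using l1_le_norm[of \<theta> j] \<theta> by linarith
  have "pairS \<theta> ?w = pairS \<theta> W + pairS \<theta> (H1x \<theta>) + ?c + pairS \<theta> (sup_xch u \<theta>)"
    by (simp add: Tx_def S.add pairS_H2x[OF \<theta>j])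
  moreover have "pairS \<theta> W = pair_xch W (sup_xch a \<theta>)" by (simp add: pairS_def W)
  ultimately have eq: "pairS \<theta> ?w = pairS \<theta> (sup_xch u \<theta>)" by (simp add: cx_def)
  have "B (\<lambda>x. u x + rep_xch ?w j x) (l1_seq \<theta> j) = 0" for j
    using arg_cong[OF eq, of "\<lambda>v. l1_seq v j"] unfolding pairS_sup_u by (simp add: pairS_seq B_add[OF ui rep_xch_integrable])
  from phase_unique[OF w \<theta>j this] show ph: "phase ?w = \<theta>" by simp
  have "Yx ?w = pair_fun_xch a (W + H2x \<theta> ?c)" unfolding Yx_def ph by (simp add: Tx_def)
  also have "\<dots> = ?c + mul_l1 ?c (gx ?w)" by (simp add: P.add W pair_fun_H2x gx_def ph)
  finally have "Zc ?w = ?c" unfolding Zc_def by (simp only: recip_cancel(1)[OF norm_gx[OF w]])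
  thus "ZW ?w = W" unfolding ZW_def ph by (simp add: Tx_def)
qed

subsection \<open>Smoothness\<close>

lemma smooth_H1x:
  assumes "lip_curve k u" "smooth_map k S V \<theta>" and S: "subspace S" "V \<subseteq> S"
  shows "smooth_map k S V (\<lambda>x. H1x (\<theta> x))"
  unfolding H1x_def
  by (intro smooth_family_add smooth_family_diff smooth_family_linear[OF _ bounded_linear_scaleR_right]
      smooth_family_linear[OF _ bounded_linear_mul_fun_xch[OF \<phi>]]
      smooth_map_sup_xch[OF assms(1) _ S] smooth_family_linear[OF assms(2) bounded_linear_shift_l1] assms(2))

lemma smooth_H2x:
  assumes "lip_curve k \<psi>" "smooth_map k S V \<theta>" "smooth_map k S V c" and S: "subspace S" "V \<subseteq> S"
  shows "smooth_map k S V (\<lambda>x. H2x (\<theta> x) (c x))"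
  unfolding H2x_def
  by (intro smooth_family_add smooth_family_linear[OF assms(3) bounded_linear_tensor_xch[OF \<psi>c]]
      smooth_map_bilinear[OF bounded_bilinear_mul_xch S assms(3)] smooth_map_sup_xch[OF assms(1,2) S])

lemma smooth_Tx:
  assumes lip: "lip_curve k u" "lip_curve k a" "lip_curve k \<psi>" and S: "subspace S" "V \<subseteq> S"
  shows "smooth_map k S V (\<lambda>p. Tx (fst p) (snd p))"
proof -
  have f: "smooth_map k S V fst" "smooth_map k S V snd"
    by (rule smooth_map_bounded_linear[OF bounded_linear_fst], rule smooth_map_bounded_linear[OF bounded_linear_snd])
  note H1 = smooth_H1x[OF lip(1) f(1) S] and sa = smooth_map_sup_xch[OF lip(2) f(1) S]
  have c: "smooth_map k S V (\<lambda>p. cx (fst p) (snd p))"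
    unfolding cx_def pairS_def
    by (intro smooth_family_diff smooth_family_minus smooth_family_add smooth_family_linear[OF H1 bounded_linear_pair_fun_xch[OF ac(1)]]
        smooth_map_bilinear[OF bounded_bilinear_pair_xch S] H1 sa f)
  show ?thesis unfolding Tx_def
    by (intro smooth_family_add f H1 smooth_H2x[OF lip(3) f(1) c S] smooth_map_sup_xch[OF lip(1) f(1) S])
qed

lemma smooth_inverse:
  assumes lip: "lip_curve k u" "lip_curve k a" "lip_curve k \<psi>" and ph: "smooth_map k UNIV (ball 0 \<epsilon>) phase"
  shows "smooth_map k UNIV (ball 0 \<epsilon>) (\<lambda>w. (phase w, ZW w))"
proof -
  note S = subspace_UNIV subset_UNIV[of "ball (0 :: (real^'n) xch) \<epsilon>"]
  have id: "smooth_map k UNIV (ball 0 \<epsilon>) (\<lambda>x :: (real^'n) xch. x)" by (rule smooth_map_bounded_linear[OF bounded_linear_ident])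
  note H1 = smooth_H1x[OF lip(1) ph S] and su = smooth_map_sup_xch[OF lip(1) ph S]
  have Y: "smooth_map k UNIV (ball 0 \<epsilon>) Yx" unfolding Yx_def
    by (intro smooth_family_linear[OF _ bounded_linear_pair_fun_xch[OF ac(1)]] smooth_family_diff id H1 su)
  have g: "smooth_map k UNIV (ball 0 \<epsilon>) gx" unfolding gx_def
    by (intro smooth_family_linear[OF _ bounded_linear_pair_fun_xch[OF ac(1)]] smooth_map_sup_xch[OF lip(3) ph S])
  have r: "smooth_map k UNIV (ball 0 \<epsilon>) (\<lambda>w. recip_l1 (gx w))"
    by (rule smooth_map_recip_l1[OF g _ S]) (use norm_gx in auto)
  have c: "smooth_map k UNIV (ball 0 \<epsilon>) Zc" unfolding Zc_def
    by (intro smooth_family_add Y smooth_map_bilinear[OF bounded_bilinear_mul_l1 S Y r])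
  have W: "smooth_map k UNIV (ball 0 \<epsilon>) ZW" unfolding ZW_def
    by (intro smooth_family_diff id H1 su smooth_H2x[OF lip(3) ph c S])
  have 1: "bounded_linear (\<lambda>x :: l1. (x, 0 :: (real^'n) xch))" and 2: "bounded_linear (\<lambda>x. (0 :: l1, x :: (real^'n) xch))"
    by (intro bounded_linear_Pair bounded_linear_ident bounded_linear_zero)+
  have "smooth_map k UNIV (ball 0 \<epsilon>) (\<lambda>w. (phase w, 0) + (0, ZW w))"
    by (intro smooth_family_add smooth_family_linear[OF ph 1] smooth_family_linear[OF W 2])
  thus ?thesis by simp
qed

subsection \<open>The derivative at the origin\<close>

text \<open>The signs are left unsimplified, in the shape that the rules of differentiation produce
  from \<open>H1x\<close>.\<close>

definition H1x' :: "l1 \<Rightarrow> (real^'n) xch" where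
  "H1x' h = mul_fun_xch \<phi> ((1/2) *\<^sub>R (- tensor_xch u' (shift_l1 1 h) - - tensor_xch u' (shift_l1 (-1) h)))
     + (1/4) *\<^sub>R (- tensor_xch u' (shift_l1 1 h) + - tensor_xch u' (shift_l1 (-1) h) - 2 *\<^sub>R (- tensor_xch u' h))"

definition Lx :: "l1 \<Rightarrow> (real^'n) xch" where
  "Lx h = H1x' h + tensor_xch \<psi> (- pair_fun_xch a (H1x' h)) + - tensor_xch u' h"

lemma zero_ops: "mul_xch h (0 :: (real^'n) xch) = 0" "mul_xch 0 v = (0 :: (real^'n) xch)"
    "pair_xch v (0 :: (real^'n) xch) = 0" "pair_xch 0 v = 0" "shift_l1 i 0 = 0"
    "mul_fun_xch \<phi> (0 :: (real^'n) xch) = 0" "pair_fun_xch a 0 = 0"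
  using bounded_bilinear.zero_right[OF bounded_bilinear_mul_xch] bounded_bilinear.zero_left[OF bounded_bilinear_mul_xch]
    bounded_bilinear.zero_right[OF bounded_bilinear_pair_xch] bounded_bilinear.zero_left[OF bounded_bilinear_pair_xch]
    linear_simps(3)[OF bounded_linear_shift_l1] linear_simps(3)[OF bounded_linear_mul_fun_xch[OF \<phi>]]
    linear_simps(3)[OF bounded_linear_pair_fun_xch[OF ac(1)]] by auto

lemma H1x_0 [simp]: "H1x 0 = 0" and cx_0 [simp]: "cx 0 0 = 0"
  by (simp_all add: H1x_def cx_def pairS_def zero_ops)

lemma sup_xch_derivative_0:
  fixes g g' :: "real \<Rightarrow> real^'n"
  assumes g: "\<And>x. (g has_vector_derivative g' x) (at x)" "lipschitz_curve K g" "lipschitz_curve L g'"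
    and f: "(f has_derivative f') (at p)" "f p = 0"
  shows "((\<lambda>p. sup_xch g (f p)) has_derivative (\<lambda>h. - tensor_xch g' (f' h))) (at p)"
proof -
  have "(sup_xch g has_derivative (\<lambda>h. - tensor_xch g' h)) (at (f p))"
    using has_derivative_sup_xch[OF g, of "f p"] by (simp add: f(2) zero_ops)
  from has_derivative_compose[OF f(1) this] show ?thesis .
qed

text \<open>At the origin both factors of every bilinear term vanish, so these terms contribute
  nothing and only the linear parts remain.\<close>

lemma Tx_has_derivative_0: "((\<lambda>p. Tx (fst p) (snd p)) has_derivative (\<lambda>h. snd h + Lx (fst h))) (at 0)"
proof -
  have f: "(fst has_derivative fst) (at (0 :: l1 \<times> (real^'n) xch))" "(snd has_derivative snd) (at (0 :: l1 \<times> (real^'n) xch))"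
    by (intro bounded_linear_imp_has_derivative bounded_linear_fst bounded_linear_snd)+
  have sh: "((\<lambda>p. shift_l1 i (fst p)) has_derivative (\<lambda>h. shift_l1 i (fst h))) (at (0 :: l1 \<times> (real^'n) xch))" for i
    by (rule bounded_linear.has_derivative[OF bounded_linear_shift_l1 f(1)])
  note su = sup_xch_derivative_0[OF u' Lu Lu1]
  have H1: "((\<lambda>p. H1x (fst p)) has_derivative (\<lambda>h. H1x' (fst h))) (at (0 :: l1 \<times> (real^'n) xch))"
    unfolding H1x_def H1x'_def
    by (intro has_derivative_add has_derivative_diff bounded_linear.has_derivative[OF bounded_linear_mul_fun_xch[OF \<phi>]]
        bounded_linear.has_derivative[OF bounded_linear_scaleR_right] su sh f(1)) (simp_all add: zero_ops)
  have sa: "((\<lambda>p. sup_xch a (fst p)) has_derivative (\<lambda>h. - tensor_xch a' (fst h))) (at (0 :: l1 \<times> (real^'n) xch))"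
    by (rule sup_xch_derivative_0[OF a La L1 f(1)]) simp
  have s\<psi>: "((\<lambda>p. sup_xch \<psi> (fst p)) has_derivative (\<lambda>h. - tensor_xch \<psi>' (fst h))) (at (0 :: l1 \<times> (real^'n) xch))"
    by (rule sup_xch_derivative_0[OF \<psi>' L\<psi> L\<psi>1 f(1)]) simp
  have c: "((\<lambda>p. cx (fst p) (snd p)) has_derivative (\<lambda>h. - pair_fun_xch a (H1x' (fst h)))) (at 0)"
    unfolding cx_def pairS_def
    by (rule has_derivative_eq_rhs[OF has_derivative_diff[OF has_derivative_minus[OF has_derivative_add[OF
          bounded_linear.has_derivative[OF bounded_linear_pair_fun_xch[OF ac(1)] H1]
          bounded_bilinear.FDERIV[OF bounded_bilinear_pair_xch H1 sa]]]
          bounded_bilinear.FDERIV[OF bounded_bilinear_pair_xch f(2) sa]]])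
       (simp add: zero_ops)
  show ?thesis unfolding Tx_def H2x_def
    by (rule has_derivative_eq_rhs[OF has_derivative_add[OF has_derivative_add[OF has_derivative_add[OF f(2) H1]
          has_derivative_add[OF bounded_linear.has_derivative[OF bounded_linear_tensor_xch[OF \<psi>c] c]
          bounded_bilinear.FDERIV[OF bounded_bilinear_mul_xch c s\<psi>]]] su[OF f(1)]]])
       (simp_all add: zero_ops Lx_def fun_eq_iff algebra_simps)
qed

lemma pair_fun_mul_fun_tensor: "pair_fun_xch a (mul_fun_xch \<phi> (tensor_xch u' h)) = 0"
proof (rule l1_eqI)
  fix j
  note [measurable] = \<phi>(1)
  have "AE x in cell. rep_xch (mul_fun_xch \<phi> (tensor_xch u' h)) j x = l1_seq h j *\<^sub>R \<phi> x *\<^sub>R u' x"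
    using rep_mul_phi[of "tensor_xch u' h" j] rep_tensor_xch[OF uc', of h j] by eventually_elim simp
  hence "cell_ip (rep_xch (mul_fun_xch \<phi> (tensor_xch u' h)) j) a = cell_ip (\<lambda>x. l1_seq h j *\<^sub>R \<phi> x *\<^sub>R u' x) a"
    by (rule cell_ip_cong_AE) measurable
  also have "\<dots> = l1_seq h j * cell_ip (\<lambda>x. \<phi> x *\<^sub>R u' x) a"
    unfolding cell_ip_def inner_scaleR_left[of "l1_seq h j"] by (rule integral_mult_right_zero)
  finally show "l1_seq (pair_fun_xch a (mul_fun_xch \<phi> (tensor_xch u' h))) j = l1_seq 0 j"
    by (simp add: l1_seq_pair_fun_xch[OF ac(1)] \<phi>u'a zero_l1.rep_eq)
qed

text \<open>The \<open>\<phi>\<close> term drops out by parity and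
  \<open>\<langle>u', a\<rangle> = 1\<close>, so the linearization of \<open>c_j\<close> is a
  quarter of the second difference of \<open>h\<close>. It is the origin of the coefficients 1/4,
  -1/2, 1/4 of \<open>\<psi>\<close> in \<open>E_phd\<close>.\<close>

lemma pair_fun_H1x': "- pair_fun_xch a (H1x' h) = (1/4) *\<^sub>R (shift_l1 1 h + shift_l1 (-1) h - 2 *\<^sub>R h)"
proof -
  interpret P: bounded_linear "pair_fun_xch a" by (rule bounded_linear_pair_fun_xch[OF ac(1)])
  interpret M: bounded_linear "mul_fun_xch \<phi> :: (real^'n) xch \<Rightarrow> _" by (rule bounded_linear_mul_fun_xch[OF \<phi>])
  show ?thesis
    by (simp add: H1x'_def P.add P.diff P.scaleR P.neg M.diff M.scaleR M.neg M.add pair_fun_mul_fun_tensor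
        pair_fun_tensor_xch[OF ac(1) uc'] u'a algebra_simps)
qed

text \<open>The argument of \<open>E_phd\<close> is \<open>j - k\<close>, so the neighbour
  \<open>k = j + 1\<close> meets index -1 and \<open>k = j - 1\<close> meets index 1.\<close>

lemma conv_E_eq:
  "conv_Z (E_phd u \<phi> \<psi>) (l1_seq h) j x
    = l1_seq h (j + 1) *\<^sub>R E_phd u \<phi> \<psi> (-1) x + l1_seq h j *\<^sub>R E_phd u \<phi> \<psi> 0 x + l1_seq h (j - 1) *\<^sub>R E_phd u \<phi> \<psi> 1 x"
proof -
  have "conv_Z (E_phd u \<phi> \<psi>) (l1_seq h) j x = infsum (\<lambda>k. l1_seq h k *\<^sub>R E_phd u \<phi> \<psi> (j - k) x) {j + 1, j, j - 1}"
    unfolding conv_Z_def by (rule infsum_cong_neutral) (auto simp: E_phd_def Let_def)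
  thus ?thesis by simp
qed

lemma conv_E_measurable: "conv_Z (E_phd u \<phi> \<psi>) (l1_seq h) j \<in> borel_measurable cell"
proof -
  have d: "vector_derivative u (at x) = u' x" for x by (rule vector_derivative_at[OF u'])
  note [measurable] = \<phi>(1)
  have "conv_Z (E_phd u \<phi> \<psi>) (l1_seq h) j = (\<lambda>x.
      l1_seq h (j + 1) *\<^sub>R ((1/4) *\<^sub>R \<psi> x - (1/4 + 1/2 * \<phi> x) *\<^sub>R u' x) + l1_seq h j *\<^sub>R (- ((1/2) *\<^sub>R (\<psi> x + u' x)))
      + l1_seq h (j - 1) *\<^sub>R ((1/4) *\<^sub>R \<psi> x - (1/4 - 1/2 * \<phi> x) *\<^sub>R u' x))"
    by (rule ext) (simp add: conv_E_eq E_phd_def d)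
  thus ?thesis by simp
qed

lemma rep_Lx: "AE x in cell. rep_xch (Lx h) j x = conv_Z (E_phd u \<phi> \<psi>) (l1_seq h) j x"
proof -
  let ?p = "tensor_xch u' (shift_l1 1 h)" and ?m = "tensor_xch u' (shift_l1 (-1) h)" and ?z = "tensor_xch u' h"
  let ?c = "(1/4) *\<^sub>R (shift_l1 1 h + shift_l1 (-1) h - 2 *\<^sub>R h)"
  have L: "Lx h = mul_fun_xch \<phi> ((1/2) *\<^sub>R (?m - ?p)) + (1/4) *\<^sub>R (2 *\<^sub>R ?z - (?p + ?m)) + tensor_xch \<psi> ?c - ?z"
    unfolding Lx_def pair_fun_H1x' unfolding H1x'_def by (simp add: algebra_simps)
  have d: "vector_derivative u (at x) = u' x" for x by (rule vector_derivative_at[OF u'])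
  have s: "l1_seq (shift_l1 1 h) j = l1_seq h (j + 1)" "l1_seq (shift_l1 (-1) h) j = l1_seq h (j - 1)"
    "l1_seq ?c j = (1/4) * (l1_seq h (j + 1) + l1_seq h (j - 1) - 2 * l1_seq h j)"
    by (simp_all add: l1_seq_shift_l1 scaleR_l1.rep_eq minus_l1.rep_eq plus_l1.rep_eq)
  show ?thesis unfolding L
    using rep_xch_minus[of "mul_fun_xch \<phi> ((1/2) *\<^sub>R (?m - ?p)) + (1/4) *\<^sub>R (2 *\<^sub>R ?z - (?p + ?m)) + tensor_xch \<psi> ?c" ?z j]
      rep_xch_plus[of "mul_fun_xch \<phi> ((1/2) *\<^sub>R (?m - ?p)) + (1/4) *\<^sub>R (2 *\<^sub>R ?z - (?p + ?m))" "tensor_xch \<psi> ?c" j]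
      rep_xch_plus[of "mul_fun_xch \<phi> ((1/2) *\<^sub>R (?m - ?p))" "(1/4) *\<^sub>R (2 *\<^sub>R ?z - (?p + ?m))" j]
      rep_mul_phi[of "(1/2) *\<^sub>R (?m - ?p)" j] rep_xch_scaleR[of "1/2" "?m - ?p" j] rep_xch_minus[of ?m ?p j]
      rep_xch_scaleR[of "1/4" "2 *\<^sub>R ?z - (?p + ?m)" j] rep_xch_minus[of "2 *\<^sub>R ?z" "?p + ?m" j] rep_xch_plus[of ?p ?m j]
      rep_xch_scaleR[of 2 ?z j] rep_tensor_xch[OF uc', of "shift_l1 1 h" j] rep_tensor_xch[OF uc', of "shift_l1 (-1) h" j]
      rep_tensor_xch[OF uc', of h j] rep_tensor_xch[OF \<psi>c, of ?c j]
  proof eventually_elim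
    case (elim x)
    have "\<phi> x *\<^sub>R (1/2) *\<^sub>R (m *\<^sub>R v - p *\<^sub>R v) + (1/4) *\<^sub>R (2 *\<^sub>R (z *\<^sub>R v) - (p *\<^sub>R v + m *\<^sub>R v))
        + ((1/4) * (p + m - 2 * z)) *\<^sub>R y - z *\<^sub>R v
      = p *\<^sub>R ((1/4) *\<^sub>R y - (1/4 + 1/2 * \<phi> x) *\<^sub>R v) + z *\<^sub>R (- ((1/2) *\<^sub>R (y + v))) + m *\<^sub>R ((1/4) *\<^sub>R y - (1/4 - 1/2 * \<phi> x) *\<^sub>R v)"
      for m p z and v y :: "real^'n"
      by (simp add: vec_eq_iff field_simps)
    thus ?case unfolding elim s conv_E_eq by (simp add: E_phd_def d)
  qed
qed

lemma L_phd_eq: "L_phd u \<phi> \<psi> = (\<lambda>h. snd h + Lx (fst h))"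
  and conv_E_funs: "conv_Z (E_phd u \<phi> \<psi>) (l1_seq h) \<in> xch_funs"
  using abs_xch_eq_rep[OF conv_E_measurable rep_Lx] by (auto simp: L_phd_def fun_eq_iff)

subsection \<open>The local diffeomorphism\<close>

text \<open>\<open>U\<close> is a ball and \<open>V\<close> is cut out by
  \<open>norm \<theta> < \<delta>\<close> and the preimage of \<open>U\<close>, so that
  \<open>T\<close> maps \<open>V\<close> into \<open>U\<close> by construction; that the inverse
  maps \<open>U\<close> into \<open>V\<close> follows from the bound on the phase.\<close>

theorem local_diffeomorphism:
  assumes lip: "\<And>k. enat k \<le> r \<Longrightarrow> lip_curve k u" "\<And>k. enat k \<le> r \<Longrightarrow> lip_curve k a" "\<And>k. enat k \<le> r \<Longrightarrow> lip_curve k \<psi>"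
    and ph: "\<And>k. enat k \<le> r \<Longrightarrow> smooth_map k UNIV (ball 0 \<epsilon>) phase"
  shows "\<exists>U V.
     open U \<and> 0 \<in> U \<and>
     openin (top_of_set (UNIV \<times> Xch_perp a)) V \<and> 0 \<in> V \<and>
     (\<forall>(\<theta>, W)\<in>V. phd_fun u a \<phi> \<psi> (l1_seq \<theta>) (rep_xch W) \<in> xch_funs) \<and>
     bij_betw (T_phd u a \<phi> \<psi>) V U \<and>
     C_class_on r (UNIV \<times> Xch_perp a) V (T_phd u a \<phi> \<psi>) \<and>
     C_class_on r UNIV U (inv_into V (T_phd u a \<phi> \<psi>)) \<and>
     (\<forall>\<theta>. conv_Z (E_phd u \<phi> \<psi>) (l1_seq \<theta>) \<in> xch_funs) \<and>
     (T_phd u a \<phi> \<psi> has_derivative L_phd u \<phi> \<psi>) (at 0 within UNIV \<times> Xch_perp a)"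
proof -
  define T where "T = (\<lambda>p. Tx (fst p) (snd p))"
  have T: "T_phd u a \<phi> \<psi> = T" by (simp add: fun_eq_iff T_phd_eq T_def)
  define U where "U = ball (0 :: (real^'n) xch) \<epsilon>"
  define S where "S = (UNIV :: l1 set) \<times> Xch_perp a"
  define O' where "O' = {p. norm (fst p) < \<delta>} \<inter> T -` U"
  define V where "V = S \<inter> O'"
  define Z where "Z = (\<lambda>w. (phase w, ZW w))"
  interpret P: bounded_linear "pair_fun_xch a" by (rule bounded_linear_pair_fun_xch[OF ac(1)])
  have perp: "Xch_perp a = {W. pair_fun_xch a W = 0}" by (rule Xch_perp_eq[OF ac(1)])
  have S: "subspace S" unfolding S_def perp
    by (auto simp: subspace_def zero_prod_def P.add P.scaleR P.zero)
  \<comment> \<open>Relative openness of \<open>V\<close> rests on continuity of \<open>T\<close> on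
    the whole space, the order 0 case of smoothness.\<close>
  have "continuous_on UNIV T"
  proof (rule continuous_at_imp_continuous_on, intro ballI)
    fix p
    have "enat 0 \<le> r" by (simp add: zero_enat_def[symmetric])
    have "smooth_map 0 UNIV UNIV T" unfolding T_def
      by (rule smooth_Tx) (use lip[OF \<open>enat 0 \<le> r\<close>] in \<open>auto simp: subspace_UNIV\<close>)
    hence c: "cont_family UNIV {[] :: (l1 \<times> (real^'n) xch) list} (\<lambda>_. 1) (\<lambda>_. T)" by simp
    show "isCont T p" unfolding isCont_def
    proof (rule tendstoI)
      fix e :: real assume "e > 0"
      hence "e / 2 > 0" by simp
      from cont_familyD(3)[OF c UNIV_I this] show "\<forall>\<^sub>F y in at p. dist (T y) (T p) < e"
        by eventually_elim (use \<open>e > 0\<close> in \<open>simp add: dist_norm\<close>)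
    qed
  qed
  hence "open O'" unfolding O'_def U_def
    by (intro open_Int open_vimage open_ball open_Collect_less continuous_intros)
  hence V: "openin (top_of_set S) V" unfolding V_def by (rule openin_open_Int)
  have T0: "T 0 = 0" by (simp add: T_def Tx_def H2x_def linear_simps(3)[OF bounded_linear_tensor_xch[OF \<psi>c]] zero_ops)
  have ZT: "Z (T p) = p" if "p \<in> V" for p
    using that Tx_left_inverse[of "snd p" "fst p"] by (auto simp: V_def S_def O'_def U_def T_def Z_def perp)
  have TZ: "T (Z w) = w" if "w \<in> U" for w
    using that Tx_inverse[of w] by (simp add: T_def Z_def U_def)
  have ZV: "Z w \<in> V" if w: "w \<in> U" for w
  proof -
    have wn: "norm w < \<epsilon>" using w by (simp add: U_def)
    have "norm (phase w) \<le> 2 * Ca * norm w" by (rule phase(3)[OF wn])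
    also have "\<dots> \<le> 2 * (Ca * \<epsilon>)" using wn nonneg by (simp add: mult_left_mono)
    also have "\<dots> < \<delta>" using \<epsilon>(4) \<delta>(1) by linarith
    finally show ?thesis using TZ[OF w] w ZW_perp[OF wn] by (simp add: V_def S_def O'_def Z_def perp)
  qed
  have bij: "bij_betw T V U"
    by (rule bij_betw_byWitness[where f' = Z]) (use ZT TZ ZV in \<open>auto simp: V_def O'_def\<close>)
  have inv: "inv_into V T w = Z w" if "w \<in> U" for w
    by (rule inv_into_f_eq) (use bij that TZ ZV in \<open>auto simp: bij_betw_def\<close>)
  have U0: "0 \<in> U" using \<epsilon>(1) by (simp add: U_def)
  have V0: "0 \<in> V" using T0 U0 \<delta>(1) S by (simp add: V_def O'_def subspace_0)
  have "C_class_on r S V T"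
    by (rule C_class_onI[OF _ S V], unfold T_def, rule smooth_Tx[OF lip S openin_imp_subset[OF V]])
  moreover have "C_class_on r UNIV U (inv_into V T)"
  proof (rule C_class_onI)
    fix k assume k: "enat k \<le> r"
    show "smooth_map k UNIV U (inv_into V T)"
      by (rule smooth_family_cong[OF smooth_inverse[OF lip[OF k] ph[OF k], folded U_def Z_def]])
         (use inv in \<open>auto simp: subspace_UNIV\<close>)
  qed (auto simp: subspace_UNIV U_def)
  moreover have "(T has_derivative L_phd u \<phi> \<psi>) (at 0 within S)"
    unfolding T_def L_phd_eq by (rule has_derivative_at_withinI[OF Tx_has_derivative_0])
  ultimately show ?thesis
    using V V0 U0 bij Tx_eq(1) conv_E_funs unfolding T S_def[symmetric]
    by (intro exI[of _ U] exI[of _ V]) (auto simp: U_def)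
qed

end

section \<open>Parity, translation and change of representative\<close>

text \<open>Integrability is not assumed: the integral of a nonintegrable function is 0 by
  convention, in agreement with the claim.\<close>

lemma cell_integral_odd:
  fixes F :: "real \<Rightarrow> real"
  assumes "\<And>x. x \<in> {-pi..pi} \<Longrightarrow> F (- x) = - F x"
  shows "(\<integral>x. F x \<partial>cell) = 0"
proof (cases "integrable cell F")
  case True
  have "(F has_integral (\<integral>x. F x \<partial>cell)) {-pi..pi}"
    using has_integral_integral_lebesgue_on[OF True] by (simp add: has_integral_Icc_iff_Ioo)
  moreover from this have "((\<lambda>x. F (- x)) has_integral (\<integral>x. F x \<partial>cell)) {-pi..-(-pi)}"
    by (subst has_integral_reflect_real)
  hence "((\<lambda>x. F (- x)) has_integral (\<integral>x. F x \<partial>cell)) {-pi..pi}" by simp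
  hence "((\<lambda>x. - F x) has_integral (\<integral>x. F x \<partial>cell)) {-pi..pi}"
    by (rule has_integral_eq[rotated]) (rule assms)
  from has_integral_neg[OF this] have "(F has_integral - (\<integral>x. F x \<partial>cell)) {-pi..pi}" by simp
  ultimately have "(\<integral>x. F x \<partial>cell) = - (\<integral>x. F x \<partial>cell)" by (rule has_integral_unique)
  thus ?thesis by simp
qed (rule not_integrable_integral_eq)

lemma ex_antiderivative:
  fixes F :: "real \<Rightarrow> real"
  assumes "continuous_on UNIV F"
  obtains G where "\<And>x. (G has_vector_derivative F x) (at x)"
  using einterval_antiderivative[of "-\<infinity>" \<infinity> F] assms by (auto simp: continuous_on_eq_continuous_at)

lemma cell_integral_shift:
  fixes F :: "real \<Rightarrow> real"
  assumes F: "continuous_on UNIV F" and G: "\<And>x. (G has_vector_derivative F x) (at x)"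
  shows "(\<integral>x. F (x - s) \<partial>cell) = G (pi - s) - G (- pi - s)"
proof (rule cell_FTC[where g = "\<lambda>x. G (x - s)"])
  show "((\<lambda>x. G (x - s)) has_vector_derivative F (x - s)) (at x)" for x
    using vector_diff_chain_at[OF has_vector_derivative_diff[OF has_vector_derivative_id has_vector_derivative_const], of G "F (x - s)" x s]
      G[of "x - s"] by (simp add: o_def)
qed (rule shift_continuous[OF F])

text \<open>The increment of a primitive over one period does not depend on the starting
  point.\<close>

lemma cell_integral_shift_periodic:
  fixes F :: "real \<Rightarrow> real"
  assumes F: "continuous_on UNIV F" "\<And>x. F (x + 2 * pi) = F x"
  shows "(\<integral>x. F (x - s) \<partial>cell) = (\<integral>x. F x \<partial>cell)"
proof -
  obtain G where G: "\<And>x. (G has_vector_derivative F x) (at x)" using ex_antiderivative[OF F(1)] by blast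
  have "((\<lambda>x. G (x + 2 * pi)) has_vector_derivative F x) (at x)" for x
    using vector_diff_chain_at[OF has_vector_derivative_add[OF has_vector_derivative_id has_vector_derivative_const], of G "F (x + 2 * pi)" x "2 * pi"]
      G[of "x + 2 * pi"] F(2)[of x] by (simp add: o_def)
  hence "((\<lambda>x. G (x + 2 * pi) - G x) has_vector_derivative 0) (at x)" for x
    using has_vector_derivative_diff[OF _ G] by fastforce
  from periodic_const_of_derivative_zero[OF this, of "- pi - s" "- pi"]
  have "G (pi - s) - G (- pi - s) = G pi - G (- pi)" by (simp add: algebra_simps)
  thus ?thesis using cell_integral_shift[OF F(1) G, of s] cell_integral_shift[OF F(1) G, of 0] by simp
qed

text \<open>A primitive is constant on either side of the support, so both ends of the cell may move
  by \<open>s\<close> without changing the integral.\<close>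

lemma cell_integral_shift_supported:
  fixes F :: "real \<Rightarrow> real"
  assumes F: "continuous_on UNIV F" "\<And>x. \<rho> \<le> \<bar>x\<bar> \<Longrightarrow> F x = 0" and s: "\<bar>s\<bar> \<le> pi - \<rho>"
  shows "(\<integral>x. F (x - s) \<partial>cell) = (\<integral>x. F x \<partial>cell)"
proof -
  obtain G where G: "\<And>x. (G has_vector_derivative F x) (at x)" using ex_antiderivative[OF F(1)] by blast
  have c: "G x = G y" if "x \<in> A" "y \<in> A" "convex A" "\<And>x. x \<in> A \<Longrightarrow> \<rho> \<le> \<bar>x\<bar>" for x y A
  proof (rule has_vector_derivative_zero_constant[of A G])
    show "(G has_vector_derivative 0) (at x within A)" if "x \<in> A" for x
      using has_vector_derivative_at_within[OF G[of x], of A] F(2)[of x] \<open>\<And>x. x \<in> A \<Longrightarrow> \<rho> \<le> \<bar>x\<bar>\<close> that by simp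
  qed (use that in auto)
  have "G (pi - s) = G pi" by (rule c[of _ "{\<rho>..}"]) (use s in auto)
  moreover have "G (- pi - s) = G (- pi)" by (rule c[of _ "{..-\<rho>}"]) (use s in auto)
  ultimately show ?thesis using cell_integral_shift[OF F(1) G, of s] cell_integral_shift[OF F(1) G, of 0] by simp
qed

text \<open>Translation moves the cell, so equality is needed almost everywhere on the line. The
  exceptional set is covered by countably many translates of its part in the cell together with the
  point \<open>-pi\<close>, which the open cell omits.\<close>

lemma periodic_AE_eq_shift:
  fixes f g :: "real \<Rightarrow> 'a::euclidean_space"
  assumes AE: "AE x in cell. f x = g x" and f: "\<And>x. f (x + 2 * pi) = f x" and g: "\<And>x. g (x + 2 * pi) = g x"
    and gc: "continuous_on UNIV g"
  shows "AE x in cell. f (x - s) = g (x - s)" "(\<lambda>x. f (x - s)) \<in> borel_measurable cell"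
proof -
  define N where "N = {x. f x \<noteq> g x}"
  have "AE x in lebesgue. x \<in> {-pi<..<pi} \<longrightarrow> f x = g x" using AE by (simp add: AE_restrict_space_iff)
  then obtain M where "M \<in> null_sets lebesgue" "{x \<in> space lebesgue. \<not> (x \<in> {-pi<..<pi} \<longrightarrow> f x = g x)} \<subseteq> M"
    unfolding eventually_ae_filter by blast
  hence "negligible ({x. x \<in> {-pi<..<pi} \<and> f x \<noteq> g x})"
    using negligible_subset[of M] by (auto simp: negligible_iff_null_sets)
  hence N0: "negligible (N \<inter> {-pi<..<pi} \<union> {-pi})" by (auto simp: N_def Int_def conj_commute)
  have "N \<subseteq> (\<Union>n::int. (\<lambda>y. of_int n * (2 * pi) + y) ` (N \<inter> {-pi<..<pi} \<union> {-pi}))"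
  proof
    fix x assume x: "x \<in> N"
    obtain y and n :: int where y: "y \<in> {-pi..<pi}" "x = y + of_int n * (2 * pi)" using cell_representative .
    have "f x = f y" "g x = g y" using y periodic_int_shift[of f "2 * pi"] periodic_int_shift[of g "2 * pi"] f g by auto
    hence "y \<in> N \<inter> {-pi<..<pi} \<union> {-pi}" using x y(1) by (auto simp: N_def)
    thus "x \<in> (\<Union>n::int. (\<lambda>y. of_int n * (2 * pi) + y) ` (N \<inter> {-pi<..<pi} \<union> {-pi}))"
      using y(2) by (auto simp: add.commute intro!: exI[of _ n])
  qed
  moreover have "negligible (\<Union>n::int. (\<lambda>y. of_int n * (2 * pi) + y) ` (N \<inter> {-pi<..<pi} \<union> {-pi}))"
  proof (rule negligible_countable_Union)
    fix A assume "A \<in> range (\<lambda>n::int. (\<lambda>y. of_int n * (2 * pi) + y) ` (N \<inter> {-pi<..<pi} \<union> {-pi}))"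
    then obtain n :: int where "A = (\<lambda>y. of_int n * (2 * pi) + y) ` (N \<inter> {-pi<..<pi} \<union> {-pi})" by blast
    thus "negligible A" using negligible_translation[OF N0, of "of_int n * (2 * pi)"] by (simp only:)
  qed simp
  ultimately have "negligible N" by (rule negligible_subset[rotated])
  from negligible_translation[OF this, of s] have "(\<lambda>y. s + y) ` N \<in> null_sets lebesgue"
    by (simp add: negligible_iff_null_sets)
  moreover have "{x \<in> space lebesgue. \<not> g (x - s) = f (x - s)} \<subseteq> (\<lambda>y. s + y) ` N"
  proof
    fix x assume "x \<in> {x \<in> space lebesgue. \<not> g (x - s) = f (x - s)}"
    hence "x - s \<in> N" by (auto simp: N_def)
    thus "x \<in> (\<lambda>y. s + y) ` N" by (intro image_eqI[of _ _ "x - s"]) auto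
  qed
  ultimately have leb: "AE x in lebesgue. g (x - s) = f (x - s)" by (rule AE_I')
  thus "AE x in cell. f (x - s) = g (x - s)" by (auto simp: AE_restrict_space_iff elim!: eventually_mono)
  have "(\<lambda>x. g (x - s)) \<in> borel_measurable lebesgue"
    by (intro measurable_completion) (use shift_continuous[OF gc] in \<open>auto intro: borel_measurable_continuous_onI\<close>)
  from borel_measurable_AE[OF this leb] show "(\<lambda>x. f (x - s)) \<in> borel_measurable cell"
    by (rule measurable_restrict_space1)
qed

lemma Xch_perp_cong:
  assumes "AE x in cell. f x = g x" "f \<in> borel_measurable cell" "g \<in> borel_measurable cell"
  shows "Xch_perp f = Xch_perp g"
proof -
  have "cell_ip (rep_xch W j) f = cell_ip (rep_xch W j) g" for W j
    by (rule cell_ip_cong_AE[OF _ assms(1)]) (use assms(2,3) in auto)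
  thus ?thesis by (simp add: Xch_perp_def)
qed

text \<open>The adjoint element enters only through the integrals in \<open>c_phd\<close>, so
  changing it almost everywhere leaves \<open>phd_fun\<close> the same at every point.\<close>

lemma phd_fun_cong:
  fixes u uad a :: "real \<Rightarrow> real^'n"
  assumes AE: "AE x in cell. uad x = a x" and p: "\<And>x. uad (x + 2 * pi) = uad x" "\<And>x. a (x + 2 * pi) = a x"
    and c: "continuous_on UNIV a" "continuous_on UNIV u" and \<phi>: "\<phi> \<in> borel_measurable cell"
    and W: "\<And>j. W j \<in> borel_measurable cell"
  shows "phd_fun u uad \<phi> \<psi> \<theta> W = phd_fun u a \<phi> \<psi> \<theta> W"
proof -
  note A = periodic_AE_eq_shift[OF AE p c(1)]
  have am: "(\<lambda>x. a (x - s)) \<in> borel_measurable cell" and um: "(\<lambda>x. u (x - s)) \<in> borel_measurable cell" for s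
    by (intro cell_measurable_continuous shift_continuous c)+
  have H: "H1_phd u \<phi> \<theta> j \<in> borel_measurable cell" for j
  proof -
    note [measurable] = \<phi> um
    show ?thesis unfolding H1_phd_def by measurable
  qed
  note [measurable] = A(2) am W H
  have m: "uad \<in> borel_measurable cell" "a \<in> borel_measurable cell" using A(2)[of 0] am[of 0] by auto
  note [measurable] = m
  have "c_phd u uad \<phi> \<theta> W j = c_phd u a \<phi> \<theta> W j" for j
  proof -
    have "cell_ip (H1_phd u \<phi> \<theta> j) (\<lambda>x. uad (x - \<theta> j)) = cell_ip (H1_phd u \<phi> \<theta> j) (\<lambda>x. a (x - \<theta> j))"
      by (rule cell_ip_cong_AE[OF _ A(1)]) auto
    moreover have "cell_ip (W j) (\<lambda>x. uad (x - \<theta> j) - uad x) = cell_ip (W j) (\<lambda>x. a (x - \<theta> j) - a x)"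
    proof (rule cell_ip_cong_AE)
      show "AE x in cell. uad (x - \<theta> j) - uad x = a (x - \<theta> j) - a x"
        using A(1)[of "\<theta> j"] AE by eventually_elim simp
    qed auto
    ultimately show ?thesis by (simp add: c_phd_def)
  qed
  thus ?thesis by (simp add: fun_eq_iff phd_fun_def H_phd_def H2_phd_def)
qed

lemma C_class_on_continuous:
  fixes f :: "'a::real_normed_vector \<Rightarrow> 'b::real_normed_vector"
  assumes "C_class_on r UNIV V f"
  shows "continuous_on V f"
proof -
  obtain G :: "nat \<Rightarrow> 'a \<Rightarrow> 'a list \<Rightarrow> 'b" where G: "\<And>x. x \<in> V \<Longrightarrow> G 0 x [] = f x"
    "\<And>x e. x \<in> V \<Longrightarrow> e > 0 \<Longrightarrow> \<exists>d>0. \<forall>y\<in>V. norm (y - x) < d \<longrightarrow> (\<forall>vs. length vs = 0 \<longrightarrow> norm (G 0 y vs - G 0 x vs) \<le> e * prod_list (map norm vs))"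
  proof -
    have "enat 0 \<le> r" by (simp add: zero_enat_def[symmetric])
    from assms show thesis unfolding C_class_on_def
      apply (elim exE conjE)
      subgoal premises p for G by (rule that[of G]) (use p \<open>enat 0 \<le> r\<close> in auto)
      done
  qed
  show ?thesis unfolding continuous_on_iff
  proof (intro ballI allI impI)
    fix x and e :: real assume x: "x \<in> V" and e: "e > 0"
    hence "e / 2 > 0" by simp
    from G(2)[OF x this] obtain d where "d > 0" "\<And>y. y \<in> V \<Longrightarrow> norm (y - x) < d \<Longrightarrow> norm (f y - f x) \<le> e / 2"
      using G(1) x by auto
    thus "\<exists>d>0. \<forall>y\<in>V. dist y x < d \<longrightarrow> dist (f y) (f x) < e"
      using e by (intro exI[of _ d]) (force simp: dist_norm)
  qed
qed

text \<open>The argument runs with the regular representative \<open>a\<close> of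
  \<open>uad\<close>; both define the same subspace \<open>Xch_perp\<close> and the same map, so the
  result transfers by rewriting.\<close>

theorem lemma2p6:
  fixes D :: "real^'n^'n" and f :: "real^'n \<Rightarrow> real^'n"
    and ustar uad \<psi> :: "real \<Rightarrow> real^'n" and \<phi> :: "real \<Rightarrow> real" and r :: enat
  assumes r: "2 \<le> r"
    and D_diag: "\<And>i j. i \<noteq> j \<Longrightarrow> D $ i $ j = 0"
    and D_pos: "\<And>i. D $ i $ i > 0"
    and f_smooth: "C_class_on r UNIV UNIV f"
    and ustar_smooth: "C_class_on r UNIV UNIV ustar"
    and ustar_even: "\<And>x. ustar (- x) = ustar x"
    and ustar_periodic: "\<And>x. ustar (x + 2 * pi) = ustar x"
    and ustar_solution: "\<And>x. D *v vector_derivative (\<lambda>y. vector_derivative ustar (at y)) (at x)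
                             + f (ustar x) = 0"
    and stable: "spectrally_stable r D f ustar"
    and uad_periodic: "\<And>x. uad (x + 2 * pi) = uad x"
    and uad_odd: "\<And>x. uad (- x) = - uad x"
    and uad_kernel: "adjoint_maps (Bloch D f ustar 0) (\<lambda>x. cvec (uad x)) (\<lambda>x. 0)"
    and uad_normalized: "cell_ip (\<lambda>x. vector_derivative ustar (at x)) uad = 1"
    and phi_smooth: "C_class_on r UNIV {-pi..pi} \<phi>"
    and phi_odd: "\<And>x. x \<in> {-pi..pi} \<Longrightarrow> \<phi> (- x) = - \<phi> x"
    and phi_mono: "mono_on {-pi..pi} \<phi>"
    and phi_right: "\<And>x. x \<in> {-pi..pi} \<Longrightarrow> x > pi/2 \<Longrightarrow> \<phi> x = 1/2"
    and phi_left: "\<And>x. x \<in> {-pi..pi} \<Longrightarrow> x < - (pi/2) \<Longrightarrow> \<phi> x = - 1/2"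
    and psi_smooth: "C_class_on \<infinity> UNIV UNIV \<psi>"
    and psi_support: "\<exists>K. compact K \<and> K \<subseteq> {-pi<..<pi} \<and> (\<forall>x. x \<notin> K \<longrightarrow> \<psi> x = 0)"
    and psi_odd: "\<And>x. \<psi> (- x) = - \<psi> x"
    and psi_normalized: "cell_ip \<psi> uad = 1"
  shows "\<exists>U V.
     open U \<and> 0 \<in> U \<and>
     openin (top_of_set (UNIV \<times> Xch_perp uad)) V \<and> 0 \<in> V \<and>
     (\<forall>(\<theta>, W)\<in>V. phd_fun ustar uad \<phi> \<psi> (l1_seq \<theta>) (rep_xch W) \<in> xch_funs) \<and>
     bij_betw (T_phd ustar uad \<phi> \<psi>) V U \<and>
     C_class_on r (UNIV \<times> Xch_perp uad) V (T_phd ustar uad \<phi> \<psi>) \<and>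
     C_class_on r UNIV U (inv_into V (T_phd ustar uad \<phi> \<psi>)) \<and>
     (\<forall>\<theta>. conv_Z (E_phd ustar \<phi> \<psi>) (l1_seq \<theta>) \<in> xch_funs) \<and>
     (T_phd ustar uad \<phi> \<psi> has_derivative L_phd ustar \<phi> \<psi>) (at 0 within UNIV \<times> Xch_perp uad)"
proof -
  have r1: "enat (Suc 0) \<le> r" 
    using order_trans[OF one_le_numeral r] by (simp add: one_enat_def)
  obtain a where areg: "\<And>k. enat k \<le> r \<Longrightarrow> C_curve (Suc k) a" "\<And>x. a (x + 2 * pi) = a x" "AE x in cell. uad x = a x"
    using adjoint_kernel_regular[OF r D_diag D_pos f_smooth ustar_smooth ustar_periodic uad_kernel] by blast
  have uC: "C_curve (Suc (Suc k)) ustar" if "enat k \<le> r" for k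
    by (rule periodic_solution_regular[OF r D_diag D_pos f_smooth ustar_smooth ustar_solution that])
  have \<psi>C: "C_curve k \<psi>" for k by (rule C_curve_of_C_class[OF psi_smooth]) auto
  obtain K where K: "compact K" "K \<subseteq> {-pi<..<pi}" "\<And>x. x \<notin> K \<Longrightarrow> \<psi> x = 0" using psi_support by blast
  \<comment> \<open>Compact support in the open cell leaves a margin to the ends.
    \<open>\<rho>\<close> lies in the middle of it, so that translates of \<open>\<psi>\<close> by
    at most \<open>pi - \<rho>\<close> stay inside.\<close>
  obtain \<rho> where \<rho>: "\<rho> < pi" "\<And>x. \<rho> \<le> \<bar>x\<bar> \<Longrightarrow> \<psi> x = 0"
  proof (cases "K = {}")
    case True
    thus ?thesis using that[of 0] K(3) by simp
  next
    case False
    have "continuous_on K (abs :: real \<Rightarrow> real)" by (intro continuous_intros)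
    then obtain z where z: "z \<in> K" "\<And>x. x \<in> K \<Longrightarrow> \<bar>x\<bar> \<le> \<bar>z\<bar>" using continuous_attains_sup[OF K(1) False] by blast
    have "z \<in> {-pi<..<pi}" using z(1) K(2) by blast
    hence "\<bar>z\<bar> < pi" by (simp add: abs_less_iff)
    show ?thesis
    proof (rule that[of "(\<bar>z\<bar> + pi) / 2"])
      fix x assume "(\<bar>z\<bar> + pi) / 2 \<le> \<bar>x\<bar>"
      hence "\<bar>z\<bar> < \<bar>x\<bar>" using \<open>\<bar>z\<bar> < pi\<close> by simp
      thus "\<psi> x = 0" using z(2)[of x] K(3) by force
    qed (use \<open>\<bar>z\<bar> < pi\<close> in simp)
  qed
  have tame: "tame ustar" "tame a" "tame \<psi>" using ustar_periodic areg(2) \<rho> by (auto simp: tame_def)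
  have lip: "lip_curve k ustar" "lip_curve k a" "lip_curve k \<psi>" if "enat k \<le> r" for k
    using lip_curve_of_C_curve[OF C_curve_Suc_imp[OF uC[OF that]] tame(1)] lip_curve_of_C_curve[OF areg(1)[OF that] tame(2)]
      lip_curve_of_C_curve[OF \<psi>C tame(3)] by auto
  define a' u' \<psi>' where "a' = (\<lambda>x. vector_derivative a (at x))" and "u' = (\<lambda>x. vector_derivative ustar (at x))"
    and "\<psi>' = (\<lambda>x. vector_derivative \<psi> (at x))"
  have a': "(a has_vector_derivative a' x) (at x)" and u': "(ustar has_vector_derivative u' x) (at x)"
    and \<psi>': "(\<psi> has_vector_derivative \<psi>' x) (at x)" for x
    unfolding a'_def u'_def \<psi>'_def
    using C_curve_SucD(1)[OF areg(1)[OF r1]] C_curve_SucD(1)[OF uC[OF r1]] C_curve_SucD(1)[OF \<psi>C[of "Suc 0"]] by auto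
  have lip': "lip_curve 0 a'" "lip_curve 0 u'" "lip_curve 0 \<psi>'"
    using lip_curve_derivative[OF lip(2)[OF r1] a'] lip_curve_derivative[OF lip(1)[OF r1] u']
      lip_curve_derivative[OF lip(3)[OF r1] \<psi>'] by auto
  obtain La L1 Lu Lu1 L\<psi> L\<psi>1 where L: "lipschitz_curve La a" "lipschitz_curve L1 a'" "lipschitz_curve Lu ustar" "lipschitz_curve Lu1 u'"
    "lipschitz_curve L\<psi> \<psi>" "lipschitz_curve L\<psi>1 \<psi>'"
    using lip[OF r1, THEN lip_curveD] lip'[THEN lip_curveD] by metis
  note cont = L[THEN lipschitz_curve_continuous]
  obtain Ca where Ca: "\<And>x. norm (a x) \<le> Ca" using tame_bounded[OF tame(2) cont(1)] by blast
  obtain C1 where C1: "\<And>x. norm (a' x) \<le> C1" using tame_bounded[OF tame_derivative[OF tame(2) a'] cont(2)] by blast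
  obtain Cu where Cu: "\<And>x. x \<in> {-pi..pi} \<Longrightarrow> norm (ustar x) \<le> Cu" using continuous_bounded_on_cell[OF cont(3)] by blast
  have \<phi>c: "continuous_on {-pi..pi} \<phi>" by (rule C_class_on_continuous[OF phi_smooth])
  have \<phi>m: "\<phi> \<in> borel_measurable cell"
    by (rule continuous_imp_measurable_on_sets_lebesgue) (auto intro: continuous_on_subset[OF \<phi>c])
  have "bounded (\<phi> ` {-pi..pi})" by (intro compact_imp_bounded compact_continuous_image \<phi>c compact_Icc)
  then obtain C\<phi> where C\<phi>: "\<And>x. x \<in> {-pi<..<pi} \<Longrightarrow> \<bar>\<phi> x\<bar> \<le> C\<phi>" unfolding bounded_iff by force
  have uadm: "uad \<in> borel_measurable cell"
    using periodic_AE_eq_shift(2)[OF areg(3) uad_periodic areg(2) cont(1), of 0] by simp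
  have am: "a \<in> borel_measurable cell" and um: "ustar \<in> borel_measurable cell" and um': "u' \<in> borel_measurable cell" and \<psi>m: "\<psi> \<in> borel_measurable cell"
    by (intro cell_measurable_continuous cont)+
  have ip: "cell_ip v a = cell_ip v uad" if "v \<in> borel_measurable cell" for v
    by (rule cell_ip_cong_AE) (use areg(3) that am uadm in auto)
  have u'_odd: "u' (- x) = - u' x" for x
  proof -
    have "((\<lambda>x. ustar (- x)) has_vector_derivative - u' (- x)) (at x)"
      using vector_diff_chain_at[OF has_vector_derivative_minus[OF has_vector_derivative_id], of ustar "u' (- x)" x] u'[of "- x"]
      by (simp add: o_def)
    hence "(ustar has_vector_derivative - u' (- x)) (at x)" by (simp add: ustar_even)
    from vector_derivative_unique_at[OF this u'[of x]] show ?thesis by (metis minus_minus)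
  qed
  have ua: "cell_ip ustar a = 0"
    unfolding ip[OF um] unfolding cell_ip_def by (rule cell_integral_odd) (simp add: ustar_even uad_odd)
  have u'a: "cell_ip u' a = 1" unfolding ip[OF um'] unfolding u'_def by (rule uad_normalized)
  have \<psi>a: "cell_ip \<psi> a = 1" unfolding ip[OF \<psi>m] by (rule psi_normalized)
  have \<phi>u'a: "cell_ip (\<lambda>x. \<phi> x *\<^sub>R u' x) a = 0"
  proof -
    have m: "(\<lambda>x. \<phi> x *\<^sub>R u' x) \<in> borel_measurable cell" using \<phi>m um' by auto
    show ?thesis unfolding ip[OF m] unfolding cell_ip_def
      by (rule cell_integral_odd) (simp add: phi_odd u'_odd uad_odd)
  qed
  \<comment> \<open>Periodicity removes the boundary term, so this is
    \<open>\<langle>u', a\<rangle> = 1\<close> integrated by parts.\<close>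
  have ua': "cell_ip ustar a' = -1"
  proof -
    have "(\<integral>x. ustar x \<bullet> a' x + u' x \<bullet> a x \<partial>cell) = 0"
    proof (rule cell_integral_deriv_periodic)
      show "((\<lambda>x. ustar x \<bullet> a x) has_vector_derivative ustar x \<bullet> a' x + u' x \<bullet> a x) (at x)" for x
        by (rule bounded_bilinear.has_vector_derivative[OF bounded_bilinear_inner u' a'])
    qed (auto intro!: continuous_intros cont simp: ustar_periodic areg(2))
    moreover have "integrable cell (\<lambda>x. ustar x \<bullet> a' x)" "integrable cell (\<lambda>x. u' x \<bullet> a x)"
      by (intro integrable_cell_continuous continuous_intros cont)+
    ultimately show ?thesis using u'a by (simp add: cell_ip_def)
  qed
  have uas: "cell_ip (\<lambda>x. ustar (x - s)) (\<lambda>x. a (x - s)) = 0" for s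
    using cell_integral_shift_periodic[of "\<lambda>x. ustar x \<bullet> a x" s] ua cont(1,3) ustar_periodic areg(2)
    by (simp add: cell_ip_def continuous_on_inner)
  have \<psi>as: "cell_ip (\<lambda>x. \<psi> (x - s)) (\<lambda>x. a (x - s)) = 1" if "\<bar>s\<bar> \<le> pi - \<rho>" for s
    using cell_integral_shift_supported[of "\<lambda>x. \<psi> x \<bullet> a x" \<rho> s] \<psi>a cont(1,5) \<rho>(2) that
    by (simp add: cell_ip_def continuous_on_inner)
  have nn: "0 \<le> Ca" "0 \<le> C1" "0 \<le> Cu" "0 \<le> L1" "0 \<le> L\<psi>"
    using order_trans[OF norm_ge_zero Ca[of 0]] order_trans[OF norm_ge_zero C1[of 0]] order_trans[OF norm_ge_zero Cu[of 0]] L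
    by (auto simp: lipschitz_curve_def)
  define Nu where "Nu = (\<integral>x. norm (ustar x) \<partial>cell)"
  have Nu: "0 \<le> Nu" by (simp add: Nu_def)
  obtain t where t: "0 < t" "t * (L1 * Nu) \<le> 1/4"
    using scaled_threshold[OF mult_nonneg_nonneg[OF nn(4) Nu], of "1/4"] by auto
  \<comment> \<open>\<open>t\<close> limits the change of slope, \<open>pi - \<rho>\<close> keeps
    the translates of \<open>\<psi>\<close> inside the cell.\<close>
  define \<delta> where "\<delta> = min t (pi - \<rho>)"
  have \<delta>: "0 < \<delta>" "L1 * \<delta> * Nu \<le> 1/4" "\<delta> \<le> pi - \<rho>"
  proof -
    have "\<delta> * (L1 * Nu) \<le> t * (L1 * Nu)" unfolding \<delta>_def using nn Nu by (intro mult_right_mono) auto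
    thus "L1 * \<delta> * Nu \<le> 1/4" using t(2) by (simp add: ac_simps)
  qed (use t(1) \<rho>(1) in \<open>auto simp: \<delta>_def\<close>)
  define K5 where "K5 = Cu * ((2 * pi + 1) * L1 * (2 * Ca)) + C1 + (2 * pi + 1) * L1 * (2 * Ca)"
  define K6 where "K6 = Ca * ((2 * pi + 1) * L\<psi>) * (2 * Ca)"
  have K: "0 \<le> K5" "0 \<le> K6" unfolding K5_def K6_def using nn by (simp_all add: add_nonneg_nonneg)
  \<comment> \<open>One constant for all smallness conditions: \<open>\<epsilon> * M \<le> 1\<close>
    bounds \<open>C1 * \<epsilon>\<close>, \<open>K5 * \<epsilon>\<close> and
    \<open>K6 * \<epsilon>\<close> by 1/4 and \<open>Ca * \<epsilon>\<close> by
    \<open>\<delta> / 8\<close>.\<close>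
  define M where "M = 4 * C1 + 8 * Ca / \<delta> + 4 * K5 + 4 * K6"
  have M0: "0 \<le> M" and parts: "4 * C1 \<le> M" "8 * Ca / \<delta> \<le> M" "4 * K5 \<le> M" "4 * K6 \<le> M"
    unfolding M_def using nn K \<delta>(1) by (auto intro!: add_nonneg_nonneg add_increasing add_increasing2)
  obtain \<epsilon> where \<epsilon>: "0 < \<epsilon>" "\<epsilon> \<le> 1" "\<epsilon> * M \<le> 1"
    using scaled_threshold[OF M0, of 1] by auto
  have le: "\<epsilon> * x \<le> 1" if "x \<le> M" for x
    using mult_left_mono[OF that, of \<epsilon>] \<epsilon> by linarith
  have \<epsilon>': "C1 * \<epsilon> \<le> 1/4" "Ca * \<epsilon> \<le> \<delta> / 8" "K5 * \<epsilon> < 1/2" "K6 * \<epsilon> < 1/2"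
    using le[OF parts(1)] le[OF parts(2)] le[OF parts(3)] le[OF parts(4)] \<delta>(1) by (auto simp: field_simps)
  interpret phase_decomposition ustar a a' La L1 Ca C1 Cu \<delta> \<epsilon> \<phi> \<psi> u' \<psi>' Lu Lu1 L\<psi> L\<psi>1 C\<phi>
  proof
    show "Ca * ((2 * pi + 1) * L\<psi>) * (2 * Ca * \<epsilon>) < 1/2" using \<epsilon>'(4) unfolding K6_def by (simp only: mult.assoc)
    show "cell_ip (\<lambda>x. \<psi> (x - s)) (\<lambda>x. a (x - s)) = 1" if "\<bar>s\<bar> \<le> \<delta>" for s
      by (rule \<psi>as) (use that \<delta>(3) in linarith)
    show "(Cu * ((2 * pi + 1) * L1 * (2 * Ca)) + C1 + (2 * pi + 1) * L1 * (2 * Ca)) * \<epsilon> < 1/2"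
      using \<epsilon>'(3) unfolding K5_def .
    show "L1 * \<delta> * (\<integral>x. norm (ustar x) \<partial>cell) \<le> 1/4" using \<delta>(2) unfolding Nu_def .
  qed (fact cont(3) a' u' \<psi>' L Ca C1 Cu \<delta>(1) \<epsilon>(1,2) \<epsilon>'(1,2) ua ua' u'a uas \<phi>u'a \<phi>m C\<phi>)+
  \<comment> \<open>\<open>smooth_phase\<close> gains one order over the regularity of
    \<open>a'\<close>, which makes up for the order lost in passing from \<open>a\<close> to
    \<open>a'\<close>. Order 0 is read off from order 1.\<close>
  have ph: "smooth_map k UNIV (ball 0 \<epsilon>) phase" if k: "enat k \<le> r" for k
  proof (cases k)
    case 0
    have "smooth_map (Suc 0) UNIV (ball 0 \<epsilon>) phase"
      by (rule smooth_phase[OF lip_curve_Suc_imp[OF lip(2)[OF r1, unfolded One_nat_def]] lip'(1)])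
    thus ?thesis using smooth_family_Suc_imp 0 by blast
  next
    case (Suc m)
    have "lip_curve (Suc m) a" using lip(2)[OF k] Suc by simp
    thus ?thesis using smooth_phase[OF lip_curve_Suc_imp lip_curve_derivative[OF _ a']] Suc by blast
  qed
  have perp: "Xch_perp uad = Xch_perp a" by (rule Xch_perp_cong[OF areg(3) uadm am])
  have phd_eq: "phd_fun ustar uad \<phi> \<psi> \<theta> (rep_xch W) = phd_fun ustar a \<phi> \<psi> \<theta> (rep_xch W)" for \<theta> W
    by (rule phd_fun_cong[OF areg(3) uad_periodic areg(2) cont(1,3) \<phi>m rep_xch_measurable])
  have T: "T_phd ustar uad \<phi> \<psi> = T_phd ustar a \<phi> \<psi>" by (simp add: T_phd_def phd_eq)
  show ?thesis unfolding perp T phd_eq by (rule local_diffeomorphism[OF lip ph])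
qed

end
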